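(* Let $p$ be a prime, let $F$ be a field containing a primitive $p$-th root of unity, and let $G=\mathrm{Gal}(F(p)/F)$. Let $N$ be a closed subgroup of $G$ of index $p$, and suppose that the corestriction map $\mathrm{cor}:H^2(N,\mathbb{F}_p)\to H^2(G,\mathbb{F}_p)$ is surjective. Let $a\in F^\times$ be chosen so that the fixed field of $N$ is $F(\sqrt[p]{a})$. Assume that $\dim_{\mathbb{F}_p}H^2(G,\mathbb{F}_p)<\infty$, and set $$x=\dim_{\mathbb{F}_p}H^1(G,\mathbb{F}_p)/\mathrm{ann}(a),\qquad y=\dim_{\mathbb{F}_p}H^2(G,\mathbb{F}_p)/\big((a)\cdot H^1(G,\mathbb{F}_p)\big).$$ Then $$\dim_{\mathbb{F}_p}H^2(N,\mathbb{F}_p)=x+py.$$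
   Context: $F(p)$ is the maximal $p$-extension of $F$: the union of all finite Galois extensions $L/F$ in a fixed algebraic closure of $F$ with $[L:F]$ a power of $p$. The group $G$ is not assumed finitely generated. Cohomology is continuous cohomology of profinite groups. Fixing a primitive $p$-th root of unity $\xi_p\in F$, Kummer theory identifies $H^1(G,\mathbb{F}_p)$ with $F^\times/F^{\times p}$; for $b\in F^\times$, $(b)\in H^1(G,\mathbb{F}_p)$ denotes the corresponding class. The product $(a)\cdot(b)\in H^2(G,\mathbb{F}_p)$ is the cup product, $(a)\cdot H^1(G,\mathbb{F}_p)$ is the image of cup product with $(a)$, and $\mathrm{ann}(a)=\{(b)\in H^1(G,\mathbb{F}_p):(a)\cdot(b)=0\}$. *)

theory Defs
  imports
    "HOL-Algebra.Algebraic_Closure"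
    "HOL-Algebra.Bij"
    "HOL-Algebra.Generated_Fields"
    "HOL-Number_Theory.Residues"
    "HOL-Analysis.Function_Topology"
    "Jordan_Normal_Form.Missing_VectorSpace"
begin

section \<open>Galois groups of extensions inside an algebraic closure\<close>

text \<open>
  Throughout, \<open>\<Omega>\<close> is an algebraic closure of its subfield \<open>F\<close>
  (\<^locale>\<open>algebraic_closure\<close>), so that \<open>ring.roots \<Omega> f\<close> lists all roots of a
  polynomial \<open>f\<close> over \<open>F\<close>, and \<open>ring.Irr \<Omega> F x\<close> is the minimal polynomial of \<open>x\<close> over \<open>F\<close>.
\<close>

definition normal_ext :: "('a, 'b) ring_scheme \<Rightarrow> 'a set \<Rightarrow> 'a set \<Rightarrow> bool" where
  "normal_ext \<Omega> F L \<longleftrightarrow> (\<forall>x\<in>L. set_mset (ring.roots \<Omega> (ring.Irr \<Omega> F x)) \<subseteq> L)"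

definition separable_ext :: "('a, 'b) ring_scheme \<Rightarrow> 'a set \<Rightarrow> 'a set \<Rightarrow> bool" where
  "separable_ext \<Omega> F L \<longleftrightarrow>
     (\<forall>x\<in>L. \<forall>y. ring.alg_mult \<Omega> (ring.Irr \<Omega> F x) y \<le> 1)"

definition finite_galois_ext :: "('a, 'b) ring_scheme \<Rightarrow> 'a set \<Rightarrow> 'a set \<Rightarrow> bool" where
  "finite_galois_ext \<Omega> F L \<longleftrightarrow>
     subfield L \<Omega> \<and> F \<subseteq> L \<and> ring.finite_dimension \<Omega> F L \<and>
     normal_ext \<Omega> F L \<and> separable_ext \<Omega> F L"

definition max_p_ext :: "('a, 'b) ring_scheme \<Rightarrow> 'a set \<Rightarrow> nat \<Rightarrow> 'a set" where
  "max_p_ext \<Omega> F p =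
     \<Union> {L. finite_galois_ext \<Omega> F L \<and> (\<exists>k. ring.dimension \<Omega> (p ^ k) F L)}"

text \<open>Automorphisms of \<open>E\<close> are extended by \<open>undefined\<close> outside \<open>E\<close>, as in \<^const>\<open>BijGroup\<close>.\<close>

definition gal :: "('a, 'b) ring_scheme \<Rightarrow> 'a set \<Rightarrow> 'a set \<Rightarrow> ('a \<Rightarrow> 'a) monoid" where
  "gal \<Omega> F E = (BijGroup E)
     \<lparr>carrier := {\<sigma> \<in> Bij E. \<sigma> \<in> ring_hom (\<Omega>\<lparr>carrier := E\<rparr>) (\<Omega>\<lparr>carrier := E\<rparr>) \<and>
                             (\<forall>x\<in>F. \<sigma> x = x)}\<rparr>"

definition krull_topology ::
    "('a, 'b) ring_scheme \<Rightarrow> 'a set \<Rightarrow> 'a set \<Rightarrow> ('a \<Rightarrow> 'a) topology" where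
  "krull_topology \<Omega> F E = topology_generated_by
     {\<sigma> <#\<^bsub>gal \<Omega> F E\<^esub> carrier (gal \<Omega> L E) | \<sigma> L.
        \<sigma> \<in> carrier (gal \<Omega> F E) \<and> finite_galois_ext \<Omega> F L \<and> L \<subseteq> E}"

definition fixed_field :: "'a set \<Rightarrow> ('a \<Rightarrow> 'a) set \<Rightarrow> 'a set" where
  "fixed_field E N = {x \<in> E. \<forall>\<sigma>\<in>N. \<sigma> x = x}"

definition primitive_root_of_unity :: "('a, 'b) ring_scheme \<Rightarrow> nat \<Rightarrow> 'a \<Rightarrow> bool" where
  "primitive_root_of_unity \<Omega> n \<xi> \<longleftrightarrow> \<xi> \<in> carrier \<Omega> \<and>
     \<xi> [^]\<^bsub>\<Omega>\<^esub> n = \<one>\<^bsub>\<Omega>\<^esub> \<and> (\<forall>k. 0 < k \<and> k < n \<longrightarrow> \<xi> [^]\<^bsub>\<Omega>\<^esub> k \<noteq> \<one>\<^bsub>\<Omega>\<^esub>)"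


section \<open>Quotient modules\<close>

text \<open>
  The ring multiplication and unit of a module record play no role.  The scalar multiplication
  is written without a choice of representative, in the style of \<^const>\<open>rcoset_mult\<close>:
  for a submodule \<open>W\<close>, every \<open>x\<close> in the coset contributes the same coset.
\<close>

definition quotient_module ::
    "('r, 'm, 'c) module_scheme \<Rightarrow> 'm set \<Rightarrow> ('r, 'm set) module" where
  "quotient_module M W =
     \<lparr>carrier = a_rcosets\<^bsub>M\<^esub> W, monoid.mult = (\<lambda>A B. W), one = W, zero = W,
      add = (\<lambda>A B. A <+>\<^bsub>M\<^esub> B),
      smult = (\<lambda>r A. \<Union>x\<in>A. W +>\<^bsub>M\<^esub> (r \<odot>\<^bsub>M\<^esub> x))\<rparr>"


section \<open>Continuous cohomology with trivial discrete coefficients\<close>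

text \<open>
  \<open>G\<close> is a group with topology \<open>T\<close>, and the ring \<open>R\<close> is regarded as a discrete module with
  trivial action.  We use the complex of homogeneous cochains: an \<open>n\<close>-cochain is a continuous
  \<open>G\<close>-invariant function of \<open>n + 1\<close> arguments, which are collected in a function on \<open>{..n}\<close>.
\<close>

definition tuples :: "('g, 'c) monoid_scheme \<Rightarrow> nat \<Rightarrow> (nat \<Rightarrow> 'g) set" where
  "tuples G n = {..n} \<rightarrow>\<^sub>E carrier G"

definition cochains ::
    "('r, 'd) ring_scheme \<Rightarrow> ('g, 'c) monoid_scheme \<Rightarrow> 'g topology \<Rightarrow> nat \<Rightarrow>
     ('r, (nat \<Rightarrow> 'g) \<Rightarrow> 'r) module" where
  "cochains R G T n =
     \<lparr>carrier = {f \<in> extensional (tuples G n).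
        continuous_map (product_topology (\<lambda>_. T) {..n}) (discrete_topology (carrier R)) f \<and>
        (\<forall>g\<in>carrier G. \<forall>x\<in>tuples G n. f (\<lambda>i\<in>{..n}. g \<otimes>\<^bsub>G\<^esub> x i) = f x)},
      monoid.mult = (\<lambda>f h. \<lambda>x\<in>tuples G n. \<zero>\<^bsub>R\<^esub>),
      one = (\<lambda>x\<in>tuples G n. \<zero>\<^bsub>R\<^esub>),
      zero = (\<lambda>x\<in>tuples G n. \<zero>\<^bsub>R\<^esub>),
      add = (\<lambda>f h. \<lambda>x\<in>tuples G n. f x \<oplus>\<^bsub>R\<^esub> h x),
      smult = (\<lambda>r f. \<lambda>x\<in>tuples G n. r \<otimes>\<^bsub>R\<^esub> f x)\<rparr>"

text \<open>\<open>(\<delta> f)(x\<^sub>0, \<dots>, x\<^sub>n\<^sub>+\<^sub>1)\<close> is the alternating sum of \<open>f\<close> over the tuples omitting one \<open>x\<^sub>i\<close>.\<close>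

definition coboundary ::
    "('r, 'd) ring_scheme \<Rightarrow> ('g, 'c) monoid_scheme \<Rightarrow> nat \<Rightarrow>
     ((nat \<Rightarrow> 'g) \<Rightarrow> 'r) \<Rightarrow> (nat \<Rightarrow> 'g) \<Rightarrow> 'r" where
  "coboundary R G n f =
     (\<lambda>x\<in>tuples G (Suc n). \<Oplus>\<^bsub>R\<^esub>i\<in>{..Suc n}.
        (\<ominus>\<^bsub>R\<^esub> \<one>\<^bsub>R\<^esub>) [^]\<^bsub>R\<^esub> i \<otimes>\<^bsub>R\<^esub> f (\<lambda>j\<in>{..n}. x (if j < i then j else Suc j)))"

definition cocycles ::
    "('r, 'd) ring_scheme \<Rightarrow> ('g, 'c) monoid_scheme \<Rightarrow> 'g topology \<Rightarrow> nat \<Rightarrow>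
     ((nat \<Rightarrow> 'g) \<Rightarrow> 'r) set" where
  "cocycles R G T n =
     {f \<in> carrier (cochains R G T n). coboundary R G n f = \<zero>\<^bsub>cochains R G T (Suc n)\<^esub>}"

fun coboundaries ::
    "('r, 'd) ring_scheme \<Rightarrow> ('g, 'c) monoid_scheme \<Rightarrow> 'g topology \<Rightarrow> nat \<Rightarrow>
     ((nat \<Rightarrow> 'g) \<Rightarrow> 'r) set" where
  "coboundaries R G T 0 = {\<zero>\<^bsub>cochains R G T 0\<^esub>}"
| "coboundaries R G T (Suc n) = coboundary R G n ` carrier (cochains R G T n)"

definition cohomology ::
    "('r, 'd) ring_scheme \<Rightarrow> ('g, 'c) monoid_scheme \<Rightarrow> 'g topology \<Rightarrow> nat \<Rightarrow>
     ('r, ((nat \<Rightarrow> 'g) \<Rightarrow> 'r) set) module" where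
  "cohomology R G T n =
     quotient_module ((cochains R G T n)\<lparr>carrier := cocycles R G T n\<rparr>) (coboundaries R G T n)"

definition coh_class ::
    "('r, 'd) ring_scheme \<Rightarrow> ('g, 'c) monoid_scheme \<Rightarrow> 'g topology \<Rightarrow> nat \<Rightarrow>
     ((nat \<Rightarrow> 'g) \<Rightarrow> 'r) \<Rightarrow> ((nat \<Rightarrow> 'g) \<Rightarrow> 'r) set" where
  "coh_class R G T n f = coboundaries R G T n +>\<^bsub>cochains R G T n\<^esub> f"


subsection \<open>Cup product\<close>

definition cup_cochain ::
    "('r, 'd) ring_scheme \<Rightarrow> ('g, 'c) monoid_scheme \<Rightarrow> nat \<Rightarrow> nat \<Rightarrow>
     ((nat \<Rightarrow> 'g) \<Rightarrow> 'r) \<Rightarrow> ((nat \<Rightarrow> 'g) \<Rightarrow> 'r) \<Rightarrow> (nat \<Rightarrow> 'g) \<Rightarrow> 'r" where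
  "cup_cochain R G m n f h =
     (\<lambda>x\<in>tuples G (m + n). f (\<lambda>i\<in>{..m}. x i) \<otimes>\<^bsub>R\<^esub> h (\<lambda>j\<in>{..n}. x (m + j)))"

definition cup ::
    "('r, 'd) ring_scheme \<Rightarrow> ('g, 'c) monoid_scheme \<Rightarrow> 'g topology \<Rightarrow> nat \<Rightarrow> nat \<Rightarrow>
     ((nat \<Rightarrow> 'g) \<Rightarrow> 'r) set \<Rightarrow> ((nat \<Rightarrow> 'g) \<Rightarrow> 'r) set \<Rightarrow> ((nat \<Rightarrow> 'g) \<Rightarrow> 'r) set" where
  "cup R G T m n A B =
     (\<Union>f\<in>A. \<Union>h\<in>B. coh_class R G T (m + n) (cup_cochain R G m n f h))"

definition annihilator ::
    "('r, 'd) ring_scheme \<Rightarrow> ('g, 'c) monoid_scheme \<Rightarrow> 'g topology \<Rightarrow>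
     ((nat \<Rightarrow> 'g) \<Rightarrow> 'r) set \<Rightarrow> ((nat \<Rightarrow> 'g) \<Rightarrow> 'r) set set" where
  "annihilator R G T A =
     {B \<in> carrier (cohomology R G T 1). cup R G T 1 1 A B = \<zero>\<^bsub>cohomology R G T 2\<^esub>}"


subsection \<open>Corestriction from a subgroup\<close>

text \<open>
  For \<open>N\<close> open of finite index in \<open>G\<close>, choose representatives \<open>c\<close> of the right cosets \<open>N c\<close>, and
  let \<open>r x \<in> N\<close> be determined by \<open>x = r x \<cdot> c\<close> with \<open>c\<close> the representative of \<open>N x\<close>.  Composition
  with the \<open>N\<close>-equivariant map \<open>r\<close> turns an \<open>N\<close>-invariant cochain \<open>f\<close> of \<open>N\<close> into an
  \<open>N\<close>-invariant function on tuples of \<open>G\<close> (this inverts restriction in cohomology), and the norm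
  over \<open>G\<close> modulo \<open>N\<close>, i.e. the sum over all translates by coset representatives, makes it
  \<open>G\<close>-invariant.  The resulting class does not depend on the representatives.
\<close>

definition coset_rep :: "'g set \<Rightarrow> 'g" where
  "coset_rep C = (SOME c. c \<in> C)"

definition coset_part :: "('g, 'c) monoid_scheme \<Rightarrow> 'g set \<Rightarrow> 'g \<Rightarrow> 'g" where
  "coset_part G N x = x \<otimes>\<^bsub>G\<^esub> inv\<^bsub>G\<^esub> (coset_rep (N #>\<^bsub>G\<^esub> x))"

definition cor_cochain ::
    "('r, 'd) ring_scheme \<Rightarrow> ('g, 'c) monoid_scheme \<Rightarrow> 'g set \<Rightarrow> nat \<Rightarrow>
     ((nat \<Rightarrow> 'g) \<Rightarrow> 'r) \<Rightarrow> (nat \<Rightarrow> 'g) \<Rightarrow> 'r" where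
  "cor_cochain R G N n f =
     (\<lambda>x\<in>tuples G n. \<Oplus>\<^bsub>R\<^esub>C\<in>rcosets\<^bsub>G\<^esub> N.
        f (\<lambda>i\<in>{..n}. coset_part G N (coset_rep C \<otimes>\<^bsub>G\<^esub> x i)))"

definition cor ::
    "('r, 'd) ring_scheme \<Rightarrow> ('g, 'c) monoid_scheme \<Rightarrow> 'g topology \<Rightarrow> 'g set \<Rightarrow> nat \<Rightarrow>
     ((nat \<Rightarrow> 'g) \<Rightarrow> 'r) set \<Rightarrow> ((nat \<Rightarrow> 'g) \<Rightarrow> 'r) set" where
  "cor R G T N n A = (\<Union>f\<in>A. coh_class R G T n (cor_cochain R G N n f))"


section \<open>Kummer classes\<close>

text \<open>
  For \<open>b \<in> F\<^sup>\<times>\<close> and a \<open>p\<close>-th root \<open>\<beta>\<close> of \<open>b\<close> in \<open>E\<close>, the Kummer character \<open>\<chi>\<close> of \<open>b\<close> is given by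
  \<open>\<sigma> \<beta> = \<xi> [^] \<chi> \<sigma> \<otimes> \<beta>\<close>; it does not depend on \<open>\<beta>\<close>, since \<open>\<xi> \<in> F\<close>.  The corresponding homogeneous
  1-cocycle is \<open>(x\<^sub>0, x\<^sub>1) \<mapsto> \<chi>(x\<^sub>0\<^sup>-\<^sup>1 x\<^sub>1)\<close>.
\<close>

definition kummer_char ::
    "('a, 'b) ring_scheme \<Rightarrow> 'a set \<Rightarrow> nat \<Rightarrow> 'a \<Rightarrow> 'a \<Rightarrow> ('a \<Rightarrow> 'a) \<Rightarrow> int" where
  "kummer_char \<Omega> E p \<xi> b \<sigma> =
     (let \<beta> = (SOME \<beta>. \<beta> \<in> E \<and> \<beta> [^]\<^bsub>\<Omega>\<^esub> p = b)
      in THE k. k \<in> carrier (residue_ring (int p)) \<and> \<sigma> \<beta> = \<xi> [^]\<^bsub>\<Omega>\<^esub> nat k \<otimes>\<^bsub>\<Omega>\<^esub> \<beta>)"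

definition kummer_class ::
    "('a, 'b) ring_scheme \<Rightarrow> 'a set \<Rightarrow> 'a set \<Rightarrow> nat \<Rightarrow> 'a \<Rightarrow> 'a \<Rightarrow>
     ((nat \<Rightarrow> ('a \<Rightarrow> 'a)) \<Rightarrow> int) set" where
  "kummer_class \<Omega> F E p \<xi> b =
     coh_class (residue_ring (int p)) (gal \<Omega> F E) (krull_topology \<Omega> F E) 1
       (\<lambda>x\<in>tuples (gal \<Omega> F E) 1.
          kummer_char \<Omega> E p \<xi> b (inv\<^bsub>gal \<Omega> F E\<^esub> (x 0) \<otimes>\<^bsub>gal \<Omega> F E\<^esub> x 1))"

end

theory Submission
  imports Defs "HOL-Algebra.Sylow" "HOL-Library.Function_Algebras" "HOL-Analysis.Product_Topology"
begin

text \<open>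
  Let \<open>s\<close> generate \<open>G / N\<close> and \<open>D = s - 1\<close>.  By Shapiro's lemma, \<open>H\<^sup>2(N)\<close> is the cohomology of the
  \<open>N\<close>-invariant homogeneous cochains of \<open>G\<close>, on which \<open>D\<^sup>p = 0\<close> and \<open>D\<^sup>p\<^sup>-\<^sup>1\<close> is the norm, hence
  corestriction.  Put \<open>F\<^sub>j = D\<^sup>j H\<^sup>2(N)\<close>.  Since corestriction is surjective, \<open>F\<^sub>p\<^sub>-\<^sub>1\<close> is the image of restriction,
  that is, \<open>H\<^sup>2(G) / (a) H\<^sup>1(G)\<close>, and corestriction induces \<open>H\<^sup>2(N) / F\<^sub>1 = H\<^sup>2(G)\<close>.  The maps
  \<open>F\<^sub>j / F\<^sub>j\<^sub>+\<^sub>1 \<rightarrow> F\<^sub>p\<^sub>-\<^sub>1\<close> given by \<open>D\<^sup>p\<^sup>-\<^sup>1\<^sup>-\<^sup>j\<close> are isomorphisms for \<open>1 \<le> j < p\<close>, so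
  \<open>dim H\<^sup>2(N) = dim H\<^sup>2(G) + (p - 1) y = dim (a) H\<^sup>1(G) + p y\<close>, and \<open>(a) H\<^sup>1(G) = H\<^sup>1(G) / ann (a)\<close>.

  Their injectivity needs the one arithmetic input: an element \<open>D w\<close> of \<open>H\<^sup>1(N)\<close> with \<open>D\<^sup>2 w = 0\<close> is a norm.
  Under Kummer theory this follows from Hilbert 90, because \<open>F(p)\<close> contains all \<open>p\<close>-th roots of its elements.
\<close>

section \<open>Counting with a cyclic group action\<close>

text \<open>Dimensions are obtained by counting: over Z/p a space of dimension n has p^n elements,
  so the claim becomes an identity between indices of groups of cocycles,
  \<open>[Z2 : B2] = [AG : BG] * [ZG : AG] ^ p\<close>. Cochains are preferred to classes because on
  N-invariant cochains of degree one D and the norm are exact (the kernel of each is the image of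
  the other), which fails for cocycles in general; every obstruction is thereby turned into a
  1-cocycle of the form D w that D kills, and it disappears once it is the norm of a cocycle. For p
  = 2 the norm is D itself; for odd p the divisibility of 0 + 1 + ... + (p - 1) by p makes the
  Kummer generators match. Surjectivity of corestriction also serves to replace an invariant cocycle
  by a norm. Finite dimension is assumed for G only, so finiteness has to be carried along with each
  index. Since F(p) may be infinite over F, resolvents are sums over quotients of G cut out by
  finitely many elements of F(p), always with coefficients in F.\<close>

definition add_subgroup :: "'m::ab_group_add set \<Rightarrow> bool" where
  "add_subgroup H \<longleftrightarrow> 0 \<in> H \<and> (\<forall>x\<in>H. \<forall>y\<in>H. x - y \<in> H)"

definition add_coset :: "'m::ab_group_add set \<Rightarrow> 'm \<Rightarrow> 'm set" where
  "add_coset H x = (+) x ` H"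

text \<open>H is not asked to lie inside K. Infinitely many cosets count as 0, which keeps the
  product formula \<open>index_tower\<close> valid without finiteness assumptions.\<close>

definition add_index :: "'m::ab_group_add set \<Rightarrow> 'm set \<Rightarrow> nat" where
  "add_index K H = card (add_coset H ` K)"

definition finite_index :: "'m::ab_group_add set \<Rightarrow> 'm set \<Rightarrow> bool" where
  "finite_index K H = finite (add_coset H ` K)"

lemma add_subgroupD:
  assumes "add_subgroup H"
  shows "0 \<in> H" "x \<in> H \<Longrightarrow> y \<in> H \<Longrightarrow> x - y \<in> H" "x \<in> H \<Longrightarrow> - x \<in> H" "x \<in> H \<Longrightarrow> y \<in> H \<Longrightarrow> x + y \<in> H"
proof -
  show 0: "0 \<in> H" and 1: "x \<in> H \<Longrightarrow> y \<in> H \<Longrightarrow> x - y \<in> H" for x y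
    using assms by (auto simp: add_subgroup_def)
  show 2: "x \<in> H \<Longrightarrow> - x \<in> H" for x using 1[OF 0, of x] by simp
  show "x \<in> H \<Longrightarrow> y \<in> H \<Longrightarrow> x + y \<in> H" using 1[of x "- y"] 2[of y] by simp
qed

lemma add_coset_eq_iff:
  assumes "add_subgroup H"
  shows "add_coset H x = add_coset H y \<longleftrightarrow> x - y \<in> H"
proof
  assume eq: "add_coset H x = add_coset H y"
  have "x \<in> add_coset H x" using add_subgroupD(1)[OF assms] by (force simp: add_coset_def)
  then obtain h where "h \<in> H" "x = y + h" using eq by (auto simp: add_coset_def)
  then show "x - y \<in> H" by simp
next
  assume xy: "x - y \<in> H"
  have "add_coset H a \<subseteq> add_coset H b" if "a - b \<in> H" for a b
  proof
    fix z assume "z \<in> add_coset H a"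
    then obtain h where "h \<in> H" "z = a + h" by (auto simp: add_coset_def)
    then have "z = b + ((a - b) + h)" "(a - b) + h \<in> H" using that add_subgroupD(4)[OF assms] by auto
    then show "z \<in> add_coset H b" unfolding add_coset_def by blast
  qed
  moreover have "y - x \<in> H" using add_subgroupD(3)[OF assms xy] by simp
  ultimately show "add_coset H x = add_coset H y" using xy by blast
qed

text \<open>A map on K whose fibres are the cosets of H counts them, so it can replace the coset
  map. In this way quotients are compared with sets of another type.\<close>

lemma index_by_fibres:
  assumes "add_subgroup H" and f: "\<And>x y. x \<in> K \<Longrightarrow> y \<in> K \<Longrightarrow> f x = f y \<longleftrightarrow> x - y \<in> H"
  shows "card (f ` K) = add_index K H" "finite (f ` K) \<longleftrightarrow> finite_index K H"
proof -
  \<comment> \<open>Evaluates f at some representative of the coset; by the assumption on fibres the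
    choice does not matter.\<close>
  define g where "g = (\<lambda>c. f (SOME x. x \<in> K \<and> add_coset H x = c))"
  have g: "g (add_coset H x) = f x" if x: "x \<in> K" for x
  proof -
    have "\<exists>x'. x' \<in> K \<and> add_coset H x' = add_coset H x" using x by blast
    then have "(SOME x'. x' \<in> K \<and> add_coset H x' = add_coset H x) \<in> K \<and>
       add_coset H (SOME x'. x' \<in> K \<and> add_coset H x' = add_coset H x) = add_coset H x" by (rule someI_ex)
    then show ?thesis using f x add_coset_eq_iff[OF assms(1)] by (simp add: g_def)
  qed
  have "bij_betw g (add_coset H ` K) (f ` K)"
  proof (rule bij_betw_imageI)
    show "inj_on g (add_coset H ` K)"
      using g f add_coset_eq_iff[OF assms(1)] by (auto simp: inj_on_def)
    show "g ` add_coset H ` K = f ` K" using g by (auto simp: image_iff)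
  qed
  then show "card (f ` K) = add_index K H" "finite (f ` K) \<longleftrightarrow> finite_index K H"
    using bij_betw_same_card[of g] bij_betw_finite[of g] unfolding add_index_def finite_index_def by metis+
qed

text \<open>Fixing a representative in each coset of L identifies K/H with K/L x L/H, as sets and
  not as groups. If an index is infinite, both sides of the product formula are 0.\<close>

lemma index_tower:
  assumes H: "add_subgroup H" and L: "add_subgroup L" and K: "add_subgroup K" and sub: "H \<subseteq> L" "L \<subseteq> K"
  shows "add_index K H = add_index K L * add_index L H"
    "finite_index K H \<longleftrightarrow> finite_index K L \<and> finite_index L H"
proof -
  define r where "r = (\<lambda>c. SOME x. x \<in> K \<and> add_coset L x = c)"
  have r: "r (add_coset L x) \<in> K" "add_coset L (r (add_coset L x)) = add_coset L x" if "x \<in> K" for x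
    using that someI_ex[of "\<lambda>x'. x' \<in> K \<and> add_coset L x' = add_coset L x"] unfolding r_def by auto
  define f where "f = (\<lambda>x. (add_coset L x, add_coset H (x - r (add_coset L x))))"
  have fib: "f x = f y \<longleftrightarrow> x - y \<in> H" if "x \<in> K" "y \<in> K" for x y
    using sub add_coset_eq_iff[OF L, of x y] add_coset_eq_iff[OF H] by (auto simp: f_def)
  have img: "f ` K = add_coset L ` K \<times> add_coset H ` L"
  proof
    show "f ` K \<subseteq> add_coset L ` K \<times> add_coset H ` L"
    proof
      fix q assume "q \<in> f ` K"
      then obtain x where x: "x \<in> K" "q = f x" by blast
      have "x - r (add_coset L x) \<in> L" using r(2)[OF x(1)] add_coset_eq_iff[OF L] by metis
      then show "q \<in> add_coset L ` K \<times> add_coset H ` L" using x by (auto simp: f_def)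
    qed
    show "add_coset L ` K \<times> add_coset H ` L \<subseteq> f ` K"
    proof
      fix q assume "q \<in> add_coset L ` K \<times> add_coset H ` L"
      then obtain x l where q: "x \<in> K" "l \<in> L" "q = (add_coset L x, add_coset H l)" by auto
      define y where "y = r (add_coset L x) + l"
      have y: "y \<in> K" using r(1)[OF q(1)] q(2) sub add_subgroupD(4)[OF K] by (auto simp: y_def)
      have "add_coset L y = add_coset L (r (add_coset L x))"
        using add_coset_eq_iff[OF L] q(2) by (simp add: y_def)
      then have "add_coset L y = add_coset L x" using r(2)[OF q(1)] by simp
      then have "f y = q" using q by (simp add: f_def y_def)
      then show "q \<in> f ` K" using y by blast
    qed
  qed
  \<comment> \<open>A product of an infinite set with the empty set is finite, so the equivalence
    for finiteness relies on nonempty factors.\<close>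
  have ne: "add_coset L ` K \<noteq> {}" "add_coset H ` L \<noteq> {}" using add_subgroupD(1)[OF K] add_subgroupD(1)[OF L] by auto
  show "add_index K H = add_index K L * add_index L H"
    using index_by_fibres(1)[OF H fib, of K] img by (simp add: add_index_def card_cartesian_product)
  show "finite_index K H \<longleftrightarrow> finite_index K L \<and> finite_index L H"
    using index_by_fibres(2)[OF H fib, of K] img ne by (auto simp: finite_index_def finite_cartesian_product_iff)
qed

text \<open>The isomorphism theorem in a form fitted to cocycles: surjectivity is asked only modulo
  H', and the kernel is described by membership of \<open>f x\<close> in H'.\<close>

lemma index_hom:
  assumes H: "add_subgroup H" and H': "add_subgroup H'"
    and add: "\<And>x y. f (x - y) = f x - f y"
    and clos: "\<And>x y. x \<in> K \<Longrightarrow> y \<in> K \<Longrightarrow> x - y \<in> K"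
    and im: "\<And>x. x \<in> K \<Longrightarrow> f x \<in> K'"
    and sur: "\<And>y. y \<in> K' \<Longrightarrow> \<exists>x\<in>K. y - f x \<in> H'"
    and ker: "\<And>x. x \<in> K \<Longrightarrow> f x \<in> H' \<longleftrightarrow> x \<in> H"
  shows "add_index K H = add_index K' H'" "finite_index K H \<longleftrightarrow> finite_index K' H'"
proof -
  have img: "(\<lambda>x. add_coset H' (f x)) ` K = add_coset H' ` K'"
  proof
    show "(\<lambda>x. add_coset H' (f x)) ` K \<subseteq> add_coset H' ` K'" using im by blast
    show "add_coset H' ` K' \<subseteq> (\<lambda>x. add_coset H' (f x)) ` K"
    proof
      fix c assume "c \<in> add_coset H' ` K'"
      then obtain y where y: "y \<in> K'" "c = add_coset H' y" by blast
      then obtain x where "x \<in> K" "y - f x \<in> H'" using sur by blast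
      then show "c \<in> (\<lambda>x. add_coset H' (f x)) ` K" using y add_coset_eq_iff[OF H', of y "f x"] by blast
    qed
  qed
  have fib: "add_coset H' (f x) = add_coset H' (f y) \<longleftrightarrow> x - y \<in> H" if "x \<in> K" "y \<in> K" for x y
    using add_coset_eq_iff[OF H'] ker[OF clos[OF that]] add by simp
  show "add_index K H = add_index K' H'" "finite_index K H \<longleftrightarrow> finite_index K' H'"
    using index_by_fibres[OF H fib, of K] img by (auto simp: add_index_def finite_index_def)
qed

text \<open>The input of the count, abstracted from groups and fields. In the application Y1
  consists of the N-invariant 1-cochains of G, Z1 and Z2 of the N-invariant cocycles, and D1, D2 are
  s - 1 for a lift s of a generator of G/N. \<open>ker_D1\<close> and \<open>ker_norm\<close> say
  that Y1 is cohomologically trivial for G/N; \<open>norm_lift\<close> is the arithmetic input;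
  \<open>cor_surj\<close> is surjectivity of corestriction, read on invariant cocycles.\<close>

locale cyclic_complex =
  fixes p :: nat and Y1 Z1 :: "'b::ab_group_add set" and Z2 :: "'c::ab_group_add set"
    and D1 :: "'b \<Rightarrow> 'b" and D2 :: "'c \<Rightarrow> 'c" and d :: "'b \<Rightarrow> 'c"
  assumes p: "2 \<le> p"
    and D1_diff: "D1 (x - y) = D1 x - D1 y" and D2_diff: "D2 (z - z') = D2 z - D2 z'"
    and d_diff: "d (x - y) = d x - d y"
    and Y1: "add_subgroup Y1" and Z2: "add_subgroup Z2"
    and Z1: "Z1 = {y \<in> Y1. d y = 0}"
    and D1_closed: "y \<in> Y1 \<Longrightarrow> D1 y \<in> Y1" and D2_closed: "z \<in> Z2 \<Longrightarrow> D2 z \<in> Z2"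
    and d_closed: "y \<in> Y1 \<Longrightarrow> d y \<in> Z2"
    and d_D: "y \<in> Y1 \<Longrightarrow> d (D1 y) = D2 (d y)"
    and ker_D1: "y \<in> Y1 \<Longrightarrow> D1 y = 0 \<Longrightarrow> \<exists>u\<in>Y1. y = (D1 ^^ (p - 1)) u"
    and ker_norm: "y \<in> Y1 \<Longrightarrow> (D1 ^^ (p - 1)) y = 0 \<Longrightarrow> \<exists>u\<in>Y1. y = D1 u"
    and D1_nil: "y \<in> Y1 \<Longrightarrow> (D1 ^^ p) y = 0" and D2_nil: "z \<in> Z2 \<Longrightarrow> (D2 ^^ p) z = 0"
    and norm_lift: "w \<in> Z1 \<Longrightarrow> D1 (D1 w) = 0 \<Longrightarrow> \<exists>n\<in>Z1. D1 w = (D1 ^^ (p - 1)) n"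
    and cor_surj: "c \<in> Z2 \<Longrightarrow> D2 c = 0 \<Longrightarrow>
      \<exists>z\<in>Z2. \<exists>y\<in>Y1. D1 y = 0 \<and> c = (D2 ^^ (p - 1)) z + d y"
begin

definition "B2 = d ` Y1"
definition "ZG = {z \<in> Z2. D2 z = 0}"
definition "BG = d ` {y \<in> Y1. D1 y = 0}"
text \<open>The cocycles of G that become coboundaries over N: the preimage of the kernel of
  restriction.\<close>

definition "AG = ZG \<inter> B2"
text \<open>The preimage in Z2 of the layer F_j; it decreases from \<open>Zf 0 = Z2\<close> to
  \<open>Zf p = B2\<close>.\<close>

definition "Zf j = {(D2 ^^ j) z + b | z b. z \<in> Z2 \<and> b \<in> B2}"

lemma additive:
  "D1 0 = 0" "D2 0 = 0" "d 0 = 0" "D1 (- x) = - D1 x" "D2 (- z) = - D2 z" "d (- x) = - d x"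
  "D1 (x + y) = D1 x + D1 y" "D2 (z + z') = D2 z + D2 z'" "d (x + y) = d x + d y"
proof -
  show 1: "D1 0 = 0" "D2 0 = 0" "d 0 = 0"
    using D1_diff[of 0 0] D2_diff[of 0 0] d_diff[of 0 0] by auto
  show 2: "D1 (- x) = - D1 x" "D2 (- z) = - D2 z" "d (- x) = - d x" for x z
    using D1_diff[of 0] D2_diff[of 0] d_diff[of 0] 1 by auto
  show "D1 (x + y) = D1 x + D1 y" "D2 (z + z') = D2 z + D2 z'" "d (x + y) = d x + d y"
    using D1_diff[of x "- y"] D2_diff[of z "- z'"] d_diff[of x "- y"] 2 by auto
qed

lemma pow_additive:
  "(D1 ^^ n) 0 = 0" "(D2 ^^ n) 0 = 0" "(D1 ^^ n) (x - y) = (D1 ^^ n) x - (D1 ^^ n) y"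
  "(D2 ^^ n) (z - z') = (D2 ^^ n) z - (D2 ^^ n) z'" "(D2 ^^ n) (z + z') = (D2 ^^ n) z + (D2 ^^ n) z'"
  by (induction n) (auto simp: additive D1_diff D2_diff)

lemma pow_closed: "y \<in> Y1 \<Longrightarrow> (D1 ^^ n) y \<in> Y1" "z \<in> Z2 \<Longrightarrow> (D2 ^^ n) z \<in> Z2"
  by (induction n) (auto simp: D1_closed D2_closed)

lemma d_pow: "y \<in> Y1 \<Longrightarrow> d ((D1 ^^ n) y) = (D2 ^^ n) (d y)"
  by (induction n) (auto simp: d_D pow_closed)

lemma pow_pow: "(D1 ^^ m) ((D1 ^^ n) y) = (D1 ^^ (m + n)) y" "(D2 ^^ m) ((D2 ^^ n) z) = (D2 ^^ (m + n)) z"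
  by (simp_all add: funpow_add)

lemma pow_Suc': "D1 ((D1 ^^ n) y) = (D1 ^^ Suc n) y" "D2 ((D2 ^^ n) z) = (D2 ^^ Suc n) z"
   "(D1 ^^ n) (D1 y) = (D1 ^^ Suc n) y" "(D2 ^^ n) (D2 z) = (D2 ^^ Suc n) z"
  by (simp_all add: funpow_swap1)

lemma D2_pow_ge: "z \<in> Z2 \<Longrightarrow> n \<ge> p \<Longrightarrow> (D2 ^^ n) z = 0"
  using pow_pow(2)[of "n - p" p z] D2_nil pow_additive(2) by simp

lemma B2_subgroup: "add_subgroup B2" and BG_subgroup: "add_subgroup BG"
  and ZG_subgroup: "add_subgroup ZG"
proof -
  have "d x - d y \<in> B2" if "x \<in> Y1" "y \<in> Y1" for x y
    using that add_subgroupD(2)[OF Y1] unfolding B2_def by (metis d_diff imageI)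
  moreover have "0 \<in> B2" unfolding B2_def using add_subgroupD(1)[OF Y1] additive(3) by (metis imageI)
  ultimately show "add_subgroup B2" by (auto simp: add_subgroup_def B2_def)
  have "d x - d y \<in> BG" if "x \<in> Y1" "y \<in> Y1" "D1 x = 0" "D1 y = 0" for x y
  proof -
    have "x - y \<in> {y \<in> Y1. D1 y = 0}" using that add_subgroupD(2)[OF Y1] D1_diff by simp
    then show ?thesis unfolding BG_def by (metis d_diff imageI)
  qed
  moreover have "0 \<in> BG"
    unfolding BG_def using add_subgroupD(1)[OF Y1] additive(1,3) by (metis (mono_tags, lifting) imageI mem_Collect_eq)
  ultimately show "add_subgroup BG" by (auto simp: add_subgroup_def BG_def)
  show "add_subgroup ZG"
    using add_subgroupD[OF Z2] by (auto simp: add_subgroup_def ZG_def D2_diff additive)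
qed

lemma AG_subgroup: "add_subgroup AG"
  using add_subgroupD[OF B2_subgroup] add_subgroupD[OF ZG_subgroup] by (auto simp: add_subgroup_def AG_def)

lemma B2_sub: "B2 \<subseteq> Z2" and BG_sub: "BG \<subseteq> AG" and BG_sub_B2: "BG \<subseteq> B2"
proof -
  show "B2 \<subseteq> Z2" using d_closed by (auto simp: B2_def)
  show "BG \<subseteq> B2" by (auto simp: B2_def BG_def)
  have "D2 (d y) = 0" if "y \<in> Y1" "D1 y = 0" for y using d_D[OF that(1)] that additive by simp
  then show "BG \<subseteq> AG" using d_closed by (auto simp: AG_def BG_def ZG_def B2_def)
qed

lemma B2_D: "b \<in> B2 \<Longrightarrow> D2 b \<in> B2"
  using d_D D1_closed unfolding B2_def by (metis (no_types, lifting) imageE imageI)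

lemma B2_pow: "b \<in> B2 \<Longrightarrow> (D2 ^^ n) b \<in> B2"
  by (induction n) (auto simp: B2_D)

lemma Z1_mem: "y \<in> Y1 \<Longrightarrow> d y = 0 \<Longrightarrow> y \<in> Z1" using Z1 by simp

text \<open>The kernel of restriction consists of the images of the connecting map
  \<open>f \<mapsto> d w\<close> with \<open>D1 w = f\<close>, i.e. of cup products with the class of the extension.\<close>

lemma ker_res:
  assumes c: "c \<in> AG"
  shows "\<exists>w\<in>Y1. D1 (D1 w) = 0 \<and> d w = c"
proof -
  have D2c: "D2 c = 0" using c by (simp add: AG_def ZG_def)
  \<comment> \<open>The exponent q with D1^q w = 0 is lowered from p down to 2, while d w stays
    equal to c.\<close>
  have step: "\<exists>w\<in>Y1. D1 (D1 w) = 0 \<and> d w = c" if "q \<le> p" "w \<in> Y1" "d w = c" "(D1 ^^ q) w = 0" for q w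
    using that
  proof (induction q arbitrary: w)
    case 0
    then show ?case using additive(1) by (intro bexI[of _ w]) auto
  next
    case (Suc m)
    show ?case
    proof (cases "m \<le> 1")
      case True
      then have "m = 0 \<or> m = 1" by auto
      then have "D1 (D1 w) = 0" using Suc.prems(4) additive by auto
      then show ?thesis using Suc.prems by blast
    next
      case False
      define x where "x = (D1 ^^ (m - 1)) w"
      have xY: "x \<in> Y1" using Suc.prems pow_closed by (simp add: x_def)
      \<comment> \<open>The exponent m - 1 is at least 1 and c is killed by D2, so x is a
        cocycle.\<close>
      have "d x = (D2 ^^ (m - 1)) c" using d_pow[OF Suc.prems(2)] Suc.prems(3) by (simp add: x_def)
      also have "\<dots> = (D2 ^^ (m - 2)) (D2 c)" using False pow_Suc'(4)[of "m - 2" c]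
        by (metis Suc_1 Suc_diff_Suc not_le One_nat_def diff_Suc_1' diff_Suc_Suc)
      finally have "d x = 0" using D2c pow_additive by simp
      then have xZ: "x \<in> Z1" using xY Z1_mem by blast
      have D1x: "D1 x = (D1 ^^ m) w" using False pow_Suc'(1)[of "m - 1" w] by (simp add: x_def)
      have "D1 (D1 x) = 0" using D1x Suc.prems(4) by simp
      then obtain n where n: "n \<in> Z1" "D1 x = (D1 ^^ (p - 1)) n" using norm_lift[OF xZ] by blast
      have nY: "n \<in> Y1" "d n = 0" using n Z1 by auto
      \<comment> \<open>Applying D1^m to the correction gives the norm of n, which cancels D1^m w;
        since n is a cocycle, d w is not affected.\<close>
      define w' where "w' = w - (D1 ^^ (p - 1 - m)) n"
      have "w' \<in> Y1" using Suc.prems(2) pow_closed(1)[OF nY(1)] add_subgroupD(2)[OF Y1] by (simp add: w'_def)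
      moreover have "d w' = c" using Suc.prems(3) d_diff d_pow[OF nY(1)] nY(2) pow_additive by (simp add: w'_def)
      moreover have "(D1 ^^ m) w' = 0"
        using pow_additive(3) pow_pow(1)[of m "p - 1 - m" n] D1x n(2) Suc.prems(1) by (simp add: w'_def)
      ultimately show ?thesis using Suc.IH Suc.prems(1) by simp
    qed
  qed
  obtain w where "w \<in> Y1" "d w = c" using c by (auto simp: AG_def B2_def)
  then show ?thesis using step[OF order_refl] D1_nil by blast
qed

text \<open>A class fixed by s need not contain a G-invariant cocycle; with D m = d v, the
  obstruction is the norm of v modulo norms of cocycles. If the corestriction of m is trivial, then,
  after a correction, this norm is D of a cocycle, and \<open>norm_lift\<close> makes it the norm of
  a cocycle.\<close>

lemma invariant_lifts:
  assumes m: "m \<in> Z2" and v: "v \<in> Y1" "D2 m = d v" and w: "(D2 ^^ (p - 1)) m \<in> BG"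
  shows "\<exists>c\<in>ZG. \<exists>b\<in>B2. m = c + b"
proof -
  obtain w where w: "w \<in> Y1" "D1 w = 0" "(D2 ^^ (p - 1)) m = d w" using w by (auto simp: BG_def)
  \<comment> \<open>The invariant cochain w is itself a norm, so subtracting d u makes the norm of m
    vanish and not merely lie in BG.\<close>
  obtain u where u: "u \<in> Y1" "w = (D1 ^^ (p - 1)) u" using ker_D1[OF w(1,2)] by blast
  define m' where "m' = m - d u"
  define v' where "v' = v - D1 u"
  have m': "m' \<in> Z2" using m d_closed[OF u(1)] add_subgroupD(2)[OF Z2] by (simp add: m'_def)
  have v': "v' \<in> Y1" using v u D1_closed add_subgroupD(2)[OF Y1] by (simp add: v'_def)
  have Dm': "D2 m' = d v'" using v u d_diff d_D D2_diff by (simp add: m'_def v'_def)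
  have Nm': "(D2 ^^ (p - 1)) m' = 0" using w u d_pow[OF u(1)] pow_additive by (simp add: m'_def)
  \<comment> \<open>Chosen so that d x is the norm of m', which is zero, while D x is the norm of
    v'.\<close>
  define x where "x = (D1 ^^ (p - 2)) v'"
  have xY: "x \<in> Y1" using pow_closed v' by (simp add: x_def)
  have Suc2: "Suc (p - 2) = p - 1" using p by simp
  have "d x = (D2 ^^ (p - 2)) (D2 m')" using d_pow[OF v'] Dm' by (simp add: x_def)
  then have "d x = 0" using Nm' pow_Suc'(4)[of "p - 2" m'] Suc2 by simp
  then have xZ: "x \<in> Z1" using xY Z1_mem by blast
  have D1x: "D1 x = (D1 ^^ (p - 1)) v'" using pow_Suc'(1)[of "p - 2" v'] Suc2 by (simp add: x_def)
  have "D1 (D1 x) = (D1 ^^ p) v'" using D1x pow_Suc'(1)[of "p - 1" v'] p by simp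
  then obtain n where n: "n \<in> Z1" "D1 x = (D1 ^^ (p - 1)) n" using norm_lift[OF xZ] D1_nil[OF v'] by auto
  have nY: "n \<in> Y1" "d n = 0" using n Z1 by auto
  have v''Y: "v' - n \<in> Y1" using v' nY add_subgroupD(2)[OF Y1] by blast
  have "(D1 ^^ (p - 1)) (v' - n) = 0" using n D1x pow_additive by simp
  \<comment> \<open>The cochains v' and n have the same norm, so exactness of Y1 writes their
    difference as D t; subtracting d t makes m' invariant.\<close>
  then obtain t where t: "t \<in> Y1" "v' - n = D1 t" using ker_norm[OF v''Y] by blast
  have dt: "D2 (d t) = d v'" using t d_D[OF t(1)] d_diff[of v' n] nY by simp
  have "m' - d t \<in> ZG" using m' d_closed[OF t(1)] add_subgroupD(2)[OF Z2] dt Dm' D2_diff by (simp add: ZG_def)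
  moreover have "d t + d u \<in> B2" using t u add_subgroupD(4)[OF B2_subgroup] by (auto simp: B2_def)
  moreover have "m = (m' - d t) + (d t + d u)" by (simp add: m'_def)
  ultimately show ?thesis by blast
qed

text \<open>Surjectivity of corestriction turns the invariant cocycle that represents the class of m
  into a norm, up to a coboundary.\<close>

lemma invariant_is_norm:
  assumes m: "m \<in> Z2" and v: "D2 m \<in> B2" and w: "(D2 ^^ (p - 1)) m \<in> BG"
  shows "\<exists>u\<in>Z2. \<exists>b\<in>B2. m = (D2 ^^ (p - 1)) u + b"
proof -
  obtain v where "v \<in> Y1" "D2 m = d v" using v by (auto simp: B2_def)
  then obtain c b where c: "c \<in> ZG" "b \<in> B2" "m = c + b" using invariant_lifts[OF m _ _ w] by blast
  then obtain z y where "z \<in> Z2" "y \<in> Y1" "c = (D2 ^^ (p - 1)) z + d y"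
    using cor_surj unfolding ZG_def by blast
  moreover from this have "d y + b \<in> B2" using c add_subgroupD(4)[OF B2_subgroup] by (auto simp: B2_def)
  ultimately show ?thesis using c by (metis add.assoc)
qed

text \<open>On H^2(N) the kernel of D^i lies in the image of D plus the kernel of D. For j >= 1 the
  cocycle D^j z is killed by D^(p-1), so if it is fixed modulo coboundaries,
  \<open>invariant_is_norm\<close> writes it as D^(p-1) u up to a coboundary; subtracting D^(p-1-j)
  u from z lowers the exponent.\<close>

lemma ker_pow:
  assumes "1 \<le> i" "i \<le> p - 1" "z \<in> Z2" "(D2 ^^ i) z \<in> B2"
  shows "\<exists>u\<in>Z2. \<exists>z'\<in>Z2. z = D2 u + z' \<and> D2 z' \<in> B2"
  using assms
proof (induction i arbitrary: z rule: nat_induct_at_least)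
  case base
  then show ?case using add_subgroupD(1)[OF Z2] additive by (intro bexI[of _ 0] bexI[of _ z]) auto
next
  case (Suc j)
  define y where "y = (D2 ^^ j) z"
  have y: "y \<in> Z2" using pow_closed Suc by (simp add: y_def)
  have "D2 y \<in> B2" using Suc.prems(3) by (simp add: y_def)
  moreover have "(D2 ^^ (p - 1)) y \<in> BG"
  proof -
    have "(D2 ^^ (p - 1)) y = 0"
      using D2_pow_ge[OF Suc.prems(2), of "p - 1 + j"] Suc.hyps by (simp add: y_def pow_pow)
    then show ?thesis using add_subgroupD(1)[OF BG_subgroup] by simp
  qed
  ultimately obtain u b where u: "u \<in> Z2" "b \<in> B2" "y = (D2 ^^ (p - 1)) u + b"
    using invariant_is_norm[OF y] by blast
  define z1 where "z1 = z - (D2 ^^ (p - 1 - j)) u"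
  have z1: "z1 \<in> Z2" using Suc.prems pow_closed(2)[OF u(1)] add_subgroupD(2)[OF Z2] by (simp add: z1_def)
  have "(D2 ^^ j) z1 = b"
    using u(3) pow_pow(2)[of j "p - 1 - j" u] Suc.prems(1) by (simp add: z1_def pow_additive y_def)
  then obtain u' z' where "u' \<in> Z2" "z' \<in> Z2" "z1 = D2 u' + z'" "D2 z' \<in> B2"
    using Suc.IH[OF _ z1] Suc.prems(1) u(2) by auto
  moreover have "(D2 ^^ (p - 1 - j)) u = D2 ((D2 ^^ (p - 2 - j)) u)"
    using pow_Suc'(2)[of "p - 2 - j" u] Suc.prems(1) by (simp add: Suc_diff_Suc numeral_2_eq_2)
  ultimately have "z = D2 (u' + (D2 ^^ (p - 2 - j)) u) + z'" "u' + (D2 ^^ (p - 2 - j)) u \<in> Z2"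
    using u(1) pow_closed(2) add_subgroupD(4)[OF Z2] by (auto simp: z1_def additive algebra_simps)
  then show ?case using \<open>z' \<in> Z2\<close> \<open>D2 z' \<in> B2\<close> by blast
qed

lemma p1: "1 \<le> p - 1"
  using p by simp

lemma Zf_mem: "k \<in> Zf j \<longleftrightarrow> (\<exists>z\<in>Z2. \<exists>b\<in>B2. k = (D2 ^^ j) z + b)"
  by (auto simp: Zf_def)

lemma Zf_subgroup: "add_subgroup (Zf j)"
  unfolding add_subgroup_def
proof (intro conjI ballI)
  show "0 \<in> Zf j"
    unfolding Zf_mem using add_subgroupD(1)[OF Z2] add_subgroupD(1)[OF B2_subgroup]
    by (intro bexI[of _ 0]) (auto simp: pow_additive)
  fix x y assume "x \<in> Zf j" "y \<in> Zf j"
  then obtain z b z' b' where "z \<in> Z2" "b \<in> B2" "z' \<in> Z2" "b' \<in> B2" "x = (D2 ^^ j) z + b" "y = (D2 ^^ j) z' + b'"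
    by (auto simp: Zf_mem)
  then show "x - y \<in> Zf j" unfolding Zf_mem
    using add_subgroupD(2)[OF Z2] add_subgroupD(2)[OF B2_subgroup]
    by (intro bexI[of _ "z - z'"] bexI[of _ "b - b'"]) (auto simp: pow_additive)
qed

lemma Zf_0: "Zf 0 = Z2"
proof
  show "Zf 0 \<subseteq> Z2" using B2_sub add_subgroupD(4)[OF Z2] by (auto simp: Zf_def)
  show "Z2 \<subseteq> Zf 0"
  proof
    fix z assume "z \<in> Z2"
    then have "z = (D2 ^^ 0) z + 0" "z \<in> Z2" "0 \<in> B2" using add_subgroupD(1)[OF B2_subgroup] by auto
    then show "z \<in> Zf 0" unfolding Zf_mem by blast
  qed
qed

lemma Zf_p: "Zf p = B2"
  using D2_nil add_subgroupD(1)[OF Z2] by (force simp: Zf_def)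

lemma Zf_B2: "B2 \<subseteq> Zf j"
  using add_subgroupD(1)[OF Z2] pow_additive(2) by (force simp: Zf_def)

lemma Zf_Suc: "Zf (Suc j) \<subseteq> Zf j"
proof
  fix k assume "k \<in> Zf (Suc j)"
  then obtain z b where "z \<in> Z2" "b \<in> B2" "k = (D2 ^^ Suc j) z + b" unfolding Zf_mem by blast
  then have "k = (D2 ^^ j) (D2 z) + b" "D2 z \<in> Z2" "b \<in> B2" using D2_closed pow_Suc'(4)[of j z] by auto
  then show "k \<in> Zf j" unfolding Zf_mem by blast
qed

lemma B2_cancel: "b \<in> B2 \<Longrightarrow> x + b \<in> B2 \<longleftrightarrow> x \<in> B2"
  using add_subgroupD[OF B2_subgroup] by (metis add_diff_cancel_right')

text \<open>Injectivity on the layer is \<open>ker_pow\<close> with i = p - 1: writing z = D u + z'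
  with D z' in B2, the part D^j z' is a coboundary because j >= 1, and D^j (D u) lies in the next
  layer.\<close>

lemma index_step:
  assumes "1 \<le> j" "j \<le> p - 1"
  shows "add_index (Zf j) (Zf (Suc j)) = add_index (Zf (p - 1)) B2"
    "finite_index (Zf j) (Zf (Suc j)) \<longleftrightarrow> finite_index (Zf (p - 1)) B2"
proof -
  let ?f = "D2 ^^ (p - 1 - j)"
  have 1: "?f x \<in> Zf (p - 1)" if xk: "x \<in> Zf j" for x
  proof -
    obtain z b where "z \<in> Z2" "b \<in> B2" "x = (D2 ^^ j) z + b" using xk unfolding Zf_mem by blast
    then have "?f x = (D2 ^^ (p - 1)) z + ?f b" "?f b \<in> B2" "z \<in> Z2"
      using pow_pow(2)[of "p - 1 - j" j z] assms B2_pow by (auto simp: pow_additive)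
    then show ?thesis unfolding Zf_mem by blast
  qed
  have 2: "\<exists>x\<in>Zf j. y - ?f x \<in> B2" if yk: "y \<in> Zf (p - 1)" for y
  proof -
    obtain z b where z: "z \<in> Z2" "b \<in> B2" "y = (D2 ^^ (p - 1)) z + b" using yk unfolding Zf_mem by blast
    then have "(D2 ^^ j) z \<in> Zf j" unfolding Zf_mem using add_subgroupD(1)[OF B2_subgroup]
      by (intro bexI[of _ z] bexI[of _ 0]) auto
    moreover have "y - ?f ((D2 ^^ j) z) = b" using z pow_pow(2)[of "p - 1 - j" j z] assms by simp
    ultimately show ?thesis using z by blast
  qed
  have 3: "?f x \<in> B2 \<longleftrightarrow> x \<in> Zf (Suc j)" if xk: "x \<in> Zf j" for x
  proof -
    obtain z b where z: "z \<in> Z2" "b \<in> B2" "x = (D2 ^^ j) z + b" using xk unfolding Zf_mem by blast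
    have fx: "?f x = (D2 ^^ (p - 1)) z + ?f b" "?f b \<in> B2"
      using z pow_pow(2)[of "p - 1 - j" j z] assms B2_pow by (auto simp: pow_additive)
    show ?thesis
    proof
      assume "?f x \<in> B2"
      then have "(D2 ^^ (p - 1)) z \<in> B2" using fx B2_cancel by metis
      then obtain u z' where u: "u \<in> Z2" "z' \<in> Z2" "z = D2 u + z'" "D2 z' \<in> B2"
        using ker_pow[OF p1 order_refl z(1)] by blast
      have "(D2 ^^ j) z' \<in> B2" using B2_pow[OF u(4), of "j - 1"] pow_Suc'(4)[of "j - 1" z'] assms by simp
      then have "(D2 ^^ j) z' + b \<in> B2" using z add_subgroupD(4)[OF B2_subgroup] by blast
      moreover have "x = (D2 ^^ Suc j) u + ((D2 ^^ j) z' + b)"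
        using z(3) u(3) pow_additive(5)[of j "D2 u" z'] pow_Suc'(4)[of j u] by simp
      ultimately show "x \<in> Zf (Suc j)" unfolding Zf_mem using u by blast
    next
      assume "x \<in> Zf (Suc j)"
      then obtain z b where z: "z \<in> Z2" "b \<in> B2" "x = (D2 ^^ Suc j) z + b" unfolding Zf_mem by blast
      have "?f x = (D2 ^^ (p - 1 - j + Suc j)) z + ?f b" using z pow_pow(2) pow_additive(5) by metis
      then have "?f x = ?f b" using D2_pow_ge[OF z(1), of "p - 1 - j + Suc j"] assms by simp
      then show "?f x \<in> B2" using z B2_pow by simp
    qed
  qed
  show "add_index (Zf j) (Zf (Suc j)) = add_index (Zf (p - 1)) B2"
    "finite_index (Zf j) (Zf (Suc j)) \<longleftrightarrow> finite_index (Zf (p - 1)) B2"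
    using index_hom[OF Zf_subgroup B2_subgroup _ _ 1 2 3] pow_additive(4) add_subgroupD(2)[OF Zf_subgroup]
    by blast+
qed

text \<open>Counted from the bottom: i layers above B2, all of the size of the last one. The bound i
  = p - 1 stops at \<open>Zf 1\<close>, because the top layer Z2 / Zf 1 is governed by corestriction
  instead.\<close>

lemma index_chain:
  assumes "finite_index (Zf (p - 1)) B2" "i \<le> p - 1"
  shows "add_index (Zf (p - i)) B2 = add_index (Zf (p - 1)) B2 ^ i \<and> finite_index (Zf (p - i)) B2"
  using assms(2)
proof (induction i)
  case 0
  have "add_coset B2 x = add_coset B2 0" if "x \<in> B2" for x using add_coset_eq_iff[OF B2_subgroup, of x 0] that by simp
  then have "add_coset B2 ` B2 = {add_coset B2 0}" using add_subgroupD(1)[OF B2_subgroup] by blast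
  then show ?case by (simp add: Zf_p add_index_def finite_index_def)
next
  case (Suc i)
  let ?j = "p - Suc i"
  have j: "1 \<le> ?j" "?j \<le> p - 1" "Suc ?j = p - i" using Suc.prems p by auto
  have "add_index (Zf ?j) B2 = add_index (Zf ?j) (Zf (Suc ?j)) * add_index (Zf (Suc ?j)) B2"
       "finite_index (Zf ?j) B2 \<longleftrightarrow> finite_index (Zf ?j) (Zf (Suc ?j)) \<and> finite_index (Zf (Suc ?j)) B2"
    using index_tower[OF B2_subgroup Zf_subgroup[of "Suc ?j"] Zf_subgroup[of ?j] Zf_B2 Zf_Suc] by blast+
  then show ?case using index_step[OF j(1,2)] j(3) Suc assms(1) by simp
qed

text \<open>The norm maps Z2 onto ZG modulo BG. If the norm of x = D u + z' lies in BG, so does that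
  of z', because D^p = 0; then z' is itself a norm up to a coboundary, hence in the image of D, as p
  >= 2.\<close>

lemma cor_quotient:
  "add_index Z2 (Zf 1) = add_index ZG BG" "finite_index Z2 (Zf 1) \<longleftrightarrow> finite_index ZG BG"
proof -
  let ?f = "D2 ^^ (p - 1)"
  have Sp: "Suc (p - 1) = p" using p by simp
  have 1: "?f x \<in> ZG" if "x \<in> Z2" for x
    using that pow_closed D2_nil[OF that] pow_Suc'(2)[of "p - 1" x] Sp by (simp add: ZG_def)
  have 2: "\<exists>x\<in>Z2. y - ?f x \<in> BG" if "y \<in> ZG" for y
  proof -
    obtain z u where "z \<in> Z2" "u \<in> Y1" "D1 u = 0" "y = ?f z + d u" using cor_surj \<open>y \<in> ZG\<close> unfolding ZG_def by blast
    then show ?thesis by (intro bexI[of _ z]) (auto simp: BG_def)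
  qed
  have 3: "?f x \<in> BG \<longleftrightarrow> x \<in> Zf 1" if x: "x \<in> Z2" for x
  proof
    assume fx: "?f x \<in> BG"
    then obtain u z' where u: "u \<in> Z2" "z' \<in> Z2" "x = D2 u + z'" "D2 z' \<in> B2"
      using ker_pow[OF p1 order_refl x] BG_sub_B2 by blast
    have "?f x = ?f z'"
      using u D2_nil[OF u(1)] pow_Suc'(4)[of "p - 1" u] Sp by (simp add: pow_additive)
    then obtain u' b where u': "u' \<in> Z2" "b \<in> B2" "z' = ?f u' + b"
      using invariant_is_norm[OF u(2,4)] fx by metis
    have "?f u' = D2 ((D2 ^^ (p - 2)) u')" using pow_Suc'(2)[of "p - 2" u'] p
      by (metis Suc_1 Suc_diff_Suc Suc_le_lessD diff_Suc_1 diff_Suc_eq_diff_pred)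
    then have "x = (D2 ^^ 1) (u + (D2 ^^ (p - 2)) u') + b" using u u' by (simp add: additive)
    moreover have "u + (D2 ^^ (p - 2)) u' \<in> Z2" using u u' pow_closed add_subgroupD(4)[OF Z2] by simp
    ultimately show "x \<in> Zf 1" unfolding Zf_mem using u' by blast
  next
    assume "x \<in> Zf 1"
    then obtain z y where z: "z \<in> Z2" "y \<in> Y1" "x = D2 z + d y" by (auto simp: Zf_def B2_def)
    have "?f x = d ((D1 ^^ (p - 1)) y)"
      using z D2_nil[OF z(1)] pow_Suc'(4)[of "p - 1" z] Sp d_pow by (simp add: pow_additive)
    moreover have "D1 ((D1 ^^ (p - 1)) y) = 0" using pow_Suc'(1)[of "p - 1" y] Sp D1_nil[OF z(2)] by simp
    ultimately show "?f x \<in> BG" using z pow_closed by (auto simp: BG_def)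
  qed
  show "add_index Z2 (Zf 1) = add_index ZG BG" "finite_index Z2 (Zf 1) \<longleftrightarrow> finite_index ZG BG"
    using index_hom[OF Zf_subgroup BG_subgroup _ _ 1 2 3] pow_additive(4) add_subgroupD(2)[OF Z2] by blast+
qed

text \<open>The isomorphism is induced by the inclusion of ZG, hence the map \<open>id\<close>: by
  surjectivity of corestriction every invariant cocycle is already a norm modulo B2.\<close>

lemma norm_quotient:
  "add_index (Zf (p - 1)) B2 = add_index ZG AG" "finite_index (Zf (p - 1)) B2 \<longleftrightarrow> finite_index ZG AG"
proof -
  have 1: "id x \<in> Zf (p - 1)" if "x \<in> ZG" for x
    using cor_surj that unfolding ZG_def Zf_mem B2_def by fastforce
  have 2: "\<exists>x\<in>ZG. y - id x \<in> B2" if yk: "y \<in> Zf (p - 1)" for y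
  proof -
    obtain z b where z: "z \<in> Z2" "b \<in> B2" "y = (D2 ^^ (p - 1)) z + b" using yk unfolding Zf_mem by blast
    have "(D2 ^^ (p - 1)) z \<in> ZG"
      using z pow_closed D2_nil[OF z(1)] pow_Suc'(2)[of "p - 1" z] p by (simp add: ZG_def)
    then show ?thesis using z by (intro bexI[of _ "(D2 ^^ (p - 1)) z"]) auto
  qed
  have 3: "id x \<in> B2 \<longleftrightarrow> x \<in> AG" if "x \<in> ZG" for x using that by (simp add: AG_def)
  show "add_index (Zf (p - 1)) B2 = add_index ZG AG" "finite_index (Zf (p - 1)) B2 \<longleftrightarrow> finite_index ZG AG"
    using index_hom[OF AG_subgroup B2_subgroup _ _ 1 2 3] add_subgroupD(2)[OF ZG_subgroup] by auto
qed

text \<open>One factor [ZG : AG] comes from the top layer, through [ZG : BG] = [ZG : AG] [AG : BG];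
  the other p - 1 come from the layers below it.\<close>

theorem index_Z2_B2:
  assumes "finite_index ZG BG"
  shows "finite_index Z2 B2" "add_index Z2 B2 = add_index AG BG * add_index ZG AG ^ p"
proof -
  have t: "add_index ZG BG = add_index ZG AG * add_index AG BG" "finite_index ZG AG"
    using index_tower[OF BG_subgroup AG_subgroup ZG_subgroup BG_sub] assms by (auto simp: AG_def)
  have c: "add_index (Zf 1) B2 = add_index ZG AG ^ (p - 1)" "finite_index (Zf 1) B2"
    using index_chain[of "p - 1"] norm_quotient t p by auto
  have "Zf 1 \<subseteq> Z2" using Zf_Suc[of 0] Zf_0 by simp
  then have "add_index Z2 B2 = add_index Z2 (Zf 1) * add_index (Zf 1) B2" "finite_index Z2 B2"
    using index_tower[OF B2_subgroup Zf_subgroup Z2 Zf_B2] c cor_quotient assms by auto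
  moreover have "add_index ZG AG ^ p = add_index ZG AG * add_index ZG AG ^ (p - 1)"
    using p by (metis power_eq_if not_numeral_le_zero)
  ultimately show "finite_index Z2 B2" "add_index Z2 B2 = add_index AG BG * add_index ZG AG ^ p"
    using c cor_quotient t by (auto simp: mult_ac)
qed

end

section \<open>Cochains of a group with a cyclic quotient\<close>

text \<open>The ring \<open>\<Prod>\<^sub>n \<int>/n\<int>\<close>, whose factor at \<open>p\<close> is the coefficient ring \<open>\<int>/p\<int>\<close>; it turns cochains
  for a variable \<open>p\<close> into functions with values in a type.\<close>

quotient_type resid = "nat \<Rightarrow> int" / "\<lambda>f g. \<forall>n. int n dvd f n - g n"
proof (intro equivpI reflpI sympI transpI)
  fix f g h :: "nat \<Rightarrow> int"
  assume a: "\<forall>n. int n dvd f n - g n" and b: "\<forall>n. int n dvd g n - h n"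
  show "\<forall>n. int n dvd f n - h n"
  proof
    fix n
    have "int n dvd (f n - g n) + (g n - h n)" using a b by (intro dvd_add) auto
    then show "int n dvd f n - h n" by simp
  qed
qed (auto simp: dvd_diff_commute)

lemma dvd_diff_diff:
  fixes d :: int assumes "d dvd a - a'" "d dvd b - b'" shows "d dvd a - b - (a' - b')"
  using dvd_diff[OF assms] by (simp add: algebra_simps)

lemma dvd_mult_diff:
  fixes d :: int assumes "d dvd a - a'" "d dvd b - b'" shows "d dvd a * b - a' * b'"
proof -
  have "d dvd (a - a') * b + a' * (b - b')" using assms by simp
  then show ?thesis by (simp add: algebra_simps)
qed

instantiation resid :: comm_ring_1
begin
lift_definition zero_resid :: resid is "\<lambda>_. 0" .
lift_definition one_resid :: resid is "\<lambda>_. 1" .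
lift_definition plus_resid :: "resid \<Rightarrow> resid \<Rightarrow> resid" is "\<lambda>f g n. f n + g n"
  by (simp add: add_diff_add)
lift_definition minus_resid :: "resid \<Rightarrow> resid \<Rightarrow> resid" is "\<lambda>f g n. f n - g n"
  by (blast intro: dvd_diff_diff)
lift_definition uminus_resid :: "resid \<Rightarrow> resid" is "\<lambda>f n. - f n"
  by (simp add: dvd_diff_commute)
lift_definition times_resid :: "resid \<Rightarrow> resid \<Rightarrow> resid" is "\<lambda>f g n. f n * g n"
  by (blast intro: dvd_mult_diff)
instance
proof
  show "(0::resid) \<noteq> 1"
    by transfer (auto dest: spec[of _ 2])
qed (transfer; simp add: algebra_simps)+
end

text \<open>Inclusion of the factor at p, with 0 in all other factors; a ring homomorphism apart
  from the unit. Its image is a copy of Z/p inside a type that does not depend on p.\<close>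

lift_definition iota :: "nat \<Rightarrow> int \<Rightarrow> resid" is "\<lambda>p m n. if n = p then m else 0" .

lemma iota_eq_iff: "iota p m = iota p m' \<longleftrightarrow> [m = m'] (mod int p)"
  by transfer (auto simp: cong_iff_dvd_diff)

lemma iota_simps:
  "iota p (m + n) = iota p m + iota p n" "iota p (m - n) = iota p m - iota p n"
  "iota p (- m) = - iota p m" "iota p 0 = 0" "iota p (m * n) = iota p m * iota p n"
  by (transfer; auto)+

lemma iota_of_int: "of_int k * iota p m = iota p (k * m)"
proof -
  have n: "of_nat j * iota p m = iota p (int j * m)" for j
    by (induction j) (auto simp: iota_simps(1,4) distrib_right algebra_simps)
  show ?thesis
  proof (cases k)
    case (nonneg j)
    then show ?thesis using n by simp
  next
    case (neg j)
    then show ?thesis using n[of "Suc j"] iota_simps(3)[of p "int (Suc j) * m"]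
      by (simp only: of_int_minus of_int_of_nat_eq mult_minus_left)
  qed
qed

lemma iota_mod: "iota p (m mod int p) = iota p m"
  by (simp add: iota_eq_iff cong_def)

lemma iota_sum: "iota p (\<Sum>i\<in>A. g i) = (\<Sum>i\<in>A. iota p (g i))"
  by (induction A rule: infinite_finite_induct) (auto simp: iota_simps)

text \<open>In characteristic \<open>p\<close>, the \<open>(p-1)\<close>-st power of \<open>\<sigma> - 1\<close> is the norm \<open>1 + \<sigma> + \<dots> + \<sigma>\<^sup>p\<^sup>-\<^sup>1\<close>,
  since \<open>(-1)\<^sup>i\<close> times the binomial coefficient of \<open>i\<close> out of \<open>p - 1\<close> is \<open>1\<close> modulo \<open>p\<close>.\<close>

definition fdiff :: "(nat \<Rightarrow> 'a::comm_ring_1) \<Rightarrow> nat \<Rightarrow> 'a" where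
  "fdiff u i = u (Suc i) - u i"

text \<open>The binomial expansion of (shift - 1)^n; Pascal's rule is the recursion for the
  coefficients.\<close>

lemma fdiff_sum: "(fdiff ^^ n) u j = (\<Sum>i\<le>n. of_int ((- 1) ^ (n - i) * int (n choose i)) * u (j + i))"
proof (induction n arbitrary: j)
  case (Suc n)
  define c where "c n i = (- 1 :: int) ^ (n - i) * int (n choose i)" for n i
  have rec: "c (Suc n) (Suc i) = c n i - c n (Suc i)" if "i \<le> n" for i
  proof (cases "i = n")
    case False
    then have "n - i = Suc (n - Suc i)" using that by simp
    then show ?thesis by (simp add: c_def algebra_simps)
  qed (simp add: c_def)
  have c0: "c (Suc n) 0 = - c n 0" by (simp add: c_def)
  have cn: "c n (Suc n) = 0" by (simp add: c_def)
  have "(fdiff ^^ Suc n) u j = (\<Sum>i\<le>n. of_int (c n i) * u (Suc j + i)) - (\<Sum>i\<le>n. of_int (c n i) * u (j + i))"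
    by (simp only: funpow.simps comp_apply fdiff_def[of "(fdiff ^^ n) u"] Suc c_def)
  also have "(\<Sum>i\<le>n. of_int (c n i) * u (j + i)) = (\<Sum>i\<le>Suc n. of_int (c n i) * u (j + i))" by (simp add: cn)
  also have "\<dots> = of_int (c n 0) * u j + (\<Sum>i\<le>n. of_int (c n (Suc i)) * u (Suc j + i))"
    by (subst sum.atMost_Suc_shift) simp
  also have "(\<Sum>i\<le>n. of_int (c n i) * u (Suc j + i)) - \<dots> =
     of_int (c (Suc n) 0) * u j + (\<Sum>i\<le>n. of_int (c (Suc n) (Suc i)) * u (Suc j + i))"
    using rec by (simp add: c0 sum_subtractf[symmetric] left_diff_distrib[symmetric] flip: of_int_diff)
  also have "\<dots> = (\<Sum>i\<le>Suc n. of_int (c (Suc n) i) * u (j + i))"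
    by (subst sum.atMost_Suc_shift) simp
  finally show ?case by (simp add: c_def)
qed simp

text \<open>Consecutive entries of row p - 1 of Pascal's triangle add up to an entry of row p that
  is divisible by p, so they are negatives of each other modulo p.\<close>

lemma binomial_pred_prime:
  assumes "prime p" "i \<le> p - 1"
  shows "[(- 1) ^ i * int ((p - 1) choose i) = 1] (mod int p)"
  using assms(2)
proof (induction i)
  case (Suc i)
  have "p choose Suc i = (p - 1 choose i) + (p - 1 choose Suc i)"
    using prime_gt_0_nat[OF assms(1)] by (metis Suc_diff_1 binomial_Suc_Suc)
  moreover have "p dvd (p choose Suc i)"
    using Suc.prems prime_gt_1_nat[OF assms(1)] by (intro dvd_choose_prime assms(1)) auto
  ultimately have "int p dvd int (p - 1 choose i) + int (p - 1 choose Suc i)" by (metis of_nat_add of_nat_dvd_iff)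
  then have "int p dvd (- 1) ^ i * (int (p - 1 choose i) + int (p - 1 choose Suc i))" by simp
  moreover have "int p dvd (- 1) ^ i * int (p - 1 choose i) - 1"
    using Suc by (simp add: cong_iff_dvd_diff)
  ultimately have "int p dvd ((- 1) ^ i * int (p - 1 choose i) - 1) - (- 1) ^ i * (int (p - 1 choose i) + int (p - 1 choose Suc i))"
    by (rule dvd_diff[rotated])
  moreover have "((- 1) ^ i * int (p - 1 choose i) - 1) - (- 1) ^ i * (int (p - 1 choose i) + int (p - 1 choose Suc i)) =
      (- 1) ^ Suc i * int (p - 1 choose Suc i) - 1" by (simp add: distrib_left)
  ultimately show ?case by (simp only: cong_iff_dvd_diff)
qed simp

lemma fdiff_norm:
  assumes p: "prime p" and u: "\<And>i. u i \<in> range (iota p)"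
  shows "(fdiff ^^ (p - 1)) u j = (\<Sum>i<p. u (j + i))"
proof -
  have "of_int ((- 1) ^ (p - 1 - i) * int (p - 1 choose i)) * u (j + i) = u (j + i)" if i: "i \<le> p - 1" for i
  proof -
    obtain m where m: "u (j + i) = iota p m" using u by blast
    have "[(- 1) ^ (p - 1 - i) * int ((p - 1) choose (p - 1 - i)) = 1] (mod int p)"
      by (rule binomial_pred_prime[OF p]) simp
    then have "[(- 1) ^ (p - 1 - i) * int ((p - 1) choose i) * m = 1 * m] (mod int p)"
      using binomial_symmetric[OF i] by (intro cong_mult cong_refl) simp
    then show ?thesis unfolding m iota_of_int by (simp add: iota_eq_iff)
  qed
  then have "(fdiff ^^ (p - 1)) u j = (\<Sum>i\<le>p - 1. u (j + i))" unfolding fdiff_sum by (intro sum.cong) auto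
  also have "{..p - 1} = {..<p}" using prime_gt_0_nat[OF p] by auto
  finally show ?thesis .
qed

text \<open>The p-th difference is the difference of two neighbouring norms, and for a sequence of
  period p the sum over a window of length p does not depend on where the window starts.\<close>

lemma fdiff_nil:
  assumes p: "prime p" and u: "\<And>i. u i \<in> range (iota p)" "\<And>i. u (i + p) = u i"
  shows "(fdiff ^^ p) u j = 0"
proof -
  obtain q where q: "p = Suc q" using prime_gt_0_nat[OF p] gr0_conv_Suc by blast
  have "(fdiff ^^ p) u j = (fdiff ^^ (p - 1)) u (Suc j) - (fdiff ^^ (p - 1)) u j"
    by (simp add: q fdiff_def)
  also have "\<dots> = (\<Sum>i<p. u (Suc j + i)) - (\<Sum>i<p. u (j + i))" using fdiff_norm[OF p u(1)] by simp
  also have "(\<Sum>i<p. u (Suc j + i)) = (\<Sum>i<p. u (j + i)) - u j + u (j + p)"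
    unfolding q by (induction q) (auto simp: algebra_simps)
  finally show ?thesis using u(2)[of j] by simp
qed

section \<open>Locally constant functions\<close>

definition lc :: "'x topology \<Rightarrow> ('x \<Rightarrow> 'y) \<Rightarrow> bool" where
  "lc TX f \<longleftrightarrow> (\<forall>x\<in>topspace TX. \<exists>U. openin TX U \<and> x \<in> U \<and> (\<forall>y\<in>U. f y = f x))"

lemma lc_cong: "(\<And>x. x \<in> topspace TX \<Longrightarrow> f x = g x) \<Longrightarrow> lc TX f = lc TX g"
proof -
  assume eq: "\<And>x. x \<in> topspace TX \<Longrightarrow> f x = g x"
  have "lc TX g'" if eq: "\<And>x. x \<in> topspace TX \<Longrightarrow> f' x = g' x" and f: "lc TX f'" for f' g' :: "'a \<Rightarrow> 'b"
    unfolding lc_def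
  proof
    fix x assume x: "x \<in> topspace TX"
    then obtain U where U: "openin TX U" "x \<in> U" "\<forall>y\<in>U. f' y = f' x" using bspec[OF f[unfolded lc_def] x] by blast
    have "g' y = g' x" if "y \<in> U" for y
      using eq[of y] eq[OF x] bspec[OF U(3) that] subsetD[OF openin_subset[OF U(1)] that] by (simp only:)
    then show "\<exists>U. openin TX U \<and> x \<in> U \<and> (\<forall>y\<in>U. g' y = g' x)" using U(1,2) by blast
  qed
  note imp = this
  show ?thesis
  proof
    show "lc TX f \<Longrightarrow> lc TX g" by (rule imp[of f g]) (simp_all add: eq)
    show "lc TX g \<Longrightarrow> lc TX f" by (rule imp[of g f]) (simp_all add: eq)
  qed
qed

lemma lc_combine:
  assumes "lc TX f" "lc TX g" shows "lc TX (\<lambda>x. F (f x) (g x))"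
  unfolding lc_def
proof
  fix x assume x: "x \<in> topspace TX"
  obtain U where U: "openin TX U" "x \<in> U" "\<forall>y\<in>U. f y = f x" using bspec[OF assms(1)[unfolded lc_def] x] by blast
  obtain V where V: "openin TX V" "x \<in> V" "\<forall>y\<in>V. g y = g x" using bspec[OF assms(2)[unfolded lc_def] x] by blast
  show "\<exists>W. openin TX W \<and> x \<in> W \<and> (\<forall>y\<in>W. F (f y) (g y) = F (f x) (g x))"
  proof (intro exI[of _ "U \<inter> V"] conjI ballI)
    show "openin TX (U \<inter> V)" using U(1) V(1) by (rule openin_Int)
    show "x \<in> U \<inter> V" using U(2) V(2) by blast
    show "F (f y) (g y) = F (f x) (g x)" if "y \<in> U \<inter> V" for y
      using bspec[OF U(3) IntD1[OF that]] bspec[OF V(3) IntD2[OF that]] by (simp only:)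
  qed
qed

lemma lc_const: "lc TX (\<lambda>_. c)"
  unfolding lc_def using openin_topspace by blast

lemma lc_map: "lc TX f \<Longrightarrow> lc TX (\<lambda>x. F (f x))"
  using lc_combine[of TX f f "\<lambda>a b. F a"] by simp

lemma lc_sum: "(\<And>i. i \<in> A \<Longrightarrow> lc TX (f i)) \<Longrightarrow> lc TX (\<lambda>x. \<Sum>i\<in>A. f i x :: 'y::comm_monoid_add)"
proof (induction A rule: infinite_finite_induct)
  case (insert a A)
  have "lc TX (\<lambda>x. f a x + (\<Sum>i\<in>A. f i x))"
    by (rule lc_combine[of TX "f a" "\<lambda>x. \<Sum>i\<in>A. f i x" "(+)"]) (use insert in blast)+
  then show ?case using insert by simp
qed (auto intro: lc_const)

lemma lc_compose:
  assumes f: "lc TX f" and h: "continuous_map TY TX h" shows "lc TY (\<lambda>y. f (h y))"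
  unfolding lc_def
proof
  fix y assume y: "y \<in> topspace TY"
  then have "h y \<in> topspace TX" using h by (auto simp: continuous_map_def)
  then obtain U where U: "openin TX U" "h y \<in> U" "\<forall>z\<in>U. f z = f (h y)" using f unfolding lc_def by blast
  have "openin TY {z \<in> topspace TY. h z \<in> U}" using h U(1) by (auto simp: continuous_map_def)
  then show "\<exists>V. openin TY V \<and> y \<in> V \<and> (\<forall>z\<in>V. f (h z) = f (h y))"
    using U y by (intro exI[of _ "{z \<in> topspace TY. h z \<in> U}"]) blast
qed

text \<open>Continuity into a discrete space splits into a condition on values and local constancy.
  The latter does not mention the target, so it survives arbitrary operations on values.\<close>

lemma lc_continuous_map:
  "continuous_map TX (discrete_topology S) f \<longleftrightarrow> f \<in> topspace TX \<rightarrow> S \<and> lc TX f"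
proof (intro iffI conjI)
  assume c: "continuous_map TX (discrete_topology S) f"
  then show fS: "f \<in> topspace TX \<rightarrow> S" by (auto simp: continuous_map_def)
  show "lc TX f" unfolding lc_def
  proof
    fix x assume x: "x \<in> topspace TX"
    have "openin (discrete_topology S) {f x}" using fS x by auto
    then have "openin TX {y \<in> topspace TX. f y \<in> {f x}}" using c by (auto simp: continuous_map_def)
    then show "\<exists>U. openin TX U \<and> x \<in> U \<and> (\<forall>y\<in>U. f y = f x)"
      using x by (intro exI[of _ "{y \<in> topspace TX. f y \<in> {f x}}"]) auto
  qed
next
  assume a: "f \<in> topspace TX \<rightarrow> S \<and> lc TX f"
  have "openin TX {x \<in> topspace TX. f x \<in> U}" for U
  proof (subst openin_subopen, intro ballI)
    fix x assume x: "x \<in> {x \<in> topspace TX. f x \<in> U}"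
    then obtain V where V: "openin TX V" "x \<in> V" "\<forall>y\<in>V. f y = f x" using a unfolding lc_def by blast
    then show "\<exists>W. openin TX W \<and> x \<in> W \<and> W \<subseteq> {x \<in> topspace TX. f x \<in> U}"
    proof (intro exI[of _ V] conjI subsetI CollectI)
      show "openin TX V" "x \<in> V" using V by auto
      fix y assume y: "y \<in> V"
      then show "y \<in> topspace TX" using openin_subset[OF V(1)] by blast
      show "f y \<in> U" unfolding bspec[OF V(3) y] using x by blast
    qed
  qed
  then show "continuous_map TX (discrete_topology S) f" using a by (auto simp: continuous_map_def)
qed

text \<open>Extension by 0 outside the space makes equality of functions the same as equality of
  cochains, so cochains form a subgroup of the group of all functions. The set I of invariance is a
  parameter of its own: I = G gives cochains of G, and I = N gives those cochains on G that compute
  the cohomology of N.\<close>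

definition cochain_fun :: "nat \<Rightarrow> 'x topology \<Rightarrow> ('g \<Rightarrow> 'x \<Rightarrow> 'x) \<Rightarrow> 'g set \<Rightarrow> ('x \<Rightarrow> resid) set" where
  "cochain_fun p TX act I = {f. (\<forall>x. x \<notin> topspace TX \<longrightarrow> f x = 0) \<and> (\<forall>x. f x \<in> range (iota p)) \<and>
     lc TX f \<and> (\<forall>g\<in>I. \<forall>x\<in>topspace TX. f (act g x) = f x)}"

lemma iota_range:
  "0 \<in> range (iota p)" "u \<in> range (iota p) \<Longrightarrow> v \<in> range (iota p) \<Longrightarrow> u - v \<in> range (iota p)"
  "u \<in> range (iota p) \<Longrightarrow> v \<in> range (iota p) \<Longrightarrow> u + v \<in> range (iota p)"
  "(\<And>i. i \<in> A \<Longrightarrow> w i \<in> range (iota p)) \<Longrightarrow> (\<Sum>i\<in>A. w i) \<in> range (iota p)"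
proof -
  show 0: "0 \<in> range (iota p)" using iota_simps(4) by (metis rangeI)
  show "u \<in> range (iota p) \<Longrightarrow> v \<in> range (iota p) \<Longrightarrow> u - v \<in> range (iota p)"
    by (auto simp flip: iota_simps)
  show plus: "u \<in> range (iota p) \<Longrightarrow> v \<in> range (iota p) \<Longrightarrow> u + v \<in> range (iota p)" for u v
    by (auto simp flip: iota_simps)
  show "(\<And>i. i \<in> A \<Longrightarrow> w i \<in> range (iota p)) \<Longrightarrow> (\<Sum>i\<in>A. w i) \<in> range (iota p)"
    by (induction A rule: infinite_finite_induct) (auto simp: 0 plus)
qed

lemma cochain_funD:
  assumes "f \<in> cochain_fun p TX act I"
  shows "x \<notin> topspace TX \<Longrightarrow> f x = 0" "f x \<in> range (iota p)" "lc TX f"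
    "g \<in> I \<Longrightarrow> x \<in> topspace TX \<Longrightarrow> f (act g x) = f x"
  using assms by (auto simp: cochain_fun_def)

lemma cochain_funI:
  assumes "\<And>x. x \<notin> topspace TX \<Longrightarrow> f x = 0" "\<And>x. x \<in> topspace TX \<Longrightarrow> f x \<in> range (iota p)" "lc TX f"
    "\<And>g x. g \<in> I \<Longrightarrow> x \<in> topspace TX \<Longrightarrow> f (act g x) = f x"
  shows "f \<in> cochain_fun p TX act I"
proof -
  have "f x \<in> range (iota p)" for x using assms(1,2) iota_range(1)[of p] by (cases "x \<in> topspace TX") auto
  then show ?thesis using assms by (simp add: cochain_fun_def)
qed

lemma cochain_fun_diff:
  assumes "f \<in> cochain_fun p TX act I" "h \<in> cochain_fun p TX act I" shows "f - h \<in> cochain_fun p TX act I"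
proof (rule cochain_funI)
  note F = cochain_funD[OF assms(1)] and H = cochain_funD[OF assms(2)]
  show "(f - h) x = 0" if "x \<notin> topspace TX" for x using F(1)[OF that] H(1)[OF that] by simp
  show "(f - h) x \<in> range (iota p)" for x using iota_range(2)[OF F(2) H(2)] by simp
  show "lc TX (f - h)" using lc_combine[OF F(3) H(3), of "(-)"] by (simp add: fun_diff_def)
  show "(f - h) (act g x) = (f - h) x" if "g \<in> I" "x \<in> topspace TX" for g x using F(4)[OF that] H(4)[OF that] by simp
qed

lemma cochain_fun_0: "0 \<in> cochain_fun p TX act I"
  by (rule cochain_funI) (auto simp: iota_range zero_fun_def intro: lc_const)

text \<open>G/N is identified with Z/p through a character \<open>\<chi>\<close> with kernel N and
  values represented in 0, ..., p - 1; s is an element of value 1. Local constancy of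
  \<open>\<chi>\<close> expresses that N is open.\<close>

locale cyclic_quotient = group G for G (structure) +
  fixes T :: "'a topology" and N :: "'a set" and p :: nat and \<chi> :: "'a \<Rightarrow> nat" and s :: 'a
  assumes p: "prime p" and topspace_T: "topspace T = carrier G"
    and left_cont: "g \<in> carrier G \<Longrightarrow> continuous_map T T (\<lambda>x. g \<otimes> x)"
    and right_cont: "g \<in> carrier G \<Longrightarrow> continuous_map T T (\<lambda>x. x \<otimes> g)"
    and chi_less: "g \<in> carrier G \<Longrightarrow> \<chi> g < p"
    and chi_hom: "g \<in> carrier G \<Longrightarrow> h \<in> carrier G \<Longrightarrow> [\<chi> (g \<otimes> h) = \<chi> g + \<chi> h] (mod p)"
    and chi_N: "g \<in> carrier G \<Longrightarrow> g \<in> N \<longleftrightarrow> \<chi> g = 0" and N_sub: "subgroup N G"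
    and chi_lc: "lc T \<chi>" and s: "s \<in> carrier G" "\<chi> s = 1"
begin

lemma p0: "p > 0" and p1: "p > 1" using prime_gt_1_nat[OF p] by auto

lemma NG: "\<tau> \<in> N \<Longrightarrow> \<tau> \<in> carrier G" using subgroup.mem_carrier[OF N_sub] .

lemma chi_one: "\<chi> \<one> = 0" using chi_N[OF one_closed] subgroup.one_closed[OF N_sub] by simp

lemma chi_pow: "[\<chi> (s [^] (m::nat)) = m] (mod p)"
proof (induction m)
  case (Suc m)
  have "[\<chi> (s [^] Suc m) = \<chi> (s [^] m) + \<chi> s] (mod p)" using chi_hom[of "s [^] m" s] s by simp
  also have "[\<chi> (s [^] m) + \<chi> s = m + 1] (mod p)" using Suc s by (intro cong_add) auto
  finally show ?case by simp
qed (simp add: chi_one)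

lemma N_of_cong: "g \<in> carrier G \<Longrightarrow> [\<chi> g = 0] (mod p) \<Longrightarrow> g \<in> N"
  using chi_N chi_less by (simp add: cong_def)

lemma s_pow_N: "s [^] p \<in> N"
  using N_of_cong[of "s [^] p"] chi_pow[of p] s by (simp add: cong_def)

lemma chi_N_mult: "\<tau> \<in> N \<Longrightarrow> g \<in> carrier G \<Longrightarrow> \<chi> (\<tau> \<otimes> g) = \<chi> g"
  using chi_hom[OF NG, of \<tau> g] chi_N[OF NG, of \<tau>] chi_less[of g] chi_less[of "\<tau> \<otimes> g"] NG[of \<tau>]
  by (simp add: cong_def)

lemma coset_decomposition:
  assumes "g \<in> carrier G" shows "g \<otimes> inv (s [^] \<chi> g) \<in> N" "g = (g \<otimes> inv (s [^] \<chi> g)) \<otimes> s [^] \<chi> g"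
proof -
  let ?t = "g \<otimes> inv (s [^] \<chi> g)"
  have t: "?t \<in> carrier G" using assms s by simp
  show e: "g = ?t \<otimes> s [^] \<chi> g" using assms s by (simp add: m_assoc)
  have "[\<chi> g = \<chi> ?t + \<chi> (s [^] \<chi> g)] (mod p)" using chi_hom[OF t, of "s [^] \<chi> g"] e s by simp
  also have "[\<chi> ?t + \<chi> (s [^] \<chi> g) = \<chi> ?t + \<chi> g] (mod p)" using chi_pow by (rule cong_add[OF cong_refl])
  finally have "[0 = \<chi> ?t] (mod p)" by (metis add.left_neutral cong_add_rcancel_nat)
  then show "?t \<in> N" using N_of_cong[OF t] cong_sym by blast
qed

lemma N_normal: "\<tau> \<in> N \<Longrightarrow> g \<in> carrier G \<Longrightarrow> g \<otimes> \<tau> \<otimes> inv g \<in> N"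
proof -
  assume a: "\<tau> \<in> N" "g \<in> carrier G"
  have tc: "\<tau> \<in> carrier G" using NG a by blast
  have "[\<chi> (g \<otimes> \<tau> \<otimes> inv g) = \<chi> (g \<otimes> \<tau>) + \<chi> (inv g)] (mod p)" using chi_hom[of "g \<otimes> \<tau>" "inv g"] a tc by simp
  also have "[\<chi> (g \<otimes> \<tau>) + \<chi> (inv g) = \<chi> g + \<chi> \<tau> + \<chi> (inv g)] (mod p)" using chi_hom[OF a(2) tc] by (rule cong_add[OF _ cong_refl])
  also have "\<chi> g + \<chi> \<tau> + \<chi> (inv g) = \<chi> g + \<chi> (inv g)" using chi_N[OF tc] a by simp
  also have "[\<chi> g + \<chi> (inv g) = \<chi> (g \<otimes> inv g)] (mod p)" using chi_hom[of g "inv g"] a by (simp add: cong_sym)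
  also have "\<chi> (g \<otimes> inv g) = 0" using a chi_one by simp
  finally show ?thesis using N_of_cong a tc by simp
qed

end

text \<open>The equivariant map \<open>\<pi>\<close> to G cuts the space into p clopen pieces
  according to \<open>\<chi>\<close>, which s permutes cyclically. This is the source of the
  exactness of D and the norm, and it serves pairs and triples alike.\<close>

locale cochain_space = cyclic_quotient +
  fixes TX :: "'x topology" and act :: "'a \<Rightarrow> 'x \<Rightarrow> 'x" and \<pi> :: "'x \<Rightarrow> 'a"
  assumes act_closed: "g \<in> carrier G \<Longrightarrow> x \<in> topspace TX \<Longrightarrow> act g x \<in> topspace TX"
    and act_mult: "g \<in> carrier G \<Longrightarrow> h \<in> carrier G \<Longrightarrow> x \<in> topspace TX \<Longrightarrow> act (g \<otimes> h) x = act g (act h x)"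
    and act_one: "x \<in> topspace TX \<Longrightarrow> act \<one> x = x"
    and act_cont: "g \<in> carrier G \<Longrightarrow> continuous_map TX TX (act g)"
    and pi_cont: "continuous_map TX T \<pi>"
    and pi_act: "g \<in> carrier G \<Longrightarrow> x \<in> topspace TX \<Longrightarrow> \<pi> (act g x) = g \<otimes> \<pi> x"
begin

abbreviation XX where "XX \<equiv> topspace TX"
abbreviation Y where "Y \<equiv> cochain_fun p TX act N"

definition D :: "('x \<Rightarrow> resid) \<Rightarrow> 'x \<Rightarrow> resid" where
  "D f x = (if x \<in> XX then f (act s x) - f x else 0)"

lemma pi_closed: "x \<in> XX \<Longrightarrow> \<pi> x \<in> carrier G"
  using pi_cont topspace_T by (auto simp: continuous_map_def)

lemma D_diff: "D (f - h) = D f - D h"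
  by (auto simp: D_def)

lemma lc_act: "lc TX f \<Longrightarrow> g \<in> carrier G \<Longrightarrow> lc TX (\<lambda>x. f (act g x))"
  using lc_compose act_cont by blast

lemma lc_chi: "lc TX (\<lambda>x. \<chi> (\<pi> x))"
  using lc_compose[OF chi_lc pi_cont] .

lemma act_N: "\<tau> \<in> N \<Longrightarrow> g \<in> carrier G \<Longrightarrow> x \<in> XX \<Longrightarrow> \<exists>\<tau>'\<in>N. act g (act \<tau> x) = act \<tau>' (act g x)"
proof -
  assume a: "\<tau> \<in> N" "g \<in> carrier G" "x \<in> XX"
  let ?t = "g \<otimes> \<tau> \<otimes> inv g"
  have t: "?t \<in> N" using N_normal a by blast
  have "?t \<otimes> g = g \<otimes> \<tau>" using a NG by (simp add: m_assoc)
  then have "act g (act \<tau> x) = act ?t (act g x)" using act_mult[OF a(2) NG[OF a(1)] a(3)] act_mult[OF NG[OF t] a(2,3)] by simp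
  then show ?thesis using t by blast
qed

lemma Y_act:
  assumes f: "f \<in> Y" and g: "g \<in> carrier G" shows "(\<lambda>x. if x \<in> XX then f (act g x) else 0) \<in> Y"
proof (rule cochain_funI)
  note F = cochain_funD[OF f]
  show "lc TX (\<lambda>x. if x \<in> XX then f (act g x) else 0)"
    using lc_act[OF F(3) g] by (subst lc_cong[of TX _ "\<lambda>x. f (act g x)"]) auto
  show "(if act \<tau> x \<in> XX then f (act g (act \<tau> x)) else 0) = (if x \<in> XX then f (act g x) else 0)"
    if t: "\<tau> \<in> N" and x: "x \<in> XX" for \<tau> x
  proof -
    obtain \<tau>' where "\<tau>' \<in> N" "act g (act \<tau> x) = act \<tau>' (act g x)" using act_N[OF t g x] by blast
    then show ?thesis using F(4)[of \<tau>' "act g x"] act_closed NG t g x by auto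
  qed
qed (use cochain_funD(2)[OF f] in auto)

lemma D_closed: "f \<in> Y \<Longrightarrow> D f \<in> Y"
proof -
  assume f: "f \<in> Y"
  have "D f = (\<lambda>x. if x \<in> XX then f (act s x) else 0) - f"
    using cochain_funD(1)[OF f] by (auto simp: D_def fun_eq_iff)
  then show ?thesis using cochain_fun_diff[OF Y_act[OF f s(1)] f] by simp
qed

text \<open>Along the orbit of x under s, D is the difference operator on sequences, so the
  identities for \<open>fdiff\<close> carry over to cochains.\<close>

lemma D_pow:
  assumes x: "x \<in> XX"
  shows "(D ^^ n) f (act (s [^] j) x) = (fdiff ^^ n) (\<lambda>i. f (act (s [^] i) x)) j"
proof (induction n arbitrary: j)
  case (Suc n)
  have c: "act (s [^] j) x \<in> XX" using act_closed x s by simp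
  have "act s (act (s [^] j) x) = act (s [^] Suc j) x"
    using act_mult[OF s(1) nat_pow_closed[OF s(1)] x, of j] nat_pow_Suc2[OF s(1), of j] by simp
  then have "(D ^^ Suc n) f (act (s [^] j) x) = (D ^^ n) f (act (s [^] Suc j) x) - (D ^^ n) f (act (s [^] j) x)"
    using c D_def[of "(D ^^ n) f" "act (s [^] j) x"] by (simp only: funpow.simps comp_apply if_True)
  then show ?case unfolding Suc by (simp only: funpow.simps comp_apply fdiff_def[of "(fdiff ^^ n) u" for u])
qed simp

lemma D_pow': "x \<in> XX \<Longrightarrow> (D ^^ n) f x = (fdiff ^^ n) (\<lambda>i. f (act (s [^] i) x)) 0"
  using D_pow[of x n f 0] act_one by simp

lemma D_pow_outside: "f \<in> Y \<Longrightarrow> x \<notin> XX \<Longrightarrow> (D ^^ n) f x = 0"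
  using cochain_funD(1) by (cases n) (auto simp: D_def)

lemma norm_formula:
  assumes f: "f \<in> Y" and x: "x \<in> XX"
  shows "(D ^^ (p - 1)) f x = (\<Sum>i<p. f (act (s [^] i) x))"
  using D_pow'[OF x] fdiff_norm[OF p, of "\<lambda>i. f (act (s [^] i) x)" 0] cochain_funD(2)[OF f] by simp

lemma s_pow_period:
  assumes f: "f \<in> Y" and x: "x \<in> XX" shows "f (act (s [^] (i + p)) x) = f (act (s [^] i) x)"
proof -
  have "act (s [^] (p + i)) x = act (s [^] p) (act (s [^] i) x)"
    using act_mult[of "s [^] p" "s [^] i" x] s x by (simp add: nat_pow_mult)
  then show ?thesis using cochain_funD(4)[OF f s_pow_N, of "act (s [^] i) x"] act_closed s x by (simp add: add.commute)
qed

lemma D_nil: "f \<in> Y \<Longrightarrow> (D ^^ p) f = 0"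
proof
  fix x assume f: "f \<in> Y"
  show "(D ^^ p) f x = 0 x"
  proof (cases "x \<in> XX")
    case True
    then show ?thesis
      using D_pow'[OF True] fdiff_nil[OF p, of "\<lambda>i. f (act (s [^] i) x)" 0] cochain_funD(2)[OF f] s_pow_period[OF f True] by simp
  qed (use D_pow_outside[OF f] in simp)
qed

lemma chi_act_s: "x \<in> XX \<Longrightarrow> [\<chi> (\<pi> (act (s [^] (i::nat)) x)) = i + \<chi> (\<pi> x)] (mod p)"
proof -
  assume x: "x \<in> XX"
  have "[\<chi> (s [^] i \<otimes> \<pi> x) = \<chi> (s [^] i) + \<chi> (\<pi> x)] (mod p)" using chi_hom[OF _ pi_closed[OF x]] s by simp
  also have "[\<chi> (s [^] i) + \<chi> (\<pi> x) = i + \<chi> (\<pi> x)] (mod p)" using chi_pow by (rule cong_add[OF _ cong_refl])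
  finally show ?thesis using pi_act x s by simp
qed

lemma chi_act_N: "\<tau> \<in> N \<Longrightarrow> x \<in> XX \<Longrightarrow> \<chi> (\<pi> (act \<tau> x)) = \<chi> (\<pi> x)"
  using pi_act NG chi_N_mult pi_closed by simp

lemma D_zero_invariant:
  assumes f: "f \<in> Y" and z: "D f = 0" and x: "x \<in> XX"
  shows "f (act (s [^] (i::nat)) x) = f x"
proof (induction i)
  case (Suc i)
  have c: "act (s [^] i) x \<in> XX" using act_closed x s by simp
  have "act s (act (s [^] i) x) = act (s [^] Suc i) x"
    using act_mult[OF s(1) nat_pow_closed[OF s(1)] x, of i] nat_pow_Suc2[OF s(1), of i] by simp
  then have "D f (act (s [^] i) x) = f (act (s [^] Suc i) x) - f (act (s [^] i) x)" using c by (simp add: D_def)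
  then show ?case using z Suc by simp
qed (use act_one x in simp)

text \<open>An s-invariant f is the norm of its part supported where \<open>\<chi>\<close> vanishes,
  since p consecutive points of an orbit under s meet that piece exactly once.\<close>

lemma ker_D:
  assumes f: "f \<in> Y" and z: "D f = 0"
  shows "\<exists>u\<in>Y. f = (D ^^ (p - 1)) u"
proof
  note F = cochain_funD[OF f]
  let ?u = "\<lambda>x. if x \<in> XX \<and> \<chi> (\<pi> x) = 0 then f x else 0"
  show u: "?u \<in> Y"
  proof (rule cochain_funI)
    have "lc TX (\<lambda>x. if \<chi> (\<pi> x) = 0 then f x else 0)"
      by (rule lc_combine[OF lc_chi F(3), of "\<lambda>c v. if c = 0 then v else 0"])
    then show "lc TX ?u" by (subst lc_cong[of TX _ "\<lambda>x. if \<chi> (\<pi> x) = 0 then f x else 0"]) auto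
    show "?u x \<in> range (iota p)" for x using F(2) iota_range(1)[of p] by auto
    show "?u (act \<tau> x) = ?u x" if "\<tau> \<in> N" "x \<in> XX" for \<tau> x
      using that F(4) chi_act_N act_closed NG by auto
  qed auto
  show "f = (D ^^ (p - 1)) ?u"
  proof
    fix x show "f x = (D ^^ (p - 1)) ?u x"
    proof (cases "x \<in> XX")
      case True
      \<comment> \<open>The one number of steps below p that moves x to the piece where
        \<open>\<chi>\<close> is 0; the reduction mod p covers the case in which x already lies
        there.\<close>
      define i0 where "i0 = (p - \<chi> (\<pi> x)) mod p"
      have c: "\<chi> (\<pi> x) < p" using chi_less pi_closed True by simp
      have i0: "i0 < p" using p0 by (simp add: i0_def)
      have iff: "\<chi> (\<pi> (act (s [^] i) x)) = 0 \<longleftrightarrow> i = i0" if "i < p" for i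
      proof -
        have ax: "act (s [^] i) x \<in> XX" using act_closed True s by simp
        have "\<chi> (\<pi> (act (s [^] i) x)) = (i + \<chi> (\<pi> x)) mod p"
          using chi_act_s[OF True, of i] chi_less[OF pi_closed[OF ax]] by (simp add: cong_def)
        moreover have "(i + \<chi> (\<pi> x)) mod p = 0 \<longleftrightarrow> i = i0"
        proof (cases "\<chi> (\<pi> x) = 0")
          case True
          then show ?thesis using that by (simp add: i0_def)
        next
          case False
          then have "i0 = p - \<chi> (\<pi> x)" using c by (simp add: i0_def)
          then show ?thesis using that c False by (auto simp: mod_if)
        qed
        ultimately show ?thesis by simp
      qed
      have "(D ^^ (p - 1)) ?u x = (\<Sum>i<p. ?u (act (s [^] i) x))" using norm_formula[OF u True] .
      also have "\<dots> = (\<Sum>i<p. if i = i0 then f x else 0)"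
        using iff D_zero_invariant[OF f z True] act_closed True s by (intro sum.cong) auto
      also have "\<dots> = f x" using i0 by simp
      finally show ?thesis ..
    qed (use F(1) D_pow_outside[OF u] in simp)
  qed
qed

text \<open>Summing f along the orbit, starting at the piece where \<open>\<chi>\<close> is 0,
  inverts D. The sum closes up consistently after p steps because the norm of f vanishes.\<close>

lemma ker_norm:
  assumes f: "f \<in> Y" and z: "(D ^^ (p - 1)) f = 0"
  shows "\<exists>u\<in>Y. f = D u"
proof
  note F = cochain_funD[OF f]
  \<comment> \<open>The preceding points s^(-1-j) x are written as s^(p-1-j) x, which has the same
    value under f because s^p lies in N. The outer range does not depend on x, so that local
    constancy can be checked term by term.\<close>
  let ?v = "\<lambda>x. \<Sum>j<p - 1. if j < \<chi> (\<pi> x) then f (act (s [^] (p - 1 - j)) x) else 0"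
  let ?u = "\<lambda>x. if x \<in> XX then ?v x else 0"
  show u: "?u \<in> Y"
  proof (rule cochain_funI)
    have "lc TX (\<lambda>x. if j < \<chi> (\<pi> x) then f (act (s [^] (p - 1 - j)) x) else 0)" for j
      by (rule lc_combine[OF lc_chi lc_act[OF F(3)], of _ "\<lambda>c v. if j < c then v else 0"]) (use s in simp)
    then have "lc TX ?v" by (rule lc_sum)
    then show "lc TX ?u" by (subst lc_cong[of TX _ ?v]) auto
    show "?u x \<in> range (iota p)" for x using F(2) iota_range(1)[of p] by (auto intro!: iota_range(4))
    show "?u (act \<tau> x) = ?u x" if t: "\<tau> \<in> N" "x \<in> XX" for \<tau> x
    proof -
      have "f (act (s [^] i) (act \<tau> x)) = f (act (s [^] i) x)" for i :: nat
        using cochain_funD(4)[OF Y_act[OF f, of "s [^] i"] t] s t act_closed NG by simp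
      then show ?thesis by (simp only: chi_act_N[OF t] act_closed[OF NG[OF t(1)] t(2)] t(2) if_True)
    qed
  qed auto
  show "f = D ?u"
  proof
    fix x show "f x = D ?u x"
    proof (cases "x \<in> XX")
      case True
      define c where "c = \<chi> (\<pi> x)"
      have cp: "c < p" using chi_less pi_closed True by (simp add: c_def)
      have sx: "act s x \<in> XX" using act_closed s True by simp
      have cs: "\<chi> (\<pi> (act s x)) = (1 + c) mod p"
        using chi_act_s[OF True, of 1] chi_less[OF pi_closed[OF sx]] s by (simp add: cong_def c_def)
      have shift: "act (s [^] i) (act s x) = act (s [^] Suc i) x" for i :: nat
        using act_mult[of "s [^] i" s x] s True by simp
      have sum: "(\<Sum>j<p - 1. if j < m then g j else 0) = (\<Sum>j<m. g j)" if "m \<le> p - 1" for m and g :: "nat \<Rightarrow> resid"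
      proof -
        have "(\<Sum>j<p - 1. if j < m then g j else 0) = (\<Sum>j\<in>{..<p - 1} \<inter> {j. j < m}. g j)" by (simp add: sum.inter_restrict)
        also have "{..<p - 1} \<inter> {j. j < m} = {..<m}" using that by auto
        finally show ?thesis .
      qed
      have ux: "?u x = (\<Sum>j<c. f (act (s [^] (p - 1 - j)) x))" using True cp sum[of c] by (simp add: c_def)
      have fp: "f (act (s [^] p) x) = f x" using s_pow_period[OF f True, of 0] act_one[OF True] by simp
      show ?thesis
      proof (cases "Suc c < p")
        case True
        have "?u (act s x) = (\<Sum>j<Suc c. f (act (s [^] Suc (p - 1 - j)) x))"
          using sx cs sum[of "Suc c"] True shift by simp
        also have "\<dots> = f (act (s [^] p) x) + (\<Sum>j<c. f (act (s [^] Suc (p - 1 - Suc j)) x))"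
          using p0 by (subst sum.lessThan_Suc_shift) simp
        also have "(\<Sum>j<c. f (act (s [^] Suc (p - 1 - Suc j)) x)) = (\<Sum>j<c. f (act (s [^] (p - 1 - j)) x))"
          using True by (intro sum.cong refl) (simp add: Suc_diff_Suc)
        finally show ?thesis using ux fp \<open>x \<in> XX\<close> by (simp add: D_def)
      next
        case False
        \<comment> \<open>The wrap-around: x lies in the last piece and s x in the piece where
          \<open>\<chi>\<close> is 0, where the sum defining u is empty.\<close>
        then have c: "c = p - 1" using cp by simp
        have "?u (act s x) = 0" using cs c p0 by simp
        moreover have "?u x + f x = 0"
        proof -
          have "(\<Sum>i<p. f (act (s [^] i) x)) = 0" using norm_formula[OF f \<open>x \<in> XX\<close>] z by simp
          moreover have "{..<p} = insert 0 (Suc ` {..<p - 1})" using p0 by (auto simp: image_iff gr0_conv_Suc less_Suc_eq_0_disj)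
          then have "(\<Sum>i<p. f (act (s [^] i) x)) = f (act (s [^] (0::nat)) x) + (\<Sum>i<p - 1. f (act (s [^] Suc i) x))"
            by (simp add: sum.reindex del: nat_pow_Suc)
          moreover have "(\<Sum>i<p - 1. f (act (s [^] Suc i) x)) = (\<Sum>j<p - 1. f (act (s [^] Suc (p - 1 - Suc j)) x))"
            by (subst sum.nat_diff_reindex[symmetric]) simp
          moreover have "(\<Sum>j<p - 1. f (act (s [^] Suc (p - 1 - Suc j)) x)) = (\<Sum>j<p - 1. f (act (s [^] (p - 1 - j)) x))"
            by (intro sum.cong refl) (simp add: Suc_diff_Suc)
          ultimately show ?thesis using ux c act_one[OF \<open>x \<in> XX\<close>] by (simp add: add.commute)
        qed
        ultimately show ?thesis using \<open>x \<in> XX\<close> by (simp add: D_def) (metis add.inverse_unique add.commute neg_eq_iff_add_eq_0)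
      qed
    qed (use F(1) in \<open>simp add: D_def\<close>)
  qed
qed

text \<open>G is the union of the cosets N s^i, so invariance under N together with invariance under
  s is invariance under G.\<close>

lemma Y_ker_D_iff: "f \<in> cochain_fun p TX act (carrier G) \<longleftrightarrow> f \<in> Y \<and> D f = 0"
proof
  assume a: "f \<in> cochain_fun p TX act (carrier G)"
  note F = cochain_funD[OF a]
  have "f \<in> Y" using F NG by (intro cochain_funI) auto
  moreover have "D f = 0" using F(4)[OF s(1)] by (auto simp: D_def)
  ultimately show "f \<in> Y \<and> D f = 0" ..
next
  assume a: "f \<in> Y \<and> D f = 0"
  note F = cochain_funD[OF conjunct1[OF a]]
  show "f \<in> cochain_fun p TX act (carrier G)"
  proof (rule cochain_funI)
    fix g x assume g: "g \<in> carrier G" and x: "x \<in> XX"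
    note cd = coset_decomposition[OF g]
    have "act g x = act (g \<otimes> inv (s [^] \<chi> g)) (act (s [^] \<chi> g) x)"
      using act_mult[OF NG[OF cd(1)], of "s [^] \<chi> g" x] cd(2) s x by simp
    then have "f (act g x) = f (act (s [^] \<chi> g) x)" using F(4)[OF cd(1)] act_closed s x by simp
    then show "f (act g x) = f x" using D_zero_invariant[OF conjunct1[OF a] conjunct2[OF a] x] by simp
  qed (use F in auto)
qed

end

section \<open>Cochains of degree one and two as functions on pairs and triples\<close>

definition act2 :: "('g, 'c) monoid_scheme \<Rightarrow> 'g \<Rightarrow> 'g \<times> 'g \<Rightarrow> 'g \<times> 'g" where
  "act2 G g = (\<lambda>(a, b). (g \<otimes>\<^bsub>G\<^esub> a, g \<otimes>\<^bsub>G\<^esub> b))"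

definition act3 :: "('g, 'c) monoid_scheme \<Rightarrow> 'g \<Rightarrow> 'g \<times> 'g \<times> 'g \<Rightarrow> 'g \<times> 'g \<times> 'g" where
  "act3 G g = (\<lambda>(a, b, c). (g \<otimes>\<^bsub>G\<^esub> a, g \<otimes>\<^bsub>G\<^esub> b, g \<otimes>\<^bsub>G\<^esub> c))"

abbreviation T2 where "T2 T \<equiv> prod_topology T T"
abbreviation T3 where "T3 T \<equiv> prod_topology T (prod_topology T T)"

definition C1 where "C1 p G T I = cochain_fun p (T2 T) (act2 G) I"
definition C2 where "C2 p G T I = cochain_fun p (T3 T) (act3 G) I"

definition d1 :: "'g set \<Rightarrow> ('g \<times> 'g \<Rightarrow> resid) \<Rightarrow> 'g \<times> 'g \<times> 'g \<Rightarrow> resid" where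
  "d1 H f = (\<lambda>(a, b, c). if a \<in> H \<and> b \<in> H \<and> c \<in> H then f (b, c) - f (a, c) + f (a, b) else 0)"

text \<open>Stated as an equation between values, so that 3-cochains do not have to be
  formed.\<close>

definition cocycle2 :: "'g set \<Rightarrow> ('g \<times> 'g \<times> 'g \<Rightarrow> resid) \<Rightarrow> bool" where
  "cocycle2 H f \<longleftrightarrow> (\<forall>a\<in>H. \<forall>b\<in>H. \<forall>c\<in>H. \<forall>e\<in>H. f (b, c, e) - f (a, c, e) + f (a, b, e) - f (a, b, c) = 0)"

lemma d1_diff: "d1 H (f - g) = d1 H f - d1 H g"
  by (auto simp: d1_def fun_eq_iff)

lemma cocycle2_diff: "cocycle2 H f \<Longrightarrow> cocycle2 H g \<Longrightarrow> cocycle2 H (f - g)"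
  unfolding cocycle2_def
proof (intro ballI)
  fix a b c e
  assume f: "\<forall>a\<in>H. \<forall>b\<in>H. \<forall>c\<in>H. \<forall>e\<in>H. f (b, c, e) - f (a, c, e) + f (a, b, e) - f (a, b, c) = 0"
    and g: "\<forall>a\<in>H. \<forall>b\<in>H. \<forall>c\<in>H. \<forall>e\<in>H. g (b, c, e) - g (a, c, e) + g (a, b, e) - g (a, b, c) = 0"
    and m: "a \<in> H" "b \<in> H" "c \<in> H" "e \<in> H"
  have "(f (b, c, e) - f (a, c, e) + f (a, b, e) - f (a, b, c)) - (g (b, c, e) - g (a, c, e) + g (a, b, e) - g (a, b, c)) = 0"
    using f m g by (metis diff_zero)
  then show "(f - g) (b, c, e) - (f - g) (a, c, e) + (f - g) (a, b, e) - (f - g) (a, b, c) = 0"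
    by (simp add: algebra_simps)
qed

lemma cocycle2_d1: "cocycle2 H (d1 H f)"
  by (auto simp: cocycle2_def d1_def)

lemma T3_projections:
  "continuous_map (T3 T) T (\<lambda>x. fst (snd x))" "continuous_map (T3 T) T (\<lambda>x. snd (snd x))"
  using continuous_map_compose[OF continuous_map_snd continuous_map_fst, unfolded comp_def]
    continuous_map_compose[OF continuous_map_snd continuous_map_snd, unfolded comp_def] by blast+

lemma d1_C1:
  assumes top: "topspace T = H" and act: "\<And>g a. g \<in> I \<Longrightarrow> a \<in> H \<Longrightarrow> g \<otimes>\<^bsub>G\<^esub> a \<in> H" and f: "f \<in> C1 p G T I"
  shows "d1 H f \<in> C2 p G T I"
  unfolding C2_def
proof (rule cochain_funI)
  note F = cochain_funD[OF f[unfolded C1_def]]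
  have c: "continuous_map (T3 T) (T2 T) (\<lambda>x. (fst (snd x), snd (snd x)))"
    "continuous_map (T3 T) (T2 T) (\<lambda>x. (fst x, snd (snd x)))"
    "continuous_map (T3 T) (T2 T) (\<lambda>x. (fst x, fst (snd x)))"
    by (intro continuous_map_pairedI continuous_map_fst T3_projections)+
  have "lc (T3 T) (\<lambda>x. f (fst (snd x), snd (snd x)) - f (fst x, snd (snd x)) + f (fst x, fst (snd x)))"
    using lc_combine[OF lc_combine[OF lc_compose[OF F(3) c(1)] lc_compose[OF F(3) c(2)], of "(-)"]
        lc_compose[OF F(3) c(3)], of "(+)"] .
  then show "lc (T3 T) (d1 H f)"
    by (subst lc_cong[of _ _ "\<lambda>x. f (fst (snd x), snd (snd x)) - f (fst x, snd (snd x)) + f (fst x, fst (snd x))"])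
      (auto simp: d1_def top)
  show "d1 H f x = 0" if "x \<notin> topspace (T3 T)" for x using that by (cases x) (auto simp: d1_def top)
  show "d1 H f x \<in> range (iota p)" for x
    unfolding d1_def case_prod_beta by (simp add: iota_range F(2))
  show "d1 H f (act3 G g x) = d1 H f x" if gI: "g \<in> I" and xt: "x \<in> topspace (T3 T)" for g x
  proof -
    obtain a b c where x: "x = (a, b, c)" "a \<in> H" "b \<in> H" "c \<in> H" using xt top by (cases x) auto
    have "f (g \<otimes>\<^bsub>G\<^esub> u, g \<otimes>\<^bsub>G\<^esub> v) = f (u, v)" if "u \<in> H" "v \<in> H" for u v
      using F(4)[OF gI, of "(u, v)"] that top by (simp add: act2_def)
    then show ?thesis using x act[OF gI] by (simp add: d1_def act3_def)
  qed
qed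

lemma C_subgroup: "add_subgroup (C1 p G T I)" "add_subgroup (C2 p G T I)"
  unfolding add_subgroup_def C1_def C2_def using cochain_fun_0 cochain_fun_diff by blast+

lemma C2_outside: "f \<in> C2 p G T I \<Longrightarrow> \<not> (a \<in> topspace T \<and> b \<in> topspace T \<and> c \<in> topspace T) \<Longrightarrow> f (a, b, c) = 0"
  using cochain_funD(1)[of f p "T3 T" "act3 G" I "(a, b, c)"] by (simp add: C2_def)

lemma C1_outside: "f \<in> C1 p G T I \<Longrightarrow> \<not> (a \<in> topspace T \<and> b \<in> topspace T) \<Longrightarrow> f (a, b) = 0"
  using cochain_funD(1)[of f p "T2 T" "act2 G" I "(a, b)"] by (simp add: C1_def)

context cyclic_quotient
begin

abbreviation Y1 where "Y1 \<equiv> C1 p G T N"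
abbreviation Y2 where "Y2 \<equiv> C2 p G T N"

lemma cochain_space1: "cochain_space G T N p \<chi> s (T2 T) (act2 G) fst"
proof (intro cochain_space.intro cyclic_quotient_axioms cochain_space_axioms.intro)
  show "continuous_map (T2 T) (T2 T) (act2 G g)" if "g \<in> carrier G" for g
  proof -
    have "continuous_map (T2 T) (T2 T) (\<lambda>x. (g \<otimes> fst x, g \<otimes> snd x))"
      using continuous_map_compose[OF continuous_map_fst left_cont[OF that], unfolded comp_def]
        continuous_map_compose[OF continuous_map_snd left_cont[OF that], unfolded comp_def]
      by (intro continuous_map_pairedI)
    then show ?thesis by (simp add: act2_def case_prod_beta')
  qed
qed (auto simp: act2_def topspace_T m_assoc continuous_map_fst)

lemma cochain_space2: "cochain_space G T N p \<chi> s (T3 T) (act3 G) fst"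
proof (intro cochain_space.intro cyclic_quotient_axioms cochain_space_axioms.intro)
  show "continuous_map (T3 T) (T3 T) (act3 G g)" if "g \<in> carrier G" for g
  proof -
    note s = T3_projections[of T]
    have "continuous_map (T3 T) (T3 T) (\<lambda>x. (g \<otimes> fst x, g \<otimes> fst (snd x), g \<otimes> snd (snd x)))"
      using continuous_map_compose[OF continuous_map_fst left_cont[OF that], unfolded comp_def]
        continuous_map_compose[OF s(1) left_cont[OF that], unfolded comp_def]
        continuous_map_compose[OF s(2) left_cont[OF that], unfolded comp_def]
      by (intro continuous_map_pairedI)
    then show ?thesis by (simp add: act3_def case_prod_beta')
  qed
qed (auto simp: act3_def topspace_T m_assoc continuous_map_fst)

end

sublocale cyclic_quotient \<subseteq> c1: cochain_space G T N p \<chi> s "T2 T" "act2 G" fst by (rule cochain_space1)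
sublocale cyclic_quotient \<subseteq> c2: cochain_space G T N p \<chi> s "T3 T" "act3 G" fst by (rule cochain_space2)

context cyclic_quotient
begin

definition "Z1 = {f \<in> Y1. d1 (carrier G) f = 0}"
definition "Z2 = {f \<in> Y2. cocycle2 (carrier G) f}"

lemma d1_Y1: "f \<in> Y1 \<Longrightarrow> d1 (carrier G) f \<in> Z2"
  using d1_C1[OF topspace_T, of N G f p] NG cocycle2_d1 by (simp add: Z2_def)

lemma d1_D: "d1 (carrier G) (c1.D f) = c2.D (d1 (carrier G) f)"
  using s by (auto simp: d1_def c1.D_def c2.D_def act2_def act3_def topspace_T fun_eq_iff)

lemma Z2_D: "f \<in> Z2 \<Longrightarrow> c2.D f \<in> Z2"
proof -
  assume f: "f \<in> Z2"
  then have "c2.D f \<in> Y2" using c2.D_closed by (simp add: Z2_def C2_def)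
  moreover have "cocycle2 (carrier G) (c2.D f)"
    unfolding cocycle2_def
  proof (intro ballI)
    fix a b c e assume m: "a \<in> carrier G" "b \<in> carrier G" "c \<in> carrier G" "e \<in> carrier G"
    have f': "cocycle2 (carrier G) f" using f by (simp add: Z2_def)
    have "(f (s \<otimes> b, s \<otimes> c, s \<otimes> e) - f (s \<otimes> a, s \<otimes> c, s \<otimes> e) + f (s \<otimes> a, s \<otimes> b, s \<otimes> e) - f (s \<otimes> a, s \<otimes> b, s \<otimes> c))
       - (f (b, c, e) - f (a, c, e) + f (a, b, e) - f (a, b, c)) = 0"
      using f' m s(1) unfolding cocycle2_def by (metis diff_zero m_closed)
    then show "c2.D f (b, c, e) - c2.D f (a, c, e) + c2.D f (a, b, e) - c2.D f (a, b, c) = 0"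
      using m by (simp add: c2.D_def act3_def topspace_T algebra_simps)
  qed
  ultimately show ?thesis by (simp add: Z2_def)
qed

end

text \<open>The arithmetic input in inhomogeneous form, with W(y) for w(1, y) and f(y) for (D w)(1,
  y): what remains for field theory is a statement about integer-valued functions on G. N-invariance
  of w becomes additivity of W for a left factor in N, and G-invariance of D w makes f a character
  of G. Only residues modulo p carry meaning, hence local constancy is asked of them.\<close>

locale norm_lifting = cyclic_quotient +
  assumes lift: "\<And>W f :: 'a \<Rightarrow> int. \<lbrakk>odd p;
      \<And>\<tau> x. \<tau> \<in> N \<Longrightarrow> x \<in> carrier G \<Longrightarrow> [W (\<tau> \<otimes> x) = W \<tau> + W x] (mod int p); lc T (\<lambda>x. W x mod int p);
      \<And>g h. g \<in> carrier G \<Longrightarrow> h \<in> carrier G \<Longrightarrow> [f (g \<otimes> h) = f g + f h] (mod int p); lc T (\<lambda>x. f x mod int p);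
      \<And>y. y \<in> carrier G \<Longrightarrow> [W (s \<otimes> y) = W y + f y + W s] (mod int p)\<rbrakk> \<Longrightarrow>
    \<exists>\<nu>::'a \<Rightarrow> int. (\<forall>\<tau>\<in>N. \<forall>x\<in>carrier G. [\<nu> (\<tau> \<otimes> x) = \<nu> \<tau> + \<nu> x] (mod int p)) \<and> lc T \<nu> \<and>
      (\<forall>x\<in>carrier G. [(\<Sum>i<p. \<nu> (s [^] i \<otimes> x)) = f x] (mod int p))"
begin

lemma norm_lift:
  assumes w: "w \<in> Z1" and DD: "c1.D (c1.D w) = 0"
  shows "\<exists>n\<in>Z1. c1.D w = (c1.D ^^ (p - 1)) n"
proof (cases "odd p")
  case False
  \<comment> \<open>For p = 2 the norm is D itself, so w serves as n.\<close>
  then have "p = 2" using p primes_dvd_imp_eq two_is_prime_nat by blast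
  then show ?thesis using w by (intro bexI[of _ w]) auto
next
  case True
  have wY: "w \<in> c1.Y" using w by (simp add: Z1_def C1_def)
  note wD = cochain_funD[OF wY]
  define F where "F = c1.D w"
  have FY: "F \<in> c1.Y" "c1.D F = 0" using c1.D_closed[OF wY] DD by (auto simp: F_def)
  have FG: "F \<in> cochain_fun p (T2 T) (act2 G) (carrier G)" using c1.Y_ker_D_iff FY by blast
  note FD = cochain_funD[OF FG]
  have wc: "w (b, c) - w (a, c) + w (a, b) = 0" if "a \<in> carrier G" "b \<in> carrier G" "c \<in> carrier G" for a b c
  proof -
    have "d1 (carrier G) w (a, b, c) = 0" using w by (simp add: Z1_def)
    then show ?thesis using that by (simp add: d1_def)
  qed
  have w_chain: "w (a, c) = w (a, b) + w (b, c)" if "a \<in> carrier G" "b \<in> carrier G" "c \<in> carrier G" for a b c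
    using wc[OF that] by (simp add: algebra_simps)
  have F_val: "F (a, b) = w (s \<otimes> a, s \<otimes> b) - w (a, b)" if "a \<in> carrier G" "b \<in> carrier G" for a b
    using that by (simp add: F_def c1.D_def act2_def topspace_T)
  have F_chain: "F (a, c) = F (a, b) + F (b, c)" if m: "a \<in> carrier G" "b \<in> carrier G" "c \<in> carrier G" for a b c
    using w_chain[OF m] w_chain[of "s \<otimes> a" "s \<otimes> b" "s \<otimes> c"] m s by (simp add: F_val)
  have w_inv: "w (\<tau> \<otimes> a, \<tau> \<otimes> b) = w (a, b)" if "\<tau> \<in> N" "a \<in> carrier G" "b \<in> carrier G" for \<tau> a b
    using wD(4)[OF that(1), of "(a, b)"] that by (simp add: act2_def topspace_T)
  have F_inv: "F (g \<otimes> a, g \<otimes> b) = F (a, b)" if "g \<in> carrier G" "a \<in> carrier G" "b \<in> carrier G" for g a b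
    using FD(4)[OF that(1), of "(a, b)"] that by (simp add: act2_def topspace_T)
  \<comment> \<open>The integer is chosen as a function of the value of w, so local constancy is
    inherited.\<close>
  define W where "W y = (SOME k. iota p k = w (\<one>, y))" for y
  define f where "f y = (SOME k. iota p k = F (\<one>, y))" for y
  have W: "iota p (W y) = w (\<one>, y)" for y
    unfolding W_def using wD(2)[of "(\<one>, y)"] by (metis (mono_tags, lifting) rangeE someI_ex)
  have f: "iota p (f y) = F (\<one>, y)" for y
    unfolding f_def using FD(2)[of "(\<one>, y)"] by (metis (mono_tags, lifting) rangeE someI_ex)
  have pair: "continuous_map T (T2 T) (\<lambda>y. (\<one>, y))"
    by (intro continuous_map_pairedI) (auto simp: topspace_T)
  have "\<exists>\<nu>::'a \<Rightarrow> int. (\<forall>\<tau>\<in>N. \<forall>x\<in>carrier G. [\<nu> (\<tau> \<otimes> x) = \<nu> \<tau> + \<nu> x] (mod int p)) \<and> lc T \<nu> \<and>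
      (\<forall>x\<in>carrier G. [(\<Sum>i<p. \<nu> (s [^] i \<otimes> x)) = f x] (mod int p))"
  proof (rule lift[OF True, of W f])
    show "[W (\<tau> \<otimes> x) = W \<tau> + W x] (mod int p)" if "\<tau> \<in> N" "x \<in> carrier G" for \<tau> x
    proof -
      have "w (\<one>, \<tau> \<otimes> x) = w (\<one>, \<tau>) + w (\<tau> \<otimes> \<one>, \<tau> \<otimes> x)" using w_chain[of \<one> \<tau> "\<tau> \<otimes> x"] that NG by simp
      then have "w (\<one>, \<tau> \<otimes> x) = w (\<one>, \<tau>) + w (\<one>, x)" using w_inv[OF that(1) one_closed that(2)] by simp
      then show ?thesis unfolding iota_eq_iff[symmetric] iota_simps W .
    qed
    show "[f (g \<otimes> h) = f g + f h] (mod int p)" if "g \<in> carrier G" "h \<in> carrier G" for g h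
    proof -
      have "F (\<one>, g \<otimes> h) = F (\<one>, g) + F (g \<otimes> \<one>, g \<otimes> h)" using F_chain[of \<one> g "g \<otimes> h"] that by simp
      then have "F (\<one>, g \<otimes> h) = F (\<one>, g) + F (\<one>, h)" using F_inv[OF that(1) one_closed that(2)] by simp
      then show ?thesis unfolding iota_eq_iff[symmetric] iota_simps f .
    qed
    show "lc T (\<lambda>x. W x mod int p)" unfolding W_def
      using lc_map[OF lc_compose[OF wD(3) pair], of "\<lambda>v. (SOME k. iota p k = v) mod int p"] .
    show "lc T (\<lambda>x. f x mod int p)" unfolding f_def
      using lc_map[OF lc_compose[OF FD(3) pair], of "\<lambda>v. (SOME k. iota p k = v) mod int p"] .
    show "[W (s \<otimes> y) = W y + f y + W s] (mod int p)" if "y \<in> carrier G" for y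
    proof -
      have "w (\<one>, s \<otimes> y) = w (\<one>, s) + w (s \<otimes> \<one>, s \<otimes> y)" using w_chain[of \<one> s "s \<otimes> y"] that s by simp
      also have "\<dots> = w (\<one>, y) + F (\<one>, y) + w (\<one>, s)" using F_val[OF one_closed that] by (simp only: algebra_simps)
      finally show ?thesis unfolding iota_eq_iff[symmetric] iota_simps W f .
    qed
  qed
  then obtain \<nu> :: "'a \<Rightarrow> int" where nu: "\<And>\<tau> x. \<tau> \<in> N \<Longrightarrow> x \<in> carrier G \<Longrightarrow> [\<nu> (\<tau> \<otimes> x) = \<nu> \<tau> + \<nu> x] (mod int p)"
    "lc T \<nu>" "\<And>x. x \<in> carrier G \<Longrightarrow> [(\<Sum>i<p. \<nu> (s [^] i \<otimes> x)) = f x] (mod int p)" by blast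
  \<comment> \<open>The difference of two values of \<nu>: formally the coboundary of a 0-cochain
    that need not be N-invariant, and therefore closed.\<close>
  define n where "n = (\<lambda>(a, b). if a \<in> carrier G \<and> b \<in> carrier G then iota p (\<nu> b) - iota p (\<nu> a) else 0)"
  have nY: "n \<in> c1.Y"
  proof (rule cochain_funI)
    show "n x = 0" if "x \<notin> topspace (T2 T)" for x using that by (cases x) (auto simp: n_def topspace_T)
    show "n x \<in> range (iota p)" for x by (auto simp: n_def split: prod.splits intro!: iota_range)
    have "lc (T2 T) (\<lambda>x. iota p (\<nu> (snd x)) - iota p (\<nu> (fst x)))"
      using lc_combine[OF lc_compose[OF nu(2) continuous_map_snd] lc_compose[OF nu(2) continuous_map_fst],
          of "\<lambda>u v. iota p u - iota p v"] .
    then show "lc (T2 T) n"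
      by (subst lc_cong[of _ _ "\<lambda>x. iota p (\<nu> (snd x)) - iota p (\<nu> (fst x))"]) (auto simp: n_def topspace_T)
    show "n (act2 G \<tau> x) = n x" if t: "\<tau> \<in> N" "x \<in> topspace (T2 T)" for \<tau> x
    proof -
      obtain a b where x: "x = (a, b)" "a \<in> carrier G" "b \<in> carrier G" using t(2) topspace_T by (cases x) auto
      have "iota p (\<nu> (\<tau> \<otimes> c)) = iota p (\<nu> \<tau>) + iota p (\<nu> c)" if "c \<in> carrier G" for c
        using nu(1)[OF t(1) that] unfolding iota_eq_iff[symmetric] iota_simps .
      then show ?thesis using x t NG by (simp add: n_def act2_def)
    qed
  qed
  have "n \<in> Z1" using nY by (auto simp: Z1_def C1_def d1_def n_def fun_eq_iff)
  moreover have "F = (c1.D ^^ (p - 1)) n"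
  proof
    fix x show "F x = (c1.D ^^ (p - 1)) n x"
    proof (cases "x \<in> topspace (T2 T)")
      case True
      then obtain a b where x: "x = (a, b)" "a \<in> carrier G" "b \<in> carrier G" using topspace_T by (cases x) auto
      have sm: "(\<Sum>i<p. iota p (\<nu> (s [^] i \<otimes> c))) = F (\<one>, c)" if "c \<in> carrier G" for c
        using nu(3)[OF that] unfolding iota_eq_iff[symmetric] iota_sum f .
      have "(c1.D ^^ (p - 1)) n x = (\<Sum>i<p. iota p (\<nu> (s [^] i \<otimes> b)) - iota p (\<nu> (s [^] i \<otimes> a)))"
        using c1.norm_formula[OF nY True] x s by (simp add: n_def act2_def)
      also have "\<dots> = F (\<one>, b) - F (\<one>, a)" using sm x by (simp add: sum_subtractf)
      also have "\<dots> = F x" using F_chain[of \<one> a b] x by simp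
      finally show ?thesis ..
    qed (use cochain_funD(1)[OF FY(1)] c1.D_pow_outside[OF nY] in simp)
  qed
  ultimately show ?thesis unfolding F_def by blast
qed

end

section \<open>Shapiro's lemma for the subgroup N\<close>

context cyclic_quotient
begin

abbreviation "Nrec \<equiv> G\<lparr>carrier := N\<rparr>"
abbreviation "TN \<equiv> subtopology T N"

definition "Z2N = {f \<in> C2 p Nrec TN N. cocycle2 N f}"
definition "B2N = d1 N ` C1 p Nrec TN N"
definition "Z1G = {f \<in> C1 p G T (carrier G). d1 (carrier G) f = 0}"
definition "Z2G = {f \<in> C2 p G T (carrier G). cocycle2 (carrier G) f}"
definition "B2G = d1 (carrier G) ` C1 p G T (carrier G)"

lemma topspace_TN: "topspace TN = N"
  using NG topspace_T by auto

lemma act_Nrec: "act2 Nrec = act2 G" "act3 Nrec = act3 G"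
  by (auto simp: act2_def act3_def fun_eq_iff)

lemma incl_cont: "continuous_map TN T (\<lambda>x. x)"
  using continuous_map_from_subtopology[OF continuous_map_id] by (simp add: id_def)

definition "res1 z = (\<lambda>(a, b). if a \<in> N \<and> b \<in> N then z (a, b) else (0::resid))"
definition "res2 z = (\<lambda>(a, b, c). if a \<in> N \<and> b \<in> N \<and> c \<in> N then z (a, b, c) else (0::resid))"

lemma res1_closed: "z \<in> Y1 \<Longrightarrow> res1 z \<in> C1 p Nrec TN N"
  unfolding C1_def act_Nrec
proof (rule cochain_funI)
  assume z: "z \<in> c1.Y"
  note Z = cochain_funD[OF z]
  have "continuous_map (T2 TN) (T2 T) (\<lambda>x. (fst x, snd x))"
    using continuous_map_compose[OF continuous_map_fst incl_cont, unfolded comp_def]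
      continuous_map_compose[OF continuous_map_snd incl_cont, unfolded comp_def]
    by (intro continuous_map_pairedI)
  from lc_compose[OF Z(3) this] show "lc (T2 TN) (res1 z)"
    by (subst lc_cong[of _ _ "\<lambda>x. z (fst x, snd x)"]) (auto simp: res1_def topspace_TN)
  show "res1 z x = 0" if "x \<notin> topspace (T2 TN)" for x using that topspace_TN by (cases x) (auto simp: res1_def)
  show "res1 z x \<in> range (iota p)" for x unfolding res1_def case_prod_beta by (simp add: Z(2) iota_range)
  show "res1 z (act2 G g x) = res1 z x" if "g \<in> N" "x \<in> topspace (T2 TN)" for g x
    using that Z(4)[of g x] topspace_TN subgroup.m_closed[OF N_sub] NG topspace_T
    by (cases x) (auto simp: res1_def act2_def)
qed

lemma res2_closed: "z \<in> Y2 \<Longrightarrow> res2 z \<in> C2 p Nrec TN N"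
  unfolding C2_def act_Nrec
proof (rule cochain_funI)
  assume z: "z \<in> c2.Y"
  note Z = cochain_funD[OF z]
  have "continuous_map (T3 TN) (T3 T) (\<lambda>x. (fst x, fst (snd x), snd (snd x)))"
    using continuous_map_compose[OF continuous_map_fst incl_cont, unfolded comp_def]
      continuous_map_compose[OF T3_projections(1) incl_cont, unfolded comp_def]
      continuous_map_compose[OF T3_projections(2) incl_cont, unfolded comp_def]
    by (intro continuous_map_pairedI)
  from lc_compose[OF Z(3) this] show "lc (T3 TN) (res2 z)"
    by (subst lc_cong[of _ _ "\<lambda>x. z (fst x, fst (snd x), snd (snd x))"]) (auto simp: res2_def topspace_TN)
  show "res2 z x = 0" if "x \<notin> topspace (T3 TN)" for x using that topspace_TN by (cases x) (auto simp: res2_def)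
  show "res2 z x \<in> range (iota p)" for x unfolding res2_def case_prod_beta by (simp add: Z(2) iota_range)
  show "res2 z (act3 G g x) = res2 z x" if "g \<in> N" "x \<in> topspace (T3 TN)" for g x
    using that Z(4)[of g x] topspace_TN subgroup.m_closed[OF N_sub] NG topspace_T
    by (cases x) (auto simp: res2_def act3_def)
qed

definition "pull2 q m = (\<lambda>(a, b). if a \<in> carrier G \<and> b \<in> carrier G then m (q a, q b) else (0::resid))"
definition "pull3 q m = (\<lambda>(a, b, c). if a \<in> carrier G \<and> b \<in> carrier G \<and> c \<in> carrier G
   then m (q a, q b, q c) else (0::resid))"

text \<open>Equivariance under N is the whole algebraic condition; points of N may be moved. This
  admits both \<open>rt\<close>, which fixes N, and \<open>coset_part\<close>, which is built from
  arbitrary representatives.\<close>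

definition retraction :: "('a \<Rightarrow> 'a) \<Rightarrow> bool" where
  "retraction q \<longleftrightarrow> continuous_map T TN q \<and> (\<forall>\<tau>\<in>N. \<forall>x\<in>carrier G. q (\<tau> \<otimes> x) = \<tau> \<otimes> q x)"

lemma retraction_closed: "retraction q \<Longrightarrow> x \<in> carrier G \<Longrightarrow> q x \<in> N"
  using topspace_T topspace_TN by (auto simp: retraction_def continuous_map_def)

lemma pull2_closed:
  assumes q: "retraction q" and m: "m \<in> C1 p Nrec TN N" shows "pull2 q m \<in> Y1"
  unfolding C1_def
proof (rule cochain_funI)
  note M = cochain_funD[OF m[unfolded C1_def act_Nrec]]
  have qc: "continuous_map T TN q" using q by (simp add: retraction_def)
  have "continuous_map (T2 T) (T2 TN) (\<lambda>x. (q (fst x), q (snd x)))"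
    using continuous_map_compose[OF continuous_map_fst qc, unfolded comp_def]
      continuous_map_compose[OF continuous_map_snd qc, unfolded comp_def]
    by (intro continuous_map_pairedI)
  from lc_compose[OF M(3) this] show "lc (T2 T) (pull2 q m)"
    by (subst lc_cong[of _ _ "\<lambda>x. m (q (fst x), q (snd x))"]) (auto simp: pull2_def topspace_T)
  show "pull2 q m x = 0" if "x \<notin> topspace (T2 T)" for x using that topspace_T by (cases x) (auto simp: pull2_def)
  show "pull2 q m x \<in> range (iota p)" for x unfolding pull2_def case_prod_beta by (simp add: M(2) iota_range)
  show "pull2 q m (act2 G g x) = pull2 q m x" if g: "g \<in> N" "x \<in> topspace (T2 T)" for g x
  proof -
    obtain a b where x: "x = (a, b)" "a \<in> carrier G" "b \<in> carrier G" using g(2) topspace_T by (cases x) auto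
    then have "m (g \<otimes> q a, g \<otimes> q b) = m (q a, q b)"
      using M(4)[OF g(1), of "(q a, q b)"] retraction_closed[OF q] topspace_T NG by (simp add: act2_def)
    then show ?thesis using x g NG q by (simp add: pull2_def act2_def retraction_def)
  qed
qed

lemma pull3_closed:
  assumes q: "retraction q" and m: "m \<in> C2 p Nrec TN N" shows "pull3 q m \<in> Y2"
  unfolding C2_def
proof (rule cochain_funI)
  note M = cochain_funD[OF m[unfolded C2_def act_Nrec]]
  have qc: "continuous_map T TN q" using q by (simp add: retraction_def)
  have "continuous_map (T3 T) (T3 TN) (\<lambda>x. (q (fst x), q (fst (snd x)), q (snd (snd x))))"
    using continuous_map_compose[OF continuous_map_fst qc, unfolded comp_def]
      continuous_map_compose[OF T3_projections(1) qc, unfolded comp_def]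
      continuous_map_compose[OF T3_projections(2) qc, unfolded comp_def]
    by (intro continuous_map_pairedI)
  from lc_compose[OF M(3) this] show "lc (T3 T) (pull3 q m)"
    by (subst lc_cong[of _ _ "\<lambda>x. m (q (fst x), q (fst (snd x)), q (snd (snd x)))"]) (auto simp: pull3_def topspace_T)
  show "pull3 q m x = 0" if "x \<notin> topspace (T3 T)" for x using that topspace_T by (cases x) (auto simp: pull3_def)
  show "pull3 q m x \<in> range (iota p)" for x unfolding pull3_def case_prod_beta by (simp add: M(2) iota_range)
  show "pull3 q m (act3 G g x) = pull3 q m x" if g: "g \<in> N" "x \<in> topspace (T3 T)" for g x
  proof -
    obtain a b c where x: "x = (a, b, c)" "a \<in> carrier G" "b \<in> carrier G" "c \<in> carrier G"
      using g(2) topspace_T by (cases x) auto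
    then have "m (g \<otimes> q a, g \<otimes> q b, g \<otimes> q c) = m (q a, q b, q c)"
      using M(4)[OF g(1), of "(q a, q b, q c)"] retraction_closed[OF q] topspace_T NG by (simp add: act3_def)
    then show ?thesis using x g NG q by (simp add: pull3_def act3_def retraction_def)
  qed
qed

lemma pull3_cocycle: "retraction q \<Longrightarrow> m \<in> Z2N \<Longrightarrow> pull3 q m \<in> Z2"
  using pull3_closed[of q m] retraction_closed[of q] by (simp add: Z2N_def Z2_def cocycle2_def pull3_def)

lemma d1_pull: "retraction q \<Longrightarrow> d1 (carrier G) (pull2 q v) = pull3 q (d1 N v)"
  using retraction_closed by (auto simp: d1_def pull2_def pull3_def fun_eq_iff)

text \<open>Right translation by an element that depends only on the coset commutes with the left
  action of N. It is continuous because near each point it is a single translation.\<close>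

lemma coset_shift_retraction:
  assumes u: "\<And>j. u j \<in> carrier G" and img: "\<And>x. x \<in> carrier G \<Longrightarrow> x \<otimes> u (\<chi> x) \<in> N"
    and eq: "\<And>x. x \<in> carrier G \<Longrightarrow> q x = x \<otimes> u (\<chi> x)"
  shows "retraction q"
  unfolding retraction_def
proof (intro conjI ballI)
  have "continuous_map T T q"
    unfolding continuous_map_def topspace_T
  proof (intro conjI allI impI)
    show "q \<in> carrier G \<rightarrow> carrier G" using eq u by auto
    fix A assume A: "openin T A"
    show "openin T {x \<in> carrier G. q x \<in> A}"
    proof (subst openin_subopen, intro ballI)
      fix x assume x: "x \<in> {x \<in> carrier G. q x \<in> A}"
      then have xc: "x \<in> topspace T" using topspace_T by simp
      obtain U where U: "openin T U" "x \<in> U" "\<forall>y\<in>U. \<chi> y = \<chi> x"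
        using bspec[OF chi_lc[unfolded lc_def] xc] by blast
      let ?V = "{y \<in> topspace T. y \<otimes> u (\<chi> x) \<in> A}"
      have V: "openin T ?V" using right_cont[OF u] A by (auto simp: continuous_map_def)
      have "U \<inter> ?V \<subseteq> {x \<in> carrier G. q x \<in> A}"
      proof
        fix y assume y: "y \<in> U \<inter> ?V"
        then have "y \<in> carrier G" "\<chi> y = \<chi> x" "y \<otimes> u (\<chi> x) \<in> A" using U(3) topspace_T by auto
        then show "y \<in> {x \<in> carrier G. q x \<in> A}" using eq[of y] by simp
      qed
      moreover have "x \<in> U \<inter> ?V" using U(2) x xc eq[of x] by simp
      ultimately show "\<exists>W. openin T W \<and> x \<in> W \<and> W \<subseteq> {x \<in> carrier G. q x \<in> A}"
        using openin_Int[OF U(1) V] by blast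
    qed
  qed
  then show "continuous_map T TN q"
    unfolding continuous_map_in_subtopology using eq img topspace_T by auto
  fix \<tau> x assume "\<tau> \<in> N" "x \<in> carrier G"
  then show "q (\<tau> \<otimes> x) = \<tau> \<otimes> q x" using eq chi_N_mult NG u by (simp add: m_assoc)
qed

definition "rt x = x \<otimes> inv (s [^] \<chi> x)"

lemma rt: "retraction rt" "\<tau> \<in> N \<Longrightarrow> rt \<tau> = \<tau>"
proof -
  show "retraction rt"
    by (rule coset_shift_retraction[of "\<lambda>j. inv (s [^] j)"]) (use s coset_decomposition(1) in \<open>auto simp: rt_def\<close>)
  show "rt \<tau> = \<tau>" if "\<tau> \<in> N" using chi_N[OF NG[OF that]] NG[OF that] that by (simp add: rt_def)
qed

text \<open>Shapiro's lemma; \<open>h\<close> is the prism operator between the identity and the retraction.\<close>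

lemma prism:
  assumes z: "z \<in> Z2" and q: "retraction q"
  defines "h \<equiv> \<lambda>(a, b). if a \<in> carrier G \<and> b \<in> carrier G then z (q a, a, b) - z (q a, q b, b) else 0"
  shows "h \<in> Y1" "z = pull3 q z + d1 (carrier G) h"
proof -
  have zY: "z \<in> c2.Y" and zc: "cocycle2 (carrier G) z" using z by (auto simp: Z2_def C2_def)
  note Z = cochain_funD[OF zY]
  have qc: "continuous_map T T q"
    using q continuous_map_in_subtopology by (auto simp: retraction_def)
  have qG: "x \<in> carrier G \<Longrightarrow> q x \<in> carrier G" for x using retraction_closed[OF q] NG by blast
  show "h \<in> Y1"
    unfolding C1_def
  proof (rule cochain_funI)
    have c: "continuous_map (T2 T) (T3 T) (\<lambda>x. (q (fst x), fst x, snd x))"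
      "continuous_map (T2 T) (T3 T) (\<lambda>x. (q (fst x), q (snd x), snd x))"
    proof -
      have q1: "continuous_map (T2 T) T (\<lambda>x. q (fst x))" "continuous_map (T2 T) T (\<lambda>x. q (snd x))"
        using continuous_map_compose[OF continuous_map_fst qc, unfolded comp_def]
          continuous_map_compose[OF continuous_map_snd qc, unfolded comp_def] by blast+
      show "continuous_map (T2 T) (T3 T) (\<lambda>x. (q (fst x), fst x, snd x))"
        by (rule continuous_map_pairedI[OF q1(1) continuous_map_pairedI[OF continuous_map_fst continuous_map_snd]])
      show "continuous_map (T2 T) (T3 T) (\<lambda>x. (q (fst x), q (snd x), snd x))"
        by (rule continuous_map_pairedI[OF q1(1) continuous_map_pairedI[OF q1(2) continuous_map_snd]])
    qed
    have "lc (T2 T) (\<lambda>x. z (q (fst x), fst x, snd x) - z (q (fst x), q (snd x), snd x))"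
      using lc_combine[OF lc_compose[OF Z(3) c(1)] lc_compose[OF Z(3) c(2)], of "(-)"] .
    then show "lc (T2 T) h"
      by (subst lc_cong[of _ _ "\<lambda>x. z (q (fst x), fst x, snd x) - z (q (fst x), q (snd x), snd x)"])
        (auto simp: h_def topspace_T)
    show "h x = 0" if "x \<notin> topspace (T2 T)" for x using that topspace_T by (cases x) (auto simp: h_def)
    show "h x \<in> range (iota p)" for x unfolding h_def case_prod_beta by (simp add: Z(2) iota_range)
    show "h (act2 G g x) = h x" if g: "g \<in> N" "x \<in> topspace (T2 T)" for g x
    proof -
      obtain a b where x: "x = (a, b)" "a \<in> carrier G" "b \<in> carrier G" using g(2) topspace_T by (cases x) auto
      have "z (g \<otimes> u, g \<otimes> v, g \<otimes> w) = z (u, v, w)" if "u \<in> carrier G" "v \<in> carrier G" "w \<in> carrier G" for u v w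
        using Z(4)[OF g(1), of "(u, v, w)"] that topspace_T by (simp add: act3_def)
      then show ?thesis using x g NG q qG by (simp add: h_def act2_def retraction_def)
    qed
  qed
  show "z = pull3 q z + d1 (carrier G) h"
  proof
    fix x show "z x = (pull3 q z + d1 (carrier G) h) x"
    proof (cases x)
      case (fields a b c)
      show ?thesis
      proof (cases "a \<in> carrier G \<and> b \<in> carrier G \<and> c \<in> carrier G")
        case True
        then have m: "a \<in> carrier G" "b \<in> carrier G" "c \<in> carrier G" by auto
        have cz: "z (v, w, t) - z (u, w, t) + z (u, v, t) - z (u, v, w) = 0"
          if "u \<in> carrier G" "v \<in> carrier G" "w \<in> carrier G" "t \<in> carrier G" for u v w t
          using zc that unfolding cocycle2_def by blast
        \<comment> \<open>The three cocycle identities, for (q a, a, b, c), (q a, q b, b, c) and (q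
          a, q b, q c, c), belong to the three simplices of the prism over a triangle; together they
          give the homotopy formula.\<close>
        have 1: "z (a, b, c) = z (q a, b, c) - z (q a, a, c) + z (q a, a, b)"
          using cz[of "q a" a b c] m qG by (simp add: algebra_simps eq_diff_eq)
        have 2: "z (q b, b, c) = z (q a, b, c) - z (q a, q b, c) + z (q a, q b, b)"
          using cz[of "q a" "q b" b c] m qG by (simp add: algebra_simps eq_diff_eq)
        have 3: "z (q b, q c, c) = z (q a, q c, c) - z (q a, q b, c) + z (q a, q b, q c)"
          using cz[of "q a" "q b" "q c" c] m qG by (simp add: algebra_simps eq_diff_eq)
        have "d1 (carrier G) h (a, b, c) = (z (q b, b, c) - z (q b, q c, c)) - (z (q a, a, c) - z (q a, q c, c))
            + (z (q a, a, b) - z (q a, q b, b))" using m by (simp add: d1_def h_def)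
        then have "pull3 q z (a, b, c) + d1 (carrier G) h (a, b, c) = z (a, b, c)"
          unfolding 1 2 3 using m by (simp add: pull3_def algebra_simps)
        then show ?thesis using fields by simp
      next
        case False
        then show ?thesis using fields Z(1)[of "(a, b, c)"] topspace_T by (auto simp: pull3_def d1_def)
      qed
    qed
  qed
qed

text \<open>Pulling back along \<open>rt\<close> is an exact right inverse of restriction already on
  cochains. If the restriction of a cocycle is a coboundary, the prism operator makes the cocycle
  the coboundary of an N-invariant cochain of G.\<close>

lemma shapiro:
  "add_index Z2 (d1 (carrier G) ` Y1) = add_index Z2N B2N"
  "finite_index Z2 (d1 (carrier G) ` Y1) \<longleftrightarrow> finite_index Z2N B2N"
proof -
  have img_sub: "add_subgroup (d1 H ` A)" if "add_subgroup A" for H :: "'a set" and A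
  proof -
    have "0 = d1 H 0" by (auto simp: d1_def fun_eq_iff)
    moreover have "d1 H x - d1 H y = d1 H (x - y)" for x y by (simp add: d1_diff)
    ultimately show ?thesis using add_subgroupD[OF that] by (auto simp: add_subgroup_def image_iff)
  qed
  have rd: "res2 (x - y) = res2 x - res2 y" for x y by (auto simp: res2_def fun_eq_iff)
  have cl: "x - y \<in> Z2" if "x \<in> Z2" "y \<in> Z2" for x y
    using that cocycle2_diff add_subgroupD(2)[OF C_subgroup(2)] by (auto simp: Z2_def)
  have im: "res2 x \<in> Z2N" if "x \<in> Z2" for x
  proof -
    have "cocycle2 N (res2 x)" using that NG by (simp add: Z2_def cocycle2_def res2_def)
    then show ?thesis using that res2_closed by (simp add: Z2_def Z2N_def)
  qed
  have rp: "res2 (pull3 rt m) = m" if "m \<in> C2 p Nrec TN N" for m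
  proof
    fix x show "res2 (pull3 rt m) x = m x"
      using C2_outside[OF that] topspace_TN rt(2) NG by (cases x) (auto simp: res2_def pull3_def)
  qed
  have sur: "\<exists>x\<in>Z2. y - res2 x \<in> B2N" if "y \<in> Z2N" for y
  proof
    show "pull3 rt y \<in> Z2" using pull3_cocycle[OF rt(1) that] .
    have "0 \<in> B2N" unfolding B2N_def using add_subgroupD(1)[OF img_sub[OF C_subgroup(1)]] .
    then show "y - res2 (pull3 rt y) \<in> B2N" using rp that by (simp add: Z2N_def)
  qed
  have ker: "res2 x \<in> B2N \<longleftrightarrow> x \<in> d1 (carrier G) ` Y1" if x: "x \<in> Z2" for x
  proof
    assume "res2 x \<in> B2N"
    then obtain v where v: "v \<in> C1 p Nrec TN N" "res2 x = d1 N v" by (auto simp: B2N_def)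
    have "pull3 rt x = pull3 rt (res2 x)"
      using retraction_closed[OF rt(1)] by (auto simp: pull3_def res2_def fun_eq_iff)
    also have "\<dots> = d1 (carrier G) (pull2 rt v)" using d1_pull[OF rt(1)] v(2) by simp
    finally have e: "pull3 rt x = d1 (carrier G) (pull2 rt v)" .
    note pr = prism[OF x rt(1)]
    have "x \<in> (\<lambda>u. d1 (carrier G) u) ` Y1"
    proof
      let ?h = "\<lambda>(a, b). if a \<in> carrier G \<and> b \<in> carrier G then x (rt a, a, b) - x (rt a, rt b, b) else 0"
      show "pull2 rt v + ?h \<in> Y1" using pull2_closed[OF rt(1) v(1)] pr(1) add_subgroupD(4)[OF C_subgroup(1)] by blast
      have "d1 (carrier G) (pull2 rt v + ?h) = d1 (carrier G) (pull2 rt v) + d1 (carrier G) ?h"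
        by (auto simp: d1_def fun_eq_iff)
      then show "x = d1 (carrier G) (pull2 rt v + ?h)" using pr(2) e by simp
    qed
    then show "x \<in> d1 (carrier G) ` Y1" .
  next
    assume "x \<in> d1 (carrier G) ` Y1"
    then obtain y where y: "y \<in> Y1" "x = d1 (carrier G) y" by blast
    have "res2 x = d1 N (res1 y)" using NG y(2) by (auto simp: res2_def res1_def d1_def fun_eq_iff)
    then show "res2 x \<in> B2N" using res1_closed[OF y(1)] by (auto simp: B2N_def)
  qed
  have H: "add_subgroup (d1 (carrier G) ` Y1)" "add_subgroup B2N"
    using img_sub[OF C_subgroup(1)] by (auto simp: B2N_def)
  show "add_index Z2 (d1 (carrier G) ` Y1) = add_index Z2N B2N"
    "finite_index Z2 (d1 (carrier G) ` Y1) \<longleftrightarrow> finite_index Z2N B2N"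
    using index_hom[OF H rd cl im sur ker] by blast+
qed

subsection \<open>The cup product with the class of \<open>\<chi>\<close>\<close>

definition "cupm f = (\<lambda>(a, b, c). if a \<in> carrier G \<and> b \<in> carrier G \<and> c \<in> carrier G
   then iota p (int (\<chi> b) - int (\<chi> a)) * f (b, c) else 0)"
text \<open>A preimage of f under D whose coboundary is \<chi> cup f when f is a cocycle of G; this
  explicit choice identifies the connecting map with the cup product.\<close>

definition "tmul f = (\<lambda>(a, b). if a \<in> carrier G \<and> b \<in> carrier G then iota p (int (\<chi> a)) * f (a, b) else 0)"

lemma tmul_closed: "f \<in> C1 p G T (carrier G) \<Longrightarrow> tmul f \<in> Y1"
  unfolding C1_def
proof (rule cochain_funI)
  assume f: "f \<in> cochain_fun p (T2 T) (act2 G) (carrier G)"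
  note F = cochain_funD[OF f]
  have "lc (T2 T) (\<lambda>x. iota p (int (\<chi> (fst x))) * f x)"
    using lc_combine[OF lc_compose[OF chi_lc continuous_map_fst] F(3), of "\<lambda>u v. iota p (int u) * v"] .
  then show "lc (T2 T) (tmul f)"
    by (subst lc_cong[of _ _ "\<lambda>x. iota p (int (\<chi> (fst x))) * f x"]) (auto simp: tmul_def topspace_T)
  show "tmul f x = 0" if "x \<notin> topspace (T2 T)" for x using that topspace_T by (cases x) (auto simp: tmul_def)
  show "tmul f x \<in> range (iota p)" for x
  proof -
    obtain k where "f x = iota p k" using F(2) by blast
    then show ?thesis unfolding tmul_def case_prod_beta by (simp add: iota_range flip: iota_simps)
  qed
  show "tmul f (act2 G g x) = tmul f x" if "g \<in> N" "x \<in> topspace (T2 T)" for g x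
    using that F(4)[OF NG[OF that(1)], of x] chi_N_mult NG topspace_T by (cases x) (auto simp: tmul_def act2_def)
qed

lemma D_tmul: "f \<in> C1 p G T (carrier G) \<Longrightarrow> c1.D (tmul f) = f"
proof
  fix x assume f: "f \<in> C1 p G T (carrier G)"
  note F = cochain_funD[OF f[unfolded C1_def]]
  show "c1.D (tmul f) x = f x"
  proof (cases x)
    case (Pair a b)
    show ?thesis
    proof (cases "a \<in> carrier G \<and> b \<in> carrier G")
      case True
      obtain k where k: "f x = iota p k" using F(2) by blast
      have "f (s \<otimes> a, s \<otimes> b) = f (a, b)"
        using F(4)[OF s(1), of "(a, b)"] True topspace_T by (simp add: act2_def)
      then have "c1.D (tmul f) x = iota p (int (\<chi> (s \<otimes> a)) * k) - iota p (int (\<chi> a) * k)"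
        using True Pair k s by (simp add: c1.D_def tmul_def act2_def topspace_T iota_simps)
      also have "\<dots> = iota p ((int (\<chi> (s \<otimes> a)) - int (\<chi> a)) * k)" by (simp add: iota_simps algebra_simps)
      also have "\<dots> = iota p k"
      proof -
        \<comment> \<open>Under s the value of \<chi> increases by 1 only modulo p: as natural
          numbers it drops from p - 1 to 0.\<close>
        have "[\<chi> (s \<otimes> a) = 1 + \<chi> a] (mod p)" using chi_hom[OF s(1), of a] True s by simp
        then have "[int (\<chi> (s \<otimes> a)) = int (1 + \<chi> a)] (mod int p)" by (simp only: cong_int_iff)
        then have "[int (\<chi> (s \<otimes> a)) - int (\<chi> a) = int (1 + \<chi> a) - int (\<chi> a)] (mod int p)"
          by (rule cong_diff[OF _ cong_refl])
        then have "[(int (\<chi> (s \<otimes> a)) - int (\<chi> a)) * k = 1 * k] (mod int p)" by (intro cong_mult cong_refl) simp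
        then show ?thesis by (simp add: iota_eq_iff)
      qed
      finally show ?thesis using k by simp
    next
      case False
      then show ?thesis using Pair C1_outside[OF f, of a b] topspace_T by (auto simp: c1.D_def)
    qed
  qed
qed

lemma d1_tmul: "f \<in> Z1G \<Longrightarrow> d1 (carrier G) (tmul f) = cupm f"
proof
  fix x assume f: "f \<in> Z1G"
  show "d1 (carrier G) (tmul f) x = cupm f x"
  proof (cases x)
    case (fields a b c)
    show ?thesis
    proof (cases "a \<in> carrier G \<and> b \<in> carrier G \<and> c \<in> carrier G")
      case True
      have "d1 (carrier G) f (a, b, c) = 0" using f by (simp add: Z1G_def)
      then have "f (a, c) = f (a, b) + f (b, c)" using True by (simp add: d1_def algebra_simps)
      then show ?thesis using True fields by (simp add: d1_def tmul_def cupm_def iota_simps algebra_simps)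
    qed (use fields in \<open>auto simp: d1_def cupm_def\<close>)
  qed
qed

lemma cupm_diff: "cupm (f - g) = cupm f - cupm g"
  by (auto simp: cupm_def fun_eq_iff algebra_simps)

lemma invariant_C1: "f \<in> C1 p G T (carrier G) \<longleftrightarrow> f \<in> Y1 \<and> c1.D f = 0"
  unfolding C1_def by (rule c1.Y_ker_D_iff)

lemma invariant_C2: "f \<in> C2 p G T (carrier G) \<longleftrightarrow> f \<in> Y2 \<and> c2.D f = 0"
  unfolding C2_def by (rule c2.Y_ker_D_iff)

end

section \<open>The count for a group with surjective corestriction\<close>

locale cor_surjective = norm_lifting +
  assumes cor_surj: "c \<in> Z2G \<Longrightarrow>
    \<exists>z\<in>Z2. \<exists>y\<in>C1 p G T (carrier G). c = (c2.D ^^ (p - 1)) z + d1 (carrier G) y"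
begin

lemma complex: "cyclic_complex p Y1 Z1 Z2 c1.D c2.D (d1 (carrier G))"
proof
  show "2 \<le> p" using p1 by simp
  show "c1.D (x - y) = c1.D x - c1.D y" for x y by (rule c1.D_diff)
  show "c2.D (x - y) = c2.D x - c2.D y" for x y by (rule c2.D_diff)
  show "d1 (carrier G) (x - y) = d1 (carrier G) x - d1 (carrier G) y" for x y by (rule d1_diff)
  show "add_subgroup Y1" by (rule C_subgroup)
  show "add_subgroup Z2"
    unfolding add_subgroup_def
  proof (intro conjI ballI)
    show "0 \<in> Z2" using add_subgroupD(1)[OF C_subgroup(2)] by (simp add: Z2_def cocycle2_def)
    fix x y assume xy: "x \<in> Z2" "y \<in> Z2"
    then have "x - y \<in> Y2" using add_subgroupD(2)[OF C_subgroup(2)[of p G T N], of x y] unfolding Z2_def by blast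
    moreover have "cocycle2 (carrier G) (x - y)" using xy cocycle2_diff[of "carrier G" x y] unfolding Z2_def by blast
    ultimately show "x - y \<in> Z2" unfolding Z2_def by blast
  qed
  show "Z1 = {y \<in> Y1. d1 (carrier G) y = 0}" by (rule Z1_def)
  show "c1.D y \<in> Y1" if "y \<in> Y1" for y using that c1.D_closed by (simp add: C1_def)
  show "c2.D z \<in> Z2" if "z \<in> Z2" for z using Z2_D[OF that] .
  show "d1 (carrier G) y \<in> Z2" if "y \<in> Y1" for y using d1_Y1[OF that] .
  show "d1 (carrier G) (c1.D y) = c2.D (d1 (carrier G) y)" for y by (rule d1_D)
  show "\<exists>u\<in>Y1. y = (c1.D ^^ (p - 1)) u" if "y \<in> Y1" "c1.D y = 0" for y using c1.ker_D that by (simp add: C1_def)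
  show "\<exists>u\<in>Y1. y = c1.D u" if "y \<in> Y1" "(c1.D ^^ (p - 1)) y = 0" for y using c1.ker_norm that by (simp add: C1_def)
  show "(c1.D ^^ p) y = 0" if "y \<in> Y1" for y using c1.D_nil that by (simp add: C1_def)
  show "(c2.D ^^ p) z = 0" if "z \<in> Z2" for z using c2.D_nil that by (simp add: Z2_def C2_def)
  show "\<exists>n\<in>Z1. c1.D w = (c1.D ^^ (p - 1)) n" if "w \<in> Z1" "c1.D (c1.D w) = 0" for w using norm_lift[OF that] .
  show "\<exists>z\<in>Z2. \<exists>y\<in>Y1. c1.D y = 0 \<and> c = (c2.D ^^ (p - 1)) z + d1 (carrier G) y" if "c \<in> Z2" "c2.D c = 0" for c
  proof -
    have "c \<in> Z2G" using that invariant_C2[of c] unfolding Z2G_def Z2_def by blast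
    then obtain z y where "z \<in> Z2" "y \<in> C1 p G T (carrier G)" "c = (c2.D ^^ (p - 1)) z + d1 (carrier G) y"
      using cor_surj by blast
    then show ?thesis using invariant_C1[of y] by blast
  qed
qed

text \<open>The preimage in \<open>Z2G\<close> of the subspace of cup products with \<chi>. It turns
  out to be the preimage of the kernel of restriction.\<close>

definition "AG = {cupm f + b | f b. f \<in> Z1G \<and> b \<in> B2G}"

text \<open>The abstract count in terms of G and N: Shapiro's lemma replaces Z2 / B2 by the
  cohomology of N, and [AG : BG] becomes the index of the annihilator of \<chi>, because f |->
  \<chi> cup f maps onto AG modulo coboundaries.\<close>

theorem card_H2N:
  assumes fin: "finite_index Z2G B2G"
  shows "finite_index Z2N B2N"
    "add_index Z2N B2N = add_index Z1G {f \<in> Z1G. cupm f \<in> B2G} * add_index Z2G AG ^ p"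
    "add_subgroup AG" "AG \<subseteq> Z2G" "B2G \<subseteq> AG" "add_subgroup B2G" "add_subgroup {f \<in> Z1G. cupm f \<in> B2G}"
proof -
  interpret cc: cyclic_complex p Y1 Z1 Z2 c1.D c2.D "d1 (carrier G)" by (rule complex)
  have ZG: "cc.ZG = Z2G"
    unfolding cc.ZG_def Z2G_def
    by (rule Set.set_eqI) (simp only: Z2_def mem_Collect_eq invariant_C2 conj_ac)
  have "{y \<in> Y1. c1.D y = 0} = C1 p G T (carrier G)"
    by (rule Set.set_eqI) (simp only: mem_Collect_eq invariant_C1)
  then have BG: "cc.BG = B2G" by (simp only: cc.BG_def B2G_def)
  have Z1G: "f \<in> Z1G \<longleftrightarrow> f \<in> Z1 \<and> c1.D f = 0" for f
    by (simp only: Z1G_def Z1_def mem_Collect_eq invariant_C1[of f] conj_ac)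
  have cup_AG: "cupm f \<in> cc.AG" if f: "f \<in> Z1G" for f
  proof -
    have t: "tmul f \<in> Y1" "c1.D (tmul f) = f" using f tmul_closed D_tmul by (auto simp: Z1G_def)
    have "c2.D (cupm f) = 0" using d1_D[of "tmul f"] t(2) f d1_tmul[OF f] by (simp add: Z1G_def)
    moreover have "cupm f \<in> Z2" using d1_Y1[OF t(1)] d1_tmul[OF f] by simp
    moreover have "cupm f \<in> cc.B2" unfolding cc.B2_def using imageI[OF t(1), of "d1 (carrier G)"] d1_tmul[OF f] by simp
    ultimately show ?thesis by (simp add: cc.AG_def cc.ZG_def)
  qed
  \<comment> \<open>A cochain w with d w = c and D (D w) = 0 differs from \<open>tmul (D w)\<close>
    by a G-invariant cochain, so c differs from a cup product by a coboundary of G.\<close>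
  have lifts: "\<exists>f\<in>Z1G. c - cupm f \<in> cc.BG" if c: "c \<in> cc.AG" for c
  proof -
    obtain w where w: "w \<in> Y1" "c1.D (c1.D w) = 0" "d1 (carrier G) w = c" using cc.ker_res[OF c] by blast
    define f where "f = c1.D w"
    have fY: "f \<in> Y1" using w c1.D_closed by (simp add: f_def C1_def)
    have "d1 (carrier G) f = c2.D c" using d1_D w(3) by (simp add: f_def)
    also have "\<dots> = 0" using c by (simp add: cc.AG_def cc.ZG_def)
    finally have fZ: "f \<in> Z1G" using Z1G w(2) fY by (simp add: Z1_def f_def)
    have t: "tmul f \<in> Y1" "c1.D (tmul f) = f" using fZ tmul_closed D_tmul by (auto simp: Z1G_def)
    have "w - tmul f \<in> Y1" using w(1) t(1) add_subgroupD(2)[OF C_subgroup(1)] by blast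
    moreover have "c1.D (w - tmul f) = 0" using t(2) by (simp add: c1.D_diff f_def)
    moreover have "d1 (carrier G) (w - tmul f) = c - cupm f" using w(3) d1_tmul[OF fZ] by (simp add: d1_diff)
    ultimately have "c - cupm f \<in> cc.BG" unfolding cc.BG_def by (metis (mono_tags, lifting) imageI mem_Collect_eq)
    then show ?thesis using fZ by blast
  qed
  have AGeq: "AG = cc.AG"
  proof
    show "AG \<subseteq> cc.AG"
    proof
      fix c assume "c \<in> AG"
      then obtain f b where fb: "f \<in> Z1G" "b \<in> cc.BG" "c = cupm f + b" unfolding AG_def BG[symmetric] by blast
      show "c \<in> cc.AG"
        unfolding fb(3) by (rule add_subgroupD(4)[OF cc.AG_subgroup cup_AG[OF fb(1)] subsetD[OF cc.BG_sub fb(2)]])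
    qed
    show "cc.AG \<subseteq> AG"
    proof
      fix c assume "c \<in> cc.AG"
      then obtain f where f: "f \<in> Z1G" "c - cupm f \<in> B2G" using lifts BG by blast
      have "c = cupm f + (c - cupm f)" by simp
      then show "c \<in> AG" unfolding AG_def using f by blast
    qed
  qed
  let ?H = "{f \<in> Z1G. cupm f \<in> B2G}"
  have Z1Gs: "x - y \<in> Z1G" if "x \<in> Z1G" "y \<in> Z1G" for x y
    using that add_subgroupD(2)[OF C_subgroup(1)] by (auto simp: Z1G_def d1_diff)
  have "0 \<in> Z1G" using add_subgroupD(1)[OF C_subgroup(1)] by (auto simp: Z1G_def d1_def fun_eq_iff)
  moreover have "cupm 0 = 0" by (auto simp: cupm_def fun_eq_iff)
  ultimately show Hs: "add_subgroup ?H"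
    using Z1Gs add_subgroupD[OF cc.BG_subgroup[unfolded BG]] by (auto simp: add_subgroup_def cupm_diff)
  have i: "add_index Z1G ?H = add_index cc.AG cc.BG"
  proof (rule index_hom(1)[OF Hs cc.BG_subgroup cupm_diff Z1Gs cup_AG lifts])
    show "(cupm x \<in> cc.BG) = (x \<in> ?H)" if "x \<in> Z1G" for x using that BG by simp
  qed
  note cnt = cc.index_Z2_B2[unfolded ZG BG, OF fin]
  show "finite_index Z2N B2N" using cnt(1) shapiro(2) by (simp add: cc.B2_def)
  show "add_index Z2N B2N = add_index Z1G ?H * add_index Z2G AG ^ p"
    using cnt(2) shapiro(1) i AGeq BG by (simp add: cc.B2_def)
  show "add_subgroup AG" using cc.AG_subgroup AGeq by simp
  show "AG \<subseteq> Z2G" using AGeq ZG by (auto simp: cc.AG_def)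
  show "B2G \<subseteq> AG" using AGeq BG cc.BG_sub by simp
  show "add_subgroup B2G" using cc.BG_subgroup BG by simp
qed

end

section \<open>The cohomology modules\<close>

text \<open>Coordinates in a basis are a bijection with the functions from the basis to K;
  conversely a finite space is generated by the set of all its vectors.\<close>

lemma fin_dim_iff_card:
  assumes V: "vectorspace K V" and K: "finite (carrier K)"
  shows "vectorspace.fin_dim K V \<longleftrightarrow> finite (carrier V)"
    "finite (carrier V) \<Longrightarrow> card (carrier V) = card (carrier K) ^ vectorspace.dim K V"
proof -
  interpret vectorspace K V by (rule V)
  have basis: "finite (carrier V) \<and> card (carrier V) = card (carrier K) ^ dim" if fd: fin_dim
  proof -
    obtain B where B: "finite B" "basis B" using finite_basis_exists[OF fd] by blast
    have Bc: "B \<subseteq> carrier V" using B(2) by (simp add: basis_def)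
    note bc = iffD1[OF basis_criterion[OF B(1) Bc] B(2), rule_format]
    have "bij_betw (\<lambda>a. lincomb a B) (B \<rightarrow>\<^sub>E carrier K) (carrier V)"
    proof (rule bij_betw_imageI)
      show "inj_on (\<lambda>a. lincomb a B) (B \<rightarrow>\<^sub>E carrier K)"
      proof (rule inj_onI)
        fix a b assume a: "a \<in> B \<rightarrow>\<^sub>E carrier K" and b: "b \<in> B \<rightarrow>\<^sub>E carrier K" and e: "lincomb a B = lincomb b B"
        have "lincomb a B \<in> carrier V" using lincomb_closed[OF Bc, of a] a by (auto simp: PiE_def)
        from bc[OF this] show "a = b" using a b e by metis
      qed
      show "(\<lambda>a. lincomb a B) ` (B \<rightarrow>\<^sub>E carrier K) = carrier V"
      proof
        show "(\<lambda>a. lincomb a B) ` (B \<rightarrow>\<^sub>E carrier K) \<subseteq> carrier V" using lincomb_closed[OF Bc] by (auto simp: PiE_def)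
        show "carrier V \<subseteq> (\<lambda>a. lincomb a B) ` (B \<rightarrow>\<^sub>E carrier K)"
        proof
          fix v assume "v \<in> carrier V"
          from ex1_implies_ex[OF bc[OF this]] show "v \<in> (\<lambda>a. lincomb a B) ` (B \<rightarrow>\<^sub>E carrier K)" by blast
        qed
      qed
    qed
    then have "finite (carrier V) = finite (B \<rightarrow>\<^sub>E carrier K)" "card (carrier V) = card (B \<rightarrow>\<^sub>E carrier K)"
      by (metis bij_betw_finite, metis bij_betw_same_card)
    then show ?thesis using B K by (simp add: finite_PiE card_PiE dim_basis)
  qed
  have "fin_dim" if f: "finite (carrier V)"
  proof -
    have "carrier V \<subseteq> span (carrier V)" using in_own_span[OF order_refl] .
    then have "gen_set (carrier V)" using span_is_subset2[OF order_refl] by blast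
    then show ?thesis unfolding fin_dim_def using f by blast
  qed
  then show "fin_dim \<longleftrightarrow> finite (carrier V)" "finite (carrier V) \<Longrightarrow> card (carrier V) = card (carrier K) ^ dim"
    using basis by blast+
qed

section \<open>Presentations of modules over Z/p by groups of functions\<close>

definition scal :: "int \<Rightarrow> ('x \<Rightarrow> resid) \<Rightarrow> 'x \<Rightarrow> resid" where
  "scal r f = (\<lambda>x. of_int r * f x)"

lemma scal_simps:
  "scal (r + r') f = scal r f + scal r' f" "scal r (f + g) = scal r f + scal r g" "scal (r * r') f = scal r (scal r' f)"
  "scal 1 f = f" "scal 0 f = 0" "scal r (f - g) = scal r f - scal r g" "scal r 0 = 0"
  by (simp_all add: scal_def fun_eq_iff algebra_simps)

lemma add_subgroup_scal:
  assumes A: "add_subgroup A" and f: "f \<in> A" shows "scal r f \<in> A"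
proof -
  have n: "scal (int n) f \<in> A" for n
  proof (induction n)
    case 0 show ?case unfolding of_nat_0 scal_simps(5) by (rule add_subgroupD(1)[OF A])
  next
    case (Suc n)
    have "scal (int (Suc n)) f = scal (int n) f + f" by (simp add: scal_def fun_eq_iff algebra_simps)
    then show ?case using add_subgroupD(4)[OF A Suc f] by (simp only:)
  qed
  show ?thesis
  proof (cases "0 \<le> r")
    case True then show ?thesis using n[of "nat r"] by simp
  next
    case False
    have "scal r f = - scal (int (nat (- r))) f" using False by (simp add: scal_def fun_eq_iff)
    then show ?thesis using add_subgroupD(3)[OF A n] by (simp only:)
  qed
qed

text \<open>A presentation of a module over \<open>\<int>/p\<int>\<close> as a quotient \<open>A / B\<close> of \<open>p\<close>-torsion groups of functions.\<close>

locale presentation =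
  fixes p :: nat and M :: "(int, 'm, 'c) module_scheme" and A B :: "('x \<Rightarrow> resid) set" and \<pi> :: "('x \<Rightarrow> resid) \<Rightarrow> 'm"
  assumes prime_p: "prime p" and A: "add_subgroup A" and B: "add_subgroup B" "B \<subseteq> A"
    and torsion: "f \<in> A \<Longrightarrow> scal (int p) f = 0"
    and carrier_M: "carrier M = \<pi> ` A"
    and add: "f \<in> A \<Longrightarrow> h \<in> A \<Longrightarrow> \<pi> f \<oplus>\<^bsub>M\<^esub> \<pi> h = \<pi> (f + h)"
    and zero: "\<zero>\<^bsub>M\<^esub> = \<pi> 0"
    and smult: "r \<in> carrier (residue_ring (int p)) \<Longrightarrow> f \<in> A \<Longrightarrow> r \<odot>\<^bsub>M\<^esub> \<pi> f = \<pi> (scal r f)"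
    and ker: "f \<in> A \<Longrightarrow> h \<in> A \<Longrightarrow> \<pi> f = \<pi> h \<longleftrightarrow> f - h \<in> B"
begin

abbreviation "k \<equiv> residue_ring (int p)"

lemma k_field: "field k"
  using residues_prime.is_field[of p] prime_p by (simp add: residues_prime_def)

text \<open>Torsion lets integer multiples stand for scalars from Z/p, whose sums and products are
  reduced modulo p.\<close>

lemma scal_mod: "f \<in> A \<Longrightarrow> scal (r mod int p) f = scal r f"
proof -
  assume f: "f \<in> A"
  have "scal r f = scal (r mod int p + (r div int p) * int p) f" by simp
  also have "\<dots> = scal (r mod int p) f" by (simp only: scal_simps torsion[OF f] add_0_right)
  finally show ?thesis by simp
qed

lemma in_M: "v \<in> carrier M \<Longrightarrow> \<exists>f\<in>A. v = \<pi> f"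
  using carrier_M by blast

lemma vectorspace: "vectorspace k M"
proof -
  interpret kf: field k by (rule k_field)
  have ag: "abelian_group M"
  proof (rule abelian_groupI)
    fix u v w assume "u \<in> carrier M" "v \<in> carrier M" "w \<in> carrier M"
    then obtain f g h where m: "f \<in> A" "g \<in> A" "h \<in> A" "u = \<pi> f" "v = \<pi> g" "w = \<pi> h" using in_M by meson
    show "u \<oplus>\<^bsub>M\<^esub> v \<oplus>\<^bsub>M\<^esub> w = u \<oplus>\<^bsub>M\<^esub> (v \<oplus>\<^bsub>M\<^esub> w)" using m add_subgroupD(4)[OF A] by (simp add: add add.assoc)
  next
    fix u v assume "u \<in> carrier M" "v \<in> carrier M"
    then obtain f g where m: "f \<in> A" "g \<in> A" "u = \<pi> f" "v = \<pi> g" using in_M by meson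
    show "u \<oplus>\<^bsub>M\<^esub> v \<in> carrier M" using m add_subgroupD(4)[OF A] by (simp add: add carrier_M)
    show "u \<oplus>\<^bsub>M\<^esub> v = v \<oplus>\<^bsub>M\<^esub> u" using m by (simp add: add add.commute)
  next
    show "\<zero>\<^bsub>M\<^esub> \<in> carrier M" using zero carrier_M add_subgroupD(1)[OF A] by simp
  next
    fix u assume "u \<in> carrier M"
    then obtain f where m: "f \<in> A" "u = \<pi> f" using in_M by meson
    show "\<zero>\<^bsub>M\<^esub> \<oplus>\<^bsub>M\<^esub> u = u" using m add_subgroupD(1)[OF A] by (simp add: add zero)
    have "\<pi> (- f) \<oplus>\<^bsub>M\<^esub> u = \<zero>\<^bsub>M\<^esub>" using m add_subgroupD(3)[OF A] by (simp add: add zero)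
    then show "\<exists>v\<in>carrier M. v \<oplus>\<^bsub>M\<^esub> u = \<zero>\<^bsub>M\<^esub>" using carrier_M add_subgroupD(3)[OF A m(1)] by blast
  qed
  have "module k M"
  proof (rule module.intro)
    show "cring k" by (rule kf.is_cring)
    show "abelian_group M" by (rule ag)
    show "module_axioms k M"
    proof
      show "\<one>\<^bsub>k\<^esub> \<odot>\<^bsub>M\<^esub> u = u" if u: "u \<in> carrier M" for u
      proof -
        obtain f where m: "f \<in> A" "u = \<pi> f" using in_M[OF u] by meson
        show ?thesis using smult[OF kf.one_closed m(1)] m(2) by (simp add: residue_ring_def scal_simps)
      qed
      show "a \<odot>\<^bsub>M\<^esub> u \<in> carrier M" if a: "a \<in> carrier k" and u: "u \<in> carrier M" for a u
        using in_M[OF u] a add_subgroup_scal[OF A] by (auto simp: smult carrier_M)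
      fix a b u assume a: "a \<in> carrier k" and b: "b \<in> carrier k" and u: "u \<in> carrier M"
      obtain f where m: "f \<in> A" "u = \<pi> f" using in_M[OF u] by meson
      show "(a \<oplus>\<^bsub>k\<^esub> b) \<odot>\<^bsub>M\<^esub> u = a \<odot>\<^bsub>M\<^esub> u \<oplus>\<^bsub>M\<^esub> b \<odot>\<^bsub>M\<^esub> u"
        using smult[OF kf.add.m_closed[OF a b] m(1)] a b m add_subgroup_scal[OF A m(1)]
        by (simp add: smult add residue_ring_def scal_mod scal_simps)
      show "(a \<otimes>\<^bsub>k\<^esub> b) \<odot>\<^bsub>M\<^esub> u = a \<odot>\<^bsub>M\<^esub> (b \<odot>\<^bsub>M\<^esub> u)"
        using smult[OF kf.m_closed[OF a b] m(1)] a b m add_subgroup_scal[OF A m(1)]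
        by (simp add: smult residue_ring_def scal_mod scal_simps)
    next
      fix a u v assume a: "a \<in> carrier k" and u: "u \<in> carrier M" and v: "v \<in> carrier M"
      obtain f where m: "f \<in> A" "u = \<pi> f" using in_M[OF u] by meson
      obtain g where n: "g \<in> A" "v = \<pi> g" using in_M[OF v] by meson
      show "a \<odot>\<^bsub>M\<^esub> (u \<oplus>\<^bsub>M\<^esub> v) = a \<odot>\<^bsub>M\<^esub> u \<oplus>\<^bsub>M\<^esub> a \<odot>\<^bsub>M\<^esub> v"
        using a m n add_subgroup_scal[OF A] add_subgroupD(4)[OF A] by (simp add: smult add scal_simps)
    qed
  qed
  then show ?thesis by (intro vectorspace.intro k_field)
qed

text \<open>The fibres of \<open>\<pi>\<close> are cosets of B, so M has [A : B] elements.\<close>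

lemma dimension:
  "vectorspace.fin_dim k M \<longleftrightarrow> finite_index A B"
  "finite_index A B \<Longrightarrow> add_index A B = p ^ vectorspace.dim k M"
proof -
  have k: "finite (carrier k)" "card (carrier k) = p" by (simp_all add: residue_ring_def)
  note i = index_by_fibres[OF B(1) ker]
  show f: "vectorspace.fin_dim k M \<longleftrightarrow> finite_index A B"
    using fin_dim_iff_card(1)[OF vectorspace k(1)] i(2) carrier_M by simp
  show "add_index A B = p ^ vectorspace.dim k M" if "finite_index A B"
    using fin_dim_iff_card(2)[OF vectorspace k(1)] i carrier_M that k(2) by simp
qed

definition quotient_map :: "('x \<Rightarrow> resid) set \<Rightarrow> ('x \<Rightarrow> resid) \<Rightarrow> 'm set" where
  "quotient_map B' f = \<pi> ` B' +>\<^bsub>M\<^esub> \<pi> f"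

context
  fixes B' assumes B': "add_subgroup B'" "B \<subseteq> B'" "B' \<subseteq> A"
begin

lemma quotient_map_eq:
  assumes f: "f \<in> A" shows "quotient_map B' f = \<pi> ` {h \<in> A. h - f \<in> B'}"
proof -
  have "quotient_map B' f = (\<lambda>b. \<pi> b \<oplus>\<^bsub>M\<^esub> \<pi> f) ` B'"
    by (auto simp: quotient_map_def a_r_coset_def r_coset_def)
  also have "\<dots> = (\<lambda>b. \<pi> (b + f)) ` B'" using B'(3) f by (intro image_cong refl) (auto simp: add)
  also have "\<dots> = \<pi> ` ((\<lambda>b. b + f) ` B')" by (simp add: image_image)
  also have "(\<lambda>b. b + f) ` B' = {h \<in> A. h - f \<in> B'}"
  proof
    show "(\<lambda>b. b + f) ` B' \<subseteq> {h \<in> A. h - f \<in> B'}" using B'(3) f add_subgroupD(4)[OF A] by auto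
    show "{h \<in> A. h - f \<in> B'} \<subseteq> (\<lambda>b. b + f) ` B'" using image_eqI[of _ "\<lambda>b. b + f" "_ - f" B'] by fastforce
  qed
  finally show ?thesis .
qed

lemma quotient_map_cong: "f \<in> A \<Longrightarrow> g \<in> A \<Longrightarrow> f - g \<in> B' \<Longrightarrow> quotient_map B' f = quotient_map B' g"
proof -
  assume m: "f \<in> A" "g \<in> A" "f - g \<in> B'"
  have "h - f \<in> B' \<longleftrightarrow> h - g \<in> B'" for h
  proof
    show "h - f \<in> B' \<Longrightarrow> h - g \<in> B'" using add_subgroupD(4)[OF B'(1) _ m(3), of "h - f"] by simp
    show "h - g \<in> B' \<Longrightarrow> h - f \<in> B'" using add_subgroupD(2)[OF B'(1) _ m(3), of "h - g"] by simp
  qed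
  then show ?thesis by (simp add: quotient_map_eq m)
qed

text \<open>A stays the same and only the group of relations grows. Thus cohomology, its quotient by
  cup products and its quotient by an annihilator are all counted by indices of subgroups of
  function spaces.\<close>

lemma quotient_presentation: "presentation p (quotient_module M (\<pi> ` B')) A B' (quotient_map B')"
proof
  show "prime p" by (rule prime_p)
  show "add_subgroup A" by (rule A)
  show "add_subgroup B'" by (rule B')
  show "B' \<subseteq> A" by (rule B')
  show "scal (int p) f = 0" if "f \<in> A" for f using torsion[OF that] .
  show "carrier (quotient_module M (\<pi> ` B')) = quotient_map B' ` A"
    by (auto simp: quotient_module_def A_RCOSETS_def RCOSETS_def quotient_map_def carrier_M a_r_coset_def)
  show "\<zero>\<^bsub>quotient_module M (\<pi> ` B')\<^esub> = quotient_map B' 0"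
  proof -
    have "{h \<in> A. h - 0 \<in> B'} = B'" using B'(3) by auto
    then show ?thesis using quotient_map_eq[OF add_subgroupD(1)[OF A]] by (simp add: quotient_module_def)
  qed
  show "quotient_map B' f \<oplus>\<^bsub>quotient_module M (\<pi> ` B')\<^esub> quotient_map B' h = quotient_map B' (f + h)"
    if f: "f \<in> A" and h: "h \<in> A" for f h
  proof -
    have fh: "f + h \<in> A" using add_subgroupD(4)[OF A f h] .
    have "quotient_map B' f <+>\<^bsub>M\<^esub> quotient_map B' h = quotient_map B' (f + h)"
    proof
      show "quotient_map B' f <+>\<^bsub>M\<^esub> quotient_map B' h \<subseteq> quotient_map B' (f + h)"
      proof
        fix v assume "v \<in> quotient_map B' f <+>\<^bsub>M\<^esub> quotient_map B' h"
        then obtain a b where ab: "a \<in> A" "a - f \<in> B'" "b \<in> A" "b - h \<in> B'" "v = \<pi> a \<oplus>\<^bsub>M\<^esub> \<pi> b"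
          by (auto simp: set_add_def set_mult_def quotient_map_eq f h)
        have e: "a + b - (f + h) = (a - f) + (b - h)" by simp
        have "a + b - (f + h) \<in> B'" unfolding e by (rule add_subgroupD(4)[OF B'(1) ab(2,4)])
        then show "v \<in> quotient_map B' (f + h)"
          using ab add_subgroupD(4)[OF A ab(1,3)] by (simp add: quotient_map_eq[OF fh] add)
      qed
      show "quotient_map B' (f + h) \<subseteq> quotient_map B' f <+>\<^bsub>M\<^esub> quotient_map B' h"
      proof
        fix v assume "v \<in> quotient_map B' (f + h)"
        then obtain a where a: "a \<in> A" "a - (f + h) \<in> B'" "v = \<pi> a" by (auto simp: quotient_map_eq[OF fh])
        have ah: "a - h \<in> A" using add_subgroupD(2)[OF A a(1) h] .
        have "a - h - f \<in> B'" using a(2) by (simp add: algebra_simps)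
        then have m: "\<pi> (a - h) \<in> quotient_map B' f" "\<pi> h \<in> quotient_map B' h"
          using f h ah add_subgroupD(1)[OF B'(1)] by (auto simp: quotient_map_eq)
        have "v = \<pi> (a - h) \<oplus>\<^bsub>M\<^esub> \<pi> h" using a ah h by (simp add: add)
        then show "v \<in> quotient_map B' f <+>\<^bsub>M\<^esub> quotient_map B' h"
          unfolding set_add_def set_mult_def using m by auto
      qed
    qed
    then show ?thesis by (simp add: quotient_module_def)
  qed
  show "r \<odot>\<^bsub>quotient_module M (\<pi> ` B')\<^esub> quotient_map B' f = quotient_map B' (scal r f)"
    if r: "r \<in> carrier k" and f: "f \<in> A" for r f
  proof -
    \<comment> \<open>\<open>smult\<close> is a union over the elements of the coset: all of them
      yield the same coset, and there is at least one.\<close>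
    have "(\<Union>x\<in>quotient_map B' f. \<pi> ` B' +>\<^bsub>M\<^esub> (r \<odot>\<^bsub>M\<^esub> x)) = (\<Union>h\<in>{h \<in> A. h - f \<in> B'}. quotient_map B' (scal r h))"
      unfolding quotient_map_eq[OF f] UN_simps using r by (intro SUP_cong refl) (auto simp: smult quotient_map_def)
    also have "\<dots> = (\<Union>h\<in>{h \<in> A. h - f \<in> B'}. quotient_map B' (scal r f))"
    proof (intro SUP_cong refl quotient_map_cong)
      fix h assume h: "h \<in> {h \<in> A. h - f \<in> B'}"
      show "scal r h \<in> A" "scal r f \<in> A" using h f add_subgroup_scal[OF A] by auto
      show "scal r h - scal r f \<in> B'" using h add_subgroup_scal[OF B'(1), of "h - f" r] by (simp add: scal_simps)
    qed
    also have "\<dots> = quotient_map B' (scal r f)" using f add_subgroupD(1)[OF B'(1)] by auto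
    finally show ?thesis by (simp add: quotient_module_def)
  qed
  show "quotient_map B' f = quotient_map B' h \<longleftrightarrow> f - h \<in> B'" if f: "f \<in> A" and h: "h \<in> A" for f h
  proof
    assume e: "quotient_map B' f = quotient_map B' h"
    have "\<pi> f \<in> quotient_map B' f" using f add_subgroupD(1)[OF B'(1)] by (auto simp: quotient_map_eq)
    \<comment> \<open>The equality concerns images under \<open>\<pi>\<close>, not functions; the
      kernel B of \<open>\<pi>\<close> is absorbed because it lies in B'.\<close>
    then obtain a where a: "a \<in> A" "a - h \<in> B'" "\<pi> f = \<pi> a" using e by (auto simp: quotient_map_eq[OF h])
    have "f - a \<in> B'" using ker[OF f a(1)] a(3) B'(2) by blast
    from add_subgroupD(4)[OF B'(1) this a(2)] show "f - h \<in> B'" by simp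
  qed (rule quotient_map_cong[OF f h])
qed

end
end

lemma (in presentation) restrict_presentation:
  assumes A': "add_subgroup A'" "B \<subseteq> A'" "A' \<subseteq> A"
  shows "presentation p (M\<lparr>carrier := \<pi> ` A'\<rparr>) A' B \<pi>"
proof
  show "prime p" "add_subgroup A'" "add_subgroup B" "B \<subseteq> A'" using prime_p A' B by blast+
qed (use A'(3) in \<open>auto simp: torsion add zero smult ker subset_iff\<close>)

section \<open>Residues modulo p represented by integers\<close>

definition val :: "nat \<Rightarrow> resid \<Rightarrow> int" where
  "val p r = (THE m. m \<in> {0..int p - 1} \<and> iota p m = r)"

lemma val_iota: "p > 0 \<Longrightarrow> val p (iota p m) = m mod int p"
  unfolding val_def
proof (rule the_equality)
  assume p: "p > 0"
  then show "m mod int p \<in> {0..int p - 1} \<and> iota p (m mod int p) = iota p m" by (simp add: iota_eq_iff cong_def)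
  fix m' assume m': "m' \<in> {0..int p - 1} \<and> iota p m' = iota p m"
  then have "m' mod int p = m mod int p" by (simp add: iota_eq_iff cong_def)
  then show "m' = m mod int p" using m' by simp
qed

lemma val_range:
  assumes "p > 0" "r \<in> range (iota p)"
  shows "iota p (val p r) = r" "val p r \<in> {0..int p - 1}"
proof -
  obtain m where m: "r = iota p m" using assms by blast
  show "iota p (val p r) = r" using assms(1) by (simp add: m val_iota iota_eq_iff cong_def)
  show "val p r \<in> {0..int p - 1}" using assms(1) by (simp add: m val_iota)
qed

lemma val_eqI: "p > 0 \<Longrightarrow> m \<in> {0..int p - 1} \<Longrightarrow> iota p m = r \<Longrightarrow> val p r = m"
  using val_iota[of p m] by auto

lemma iota_residue:
  assumes p: "prime p" and a: "a \<in> carrier (residue_ring (int p))" and b: "b \<in> carrier (residue_ring (int p))"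
  shows "iota p (a \<oplus>\<^bsub>residue_ring (int p)\<^esub> b) = iota p a + iota p b"
    "iota p (a \<otimes>\<^bsub>residue_ring (int p)\<^esub> b) = iota p a * iota p b"
    "iota p ((\<ominus>\<^bsub>residue_ring (int p)\<^esub> \<one>\<^bsub>residue_ring (int p)\<^esub>) [^]\<^bsub>residue_ring (int p)\<^esub> (i::nat) \<otimes>\<^bsub>residue_ring (int p)\<^esub> b) = (- 1) ^ i * iota p b"
proof -
  let ?k = "residue_ring (int p)"
  interpret k: field ?k using residues_prime.is_field[of p] p by (simp add: residues_prime_def)
  have add: "iota p (a \<oplus>\<^bsub>?k\<^esub> b) = iota p a + iota p b" for a b
    by (simp add: residue_ring_def iota_simps(1)[symmetric] iota_eq_iff cong_def)
  then show "iota p (a \<oplus>\<^bsub>?k\<^esub> b) = iota p a + iota p b" .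
  have mult: "iota p (a \<otimes>\<^bsub>?k\<^esub> b) = iota p a * iota p b" for a b
    by (simp add: residue_ring_def iota_simps(5)[symmetric] iota_eq_iff cong_def)
  then show "iota p (a \<otimes>\<^bsub>?k\<^esub> b) = iota p a * iota p b" .
  let ?e = "\<ominus>\<^bsub>?k\<^esub> \<one>\<^bsub>?k\<^esub>"
  have "iota p ?e + iota p 1 = iota p \<zero>\<^bsub>?k\<^esub>" using k.l_neg[OF k.one_closed] add[of ?e "\<one>\<^bsub>?k\<^esub>"] by (simp add: residue_ring_def)
  then have e: "iota p ?e = iota p (- 1)"
    by (simp add: residue_ring_def iota_simps(4) iota_simps(3)[of p 1] eq_neg_iff_add_eq_0)
  show "iota p (?e [^]\<^bsub>?k\<^esub> i \<otimes>\<^bsub>?k\<^esub> b) = (- 1) ^ i * iota p b"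
    using b
  proof (induction i arbitrary: b)
    case 0 then show ?case by simp
  next
    case (Suc i)
    have "?e [^]\<^bsub>?k\<^esub> Suc i \<otimes>\<^bsub>?k\<^esub> b = ?e [^]\<^bsub>?k\<^esub> i \<otimes>\<^bsub>?k\<^esub> (?e \<otimes>\<^bsub>?k\<^esub> b)" using Suc.prems by (simp add: k.m_assoc)
    also have "iota p \<dots> = (- 1) ^ i * iota p (?e \<otimes>\<^bsub>?k\<^esub> b)" using Suc.prems by (intro Suc.IH) simp
    also have "iota p (?e \<otimes>\<^bsub>?k\<^esub> b) = - iota p b" by (simp add: mult e iota_simps(5)[symmetric] iota_simps(3)[symmetric])
    finally show ?case by simp
  qed
qed

lemma iota_finsum:
  assumes p: "prime p" and S: "finite S" and g: "g \<in> S \<rightarrow> carrier (residue_ring (int p))"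
  shows "iota p (finsum (residue_ring (int p)) g S) = (\<Sum>i\<in>S. iota p (g i))"
proof -
  let ?k = "residue_ring (int p)"
  interpret k: field ?k using residues_prime.is_field[of p] p by (simp add: residues_prime_def)
  show ?thesis using S g
  proof (induction S)
    case empty show ?case unfolding k.finsum_empty sum.empty by (simp add: residue_ring_def iota_simps)
  next
    case (insert i S)
    have "finsum ?k g (insert i S) = g i \<oplus>\<^bsub>?k\<^esub> finsum ?k g S"
      using insert by (intro k.finsum_insert) auto
    then show ?case using insert iota_residue(1)[OF p, of "g i" "finsum ?k g S"] by (simp add: k.finsum_closed)
  qed
qed

section \<open>Encoding of cochains on tuples\<close>

lemma topspace_tuples: "topspace TH = carrier H \<Longrightarrow> topspace (product_topology (\<lambda>_. TH) {..n}) = tuples H n"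
  by (simp add: tuples_def)

lemma coboundary_value:
  assumes p: "prime p" and f: "f \<in> tuples H n \<rightarrow> carrier (residue_ring (int p))" and x: "x \<in> tuples H (Suc n)"
  shows "iota p (coboundary (residue_ring (int p)) H n f x)
      = (\<Sum>i\<le>Suc n. (- 1) ^ i * iota p (f (\<lambda>j\<in>{..n}. x (if j < i then j else Suc j))))"
    "coboundary (residue_ring (int p)) H n f x \<in> carrier (residue_ring (int p))"
proof -
  let ?k = "residue_ring (int p)"
  interpret k: field ?k using residues_prime.is_field[of p] p by (simp add: residues_prime_def)
  have face: "(\<lambda>j\<in>{..n}. x (if j < i then j else Suc j)) \<in> tuples H n" for i
    using x by (auto simp: tuples_def PiE_def Pi_def)
  have F: "f (\<lambda>j\<in>{..n}. x (if j < i then j else Suc j)) \<in> carrier ?k" for i using f face by blast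
  have cl: "(\<lambda>i. (\<ominus>\<^bsub>?k\<^esub> \<one>\<^bsub>?k\<^esub>) [^]\<^bsub>?k\<^esub> i \<otimes>\<^bsub>?k\<^esub> f (\<lambda>j\<in>{..n}. x (if j < i then j else Suc j))) \<in> {..Suc n} \<rightarrow> carrier ?k"
    using F by simp
  show "iota p (coboundary ?k H n f x) = (\<Sum>i\<le>Suc n. (- 1) ^ i * iota p (f (\<lambda>j\<in>{..n}. x (if j < i then j else Suc j))))"
    unfolding coboundary_def restrict_apply'[OF x] iota_finsum[OF p finite_atMost cl]
    by (intro sum.cong refl iota_residue(3)[OF p F F])
  show "coboundary ?k H n f x \<in> carrier ?k"
    unfolding coboundary_def restrict_apply'[OF x] by (rule k.finsum_closed[OF cl])
qed

text \<open>Homogeneous cochains on tuples, encoded by \<open>t\<close> as functions on a space \<open>TX\<close> of pairs or triples.\<close>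

locale tuple_code =
  fixes p :: nat and H :: "('g, 'c) monoid_scheme" and TH :: "'g topology" and n :: nat
    and TX :: "'x topology" and act :: "'g \<Rightarrow> 'x \<Rightarrow> 'x" and t :: "(nat \<Rightarrow> 'g) \<Rightarrow> 'x" and u :: "'x \<Rightarrow> nat \<Rightarrow> 'g"
  assumes p: "prime p" and top: "topspace TH = carrier H"
    and t_cont: "continuous_map (product_topology (\<lambda>_. TH) {..n}) TX t"
    and u_cont: "continuous_map TX (product_topology (\<lambda>_. TH) {..n}) u"
    and tu: "x \<in> topspace TX \<Longrightarrow> t (u x) = x" and ut: "y \<in> tuples H n \<Longrightarrow> u (t y) = y"
    and act: "g \<in> carrier H \<Longrightarrow> x \<in> topspace TX \<Longrightarrow> act g x \<in> topspace TX"
    and equiv: "g \<in> carrier H \<Longrightarrow> x \<in> topspace TX \<Longrightarrow> u (act g x) = (\<lambda>i\<in>{..n}. g \<otimes>\<^bsub>H\<^esub> u x i)"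
begin

abbreviation "k \<equiv> residue_ring (int p)"
abbreviation "CF \<equiv> cochain_fun p TX act (carrier H)"

definition dec :: "('x \<Rightarrow> resid) \<Rightarrow> (nat \<Rightarrow> 'g) \<Rightarrow> int" where
  "dec h = (\<lambda>y\<in>tuples H n. val p (h (t y)))"
definition enc :: "((nat \<Rightarrow> 'g) \<Rightarrow> int) \<Rightarrow> 'x \<Rightarrow> resid" where
  "enc f = (\<lambda>x. if x \<in> topspace TX then iota p (f (u x)) else 0)"

lemma p_pos: "p > 0" using prime_gt_0_nat[OF p] .

lemma t_mem: "y \<in> tuples H n \<Longrightarrow> t y \<in> topspace TX" and u_mem: "x \<in> topspace TX \<Longrightarrow> u x \<in> tuples H n"
  using t_cont u_cont topspace_tuples[OF top] by (auto simp: continuous_map_def)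

lemma t_act:
  assumes g: "g \<in> carrier H" and y: "y \<in> tuples H n" shows "t (\<lambda>i\<in>{..n}. g \<otimes>\<^bsub>H\<^esub> y i) = act g (t y)"
  using equiv[OF g t_mem[OF y]] tu[OF act[OF g t_mem[OF y]]] by (simp add: ut[OF y])

lemma iota_dec: "h \<in> CF \<Longrightarrow> y \<in> tuples H n \<Longrightarrow> iota p (dec h y) = h (t y)"
  "h \<in> CF \<Longrightarrow> dec h \<in> tuples H n \<rightarrow> carrier k"
  using val_range[OF p_pos cochain_funD(2)[of h p TX act]] by (auto simp: dec_def residue_ring_def)

lemma dec_closed: "h \<in> CF \<Longrightarrow> dec h \<in> carrier (cochains k H TH n)"
proof -
  assume h: "h \<in> CF"
  note D = cochain_funD[OF h]
  have "lc (product_topology (\<lambda>_. TH) {..n}) (\<lambda>y. val p (h (t y)))" by (rule lc_map[OF lc_compose[OF D(3) t_cont]])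
  then have "lc (product_topology (\<lambda>_. TH) {..n}) (dec h)"
    by (subst lc_cong[of _ _ "\<lambda>y. val p (h (t y))"]) (simp_all add: dec_def tuples_def top)
  then have c: "continuous_map (product_topology (\<lambda>_. TH) {..n}) (discrete_topology (carrier k)) (dec h)"
    unfolding lc_continuous_map topspace_tuples[OF top] using iota_dec(2)[OF h] by simp
  have "dec h (\<lambda>i\<in>{..n}. g \<otimes>\<^bsub>H\<^esub> x i) = dec h x" if g: "g \<in> carrier H" and x: "x \<in> tuples H n" for g x
  proof -
    have "(\<lambda>i\<in>{..n}. g \<otimes>\<^bsub>H\<^esub> x i) \<in> tuples H n"
      using u_mem[OF act[OF g t_mem[OF x]]] equiv[OF g t_mem[OF x]] ut[OF x] by simp
    then show ?thesis using x D(4)[OF g t_mem[OF x]] t_act[OF g x] by (simp add: dec_def)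
  qed
  then show ?thesis using c by (simp add: cochains_def dec_def)
qed

lemma enc_closed:
  assumes f: "f \<in> carrier (cochains k H TH n)"
  shows "enc f \<in> CF" "dec (enc f) = f"
proof -
  have fe: "f \<in> extensional (tuples H n)"
    and fc: "f \<in> tuples H n \<rightarrow> carrier k" "lc (product_topology (\<lambda>_. TH) {..n}) f"
    and fi: "\<And>g x. g \<in> carrier H \<Longrightarrow> x \<in> tuples H n \<Longrightarrow> f (\<lambda>i\<in>{..n}. g \<otimes>\<^bsub>H\<^esub> x i) = f x"
    using f unfolding cochains_def lc_continuous_map topspace_tuples[OF top] by simp_all
  show "enc f \<in> CF"
  proof (rule cochain_funI)
    have "lc TX (\<lambda>x. iota p (f (u x)))" by (rule lc_map[OF lc_compose[OF fc(2) u_cont]])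
    then show "lc TX (enc f)" by (subst lc_cong[of _ _ "\<lambda>x. iota p (f (u x))"]) (simp_all add: enc_def)
    show "enc f (act g x) = enc f x" if "g \<in> carrier H" "x \<in> topspace TX" for g x
      using that act[OF that] equiv[OF that] fi[OF that(1) u_mem[OF that(2)]] by (simp add: enc_def)
  qed (simp_all add: enc_def)
  show "dec (enc f) = f"
  proof (rule extensionalityI[OF _ fe])
    show "dec (enc f) \<in> extensional (tuples H n)" by (simp add: dec_def)
    fix y assume y: "y \<in> tuples H n"
    have "f y \<in> {0..int p - 1}" using fc(1) y by (auto simp: residue_ring_def)
    then show "dec (enc f) y = f y" using y t_mem[OF y] by (simp add: dec_def enc_def ut val_iota p_pos)
  qed
qed

text \<open>The relations are trivial: decoding is an isomorphism of the function group with the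
  module of cochains. Cocycles and cohomology are obtained from it by restriction and
  quotients.\<close>

lemma cochain_presentation: "presentation p (cochains k H TH n) CF {0} dec"
proof
  show "prime p" by (rule p)
  show "add_subgroup CF" unfolding add_subgroup_def using cochain_fun_0 cochain_fun_diff by blast
  show "add_subgroup {0 :: 'x \<Rightarrow> resid}" by (simp add: add_subgroup_def)
  show "{0} \<subseteq> CF" using cochain_fun_0 by blast
  show "scal (int p) f = 0" if f: "f \<in> CF" for f
  proof
    fix x
    obtain m where "f x = iota p m" using cochain_funD(2)[OF f] by blast
    then show "scal (int p) f x = 0 x" by (simp add: scal_def iota_of_int[of "int p", simplified] iota_eq_iff[of p _ 0, unfolded iota_simps(4)] cong_def)
  qed
  show "carrier (cochains k H TH n) = dec ` CF"
  proof
    show "carrier (cochains k H TH n) \<subseteq> dec ` CF"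
    proof
      fix f assume f: "f \<in> carrier (cochains k H TH n)"
      show "f \<in> dec ` CF" using enc_closed[OF f] by (metis image_eqI)
    qed
    show "dec ` CF \<subseteq> carrier (cochains k H TH n)" using dec_closed by (rule image_subsetI)
  qed
  have kc: "carrier k = {0..int p - 1}" by (simp add: residue_ring_def)
  note V = val_range[OF p_pos cochain_funD(2)]
  show "dec f \<oplus>\<^bsub>cochains k H TH n\<^esub> dec h = dec (f + h)" if f: "f \<in> CF" and h: "h \<in> CF" for f h
  proof -
    have "val p (f x) \<oplus>\<^bsub>k\<^esub> val p (h x) = val p (f x + h x)" for x
      by (rule val_eqI[OF p_pos, symmetric])
        (use V(2)[OF f, of x] V(2)[OF h, of x] p_pos in \<open>simp_all add: residue_ring_def iota_mod iota_simps V(1)[OF f] V(1)[OF h]\<close>)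
    then show ?thesis by (auto simp: cochains_def dec_def fun_eq_iff restrict_def)
  qed
  show "\<zero>\<^bsub>cochains k H TH n\<^esub> = dec 0"
    using val_iota[OF p_pos, of 0] by (auto simp: cochains_def dec_def iota_simps residue_ring_def)
  show "r \<odot>\<^bsub>cochains k H TH n\<^esub> dec f = dec (scal r f)" if r: "r \<in> carrier k" and f: "f \<in> CF" for r f
  proof -
    have "r \<otimes>\<^bsub>k\<^esub> val p (f x) = val p (of_int r * f x)" for x
      by (rule val_eqI[OF p_pos, symmetric])
        (use V(2)[OF f, of x] p_pos in \<open>simp_all add: residue_ring_def iota_mod iota_of_int[symmetric] V(1)[OF f]\<close>)
    then show ?thesis by (auto simp: cochains_def dec_def scal_def fun_eq_iff restrict_def)
  qed
  show "dec f = dec h \<longleftrightarrow> f - h \<in> {0}" if f: "f \<in> CF" and h: "h \<in> CF" for f h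
  proof
    assume e: "dec f = dec h"
    \<comment> \<open>Off the space both functions vanish, so agreement on tuples is agreement
      everywhere.\<close>
    have "f x = h x" for x
    proof (cases "x \<in> topspace TX")
      case True
      have "f (t (u x)) = h (t (u x))" using e iota_dec(1)[OF f u_mem[OF True]] iota_dec(1)[OF h u_mem[OF True]] by simp
      then show ?thesis by (simp add: tu True)
    qed (simp add: cochain_funD(1)[OF f] cochain_funD(1)[OF h])
    then show "f - h \<in> {0}" by (simp add: fun_eq_iff)
  qed simp
qed

end

definition t1 :: "(nat \<Rightarrow> 'g) \<Rightarrow> 'g \<times> 'g" where "t1 x = (x 0, x 1)"
definition t2 :: "(nat \<Rightarrow> 'g) \<Rightarrow> 'g \<times> 'g \<times> 'g" where "t2 x = (x 0, x 1, x 2)"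
definition u1 :: "'g \<times> 'g \<Rightarrow> nat \<Rightarrow> 'g" where
  "u1 y = (\<lambda>i\<in>{..1}. if i = 0 then fst y else snd y)"
definition u2 :: "'g \<times> 'g \<times> 'g \<Rightarrow> nat \<Rightarrow> 'g" where
  "u2 y = (\<lambda>i\<in>{..2}. if i = 0 then fst y else if i = 1 then fst (snd y) else snd (snd y))"

lemma le_2: "(i::nat) \<le> 2 \<longleftrightarrow> i = 0 \<or> i = 1 \<or> i = 2" by auto

section \<open>Cohomology in degrees one and two\<close>

locale coefficient_group = group H for H (structure) +
  fixes TH and p :: nat
  assumes p: "prime p" and top: "topspace TH = carrier H"
begin

abbreviation "k \<equiv> residue_ring (int p)"

lemma pairs_code: "tuple_code p H TH 1 (T2 TH) (act2 H) t1 u1"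
proof
  show "prime p" "topspace TH = carrier H" by (rule p, rule top)
  show "continuous_map (product_topology (\<lambda>_. TH) {..1}) (T2 TH) t1"
    unfolding t1_def by (intro continuous_map_pairedI continuous_map_product_projection) auto
  show "continuous_map (T2 TH) (product_topology (\<lambda>_. TH) {..1}) u1"
    unfolding continuous_map_componentwise
  proof (intro conjI ballI)
    fix i :: nat assume "i \<in> {..1}"
    then show "continuous_map (T2 TH) TH (\<lambda>x. u1 x i)"
      by (cases "i = 0") (simp_all add: u1_def continuous_map_fst[unfolded] continuous_map_snd)
  qed (auto simp: u1_def)
  show "t1 (u1 x) = x" for x :: "'a \<times> 'a" by (simp add: t1_def u1_def)
  show "u1 (t1 y) = y" if "y \<in> tuples H 1" for y
    using that by (auto simp: t1_def u1_def tuples_def fun_eq_iff PiE_def extensional_def le_Suc_eq)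
qed (auto simp: act2_def u1_def top)

lemma triples_code: "tuple_code p H TH 2 (T3 TH) (act3 H) t2 u2"
proof
  show "prime p" "topspace TH = carrier H" by (rule p, rule top)
  show "continuous_map (product_topology (\<lambda>_. TH) {..2}) (T3 TH) t2"
    unfolding t2_def by (intro continuous_map_pairedI continuous_map_product_projection) auto
  show "continuous_map (T3 TH) (product_topology (\<lambda>_. TH) {..2}) u2"
    unfolding continuous_map_componentwise
  proof (intro conjI ballI)
    fix i :: nat assume "i \<in> {..2}"
    then consider "i = 0" | "i = 1" | "i = 2" using le_2[of i] by auto
    then show "continuous_map (T3 TH) TH (\<lambda>x. u2 x i)"
      by cases (simp_all add: u2_def continuous_map_fst T3_projections)
  qed (auto simp: u2_def)
  show "t2 (u2 x) = x" for x :: "'a \<times> 'a \<times> 'a" by (simp add: t2_def u2_def)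
  show "u2 (t2 y) = y" if "y \<in> tuples H 2" for y
    using that by (auto simp: t2_def u2_def tuples_def fun_eq_iff PiE_def extensional_def le_2)
qed (auto simp: act3_def u2_def top fun_eq_iff)

sublocale q1: tuple_code p H TH 1 "T2 TH" "act2 H" t1 u1 by (rule pairs_code)
sublocale q2: tuple_code p H TH 2 "T3 TH" "act3 H" t2 u2 by (rule triples_code)

abbreviation "Z1' \<equiv> {f \<in> C1 p H TH (carrier H). d1 (carrier H) f = 0}"
abbreviation "Z2' \<equiv> {f \<in> C2 p H TH (carrier H). cocycle2 (carrier H) f}"
abbreviation "B2' \<equiv> d1 (carrier H) ` C1 p H TH (carrier H)"

lemma pres1: "presentation p (cochains k H TH 1) (C1 p H TH (carrier H)) {0} q1.dec"
  and pres2: "presentation p (cochains k H TH 2) (C2 p H TH (carrier H)) {0} q2.dec"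
  unfolding C1_def C2_def by (rule q1.cochain_presentation q2.cochain_presentation)+

lemma d1_C2: "f \<in> C1 p H TH (carrier H) \<Longrightarrow> d1 (carrier H) f \<in> C2 p H TH (carrier H)"
  by (rule d1_C1[OF top]) auto

lemma iota_inj: "m \<in> carrier k \<Longrightarrow> m' \<in> carrier k \<Longrightarrow> iota p m = iota p m' \<Longrightarrow> m = m'"
  using val_eqI[of p m "iota p m"] val_eqI[of p m' "iota p m"] prime_gt_0_nat[OF p] by (simp add: residue_ring_def)

lemma coboundary_dec1:
  assumes f: "f \<in> C1 p H TH (carrier H)"
  shows "coboundary k H 1 (q1.dec f) = q2.dec (d1 (carrier H) f)"
proof
  fix x
  show "coboundary k H 1 (q1.dec f) x = q2.dec (d1 (carrier H) f) x"
  proof (cases "x \<in> tuples H 2")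
    case True
    then have x: "x \<in> tuples H (Suc 1)" by (simp add: numeral_2_eq_2)
    have xm: "x 0 \<in> carrier H" "x 1 \<in> carrier H" "x 2 \<in> carrier H" using True by (auto simp: tuples_def)
    have df: "d1 (carrier H) f \<in> q2.CF" using d1_C2[OF f] by (simp add: C2_def)
    have fC: "f \<in> q1.CF" using f by (simp add: C1_def)
    have face: "(\<lambda>j\<in>{..1}. x (if j < i then j else Suc j)) \<in> tuples H 1" for i
      using True by (auto simp: tuples_def PiE_def Pi_def)
    have "iota p (coboundary k H 1 (q1.dec f) x) = (\<Sum>i\<le>Suc 1. (- 1) ^ i * f (t1 (\<lambda>j\<in>{..1}. x (if j < i then j else Suc j))))"
      unfolding coboundary_value(1)[OF p q1.iota_dec(2)[OF fC] x]
      by (intro sum.cong refl) (simp only: q1.iota_dec(1)[OF fC face])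
    also have "\<dots> = d1 (carrier H) f (t2 x)" using xm by (simp add: t1_def t2_def d1_def numeral_2_eq_2)
    also have "\<dots> = iota p (q2.dec (d1 (carrier H) f) x)" using q2.iota_dec(1)[OF df True] by simp
    finally show ?thesis
      using iota_inj[OF coboundary_value(2)[OF p q1.iota_dec(2)[OF fC] x]] q2.iota_dec(2)[OF df] True by blast
  next
    case False
    then have "x \<notin> tuples H (Suc 1)" by (simp add: numeral_2_eq_2)
    then show ?thesis using False by (simp only: coboundary_def q2.dec_def restrict_apply if_False)
  qed
qed

lemma coboundary_dec2:
  assumes f: "f \<in> C2 p H TH (carrier H)"
  shows "coboundary k H 2 (q2.dec f) = \<zero>\<^bsub>cochains k H TH 3\<^esub> \<longleftrightarrow> cocycle2 (carrier H) f"
proof -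
  have fC: "f \<in> q2.CF" using f by (simp add: C2_def)
  have val: "iota p (coboundary k H 2 (q2.dec f) x)
      = f (x 1, x 2, x 3) - f (x 0, x 2, x 3) + f (x 0, x 1, x 3) - f (x 0, x 1, x 2)" if x: "x \<in> tuples H (Suc 2)" for x
  proof -
    have face: "(\<lambda>j\<in>{..2}. x (if j < i then j else Suc j)) \<in> tuples H 2" for i
      using x by (auto simp: tuples_def PiE_def Pi_def)
    have "iota p (coboundary k H 2 (q2.dec f) x) = (\<Sum>i\<le>Suc 2. (- 1) ^ i * f (t2 (\<lambda>j\<in>{..2}. x (if j < i then j else Suc j))))"
      unfolding coboundary_value(1)[OF p q2.iota_dec(2)[OF fC] x]
      by (intro sum.cong refl) (simp only: q2.iota_dec(1)[OF fC face])
    then show ?thesis by (simp add: t2_def numeral_2_eq_2 numeral_3_eq_3)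
  qed
  have z: "coboundary k H 2 (q2.dec f) = \<zero>\<^bsub>cochains k H TH 3\<^esub>
      \<longleftrightarrow> (\<forall>x\<in>tuples H (Suc 2). iota p (coboundary k H 2 (q2.dec f) x) = 0)"
  proof
    assume e: "coboundary k H 2 (q2.dec f) = \<zero>\<^bsub>cochains k H TH 3\<^esub>"
    show "\<forall>x\<in>tuples H (Suc 2). iota p (coboundary k H 2 (q2.dec f) x) = 0"
      unfolding e by (simp add: cochains_def residue_ring_def iota_simps)
  next
    assume e: "\<forall>x\<in>tuples H (Suc 2). iota p (coboundary k H 2 (q2.dec f) x) = 0"
    have "coboundary k H 2 (q2.dec f) x = \<zero>\<^bsub>k\<^esub>" if x: "x \<in> tuples H (Suc 2)" for x
    proof (rule iota_inj[OF coboundary_value(2)[OF p q2.iota_dec(2)[OF fC] x]])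
      show "\<zero>\<^bsub>k\<^esub> \<in> carrier k" using prime_gt_0_nat[OF p] by (simp add: residue_ring_def)
      show "iota p (coboundary k H 2 (q2.dec f) x) = iota p \<zero>\<^bsub>k\<^esub>" using bspec[OF e x] by (simp add: residue_ring_def iota_simps)
    qed
    then show "coboundary k H 2 (q2.dec f) = \<zero>\<^bsub>cochains k H TH 3\<^esub>"
      by (auto simp: cochains_def fun_eq_iff coboundary_def restrict_def)
  qed
  show ?thesis
    unfolding z
  proof
    assume e: "\<forall>x\<in>tuples H (Suc 2). iota p (coboundary k H 2 (q2.dec f) x) = 0"
    show "cocycle2 (carrier H) f"
      unfolding cocycle2_def
    proof (intro ballI)
      fix a b c e' assume m: "a \<in> carrier H" "b \<in> carrier H" "c \<in> carrier H" "e' \<in> carrier H"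
      define x where "x = (\<lambda>i\<in>{..Suc 2}. if i = 0 then a else if i = 1 then b else if i = 2 then c else e')"
      have x: "x \<in> tuples H (Suc 2)" using m by (auto simp: x_def tuples_def)
      show "f (b, c, e') - f (a, c, e') + f (a, b, e') - f (a, b, c) = 0"
        using bspec[OF e x] val[OF x] by (simp add: x_def)
    qed
  next
    assume c: "cocycle2 (carrier H) f"
    show "\<forall>x\<in>tuples H (Suc 2). iota p (coboundary k H 2 (q2.dec f) x) = 0"
    proof
      fix x assume x: "x \<in> tuples H (Suc 2)"
      have "x 0 \<in> carrier H" "x 1 \<in> carrier H" "x 2 \<in> carrier H" "x 3 \<in> carrier H" using x by (auto simp: tuples_def)
      then show "iota p (coboundary k H 2 (q2.dec f) x) = 0" unfolding val[OF x] using c unfolding cocycle2_def by blast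
    qed
  qed
qed

text \<open>A homogeneous 0-cochain is invariant under translation, hence constant, and its
  coboundary is a difference of two equal values. Classes of degree one are therefore single
  cocycles.\<close>

lemma coboundaries_1: "coboundaries k H TH 1 = {\<zero>\<^bsub>cochains k H TH 1\<^esub>}"
proof -
  have z: "coboundary k H 0 f = \<zero>\<^bsub>cochains k H TH 1\<^esub>" if f: "f \<in> carrier (cochains k H TH 0)" for f
  proof -
    have fc: "f \<in> tuples H 0 \<rightarrow> carrier k"
      using f unfolding cochains_def lc_continuous_map topspace_tuples[OF top] by simp
    have fi: "f (\<lambda>i\<in>{..0}. g \<otimes> x i) = f x" if "g \<in> carrier H" "x \<in> tuples H 0" for g x
      using f that by (simp add: cochains_def)
    have "coboundary k H 0 f x = \<zero>\<^bsub>k\<^esub>" if x: "x \<in> tuples H (Suc 0)" for x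
    proof (rule iota_inj[OF coboundary_value(2)[OF p fc x]])
      show "\<zero>\<^bsub>k\<^esub> \<in> carrier k" using prime_gt_0_nat[OF p] by (simp add: residue_ring_def)
      have xm: "x 0 \<in> carrier H" "x (Suc 0) \<in> carrier H" using x by (auto simp: tuples_def)
      have y: "(\<lambda>j\<in>{..0}. x 0) \<in> tuples H 0" using xm by (auto simp: tuples_def)
      have "(\<lambda>i\<in>{..0}. (x (Suc 0) \<otimes> inv x 0) \<otimes> (\<lambda>j\<in>{..0}. x 0) i) = (\<lambda>j\<in>{..0::nat}. x (Suc 0))"
        using xm by (auto simp: fun_eq_iff m_assoc)
      then have e: "f (\<lambda>j\<in>{..0}. x (Suc 0)) = f (\<lambda>j\<in>{..0}. x 0)" using fi[OF _ y, of "x (Suc 0) \<otimes> inv x 0"] xm by simp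
      have r: "(\<lambda>j\<in>{..0::nat}. x (if j < i then j else Suc j)) = (\<lambda>j\<in>{..0}. x (if 0 < i then 0 else Suc 0))" for i
        by (auto simp: fun_eq_iff)
      show "iota p (coboundary k H 0 f x) = iota p \<zero>\<^bsub>k\<^esub>"
        unfolding coboundary_value(1)[OF p fc x] r using e by (simp add: residue_ring_def iota_simps)
    qed
    then show ?thesis by (auto simp: cochains_def fun_eq_iff coboundary_def restrict_def)
  qed
  have "lc (product_topology (\<lambda>_. TH) {..0}) (\<lambda>x\<in>tuples H 0. \<zero>\<^bsub>k\<^esub>)"
    by (subst lc_cong[of _ _ "\<lambda>x. \<zero>\<^bsub>k\<^esub>"]) (simp_all add: lc_const tuples_def top)
  then have "continuous_map (product_topology (\<lambda>_. TH) {..0}) (discrete_topology (carrier k)) (\<lambda>x\<in>tuples H 0. \<zero>\<^bsub>k\<^esub>)"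
    unfolding lc_continuous_map topspace_tuples[OF top] using prime_gt_0_nat[OF p] by (auto simp: residue_ring_def)
  then have "(\<lambda>x\<in>tuples H 0. \<zero>\<^bsub>k\<^esub>) \<in> carrier (cochains k H TH 0)"
    by (auto simp: cochains_def tuples_def)
  \<comment> \<open>Without any 0-cochain the set of coboundaries would be empty instead of
    consisting of zero.\<close>
  then have ne: "carrier (cochains k H TH 0) \<noteq> {}" by blast
  have "coboundaries k H TH 1 = coboundary k H 0 ` carrier (cochains k H TH 0)" by simp
  also have "\<dots> = (\<lambda>_. \<zero>\<^bsub>cochains k H TH 1\<^esub>) ` carrier (cochains k H TH 0)" by (rule image_cong[OF refl]) (rule z)
  also have "\<dots> = {\<zero>\<^bsub>cochains k H TH 1\<^esub>}" using ne by (simp only: image_constant_conv if_False)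
  finally show ?thesis .
qed

lemma cocycles_1: "cocycles k H TH 1 = q1.dec ` Z1'"
proof -
  interpret a: presentation p "cochains k H TH 1" "C1 p H TH (carrier H)" "{0}" q1.dec by (rule pres1)
  interpret b: presentation p "cochains k H TH 2" "C2 p H TH (carrier H)" "{0}" q2.dec by (rule pres2)
  have "coboundary k H 1 (q1.dec f) = \<zero>\<^bsub>cochains k H TH (Suc 1)\<^esub> \<longleftrightarrow> d1 (carrier H) f = 0" if f: "f \<in> C1 p H TH (carrier H)" for f
    using b.ker[OF d1_C2[OF f] add_subgroupD(1)[OF b.A]] b.zero coboundary_dec1[OF f] by (simp add: numeral_2_eq_2)
  then show ?thesis unfolding cocycles_def a.carrier_M by blast
qed

lemma cocycles_2: "cocycles k H TH 2 = q2.dec ` Z2'"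
proof -
  interpret b: presentation p "cochains k H TH 2" "C2 p H TH (carrier H)" "{0}" q2.dec by (rule pres2)
  have s: "Suc 2 = 3" by simp
  show ?thesis unfolding cocycles_def b.carrier_M s using coboundary_dec2 by blast
qed

lemma coboundaries_2: "coboundaries k H TH 2 = q2.dec ` B2'"
proof -
  interpret a: presentation p "cochains k H TH 1" "C1 p H TH (carrier H)" "{0}" q1.dec by (rule pres1)
  have "coboundaries k H TH (Suc 1) = coboundary k H 1 ` q1.dec ` C1 p H TH (carrier H)"
    by (simp only: coboundaries.simps a.carrier_M)
  also have "\<dots> = q2.dec ` B2'" unfolding image_image by (intro image_cong refl coboundary_dec1)
  finally show ?thesis by (simp add: numeral_2_eq_2)
qed

abbreviation "\<pi>1 f \<equiv> coh_class k H TH 1 (q1.dec f)"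
abbreviation "\<pi>2 f \<equiv> coh_class k H TH 2 (q2.dec f)"

lemma Z_subgroups: "add_subgroup Z1'" "add_subgroup Z2'" "add_subgroup B2'" "B2' \<subseteq> Z2'"
proof -
  note s1 = add_subgroupD[OF C_subgroup(1)[of p H TH "carrier H"]] and s2 = add_subgroupD[OF C_subgroup(2)[of p H TH "carrier H"]]
  have d0: "d1 (carrier H) 0 = 0" by (auto simp: d1_def fun_eq_iff)
  show "add_subgroup Z1'" unfolding add_subgroup_def using s1(1,2) d0 by (simp add: d1_diff)
  have "cocycle2 (carrier H) 0" by (simp add: cocycle2_def)
  then show "add_subgroup Z2'" unfolding add_subgroup_def using s2(1,2) cocycle2_diff by blast
  show "B2' \<subseteq> Z2'" using d1_C2 cocycle2_d1 by blast
  show "add_subgroup B2'" unfolding add_subgroup_def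
  proof (intro conjI ballI)
    show "0 \<in> B2'" using s1(1) d0 by (metis imageI)
    fix x y assume "x \<in> B2'" "y \<in> B2'"
    then obtain f g where "f \<in> C1 p H TH (carrier H)" "g \<in> C1 p H TH (carrier H)" "x = d1 (carrier H) f" "y = d1 (carrier H) g" by blast
    then show "x - y \<in> B2'" using imageI[OF s1(2)[of f g], of "d1 (carrier H)"] by (simp only: d1_diff)
  qed
qed

theorem cohomology_1: "presentation p (cohomology k H TH 1) Z1' {0} \<pi>1"
proof -
  interpret a: presentation p "cochains k H TH 1" "C1 p H TH (carrier H)" "{0}" q1.dec by (rule pres1)
  have z: "{0} \<subseteq> Z1'" using add_subgroupD(1)[OF Z_subgroups(1)] by blast
  interpret b: presentation p "(cochains k H TH 1)\<lparr>carrier := q1.dec ` Z1'\<rparr>" Z1' "{0}" q1.dec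
    by (rule a.restrict_presentation[OF Z_subgroups(1) z]) blast
  have w: "coboundaries k H TH 1 = q1.dec ` {0}" using coboundaries_1 a.zero by simp
  have "b.quotient_map {0} = (\<lambda>f. \<pi>1 f)"
    by (rule ext) (simp only: b.quotient_map_def coh_class_def w a_r_coset_def r_coset_def, simp)
  then show ?thesis using b.quotient_presentation[OF b.B(1) order_refl z] by (simp only: cohomology_def cocycles_1 w)
qed

theorem cohomology_2: "presentation p (cohomology k H TH 2) Z2' B2' \<pi>2"
proof -
  interpret a: presentation p "cochains k H TH 2" "C2 p H TH (carrier H)" "{0}" q2.dec by (rule pres2)
  have z: "{0} \<subseteq> Z2'" "{0} \<subseteq> B2'" using add_subgroupD(1)[OF Z_subgroups(2)] add_subgroupD(1)[OF Z_subgroups(3)] by blast+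
  interpret b: presentation p "(cochains k H TH 2)\<lparr>carrier := q2.dec ` Z2'\<rparr>" Z2' "{0}" q2.dec
    by (rule a.restrict_presentation[OF Z_subgroups(2) z(1)]) blast
  have "b.quotient_map B2' = (\<lambda>f. \<pi>2 f)"
    by (simp add: fun_eq_iff b.quotient_map_def coh_class_def coboundaries_2 a_r_coset_def r_coset_def)
  then show ?thesis using b.quotient_presentation[OF Z_subgroups(3) z(2) Z_subgroups(4)]
    by (simp add: cohomology_def cocycles_2 coboundaries_2)
qed

lemma coh_class_1: "f \<in> C1 p H TH (carrier H) \<Longrightarrow> \<pi>1 f = {q1.dec f}"
proof -
  assume f: "f \<in> C1 p H TH (carrier H)"
  interpret a: presentation p "cochains k H TH 1" "C1 p H TH (carrier H)" "{0}" q1.dec by (rule pres1)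
  have "\<zero>\<^bsub>cochains k H TH 1\<^esub> \<oplus>\<^bsub>cochains k H TH 1\<^esub> q1.dec f = q1.dec f"
    using a.add[OF add_subgroupD(1)[OF a.A] f] a.zero by simp
  then show ?thesis by (simp only: coh_class_def coboundaries_1 a_r_coset_def r_coset_def) simp
qed

text \<open>As classes of degree one are singletons, the union over representatives in
  \<open>cup\<close> has a single term, and independence of representatives does not arise.\<close>

lemma cup_1_1:
  assumes e: "e \<in> C1 p H TH (carrier H)" and f: "f \<in> C1 p H TH (carrier H)"
  defines "c \<equiv> \<lambda>(x, y, z). if x \<in> carrier H \<and> y \<in> carrier H \<and> z \<in> carrier H then e (x, y) * f (y, z) else 0"
  shows "cup k H TH 1 1 (\<pi>1 e) (\<pi>1 f) = \<pi>2 c"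
proof -
  have E: "e \<in> q1.CF" and F: "f \<in> q1.CF" using e f by (simp_all add: C1_def)
  have "cup_cochain k H 1 1 (q1.dec e) (q1.dec f) = q2.dec c"
  proof
    fix x
    show "cup_cochain k H 1 1 (q1.dec e) (q1.dec f) x = q2.dec c x"
    proof (cases "x \<in> tuples H 2")
      case True
      have xm: "x 0 \<in> carrier H" "x 1 \<in> carrier H" "x 2 \<in> carrier H" using True by (auto simp: tuples_def)
      have m: "(\<lambda>i\<in>{..1}. x i) \<in> tuples H 1" "(\<lambda>j\<in>{..1}. x (1 + j)) \<in> tuples H 1"
        using True by (auto simp: tuples_def PiE_def Pi_def)
      have em: "q1.dec e (\<lambda>i\<in>{..1}. x i) \<in> carrier k" and fm: "q1.dec f (\<lambda>j\<in>{..1}. x (1 + j)) \<in> carrier k"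
        using q1.iota_dec(2)[OF E] q1.iota_dec(2)[OF F] m by blast+
      have "iota p (q1.dec e (\<lambda>i\<in>{..1}. x i) \<otimes>\<^bsub>k\<^esub> q1.dec f (\<lambda>j\<in>{..1}. x (1 + j))) = c (t2 x)"
        unfolding iota_residue(2)[OF p em fm] q1.iota_dec(1)[OF E m(1)] q1.iota_dec(1)[OF F m(2)]
        using xm by (simp add: c_def t1_def t2_def numeral_2_eq_2)
      moreover have "q1.dec e (\<lambda>i\<in>{..1}. x i) \<otimes>\<^bsub>k\<^esub> q1.dec f (\<lambda>j\<in>{..1}. x (1 + j)) \<in> {0..int p - 1}"
        using prime_gt_0_nat[OF p] by (simp add: residue_ring_def)
      ultimately have "val p (c (t2 x)) = q1.dec e (\<lambda>i\<in>{..1}. x i) \<otimes>\<^bsub>k\<^esub> q1.dec f (\<lambda>j\<in>{..1}. x (1 + j))"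
        by (intro val_eqI prime_gt_0_nat[OF p])
      moreover have "cup_cochain k H 1 1 (q1.dec e) (q1.dec f) x
          = q1.dec e (\<lambda>i\<in>{..1}. x i) \<otimes>\<^bsub>k\<^esub> q1.dec f (\<lambda>j\<in>{..1}. x (1 + j))"
        using True by (simp add: cup_cochain_def numeral_2_eq_2)
      moreover have "q2.dec c x = val p (c (t2 x))" using True by (simp only: q2.dec_def restrict_apply if_True)
      ultimately show ?thesis by (simp only:)
    next
      case False
      then have "x \<notin> tuples H (1 + 1)" by (simp add: numeral_2_eq_2)
      then show ?thesis using False by (simp only: cup_cochain_def q2.dec_def restrict_apply if_False)
    qed
  qed
  then show ?thesis unfolding cup_def coh_class_1[OF e] coh_class_1[OF f] by (simp add: numeral_2_eq_2)
qed

end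

context coefficient_group
begin

lemma class_self: "f \<in> C2 p H TH (carrier H) \<Longrightarrow> q2.dec f \<in> \<pi>2 f"
proof -
  assume f: "f \<in> C2 p H TH (carrier H)"
  interpret b: presentation p "cochains k H TH 2" "C2 p H TH (carrier H)" "{0}" q2.dec by (rule pres2)
  have "q2.dec 0 \<oplus>\<^bsub>cochains k H TH 2\<^esub> q2.dec f = q2.dec f"
    using b.add[OF add_subgroupD(1)[OF b.A] f] by simp
  moreover have "q2.dec 0 \<in> coboundaries k H TH 2" unfolding coboundaries_2 by (rule imageI[OF add_subgroupD(1)[OF Z_subgroups(3)]])
  ultimately show ?thesis unfolding coh_class_def a_r_coset_def r_coset_def by force
qed

lemma class_mem:
  assumes f: "f \<in> C2 p H TH (carrier H)" and h: "h \<in> C2 p H TH (carrier H)" and m: "q2.dec h \<in> \<pi>2 f"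
  shows "\<exists>y\<in>C1 p H TH (carrier H). h = d1 (carrier H) y + f"
proof -
  interpret b: presentation p "cochains k H TH 2" "C2 p H TH (carrier H)" "{0}" q2.dec by (rule pres2)
  obtain y where y: "y \<in> C1 p H TH (carrier H)"
    "q2.dec h = q2.dec (d1 (carrier H) y) \<oplus>\<^bsub>cochains k H TH 2\<^esub> q2.dec f"
    using m by (auto simp: coh_class_def a_r_coset_def r_coset_def coboundaries_2)
  then have "q2.dec h = q2.dec (d1 (carrier H) y + f)" using b.add[OF d1_C2[OF y(1)] f] by simp
  then have "h - (d1 (carrier H) y + f) \<in> {0}"
    using b.ker[OF h add_subgroupD(4)[OF b.A d1_C2[OF y(1)] f]] by simp
  then show ?thesis using y(1) by auto
qed

end

section \<open>Corestriction as a norm\<close>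

context cyclic_quotient
begin

abbreviation "k \<equiv> residue_ring (int p)"

lemma cG: "coefficient_group G T p"
  by (intro coefficient_group.intro is_group coefficient_group_axioms.intro p topspace_T)

lemma cN: "coefficient_group Nrec TN p"
  by (intro coefficient_group.intro coefficient_group_axioms.intro p subgroup.subgroup_is_group[OF N_sub is_group])
    (use topspace_TN in simp)

lemma coset_rep:
  assumes x: "x \<in> carrier G"
  shows "\<exists>\<tau>\<in>N. coset_rep (N #> x) = \<tau> \<otimes> x" "coset_rep (N #> x) \<in> carrier G"
proof -
  have "x \<in> N #> x" by (rule rcos_self[OF x N_sub])
  then have "coset_rep (N #> x) \<in> N #> x" unfolding coset_rep_def by (rule someI)
  then show "\<exists>\<tau>\<in>N. coset_rep (N #> x) = \<tau> \<otimes> x" by (auto simp: r_coset_def)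
  then show "coset_rep (N #> x) \<in> carrier G" using NG x by auto
qed

lemma coset_chi:
  assumes x: "x \<in> carrier G" shows "N #> x = N #> (s [^] \<chi> x)"
proof -
  have "x \<in> N #> (s [^] \<chi> x)" using coset_decomposition[OF x] unfolding r_coset_def by blast
  from repr_independence[OF this _ N_sub] show ?thesis using s by simp
qed

lemma coset_pow_inj: "inj_on (\<lambda>i. N #> (s [^] i)) {..<p}"
proof (rule inj_onI)
  fix i j :: nat assume i: "i \<in> {..<p}" and j: "j \<in> {..<p}" and e: "N #> (s [^] i) = N #> (s [^] j)"
  have sG: "s [^] j \<in> carrier G" "s [^] i \<in> carrier G" using s by simp_all
  have "s [^] i \<in> N #> (s [^] j)" using rcos_self[OF sG(2) N_sub] e by simp
  then obtain \<tau> where t: "\<tau> \<in> N" "s [^] i = \<tau> \<otimes> s [^] j" by (auto simp: r_coset_def)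
  have "\<chi> (s [^] i) = \<chi> (s [^] j)" using chi_N_mult[OF t(1) sG(1)] t(2) by simp
  then have "[i = j] (mod p)" using chi_pow[of i] chi_pow[of j] by (metis cong_sym cong_trans)
  then show "i = j" using i j by (simp add: cong_def)
qed

lemma rcosets_eq: "rcosets N = (\<lambda>i. N #> (s [^] i)) ` {..<p}"
proof
  show "rcosets N \<subseteq> (\<lambda>i. N #> (s [^] i)) ` {..<p}"
  proof
    fix C assume "C \<in> rcosets N"
    then obtain x where x: "x \<in> carrier G" "C = N #> x" by (auto simp: RCOSETS_def)
    have "\<chi> x \<in> {..<p}" using chi_less[OF x(1)] by simp
    then show "C \<in> (\<lambda>i. N #> (s [^] i)) ` {..<p}" using coset_chi[OF x(1)] x(2) by blast
  qed
  show "(\<lambda>i. N #> (s [^] i)) ` {..<p} \<subseteq> rcosets N" using s by (auto simp: RCOSETS_def)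
qed

text \<open>Whatever representatives \<open>coset_rep\<close> selects, x is multiplied on the right
  by an element that depends only on its coset.\<close>

lemma coset_part_retraction: "retraction (coset_part G N)"
proof (rule coset_shift_retraction)
  show u: "inv (coset_rep (N #> (s [^] j))) \<in> carrier G" for j :: nat using coset_rep(2)[of "s [^] j"] s by simp
  show "coset_part G N x = x \<otimes> inv (coset_rep (N #> (s [^] \<chi> x)))" if "x \<in> carrier G" for x
    using coset_chi[OF that] by (simp add: coset_part_def)
  show "x \<otimes> inv (coset_rep (N #> (s [^] \<chi> x))) \<in> N" if x: "x \<in> carrier G" for x
  proof -
    obtain \<tau> where t: "\<tau> \<in> N" "coset_rep (N #> x) = \<tau> \<otimes> x" using coset_rep(1)[OF x] by blast
    have "x \<otimes> inv (\<tau> \<otimes> x) = inv \<tau>"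
      using x NG[OF t(1)] by (simp add: inv_mult_group m_assoc[symmetric])
    then show ?thesis using t subgroup.m_inv_closed[OF N_sub t(1)] coset_chi[OF x] by simp
  qed
qed

lemma D_pow_Z2: "z \<in> Z2 \<Longrightarrow> (c2.D ^^ n) z \<in> Z2"
  by (induction n) (simp_all add: Z2_D)

lemma norm_invariant: "z \<in> Z2 \<Longrightarrow> (c2.D ^^ (p - 1)) z \<in> C2 p G T (carrier G)"
proof -
  assume z: "z \<in> Z2"
  then have zY: "z \<in> c2.Y" by (simp add: Z2_def C2_def)
  have "(c2.D ^^ Suc (p - 1)) z = 0" using c2.D_nil[OF zY] p0 by simp
  then show ?thesis using D_pow_Z2[OF z, of "p - 1"] by (simp add: invariant_C2 Z2_def)
qed

text \<open>A sum of translates of an N-invariant cochain over cosets does not change with the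
  representatives, so these may be taken to be the powers of s; the sum is then D^(p-1). The
  identity holds for cochains and not just for classes.\<close>

lemma cor_cochain_norm:
  assumes m: "m \<in> Z2N"
  shows "cor_cochain k G N 2 (tuple_code.dec p Nrec 2 t2 m)
    = tuple_code.dec p G 2 t2 ((c2.D ^^ (p - 1)) (pull3 (coset_part G N) m))"
proof
  interpret cG: coefficient_group G T p by (rule cG)
  interpret cN: coefficient_group Nrec TN p by (rule cN)
  let ?q = "coset_part G N"
  let ?z = "pull3 ?q m"
  have mC: "m \<in> cN.q2.CF" using m by (simp add: Z2N_def C2_def)
  have z: "?z \<in> Z2" by (rule pull3_cocycle[OF coset_part_retraction m])
  then have zY: "?z \<in> c2.Y" by (simp add: Z2_def C2_def)
  have nC: "(c2.D ^^ (p - 1)) ?z \<in> cG.q2.CF" using norm_invariant[OF z] by (simp add: C2_def)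
  fix x
  show "cor_cochain k G N 2 (cN.q2.dec m) x = cG.q2.dec ((c2.D ^^ (p - 1)) ?z) x"
  proof (cases "x \<in> tuples G 2")
    case False then show ?thesis by (simp only: cor_cochain_def cG.q2.dec_def restrict_apply if_False)
  next
    case True
    have xm: "x 0 \<in> carrier G" "x 1 \<in> carrier G" "x 2 \<in> carrier G" using True by (auto simp: tuples_def)
    have tx: "t2 x \<in> topspace (T3 T)" using cG.q2.t_mem[OF True] .
    define g where "g C = cN.q2.dec m (\<lambda>i\<in>{..2}. ?q (coset_rep C \<otimes> x i))" for C
    have gv: "iota p (g C) = ?z (act3 G (coset_rep C) (t2 x))" "g C \<in> carrier k" if C: "C \<in> rcosets N" for C
    proof -
      obtain y where y: "y \<in> carrier G" "C = N #> y" using C by (auto simp: RCOSETS_def)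
      have r: "coset_rep C \<in> carrier G" using coset_rep(2)[OF y(1)] y(2) by simp
      have tup: "(\<lambda>i\<in>{..2}. ?q (coset_rep C \<otimes> x i)) \<in> tuples Nrec 2"
        using True r retraction_closed[OF coset_part_retraction] by (auto simp: tuples_def PiE_def Pi_def)
      show "iota p (g C) = ?z (act3 G (coset_rep C) (t2 x))"
        unfolding g_def cN.q2.iota_dec(1)[OF mC tup] using xm r by (simp add: t2_def act3_def pull3_def)
      show "g C \<in> carrier k" unfolding g_def using cN.q2.iota_dec(2)[OF mC] tup by blast
    qed
    have cl: "g \<in> rcosets N \<rightarrow> carrier k" using gv(2) by blast
    have fin: "finite (rcosets N)" by (simp add: rcosets_eq)
    have cc: "cor_cochain k G N 2 (cN.q2.dec m) x = finsum k g (rcosets N)"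
      using True by (simp add: cor_cochain_def g_def[abs_def])
    interpret kf: field k using residues_prime.is_field[of p] p by (simp add: residues_prime_def)
    have "iota p (finsum k g (rcosets N)) = (\<Sum>C\<in>rcosets N. ?z (act3 G (coset_rep C) (t2 x)))"
      unfolding iota_finsum[OF p fin cl] by (intro sum.cong refl gv(1))
    also have "\<dots> = (\<Sum>i<p. ?z (act3 G (coset_rep (N #> (s [^] i))) (t2 x)))"
      unfolding rcosets_eq by (simp add: sum.reindex[OF coset_pow_inj])
    also have "\<dots> = (\<Sum>i<p. ?z (act3 G (s [^] i) (t2 x)))"
    proof (intro sum.cong refl)
      fix i :: nat
      have sG: "s [^] i \<in> carrier G" using s by simp
      obtain \<tau> where t: "\<tau> \<in> N" "coset_rep (N #> (s [^] i)) = \<tau> \<otimes> s [^] i" using coset_rep(1)[OF sG] by blast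
      have "act3 G (\<tau> \<otimes> s [^] i) (t2 x) = act3 G \<tau> (act3 G (s [^] i) (t2 x))"
        using xm sG NG[OF t(1)] by (simp add: act3_def t2_def m_assoc)
      moreover have "act3 G (s [^] i) (t2 x) \<in> topspace (T3 T)" by (rule cG.q2.act[OF sG tx])
      ultimately show "?z (act3 G (coset_rep (N #> (s [^] i))) (t2 x)) = ?z (act3 G (s [^] i) (t2 x))"
        using cochain_funD(4)[OF zY t(1)] t(2) by simp
    qed
    also have "\<dots> = (c2.D ^^ (p - 1)) ?z (t2 x)" by (rule c2.norm_formula[OF zY tx, symmetric])
    also have "\<dots> = iota p (cG.q2.dec ((c2.D ^^ (p - 1)) ?z) x)" by (rule cG.q2.iota_dec(1)[OF nC True, symmetric])
    finally have "iota p (finsum k g (rcosets N)) = iota p (cG.q2.dec ((c2.D ^^ (p - 1)) ?z) x)" .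
    then show ?thesis unfolding cc
      using cG.iota_inj[OF kf.finsum_closed[OF cl]] cG.q2.iota_dec(2)[OF nC] True by blast
  qed
qed

lemma cor_surjectiveI:
  assumes cor: "cor k G T N 2 ` carrier (cohomology k Nrec TN 2) = carrier (cohomology k G T 2)" and c: "c \<in> Z2G"
  shows "\<exists>z\<in>Z2. \<exists>y\<in>C1 p G T (carrier G). c = (c2.D ^^ (p - 1)) z + d1 (carrier G) y"
proof -
  interpret cG: coefficient_group G T p by (rule cG)
  interpret cN: coefficient_group Nrec TN p by (rule cN)
  interpret hG: presentation p "cohomology k G T 2" "cG.Z2'" "cG.B2'" "\<lambda>f. cG.\<pi>2 f" by (rule cG.cohomology_2)
  interpret hN: presentation p "cohomology k Nrec TN 2" "cN.Z2'" "cN.B2'" "\<lambda>f. cN.\<pi>2 f" by (rule cN.cohomology_2)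
  have cC: "c \<in> C2 p G T (carrier G)" and cZ: "c \<in> cG.Z2'" using c by (simp_all add: Z2G_def)
  have "cG.\<pi>2 c \<in> cor k G T N 2 ` carrier (cohomology k Nrec TN 2)" unfolding cor hG.carrier_M using cZ by blast
  then obtain m where m: "m \<in> cN.Z2'" "cG.\<pi>2 c = cor k G T N 2 (cN.\<pi>2 m)" unfolding hN.carrier_M by blast
  have mZ: "m \<in> Z2N" using m(1) by (simp add: Z2N_def)
  let ?z = "pull3 (coset_part G N) m"
  have z: "?z \<in> Z2" by (rule pull3_cocycle[OF coset_part_retraction mZ])
  have "m \<in> C2 p Nrec TN (carrier Nrec)" using m(1) by blast
  \<comment> \<open>\<open>cor\<close> is a union over representatives. Following a single one is
    enough, since its contribution is contained in the class of c.\<close>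
  from cN.class_self[OF this] have "coh_class k G T 2 (cor_cochain k G N 2 (cN.q2.dec m)) \<subseteq> cG.\<pi>2 c"
    unfolding m(2) cor_def by (rule UN_upper)
  then have "cG.q2.dec ((c2.D ^^ (p - 1)) ?z) \<in> cG.\<pi>2 c"
    using cG.class_self[OF norm_invariant[OF z]] unfolding cor_cochain_norm[OF mZ] by blast
  from cG.class_mem[OF cC norm_invariant[OF z] this]
  obtain y where y: "y \<in> C1 p G T (carrier G)" "(c2.D ^^ (p - 1)) ?z = d1 (carrier G) y + c" by blast
  have "d1 (carrier G) (- y) = - d1 (carrier G) y" by (auto simp: d1_def fun_eq_iff)
  then have "c = (c2.D ^^ (p - 1)) ?z + d1 (carrier G) (- y)" using y(2) by simp
  then show ?thesis using z add_subgroupD(3)[OF C_subgroup(1) y(1)] by blast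
qed

end

section \<open>The dimension formula\<close>

lemma finite_index_iff:
  assumes "0 \<in> K" shows "finite_index K H \<longleftrightarrow> add_index K H > 0"
proof -
  have "add_coset H ` K \<noteq> {}" using assms by blast
  then show ?thesis by (simp add: finite_index_def add_index_def card_gt_0_iff)
qed

text \<open>Both sides are exponents of p in the count \<open>card_H2N\<close>. The character
  appears twice, as the natural number \<open>\<chi> g\<close> of the locale and as the integer
  \<open>\<kappa> g\<close>, because Kummer classes are written with integer residues.\<close>

theorem (in norm_lifting) dimension_formula:
  assumes cor: "cor k G T N 2 ` carrier (cohomology k Nrec TN 2) = carrier (cohomology k G T 2)"
    and fd: "vectorspace.fin_dim k (cohomology k G T 2)"
    and kap: "\<And>g. g \<in> carrier G \<Longrightarrow> \<kappa> g = int (\<chi> g)"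
  defines "A \<equiv> coh_class k G T 1 (\<lambda>x\<in>tuples G 1. \<kappa> (inv (x 0) \<otimes> x 1))"
  shows "vectorspace.fin_dim k (cohomology k Nrec TN 2)"
    "vectorspace.dim k (cohomology k Nrec TN 2)
      = vectorspace.dim k (quotient_module (cohomology k G T 1) (annihilator k G T A))
        + p * vectorspace.dim k (quotient_module (cohomology k G T 2) (cup k G T 1 1 A ` carrier (cohomology k G T 1)))"
proof -
  interpret cs: cor_surjective G T N p \<chi> s
    by (intro cor_surjective.intro norm_lifting_axioms cor_surjective_axioms.intro cor_surjectiveI[OF cor])
  interpret cG: coefficient_group G T p by (rule cG)
  interpret cN: coefficient_group Nrec TN p by (rule cN)
  have zz: "cG.Z1' = Z1G" "cG.Z2' = Z2G" "cG.B2' = B2G" "cN.Z2' = Z2N" "cN.B2' = B2N"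
    by (simp_all add: Z1G_def Z2G_def B2G_def Z2N_def B2N_def)
  interpret h1: presentation p "cohomology k G T 1" Z1G "{0}" "\<lambda>f. cG.\<pi>1 f" using cG.cohomology_1 zz by simp
  interpret h2: presentation p "cohomology k G T 2" Z2G B2G "\<lambda>f. cG.\<pi>2 f" using cG.cohomology_2 zz by simp
  interpret hN: presentation p "cohomology k Nrec TN 2" Z2N B2N "\<lambda>f. cN.\<pi>2 f" using cN.cohomology_2 zz by simp
  have fin: "finite_index Z2G B2G" using fd h2.dimension(1) by blast
  note main = cs.card_H2N[OF fin]
  \<comment> \<open>The homogeneous cocycle of the character, as a function on pairs; its cup
    product with f is \<open>cupm f\<close>.\<close>
  define e where "e = (\<lambda>(a, b). if a \<in> carrier G \<and> b \<in> carrier G then iota p (int (\<chi> b) - int (\<chi> a)) else 0)"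
  have diff: "[int (\<chi> (g \<otimes> a)) = int (\<chi> g) + int (\<chi> a)] (mod int p)" if "g \<in> carrier G" "a \<in> carrier G" for g a
    using chi_hom[OF that] by (metis cong_int_iff of_nat_add)
  have eC: "e \<in> C1 p G T (carrier G)"
    unfolding C1_def
  proof (rule cochain_funI)
    have "lc (T2 T) (\<lambda>x. iota p (int (\<chi> (snd x)) - int (\<chi> (fst x))))"
      using lc_combine[OF lc_compose[OF chi_lc continuous_map_snd] lc_compose[OF chi_lc continuous_map_fst],
          of "\<lambda>i j. iota p (int i - int j)"] .
    then show "lc (T2 T) e"
      by (subst lc_cong[of _ _ "\<lambda>x. iota p (int (\<chi> (snd x)) - int (\<chi> (fst x)))"]) (auto simp: e_def topspace_T)
    show "e x = 0" if "x \<notin> topspace (T2 T)" for x using that by (cases x) (auto simp: e_def topspace_T)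
    show "e x \<in> range (iota p)" for x unfolding e_def case_prod_beta by (simp add: iota_range)
    show "e (act2 G g x) = e x" if g: "g \<in> carrier G" and x: "x \<in> topspace (T2 T)" for g x
    proof -
      obtain a b where ab: "x = (a, b)" "a \<in> carrier G" "b \<in> carrier G" using x topspace_T by (cases x) auto
      have "[int (\<chi> (g \<otimes> b)) - int (\<chi> (g \<otimes> a)) = (int (\<chi> g) + int (\<chi> b)) - (int (\<chi> g) + int (\<chi> a))] (mod int p)"
        by (rule cong_diff[OF diff[OF g ab(3)] diff[OF g ab(2)]])
      then show ?thesis using ab g by (simp add: e_def act2_def iota_eq_iff)
    qed
  qed
  have "(\<lambda>x\<in>tuples G 1. \<kappa> (inv (x 0) \<otimes> x 1)) = cG.q1.dec e"
    unfolding cG.q1.dec_def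
  proof (rule restrict_ext)
    fix x assume x: "x \<in> tuples G 1"
    have m: "x 0 \<in> carrier G" "x 1 \<in> carrier G" using x by (auto simp: tuples_def)
    let ?g = "inv (x 0) \<otimes> x 1"
    have g: "?g \<in> carrier G" using m by simp
    have "x 0 \<otimes> ?g = x 1" using m by (simp add: m_assoc[symmetric])
    then have "[int (\<chi> (x 1)) = int (\<chi> (x 0)) + int (\<chi> ?g)] (mod int p)" using diff[OF m(1) g] by simp
    then have "iota p (int (\<chi> ?g)) = e (t1 x)"
      using m by (simp add: e_def t1_def iota_eq_iff cong_iff_dvd_diff dvd_diff_commute algebra_simps)
    moreover have "int (\<chi> ?g) \<in> {0..int p - 1}" using chi_less[OF g] by simp
    ultimately show "\<kappa> ?g = val p (e (t1 x))" unfolding kap[OF g] using val_eqI[OF p0] by metis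
  qed
  then have A: "A = cG.\<pi>1 e" by (simp only: A_def)
  have Z1C: "f \<in> C1 p G T (carrier G)" if "f \<in> Z1G" for f using that by (simp add: Z1G_def)
  have cup: "cup k G T 1 1 A (cG.\<pi>1 f) = cG.\<pi>2 (cupm f)" if f: "f \<in> Z1G" for f
  proof -
    have "(\<lambda>(x, y, z). if x \<in> carrier G \<and> y \<in> carrier G \<and> z \<in> carrier G then e (x, y) * f (y, z) else 0) = cupm f"
      by (auto simp: cupm_def e_def fun_eq_iff)
    then show ?thesis unfolding A cG.cup_1_1[OF eC Z1C[OF f]] by (simp only:)
  qed
  have cAG: "cupm f \<in> cs.AG" if f: "f \<in> Z1G" for f
  proof -
    have "cupm f + 0 \<in> cs.AG" using f add_subgroupD(1)[OF main(6)] unfolding cs.AG_def by blast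
    then show ?thesis by simp
  qed
  let ?H = "{f \<in> Z1G. cupm f \<in> B2G}"
  have ann: "annihilator k G T A = (\<lambda>f. cG.\<pi>1 f) ` ?H"
  proof -
    have "cup k G T 1 1 A (cG.\<pi>1 f) = \<zero>\<^bsub>cohomology k G T 2\<^esub> \<longleftrightarrow> cupm f \<in> B2G" if f: "f \<in> Z1G" for f
      using h2.ker[OF subsetD[OF main(4) cAG[OF f]] add_subgroupD(1)[OF h2.A]] cup[OF f] h2.zero by simp
    then show ?thesis unfolding annihilator_def h1.carrier_M by blast
  qed
  have img: "cup k G T 1 1 A ` carrier (cohomology k G T 1) = (\<lambda>f. cG.\<pi>2 f) ` cs.AG"
  proof
    show "cup k G T 1 1 A ` carrier (cohomology k G T 1) \<subseteq> (\<lambda>f. cG.\<pi>2 f) ` cs.AG"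
    proof
      fix C assume "C \<in> cup k G T 1 1 A ` carrier (cohomology k G T 1)"
      then obtain f where f: "f \<in> Z1G" "C = cup k G T 1 1 A (cG.\<pi>1 f)" unfolding h1.carrier_M by blast
      show "C \<in> (\<lambda>f. cG.\<pi>2 f) ` cs.AG" unfolding f(2) cup[OF f(1)] by (rule imageI[OF cAG[OF f(1)]])
    qed
    show "(\<lambda>f. cG.\<pi>2 f) ` cs.AG \<subseteq> cup k G T 1 1 A ` carrier (cohomology k G T 1)"
    proof
      fix C assume "C \<in> (\<lambda>f. cG.\<pi>2 f) ` cs.AG"
      then obtain c where c: "c \<in> cs.AG" "C = cG.\<pi>2 c" by blast
      then obtain f b where fb: "f \<in> Z1G" "b \<in> B2G" "c = cupm f + b" unfolding cs.AG_def by blast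
      have "cG.\<pi>2 c = cG.\<pi>2 (cupm f)"
        using h2.ker[OF subsetD[OF main(4) c(1)] subsetD[OF main(4) cAG[OF fb(1)]]] fb(2,3) by simp
      then have "C = cup k G T 1 1 A (cG.\<pi>1 f)" using c(2) cup[OF fb(1)] by simp
      moreover have "cG.\<pi>1 f \<in> carrier (cohomology k G T 1)" unfolding h1.carrier_M using fb(1) by blast
      ultimately show "C \<in> cup k G T 1 1 A ` carrier (cohomology k G T 1)" by blast
    qed
  qed
  have zH: "{0} \<subseteq> ?H" using add_subgroupD(1)[OF main(7)] by blast
  interpret x: presentation p "quotient_module (cohomology k G T 1) (annihilator k G T A)" Z1G ?H "h1.quotient_map ?H"
    unfolding ann by (rule h1.quotient_presentation[OF main(7) zH]) blast
  interpret y: presentation p "quotient_module (cohomology k G T 2) (cup k G T 1 1 A ` carrier (cohomology k G T 1))" Z2G cs.AG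
      "h2.quotient_map cs.AG"
    unfolding img by (rule h2.quotient_presentation[OF main(3,5,4)])
  have "add_index Z2N B2N > 0" using main(1) finite_index_iff[OF add_subgroupD(1)[OF hN.A]] by blast
  \<comment> \<open>An infinite index counts as 0, so positivity of the product makes both factors
    finite.\<close>
  then have pos: "add_index Z1G ?H > 0" "add_index Z2G cs.AG > 0" unfolding main(2) using p0 by (simp_all add: power_0_left)
  have fi: "finite_index Z1G ?H" "finite_index Z2G cs.AG"
    using pos finite_index_iff[OF add_subgroupD(1)[OF h1.A]] finite_index_iff[OF add_subgroupD(1)[OF h2.A]] by blast+
  show "vectorspace.fin_dim k (cohomology k Nrec TN 2)" using hN.dimension(1) main(1) by blast
  show "vectorspace.dim k (cohomology k Nrec TN 2)
      = vectorspace.dim k (quotient_module (cohomology k G T 1) (annihilator k G T A))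
        + p * vectorspace.dim k (quotient_module (cohomology k G T 2) (cup k G T 1 1 A ` carrier (cohomology k G T 1)))"
    (is "?d = ?x + p * ?y")
  proof -
    have "p ^ ?d = p ^ ?x * (p ^ ?y) ^ p"
      using main(2) hN.dimension(2)[OF main(1)] x.dimension(2)[OF fi(1)] y.dimension(2)[OF fi(2)] by simp
    also have "\<dots> = p ^ (?x + p * ?y)" by (simp add: power_add power_mult[symmetric] mult.commute)
    finally show ?thesis using p1 power_inject_exp[of p] by blast
  qed
qed

section \<open>Galois theory of the maximal \<open>p\<close>-extension\<close>

text \<open>The homomorphism theorem phrased with the image of e in place of a quotient ring. With
  evaluation at an element as e, it defines maps on simple extensions.\<close>

lemma ring_hom_factor:
  assumes "ring A" "ring B" "ring C" and e: "e \<in> ring_hom A B" and f: "f \<in> ring_hom A C"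
    and ker: "\<And>x. \<lbrakk>x \<in> carrier A; e x = \<zero>\<^bsub>B\<^esub>\<rbrakk> \<Longrightarrow> f x = \<zero>\<^bsub>C\<^esub>"
  obtains g where "g \<in> extensional (e ` carrier A)" "g \<in> ring_hom (B\<lparr>carrier := e ` carrier A\<rparr>) C"
    and "\<And>x. x \<in> carrier A \<Longrightarrow> g (e x) = f x"
proof -
  interpret A: ring A by fact
  interpret B: ring B by fact
  interpret C: ring C by fact
  interpret E: ring_hom_ring A B e using e by (intro ring_hom_ringI2) unfold_locales
  interpret Fh: ring_hom_ring A C f using f by (intro ring_hom_ringI2) unfold_locales
  define g where "g = (\<lambda>y\<in>e ` carrier A. f (SOME x. x \<in> carrier A \<and> e x = y))"
  have g: "g (e x) = f x" if x: "x \<in> carrier A" for x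
  proof -
    let ?x = "SOME x'. x' \<in> carrier A \<and> e x' = e x"
    have x': "?x \<in> carrier A \<and> e ?x = e x" using x by (metis (mono_tags, lifting) someI_ex)
    have "e (?x \<ominus>\<^bsub>A\<^esub> x) = \<zero>\<^bsub>B\<^esub>" using x x' by (simp add: A.minus_eq B.r_neg)
    then have "f (?x \<ominus>\<^bsub>A\<^esub> x) = \<zero>\<^bsub>C\<^esub>" using x x' by (intro ker) auto
    then have "f ?x \<ominus>\<^bsub>C\<^esub> f x = \<zero>\<^bsub>C\<^esub>" using x x' by (simp add: A.minus_eq C.minus_eq)
    then have "f ?x = f x" using x x' by simp
    then show ?thesis using x by (simp add: g_def)
  qed
  have "g \<in> ring_hom (B\<lparr>carrier := e ` carrier A\<rparr>) C"
  proof (rule ring_hom_memI)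
    fix u v assume "u \<in> carrier (B\<lparr>carrier := e ` carrier A\<rparr>)" "v \<in> carrier (B\<lparr>carrier := e ` carrier A\<rparr>)"
    then obtain x y where xy: "x \<in> carrier A" "u = e x" "y \<in> carrier A" "v = e y" by auto
    show "g u \<in> carrier C" using xy g by auto
    have "g (e x \<otimes>\<^bsub>B\<^esub> e y) = g (e (x \<otimes>\<^bsub>A\<^esub> y))" "g (e x \<oplus>\<^bsub>B\<^esub> e y) = g (e (x \<oplus>\<^bsub>A\<^esub> y))"
      using xy e by (simp_all add: ring_hom_mult ring_hom_add)
    then show "g (u \<otimes>\<^bsub>B\<lparr>carrier := e ` carrier A\<rparr>\<^esub> v) = g u \<otimes>\<^bsub>C\<^esub> g v"
      "g (u \<oplus>\<^bsub>B\<lparr>carrier := e ` carrier A\<rparr>\<^esub> v) = g u \<oplus>\<^bsub>C\<^esub> g v"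
      using xy g[OF A.m_closed[OF xy(1,3)]] g[OF A.a_closed[OF xy(1,3)]] g[OF xy(1)] g[OF xy(3)] f
      by (simp_all add: ring_hom_mult ring_hom_add)
  next
    have "g \<one>\<^bsub>B\<^esub> = g (e \<one>\<^bsub>A\<^esub>)" using e by (simp add: ring_hom_one)
    then show "g \<one>\<^bsub>B\<lparr>carrier := e ` carrier A\<rparr>\<^esub> = \<one>\<^bsub>C\<^esub>"
      using g[OF A.one_closed] f by (simp add: ring_hom_one)
  qed
  moreover have "g \<in> extensional (e ` carrier A)" by (simp add: g_def)
  ultimately show thesis using g that by blast
qed

lemma card_set_mset_eq_size_iff: "card (set_mset M) = size M \<longleftrightarrow> (\<forall>x. count M x \<le> 1)"
proof (induction M)
  case (add a M)
  show ?case
  proof (cases "a \<in># M")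
    case True
    have "card (set_mset M) \<le> size M"
    proof (induction M)
      case (add b M)
      then show ?case by (simp add: card_insert_if)
    qed simp
    moreover have "count M a > 0" using True by simp
    ultimately have "card (set_mset (add_mset a M)) \<noteq> size (add_mset a M)" "\<not> count (add_mset a M) a \<le> 1"
      using True by (auto simp: insert_absorb)
    then show ?thesis by blast
  next
    case False
    then have 0: "count M a = 0" by (simp add: not_in_iff)
    have "(\<forall>x. count (add_mset a M) x \<le> 1) \<longleftrightarrow> (\<forall>x. count M x \<le> 1)"
      using 0 by (metis count_add_mset le_zero_eq nle_le One_nat_def)
    with False add show ?thesis by simp
  qed
qed simp

section \<open>Polynomials with distinct roots\<close>

context algebraically_closed
begin

text \<open>Separability as a count of distinct roots, the form in which it enters the count of
  embeddings; over an algebraically closed field it means that all multiplicities are at most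
  1.\<close>

definition simple_roots :: "'a list \<Rightarrow> bool" where
  "simple_roots P \<longleftrightarrow> card {y. is_root P y} = degree P"

lemma simple_roots_iff:
  assumes "P \<in> carrier (poly_ring L)"
  shows "simple_roots P \<longleftrightarrow> (\<forall>y. alg_mult P y \<le> 1)"
proof -
  have "{y. is_root P y} = set_mset (roots P)" using roots_mem_iff_is_root[OF assms] by auto
  moreover have "size (roots P) = degree P" using roots_over_carrier[OF assms] by (simp add: splitted_def)
  ultimately show ?thesis
    using card_set_mset_eq_size_iff[of "roots P"] alg_mult_eq_count_roots[OF assms]
    by (simp add: simple_roots_def)
qed

lemma card_roots_le:
  assumes "P \<in> carrier (poly_ring L)"
  shows "card {y. is_root P y} \<le> degree P" "finite {y. is_root P y}"
proof -
  have "{y. is_root P y} = set_mset (roots P)" using roots_mem_iff_is_root[OF assms] by auto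
  moreover have "size (roots P) = degree P" using roots_over_carrier[OF assms] by (simp add: splitted_def)
  moreover have "card (set_mset (roots P)) \<le> size (roots P)"
    using size_mset_mono[OF mset_set_set_mset_msubset, of "roots P"] by simp
  ultimately show "card {y. is_root P y} \<le> degree P" "finite {y. is_root P y}" by auto
qed

lemma simple_roots_divides:
  assumes "Q \<in> carrier (poly_ring L)" "P \<in> carrier (poly_ring L)" "P \<noteq> []" "Q pdivides P" "simple_roots P"
  shows "simple_roots Q"
proof -
  have "roots Q \<subseteq># roots P" using assms by (intro pdivides_imp_roots_incl)
  then have "alg_mult Q y \<le> alg_mult P y" for y
    using alg_mult_eq_count_roots[OF assms(1)] alg_mult_eq_count_roots[OF assms(2)]
    by (simp add: mset_subset_eq_count)
  then show ?thesis using simple_roots_iff[OF assms(1)] simple_roots_iff[OF assms(2)] assms(5)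
    by (meson order_trans)
qed

end

section \<open>Embeddings over the base field\<close>

context algebraic_closure
begin

text \<open>Embeddings into the algebraic closure instead of automorphisms: they can be restricted
  and extended along towers, and they become automorphisms once the field is stable under
  them.\<close>

definition Emb :: "'a set \<Rightarrow> ('a \<Rightarrow> 'a) set" where
  "Emb M = {\<theta> \<in> extensional M. \<theta> \<in> ring_hom (L\<lparr>carrier := M\<rparr>) L \<and> (\<forall>x\<in>K. \<theta> x = x)}"

lemma Emb_ring_hom_ring:
  assumes "subfield M L" "\<theta> \<in> Emb M"
  shows "ring_hom_ring (L\<lparr>carrier := M\<rparr>) L \<theta>"
  using assms subring_is_ring[OF subfieldE(1)] is_ring
  by (intro ring_hom_ringI2) (auto simp: Emb_def)

lemma Emb_simps:
  assumes "subfield M L" "\<theta> \<in> Emb M"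
  shows "x \<in> M \<Longrightarrow> \<theta> x \<in> carrier L" "x \<in> M \<Longrightarrow> y \<in> M \<Longrightarrow> \<theta> (x \<oplus> y) = \<theta> x \<oplus> \<theta> y"
    "x \<in> M \<Longrightarrow> y \<in> M \<Longrightarrow> \<theta> (x \<otimes> y) = \<theta> x \<otimes> \<theta> y" "\<theta> \<one> = \<one>" "\<theta> \<zero> = \<zero>" "x \<in> K \<Longrightarrow> \<theta> x = x"
    "x \<in> M \<Longrightarrow> \<theta> (\<ominus> x) = \<ominus> \<theta> x"
    "x \<in> M \<Longrightarrow> \<theta> (x [^] (n::nat)) = \<theta> x [^] n"
proof -
  interpret h: ring_hom_ring "L\<lparr>carrier := M\<rparr>" L \<theta> using assms by (rule Emb_ring_hom_ring)
  show "x \<in> M \<Longrightarrow> \<theta> x \<in> carrier L" using h.hom_closed by simp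
  show "x \<in> M \<Longrightarrow> y \<in> M \<Longrightarrow> \<theta> (x \<oplus> y) = \<theta> x \<oplus> \<theta> y" using h.hom_add by simp
  show "x \<in> M \<Longrightarrow> y \<in> M \<Longrightarrow> \<theta> (x \<otimes> y) = \<theta> x \<otimes> \<theta> y" using h.hom_mult by simp
  show "\<theta> \<one> = \<one>" using h.hom_one by simp
  show "\<theta> \<zero> = \<zero>" using h.hom_zero by simp
  show "x \<in> K \<Longrightarrow> \<theta> x = x" using assms by (simp add: Emb_def)
  show "\<theta> (\<ominus> x) = \<ominus> \<theta> x" if x: "x \<in> M"
  proof -
    have xc: "x \<in> carrier L" "\<ominus> x \<in> M"
      using x subringE(3,5)[OF subfieldE(1)[OF assms(1)]] subringE(1)[OF subfieldE(1)[OF assms(1)]] by auto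
    then have "\<theta> (\<ominus> x \<oplus> x) = \<theta> (\<ominus> x) \<oplus> \<theta> x" using h.hom_add[of "\<ominus> x" x] x by simp
    moreover have "\<theta> (\<ominus> x \<oplus> x) = \<zero>" using h.hom_zero xc by (simp add: l_neg)
    ultimately show ?thesis using x xc h.hom_closed by (intro minus_equality[symmetric]) auto
  qed
  show "x \<in> M \<Longrightarrow> \<theta> (x [^] (n::nat)) = \<theta> x [^] n"
    using h.hom_nat_pow[of x n] by (simp add: nat_pow_consistent[symmetric])
qed

lemma map_Emb_ring_hom:
  assumes "subfield M L" "\<theta> \<in> Emb M"
  shows "map \<theta> \<in> ring_hom (M[X]) (poly_ring L)"
proof -
  let ?M = "L\<lparr>carrier := M\<rparr>"
  interpret h: ring_hom_ring ?M L \<theta> using assms by (rule Emb_ring_hom_ring)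
  have sr: "subring M L" using assms(1) by (rule subfieldE)
  have Mx: "M[X] = poly_ring ?M" using univ_poly_consistent[OF sr] by simp
  have fM: "field ?M" using subfield_iff(2)[OF assms(1)] .
  have cl: "map \<theta> p \<in> carrier (poly_ring L)" if "p \<in> carrier (M[X])" for p
    using polynomial_hom[OF h.homh fM field_axioms] that Mx by simp
  have nrm: "normalize (map \<theta> p) = map \<theta> p" if "p \<in> carrier (M[X])" for p
    using cl[OF that] normalize_polynomial univ_poly_carrier by blast
  have sub: "set p \<subseteq> carrier ?M" if "p \<in> carrier (M[X])" for p
    using that by (auto simp: univ_poly_carrier[symmetric] polynomial_def)
  interpret U: ring "M[X]" using univ_poly_is_ring[OF sr] .
  show ?thesis
  proof (rule ring_hom_memI)
    fix p q assume pq: "p \<in> carrier (M[X])" "q \<in> carrier (M[X])"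
    show "map \<theta> p \<in> carrier (poly_ring L)" using cl pq by simp
    show "map \<theta> (p \<otimes>\<^bsub>M[X]\<^esub> q) = map \<theta> p \<otimes>\<^bsub>poly_ring L\<^esub> map \<theta> q"
    proof -
      have "map \<theta> (p \<otimes>\<^bsub>M[X]\<^esub> q) = normalize (map \<theta> (p \<otimes>\<^bsub>M[X]\<^esub> q))"
        using nrm[OF U.m_closed[OF pq]] by (rule sym)
      also have "\<dots> = poly_mult (map \<theta> p) (map \<theta> q)"
        using h.poly_mult_hom'[OF sub sub, OF pq] unfolding poly_mult_consistent[OF sr] univ_poly_mult .
      finally show ?thesis unfolding univ_poly_mult .
    qed
    show "map \<theta> (p \<oplus>\<^bsub>M[X]\<^esub> q) = map \<theta> p \<oplus>\<^bsub>poly_ring L\<^esub> map \<theta> q"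
    proof -
      have "map \<theta> (p \<oplus>\<^bsub>M[X]\<^esub> q) = normalize (map \<theta> (p \<oplus>\<^bsub>M[X]\<^esub> q))"
        using nrm[OF U.a_closed[OF pq]] by (rule sym)
      also have "\<dots> = poly_add (map \<theta> p) (map \<theta> q)"
        using h.poly_add_hom'[OF sub sub, OF pq] unfolding poly_add_consistent[OF sr] univ_poly_add .
      finally show ?thesis unfolding univ_poly_add .
    qed
  qed (simp add: univ_poly_one Emb_simps[OF assms])
qed

lemma Emb_eval:
  assumes "subfield M L" "\<theta> \<in> Emb M" "p \<in> carrier (M[X])" "x \<in> M"
  shows "\<theta> (eval p x) = eval (map \<theta> p) (\<theta> x)"
proof -
  interpret h: ring_hom_ring "L\<lparr>carrier := M\<rparr>" L \<theta> using assms(1,2) by (rule Emb_ring_hom_ring)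
  have "set p \<subseteq> M" using assms(3) by (auto simp: univ_poly_carrier[symmetric] polynomial_def)
  then show ?thesis using h.eval_hom'[of x p] assms(4) eval_consistent[OF subfieldE(1)[OF assms(1)]] by simp
qed

lemma poly_coeffs_subset: "p \<in> carrier (M[X]) \<Longrightarrow> set p \<subseteq> M"
  by (auto simp: univ_poly_carrier[symmetric] polynomial_def)

lemma poly_carrier_mono: "M \<subseteq> M' \<Longrightarrow> carrier (M[X]) \<subseteq> carrier (M'[X])"
  by (force simp: univ_poly_carrier[symmetric] polynomial_def)

lemma map_Emb_poly:
  assumes "subfield M L" "\<theta> \<in> Emb M" "P \<in> carrier (M[X])"
  shows "map \<theta> P \<in> carrier (poly_ring L)"
  using map_Emb_ring_hom[OF assms(1,2)] assms(3) by (auto simp: ring_hom_def)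

lemma algebraic_over: "K \<subseteq> M \<Longrightarrow> x \<in> carrier L \<Longrightarrow> (algebraic over M) x"
  using algebraic_mono algebraic_extension by blast

lemma simple_ext_subfield:
  assumes "subfield M L" "K \<subseteq> M" "r \<in> carrier L"
  shows "subfield (simple_extension M r) L" "M \<subseteq> simple_extension M r" "r \<in> simple_extension M r"
  using simple_extension_is_subfield[OF assms(1,3)] algebraic_over[OF assms(2,3)]
    simple_extension_incl[OF subfieldE(3)[OF assms(1)] assms(3)]
    simple_extension_mem[OF subfieldE(1)[OF assms(1)] assms(3)] by auto

lemma Emb_restrict:
  assumes "subfield M' L" "subfield M L" "M \<subseteq> M'" "\<theta> \<in> Emb M'" "K \<subseteq> M"
  shows "restrict \<theta> M \<in> Emb M"
proof -
  have "restrict \<theta> M \<in> ring_hom (L\<lparr>carrier := M\<rparr>) L"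
    using assms Emb_simps[OF assms(1,4)] subringE[OF subfieldE(1)[OF assms(2)]]
    by (intro ring_hom_memI) (auto simp: subset_iff)
  then show ?thesis using assms by (auto simp: Emb_def subset_iff)
qed

text \<open>Evaluation at r, and application of \<theta> followed by evaluation at y, are two
  homomorphisms on \<open>M[X]\<close>. The second kills the minimal polynomial of r, so it factors
  through the first.\<close>

lemma Emb_extend:
  assumes M: "subfield M L" "K \<subseteq> M" and th: "\<theta> \<in> Emb M" and r: "r \<in> carrier L"
    and y: "y \<in> carrier L" "eval (map \<theta> (Irr M r)) y = \<zero>"
  obtains \<theta>' where "\<theta>' \<in> Emb (simple_extension M r)" "\<And>x. x \<in> M \<Longrightarrow> \<theta>' x = \<theta> x" "\<theta>' r = y"
proof -
  have sr: "subring M L" using M by (auto dest: subfieldE)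
  have alg: "(algebraic over M) r" using algebraic_over M r by blast
  interpret U: ring "M[X]" using univ_poly_is_ring[OF sr] .
  have e: "(\<lambda>p. eval p r) \<in> ring_hom (M[X]) L"
    using eval_ring_hom[OF sr r] by (simp add: ring_hom_ring.homh)
  have ey: "(\<lambda>p. eval p y) \<in> ring_hom (poly_ring L) L"
    using eval_ring_hom[OF carrier_is_subring y(1)] by (simp add: ring_hom_ring.homh)
  have f: "(\<lambda>p. eval p y) \<circ> map \<theta> \<in> ring_hom (M[X]) L"
    using map_Emb_ring_hom[OF M(1) th] ey by (rule ring_hom_trans)
  have I: "Irr M r \<in> carrier (M[X])" using IrrE(1)[OF M(1) r alg] .
  have ker: "((\<lambda>p. eval p y) \<circ> map \<theta>) p = \<zero>" if p: "p \<in> carrier (M[X])" "eval p r = \<zero>" for p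
  proof -
    have "Irr M r divides\<^bsub>M[X]\<^esub> p"
      using Irr_minimal[OF M(1) r alg p] pdivides_iff_shell[OF M(1) I p(1)] by simp
    then obtain q where q: "q \<in> carrier (M[X])" "p = Irr M r \<otimes>\<^bsub>M[X]\<^esub> q" by (auto simp: factor_def)
    have "((\<lambda>p. eval p y) \<circ> map \<theta>) p = ((\<lambda>p. eval p y) \<circ> map \<theta>) (Irr M r) \<otimes> ((\<lambda>p. eval p y) \<circ> map \<theta>) q"
      unfolding q(2) by (rule ring_hom_mult[OF f I q(1)])
    moreover have "((\<lambda>p. eval p y) \<circ> map \<theta>) q \<in> carrier L" using ring_hom_closed[OF f q(1)] .
    ultimately show ?thesis using y(2) by simp
  qed
  obtain g where g: "g \<in> extensional ((\<lambda>p. eval p r) ` carrier (M[X]))"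
      "g \<in> ring_hom (L\<lparr>carrier := (\<lambda>p. eval p r) ` carrier (M[X])\<rparr>) L"
      "\<And>p. p \<in> carrier (M[X]) \<Longrightarrow> g (eval p r) = eval (map \<theta> p) y"
    using ring_hom_factor[OF U.ring_axioms is_ring is_ring e f] ker by auto
  have img: "(\<lambda>p. eval p r) ` carrier (M[X]) = simple_extension M r"
    using simple_extension_as_eval_img[OF subfieldE(3)[OF M(1)] r] by simp
  have Mc: "M \<subseteq> carrier L" using subfieldE(3)[OF M(1)] .
  have gM: "g x = \<theta> x" if x: "x \<in> M" for x
  proof (cases "x = \<zero>")
    case True
    have "g (eval [] r) = eval (map \<theta> []) y" using g(3) by blast
    then show ?thesis using True Emb_simps[OF M(1) th] by simp
  next
    case False
    have "[x] \<in> carrier (M[X])" using x False by (auto simp: univ_poly_carrier[symmetric] polynomial_def)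
    then have "g (eval [x] r) = eval (map \<theta> [x]) y" using g(3) by blast
    then show ?thesis using x r y Mc Emb_simps[OF M(1) th] by auto
  qed
  have "[\<one>, \<zero>] \<in> carrier (M[X])" using subringE[OF sr] by (auto simp: univ_poly_carrier[symmetric] polynomial_def)
  then have "g (eval [\<one>, \<zero>] r) = eval (map \<theta> [\<one>, \<zero>]) y" using g(3) by blast
  then have gr: "g r = y" using r y Emb_simps[OF M(1) th] by simp
  have "g \<in> Emb (simple_extension M r)" unfolding Emb_def using g(1,2) img gM M(2) Emb_simps(6)[OF M(1) th] by auto
  then show thesis using gM gr that by blast
qed

lemma Emb_simple_root:
  assumes M: "subfield M L" "K \<subseteq> M" and r: "r \<in> carrier L" and th: "\<theta> \<in> Emb (simple_extension M r)"
  shows "eval (map (restrict \<theta> M) (Irr M r)) (\<theta> r) = \<zero>"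
proof -
  note S = simple_ext_subfield[OF M r]
  have alg: "(algebraic over M) r" using algebraic_over M r by blast
  have I: "Irr M r \<in> carrier (M[X])" using IrrE(1)[OF M(1) r alg] .
  then have I': "Irr M r \<in> carrier (simple_extension M r [X])" using poly_carrier_mono[OF S(2)] by blast
  have "map (restrict \<theta> M) (Irr M r) = map \<theta> (Irr M r)" using poly_coeffs_subset[OF I] by auto
  moreover have "eval (map \<theta> (Irr M r)) (\<theta> r) = \<theta> (eval (Irr M r) r)"
    using Emb_eval[OF S(1) th I' S(3)] by simp
  ultimately show ?thesis using IrrE(4)[OF M(1) r alg] Emb_simps(5)[OF S(1) th] by (simp only:)
qed

lemma Emb_simple_eqI:
  assumes M: "subfield M L" "K \<subseteq> M" and r: "r \<in> carrier L"
    and th: "\<theta> \<in> Emb (simple_extension M r)" "\<theta>' \<in> Emb (simple_extension M r)"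
    and eq: "\<And>x. x \<in> M \<Longrightarrow> \<theta> x = \<theta>' x" "\<theta> r = \<theta>' r"
  shows "\<theta> = \<theta>'"
proof (rule extensionalityI)
  show "\<theta> \<in> extensional (simple_extension M r)" "\<theta>' \<in> extensional (simple_extension M r)"
    using th by (auto simp: Emb_def)
  fix x assume "x \<in> simple_extension M r"
  then obtain p where p: "p \<in> carrier (M[X])" "x = eval p r"
    using simple_extension_as_eval_img[OF subfieldE(3)[OF M(1)] r] by auto
  note S = simple_ext_subfield[OF M r]
  have p': "p \<in> carrier (simple_extension M r [X])" using p poly_carrier_mono[OF S(2)] by blast
  have "map \<theta> p = map \<theta>' p" using poly_coeffs_subset[OF p(1)] eq by auto
  then show "\<theta> x = \<theta>' x" using p p' Emb_eval[OF S(1) th(1) p' S(3)] Emb_eval[OF S(1) th(2) p' S(3)] eq(2) by (simp only:)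
qed

lemma Emb_base: "Emb K = {restrict id K}"
proof -
  have "restrict id K \<in> ring_hom (L\<lparr>carrier := K\<rparr>) L"
    using subringE[OF subfieldE(1)[OF subfield_axioms]] by (intro ring_hom_memI) auto
  then have "restrict id K \<in> Emb K" by (auto simp: Emb_def)
  moreover have "\<theta> = restrict id K" if "\<theta> \<in> Emb K" for \<theta>
    using that by (auto simp: Emb_def intro!: extensionalityI)
  ultimately show ?thesis by blast
qed

end


section \<open>Towers of separable steps and a Galois criterion\<close>

context algebraic_closure
begin

text \<open>Leaving the polynomial P free, instead of taking the minimal polynomial of r over M,
  makes the condition monotone in M. Both separable generators and p-th roots of nonzero elements of
  M satisfy it.\<close>

definition sep_step :: "'a set \<Rightarrow> 'a \<Rightarrow> bool" where
  "sep_step M r \<longleftrightarrow> (\<exists>P\<in>carrier (M[X]). P \<noteq> [] \<and> eval P r = \<zero> \<and> (\<forall>\<theta>\<in>Emb M. simple_roots (map \<theta> P)))"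

text \<open>The head of the list is adjoined last, in accordance with the recursion of
  \<open>finite_extension\<close>.\<close>

primrec sep_chain :: "'a set \<Rightarrow> 'a list \<Rightarrow> bool" where
  "sep_chain M [] = True"
| "sep_chain M (r # rs) = (sep_chain M rs \<and> sep_step (finite_extension M rs) r)"

lemma sep_step_Irr:
  assumes M: "subfield M L" "K \<subseteq> M" and r: "r \<in> carrier L" and "sep_step M r" and th: "\<theta> \<in> Emb M"
  shows "simple_roots (map \<theta> (Irr M r))"
proof -
  obtain P where P: "P \<in> carrier (M[X])" "P \<noteq> []" "eval P r = \<zero>" "simple_roots (map \<theta> P)"
    using assms by (auto simp: sep_step_def)
  have alg: "(algebraic over M) r" using algebraic_over M r by blast
  have I: "Irr M r \<in> carrier (M[X])" using IrrE(1)[OF M(1) r alg] .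
  have "Irr M r divides\<^bsub>M[X]\<^esub> P"
    using Irr_minimal[OF M(1) r alg P(1,3)] pdivides_iff_shell[OF M(1) I P(1)] by simp
  then obtain q where q: "q \<in> carrier (M[X])" "P = Irr M r \<otimes>\<^bsub>M[X]\<^esub> q" by (auto simp: factor_def)
  have "map \<theta> P = map \<theta> (Irr M r) \<otimes>\<^bsub>poly_ring L\<^esub> map \<theta> q"
    unfolding q(2) by (rule ring_hom_mult[OF map_Emb_ring_hom[OF M(1) th] I q(1)])
  then have "map \<theta> (Irr M r) pdivides map \<theta> P"
    using map_Emb_poly[OF M(1) th q(1)] unfolding pdivides_def factor_def by blast
  then show ?thesis
    using simple_roots_divides map_Emb_poly[OF M(1) th I] map_Emb_poly[OF M(1) th P(1)] P by blast
qed

lemma Irr_degree_pos: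
  assumes M: "subfield M L" "K \<subseteq> M" and r: "r \<in> carrier L"
  shows "0 < degree (Irr M r)" "Irr M r \<noteq> []"
proof -
  have alg: "(algebraic over M) r" using algebraic_over M r by blast
  note I = IrrE[OF M(1) r alg]
  have "degree (Irr M r) \<ge> 1" using pirreducible_degree[OF M(1) I(1,2)] by simp
  then show "0 < degree (Irr M r)" "Irr M r \<noteq> []" by auto
qed

lemma Emb_simple_bij:
  assumes M: "subfield M L" "K \<subseteq> M" and r: "r \<in> carrier L"
  shows "bij_betw (\<lambda>\<theta>. (restrict \<theta> M, \<theta> r)) (Emb (simple_extension M r))
           (Sigma (Emb M) (\<lambda>\<theta>. {y. is_root (map \<theta> (Irr M r)) y}))"
proof -
  note S = simple_ext_subfield[OF M r]
  show ?thesis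
  proof (rule bij_betwI')
    fix a b assume ab: "a \<in> Emb (simple_extension M r)" "b \<in> Emb (simple_extension M r)"
    have "a = b" if "(restrict a M, a r) = (restrict b M, b r)"
    proof (rule Emb_simple_eqI[OF M r ab])
      show "a x = b x" if "x \<in> M" for x
        using that \<open>(restrict a M, a r) = (restrict b M, b r)\<close> by (metis Pair_inject restrict_apply')
      show "a r = b r" using that by simp
    qed
    then show "((restrict a M, a r) = (restrict b M, b r)) = (a = b)" by auto
  next
    fix a assume a: "a \<in> Emb (simple_extension M r)"
    have "restrict a M \<in> Emb M" using Emb_restrict[OF S(1) M(1) S(2) a M(2)] .
    moreover have "is_root (map (restrict a M) (Irr M r)) (a r)"
      unfolding is_root_def using Emb_simple_root[OF M r a] Emb_simps(1)[OF S(1) a S(3)] Irr_degree_pos[OF M r] by simp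
    ultimately show "(restrict a M, a r) \<in> Sigma (Emb M) (\<lambda>\<theta>. {y. is_root (map \<theta> (Irr M r)) y})" by blast
  next
    fix w assume "w \<in> Sigma (Emb M) (\<lambda>\<theta>. {y. is_root (map \<theta> (Irr M r)) y})"
    then obtain \<theta> y where w: "w = (\<theta>, y)" "\<theta> \<in> Emb M" "is_root (map \<theta> (Irr M r)) y" by auto
    then obtain \<theta>' where "\<theta>' \<in> Emb (simple_extension M r)" "\<And>x. x \<in> M \<Longrightarrow> \<theta>' x = \<theta> x" "\<theta>' r = y"
      using Emb_extend[OF M w(2) r] unfolding is_root_def by blast
    moreover from this have "restrict \<theta>' M = \<theta>"
      using w(2) by (intro extensionalityI[of _ M]) (auto simp: Emb_def)
    ultimately show "\<exists>x\<in>Emb (simple_extension M r). w = (restrict x M, x r)" using w by blast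
  qed
qed

lemma finite_Emb_simple:
  assumes M: "subfield M L" "K \<subseteq> M" and r: "r \<in> carrier L" and fin: "finite (Emb M)"
  shows "finite (Emb (simple_extension M r))"
proof -
  have alg: "(algebraic over M) r" using algebraic_over M r by blast
  have "finite (Sigma (Emb M) (\<lambda>\<theta>. {y. is_root (map \<theta> (Irr M r)) y}))"
    using fin card_roots_le(2)[OF map_Emb_poly[OF M(1) _ IrrE(1)[OF M(1) r alg]]] by (intro finite_SigmaI) auto
  then show ?thesis using Emb_simple_bij[OF M r] bij_betw_finite by blast
qed

lemma card_Emb_simple:
  assumes M: "subfield M L" "K \<subseteq> M" and r: "r \<in> carrier L" and fin: "finite (Emb M)" and "sep_step M r"
  shows "card (Emb (simple_extension M r)) = card (Emb M) * degree (Irr M r)"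
proof -
  have alg: "(algebraic over M) r" using algebraic_over M r by blast
  have "card (Emb (simple_extension M r)) = card (Sigma (Emb M) (\<lambda>\<theta>. {y. is_root (map \<theta> (Irr M r)) y}))"
    using bij_betw_same_card[OF Emb_simple_bij[OF M r]] .
  also have "\<dots> = (\<Sum>\<theta>\<in>Emb M. card {y. is_root (map \<theta> (Irr M r)) y})"
    using fin card_roots_le(2)[OF map_Emb_poly[OF M(1) _ IrrE(1)[OF M(1) r alg]]] by (intro card_SigmaI) auto
  also have "\<dots> = (\<Sum>\<theta>\<in>Emb M. degree (Irr M r))"
    using sep_step_Irr[OF M r assms(5)] by (intro sum.cong) (auto simp: simple_roots_def)
  finally show ?thesis by simp
qed

lemma fe_subfield:
  assumes "subfield M L" "K \<subseteq> M" "set rs \<subseteq> carrier L"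
  shows "subfield (finite_extension M rs) L" "M \<subseteq> finite_extension M rs" "set rs \<subseteq> finite_extension M rs"
    "K \<subseteq> finite_extension M rs"
proof -
  show "subfield (finite_extension M rs) L"
    using finite_extension_is_subfield[OF assms(1,3)] algebraic_over[OF assms(2)] assms(3) by blast
  show 1: "M \<subseteq> finite_extension M rs" using finite_extension_incl[OF subfieldE(3)[OF assms(1)] assms(3)] .
  show "set rs \<subseteq> finite_extension M rs" using finite_extension_mem[OF subfieldE(1)[OF assms(1)] assms(3)] .
  show "K \<subseteq> finite_extension M rs" using 1 assms(2) by blast
qed

lemma sep_step_mono:
  assumes "subfield M L" "subfield M' L" "K \<subseteq> M" "M \<subseteq> M'" "sep_step M r"
  shows "sep_step M' r"
proof -
  obtain P where P: "P \<in> carrier (M[X])" "P \<noteq> []" "eval P r = \<zero>" "\<forall>\<theta>\<in>Emb M. simple_roots (map \<theta> P)"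
    using assms by (auto simp: sep_step_def)
  have "simple_roots (map \<theta> P)" if "\<theta> \<in> Emb M'" for \<theta>
  proof -
    have "map (restrict \<theta> M) P = map \<theta> P" using poly_coeffs_subset[OF P(1)] by auto
    then show ?thesis using P(4) Emb_restrict[OF assms(2,1,4) that assms(3)] by metis
  qed
  then show ?thesis using P poly_carrier_mono[OF assms(4)] unfolding sep_step_def by blast
qed

lemma sep_chain_mono:
  assumes "subfield M L" "subfield M' L" "K \<subseteq> M" "M \<subseteq> M'" "set rs \<subseteq> carrier L" "sep_chain M rs"
  shows "sep_chain M' rs"
  using assms(5,6)
proof (induction rs)
  case (Cons r rs)
  have "finite_extension M rs \<subseteq> finite_extension M' rs" using mono_finite_extension[OF assms(4)] .
  moreover have "K \<subseteq> M'" using assms by blast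
  ultimately show ?case
    using Cons fe_subfield[OF assms(1,3), of rs] fe_subfield[OF assms(2), of rs] sep_step_mono by auto
qed simp

lemma sep_chain_append: "sep_chain M (rs @ rs') \<longleftrightarrow> sep_chain M rs' \<and> sep_chain (finite_extension M rs') rs"
  by (induction rs) auto

lemma sep_stepI_separable:
  assumes M: "subfield M L" "K \<subseteq> M" and r: "r \<in> carrier L" and sep: "\<And>y. alg_mult (Irr K r) y \<le> 1"
  shows "sep_step M r"
proof -
  note I = IrrE[OF subfield_axioms r algebraic_over[OF subset_refl r]]
  have "map \<theta> (Irr K r) = Irr K r" if "\<theta> \<in> Emb M" for \<theta>
    using poly_coeffs_subset[OF I(1)] that by (intro map_idI) (auto simp: Emb_def)
  moreover have "Irr K r \<in> carrier (poly_ring L)"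
    using I(1) poly_carrier_mono[OF subfieldE(3)[OF subfield_axioms]] by blast
  ultimately have "\<forall>\<theta>\<in>Emb M. simple_roots (map \<theta> (Irr K r))" using simple_roots_iff sep by simp
  then show ?thesis
    using I(1,4) poly_carrier_mono[OF M(2)] Irr_degree_pos(2)[OF subfield_axioms subset_refl r]
    unfolding sep_step_def by blast
qed

text \<open>Each step multiplies the degree and the number of embeddings by the degree of a minimal
  polynomial. That embeddings extend is part of the induction; this later moves conjugates into the
  field.\<close>

lemma chain_count:
  assumes M: "subfield M L" "K \<subseteq> M" and fin: "finite (Emb M)"
    and "set rs \<subseteq> carrier L" "sep_chain M rs"
  shows "\<exists>n>0. dimension n M (finite_extension M rs) \<and> finite (Emb (finite_extension M rs)) \<and>
     card (Emb (finite_extension M rs)) = card (Emb M) * n \<and>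
     (\<forall>\<theta>\<in>Emb M. \<exists>\<theta>'\<in>Emb (finite_extension M rs). \<forall>x\<in>M. \<theta>' x = \<theta> x)"
  using assms(4,5)
proof (induction rs)
  case Nil
  have "dimension 1 M M" using dimension_one[OF M(1)] .
  then show ?case using fin by (intro exI[of _ 1]) auto
next
  case (Cons r rs)
  let ?E = "finite_extension M rs"
  have r: "r \<in> carrier L" and ss: "sep_step ?E r" using Cons.prems by auto
  obtain n where n: "n > 0" "dimension n M ?E" "finite (Emb ?E)" "card (Emb ?E) = card (Emb M) * n"
     "\<forall>\<theta>\<in>Emb M. \<exists>\<theta>'\<in>Emb ?E. \<forall>x\<in>M. \<theta>' x = \<theta> x" using Cons by auto
  have E: "subfield ?E L" "K \<subseteq> ?E" "M \<subseteq> ?E" using fe_subfield[OF M, of rs] Cons.prems by auto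
  have alg: "(algebraic over ?E) r" using algebraic_over E r by blast
  have I: "Irr ?E r \<in> carrier (?E[X])" using IrrE(1)[OF E(1) r alg] .
  have d: "0 < degree (Irr ?E r)" using Irr_degree_pos[OF E(1,2) r] by simp
  have c1: "dimension (n * degree (Irr ?E r)) M (simple_extension ?E r)"
    using telescopic_base[OF M(1) E(1) n(2) dimension_simple_extension[OF E(1) r alg]] .
  have c2: "\<exists>\<theta>''\<in>Emb (simple_extension ?E r). \<forall>x\<in>M. \<theta>'' x = \<theta> x" if th: "\<theta> \<in> Emb M" for \<theta>
  proof -
    obtain \<theta>' where th': "\<theta>' \<in> Emb ?E" "\<forall>x\<in>M. \<theta>' x = \<theta> x" using bspec[OF n(5) th] by blast
    have "card {y. is_root (map \<theta>' (Irr ?E r)) y} > 0"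
      using sep_step_Irr[OF E(1,2) r ss th'(1)] d by (simp add: simple_roots_def)
    then have "{y. is_root (map \<theta>' (Irr ?E r)) y} \<noteq> {}" by (intro notI) simp
    then obtain y where y: "is_root (map \<theta>' (Irr ?E r)) y" by blast
    have y': "y \<in> carrier L" "eval (map \<theta>' (Irr ?E r)) y = \<zero>" using y by (auto simp: is_root_def)
    obtain \<theta>'' where th'': "\<theta>'' \<in> Emb (simple_extension ?E r)" "\<And>x. x \<in> ?E \<Longrightarrow> \<theta>'' x = \<theta>' x"
      using Emb_extend[OF E(1,2) th'(1) r y'] by blast
    have "\<theta>'' x = \<theta> x" if "x \<in> M" for x using th''(2) th'(2) E(3) that by (simp add: subset_iff)
    then show ?thesis using th''(1) by blast
  qed
  show ?case
  proof (rule exI[of _ "n * degree (Irr ?E r)"], intro conjI ballI)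
    show "0 < n * degree (Irr ?E r)" using n(1) d by simp
    show "dimension (n * degree (Irr ?E r)) M (finite_extension M (r # rs))" using c1 by simp
    show "finite (Emb (finite_extension M (r # rs)))" using finite_Emb_simple[OF E(1,2) r n(3)] by simp
    show "card (Emb (finite_extension M (r # rs))) = card (Emb M) * (n * degree (Irr ?E r))"
      using n(4) card_Emb_simple[OF E(1,2) r n(3) ss] by simp
    show "\<exists>\<theta>'\<in>Emb (finite_extension M (r # rs)). \<forall>x\<in>M. \<theta>' x = \<theta> x" if "\<theta> \<in> Emb M" for \<theta>
      using c2[OF that] by simp
  qed
qed

lemma Emb_inj_on:
  assumes M: "subfield M L" and th: "\<theta> \<in> Emb M"
  shows "inj_on \<theta> M"
proof (rule inj_onI)
  note sr = subfieldE(1)[OF M]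
  fix x y assume xy: "x \<in> M" "y \<in> M" "\<theta> x = \<theta> y"
  have c: "x \<in> carrier L" "y \<in> carrier L" "x \<ominus> y \<in> M" "\<ominus> y \<in> M"
    using xy subringE[OF sr] by (auto simp: minus_eq)
  have 0: "\<theta> (x \<ominus> y) = \<zero>"
    unfolding minus_eq using xy c Emb_simps[OF M th] by (simp add: r_neg)
  show "x = y"
  proof (rule ccontr)
    assume "x \<noteq> y"
    then have nz: "x \<ominus> y \<noteq> \<zero>" using c by simp
    have i: "inv (x \<ominus> y) \<in> M" "(x \<ominus> y) \<otimes> inv (x \<ominus> y) = \<one>"
      using subfield_m_inv[OF M, of "x \<ominus> y"] c nz by auto
    have "\<theta> ((x \<ominus> y) \<otimes> inv (x \<ominus> y)) = \<zero>"
      using 0 c i(1) Emb_simps(1,3)[OF M th] by simp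
    then show False unfolding i(2) using Emb_simps(4)[OF M th] by simp
  qed
qed

lemma Emb_comp:
  assumes M: "subfield M L" and th: "\<theta> \<in> Emb M" "\<psi> \<in> Emb M" and "K \<subseteq> M" "\<psi> ` M \<subseteq> M"
  shows "compose M \<theta> \<psi> \<in> Emb M"
proof -
  note sr = subringE[OF subfieldE(1)[OF M]]
  have "compose M \<theta> \<psi> \<in> ring_hom (L\<lparr>carrier := M\<rparr>) L"
    using assms sr Emb_simps[OF M th(1)] Emb_simps[OF M th(2)]
    by (intro ring_hom_memI) (auto simp: compose_def image_subset_iff)
  moreover have "compose M \<theta> \<psi> x = x" if "x \<in> K" for x
    using that assms(4) Emb_simps(6)[OF M th(1) that] Emb_simps(6)[OF M th(2) that] by (auto simp: compose_def)
  ultimately show ?thesis unfolding Emb_def by (auto simp: compose_def)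
qed

text \<open>Composition with \<theta> on the left is an injective self-map of the finite set of
  embeddings, so it reaches the identity, and this makes \<theta> surjective.\<close>

lemma gal_eq_Emb:
  assumes M: "subfield M L" "K \<subseteq> M" and fin: "finite (Emb M)" and st: "\<And>\<theta>. \<theta> \<in> Emb M \<Longrightarrow> \<theta> ` M \<subseteq> M"
  shows "carrier (gal L K M) = Emb M"
proof
  show "carrier (gal L K M) \<subseteq> Emb M"
    using subringE(1)[OF subfieldE(1)[OF M(1)]]
    by (auto simp: gal_def Emb_def Bij_def ring_hom_def)
next
  show "Emb M \<subseteq> carrier (gal L K M)"
  proof
    fix \<theta> assume th: "\<theta> \<in> Emb M"
    have "restrict id M \<in> ring_hom (L\<lparr>carrier := M\<rparr>) L"
      using subringE[OF subfieldE(1)[OF M(1)]] by (intro ring_hom_memI) auto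
    then have idM: "restrict id M \<in> Emb M" using M by (auto simp: Emb_def)
    have "inj_on (\<lambda>\<psi>. compose M \<theta> \<psi>) (Emb M)"
    proof (rule inj_onI)
      fix \<psi> \<psi>' assume a: "\<psi> \<in> Emb M" "\<psi>' \<in> Emb M" "compose M \<theta> \<psi> = compose M \<theta> \<psi>'"
      show "\<psi> = \<psi>'"
      proof (rule extensionalityI[of _ M])
        show "\<psi> \<in> extensional M" "\<psi>' \<in> extensional M" using a by (auto simp: Emb_def)
        fix x assume x: "x \<in> M"
        have "\<theta> (\<psi> x) = \<theta> (\<psi>' x)" using a(3) x by (metis compose_eq)
        moreover have "\<psi> x \<in> M" "\<psi>' x \<in> M" using st[OF a(1)] st[OF a(2)] x by auto
        ultimately show "\<psi> x = \<psi>' x" using Emb_inj_on[OF M(1) th] by (auto dest: inj_onD)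
      qed
    qed
    then have "(\<lambda>\<psi>. compose M \<theta> \<psi>) ` Emb M = Emb M"
      using Emb_comp[OF M(1) th _ M(2) st] by (intro endo_inj_surj[OF fin]) auto
    then obtain \<psi> where psi: "\<psi> \<in> Emb M" "compose M \<theta> \<psi> = restrict id M" using idM by (metis imageE)
    have "\<theta> ` M = M"
    proof
      show "\<theta> ` M \<subseteq> M" using st[OF th] .
      show "M \<subseteq> \<theta> ` M"
      proof
        fix x assume x: "x \<in> M"
        have "\<theta> (\<psi> x) = x" using psi(2) x by (metis compose_eq id_apply restrict_apply')
        then show "x \<in> \<theta> ` M" using st[OF psi(1)] x by (metis image_eqI image_subset_iff)
      qed
    qed
    then show "\<theta> \<in> carrier (gal L K M)"
      using th Emb_inj_on[OF M(1) th] by (auto simp: gal_def Emb_def Bij_def bij_betw_def ring_hom_def)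
  qed
qed

lemma fe_minimal:
  assumes "subfield M L" "set rs \<subseteq> carrier L" "subring H L" "M \<subseteq> H" "set rs \<subseteq> H"
  shows "finite_extension M rs \<subseteq> H"
  using finite_extension_minimal[OF subfieldE(1)[OF assms(1)] assms(2)] assms(3-5) by auto

lemma Emb_image_subset:
  assumes M: "subfield M L" "K \<subseteq> M" "M = finite_extension K rs" and rs: "set rs \<subseteq> carrier L"
    and th: "\<theta> \<in> Emb M" and conj: "\<And>r. r \<in> set rs \<Longrightarrow> \<theta> r \<in> M"
  shows "\<theta> ` M \<subseteq> M"
proof -
  note sr = subringE[OF subfieldE(1)[OF M(1)]]
  have "subring {u \<in> M. \<theta> u \<in> M} L"
  proof (rule subringI)
    show "{u \<in> M. \<theta> u \<in> M} \<subseteq> carrier L" using sr(1) by blast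
    show "\<one> \<in> {u \<in> M. \<theta> u \<in> M}" using sr(3) Emb_simps(4)[OF M(1) th] by simp
    show "\<ominus> h \<in> {u \<in> M. \<theta> u \<in> M}" if "h \<in> {u \<in> M. \<theta> u \<in> M}" for h
      using that sr(5) Emb_simps(7)[OF M(1) th] by simp
    show "h1 \<otimes> h2 \<in> {u \<in> M. \<theta> u \<in> M}" "h1 \<oplus> h2 \<in> {u \<in> M. \<theta> u \<in> M}"
      if "h1 \<in> {u \<in> M. \<theta> u \<in> M}" "h2 \<in> {u \<in> M. \<theta> u \<in> M}" for h1 h2
      using that sr(6,7) Emb_simps(2,3)[OF M(1) th] by simp_all
  qed
  moreover have "K \<subseteq> {u \<in> M. \<theta> u \<in> M}" using M(2) Emb_simps(6)[OF M(1) th] by (simp add: subset_iff)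
  moreover have "set rs \<subseteq> {u \<in> M. \<theta> u \<in> M}"
    using conj fe_subfield(3)[OF subfield_axioms subset_refl rs] M(3) by auto
  ultimately have "finite_extension K rs \<subseteq> {u \<in> M. \<theta> u \<in> M}"
    using fe_minimal[OF subfield_axioms rs] by blast
  then show ?thesis using M(3) by auto
qed

text \<open>The extension \<open>M / K(x)\<close> has as many embeddings over each embedding of \<open>K(x)\<close> as its degree,
  so comparing with the count for \<open>M / K\<close> shows that \<open>Irr K x\<close> has as many roots as its degree.\<close>

lemma finite_galois_criterion:
  assumes rs: "set rs \<subseteq> carrier L" "sep_chain K rs" and M: "M = finite_extension K rs"
    and conj: "\<And>\<theta> r. \<theta> \<in> Emb M \<Longrightarrow> r \<in> set rs \<Longrightarrow> \<theta> r \<in> M"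
  shows "finite_galois_ext L K M" "carrier (gal L K M) = Emb M" "finite (Emb M)"
    "dimension (card (Emb M)) K M" "\<And>\<theta>. \<theta> \<in> Emb M \<Longrightarrow> \<theta> ` M \<subseteq> M"
proof -
  have sM: "subfield M L" "K \<subseteq> M" using fe_subfield[OF subfield_axioms subset_refl rs(1)] M by auto
  have Mc: "M \<subseteq> carrier L" using subfieldE(3)[OF sM(1)] .
  obtain n where n: "dimension n K M" "finite (Emb M)" "card (Emb M) = n" "n > 0"
    using chain_count[OF subfield_axioms subset_refl _ rs] M by (auto simp: Emb_base)
  show st: "\<theta> ` M \<subseteq> M" if "\<theta> \<in> Emb M" for \<theta>
    using Emb_image_subset[OF sM M rs(1) that conj[OF that]] .
  show "finite (Emb M)" "dimension (card (Emb M)) K M" using n by auto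
  show "carrier (gal L K M) = Emb M" using gal_eq_Emb[OF sM n(2) st] .
  have key: "simple_roots (Irr K x) \<and> (\<forall>y. is_root (Irr K x) y \<longrightarrow> y \<in> M)" if x: "x \<in> M" for x
  proof -
    let ?S = "simple_extension K x"
    have xc: "x \<in> carrier L" using x Mc by blast
    note S = simple_ext_subfield[OF subfield_axioms subset_refl xc]
    have alg: "(algebraic over K) x" using algebraic_over xc by blast
    have I: "Irr K x \<in> carrier (K[X])" using IrrE(1)[OF subfield_axioms xc alg] .
    have mapI: "map (restrict id K) (Irr K x) = Irr K x" using poly_coeffs_subset[OF I] by (intro map_idI) auto
    have finS: "finite (Emb ?S)" using finite_Emb_simple[OF subfield_axioms subset_refl xc] by (simp add: Emb_base)
    have "card (Emb ?S) = card (Sigma (Emb K) (\<lambda>\<theta>. {y. is_root (map \<theta> (Irr K x)) y}))"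
      using bij_betw_same_card[OF Emb_simple_bij[OF subfield_axioms subset_refl xc]] .
    also have "Sigma (Emb K) (\<lambda>\<theta>. {y. is_root (map \<theta> (Irr K x)) y}) = {restrict id K} \<times> {y. is_root (Irr K x) y}"
      using mapI by (auto simp: Emb_base)
    also have "card \<dots> = card {y. is_root (Irr K x) y}" by (simp add: card_cartesian_product)
    finally have cS: "card (Emb ?S) = card {y. is_root (Irr K x) y}" .
    have SM: "?S \<subseteq> M"
      using simple_extension_subring_incl[of M K x] subfieldE(1)[OF sM(1)] sM(2) x by blast
    \<comment> \<open>The same list generates M over K(x), so the chain over K can be counted there
      as well.\<close>
    have feS: "finite_extension ?S rs = M"
    proof
      show "finite_extension ?S rs \<subseteq> M"
        using fe_minimal[OF S(1) rs(1) subfieldE(1)[OF sM(1)] SM] M fe_subfield(3)[OF subfield_axioms subset_refl rs(1)] by blast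
      show "M \<subseteq> finite_extension ?S rs" unfolding M by (rule mono_finite_extension[OF S(2)])
    qed
    obtain m where m: "m > 0" "dimension m ?S M" "card (Emb M) = card (Emb ?S) * m"
      "\<forall>\<theta>\<in>Emb ?S. \<exists>\<theta>'\<in>Emb M. \<forall>x\<in>?S. \<theta>' x = \<theta> x"
      using chain_count[OF S(1,2) finS rs(1) sep_chain_mono[OF subfield_axioms S(1) subset_refl S(2) rs]]
      unfolding feS by blast
    have "dimension (degree (Irr K x) * m) K M"
      using telescopic_base[OF subfield_axioms S(1) dimension_simple_extension[OF subfield_axioms xc alg] m(2)] .
    then have "degree (Irr K x) * m = n" using dimension_is_inj[OF subfield_axioms _ n(1)] by blast
    then have "simple_roots (Irr K x)" using m(1,3) n(3) cS by (simp add: simple_roots_def)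
    \<comment> \<open>The embedding of K(x) with x |-> y extends to M, and M is stable under its
      embeddings.\<close>
    moreover have "y \<in> M" if y: "is_root (Irr K x) y" for y
    proof -
      have "restrict id K \<in> Emb K" by (simp add: Emb_base)
      moreover have "y \<in> carrier L" "eval (map (restrict id K) (Irr K x)) y = \<zero>"
        using y mapI by (auto simp: is_root_def)
      ultimately obtain \<theta> where th: "\<theta> \<in> Emb ?S" "\<theta> x = y"
        using Emb_extend[OF subfield_axioms subset_refl _ xc] by blast
      obtain \<theta>' where th': "\<theta>' \<in> Emb M" "\<forall>x\<in>?S. \<theta>' x = \<theta> x" using bspec[OF m(4) th(1)] by blast
      have "\<theta>' x = y" using bspec[OF th'(2) S(3)] th(2) by simp
      then show ?thesis using st[OF th'(1)] x by blast
    qed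
    ultimately show ?thesis by blast
  qed
  have Ic: "Irr K x \<in> carrier (poly_ring L)" if "x \<in> M" for x
    using IrrE(1)[OF subfield_axioms, of x] algebraic_over[OF subset_refl, of x] that Mc
      poly_carrier_mono[OF subfieldE(3)[OF subfield_axioms]] by blast
  have "normal_ext L K M" unfolding normal_ext_def
    using key roots_mem_iff_is_root[OF Ic] by blast
  moreover have "separable_ext L K M" unfolding separable_ext_def
    using key simple_roots_iff[OF Ic] by blast
  ultimately show "finite_galois_ext L K M"
    unfolding finite_galois_ext_def using sM finite_dimensionI[OF n(1)] by blast
qed

text \<open>A basis as a vector space also generates the field, and it provides the finite list on
  which the tower argument runs.\<close>

lemma galois_generators:
  assumes "finite_galois_ext L K M"
  obtains rs where "set rs \<subseteq> M" "M = finite_extension K rs"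
proof -
  have sM: "subfield M L" "K \<subseteq> M" "finite_dimension K M" using assms by (auto simp: finite_galois_ext_def)
  obtain n where "dimension n K M" using sM(3) by auto
  then obtain rs where rs: "set rs \<subseteq> carrier L" "Span K rs = M"
    using exists_base[OF subfield_axioms] by blast
  have rsM: "set rs \<subseteq> M" using Span_base_incl[OF subfield_axioms rs(1)] rs(2) by simp
  have "M \<subseteq> finite_extension K rs"
  proof -
    note f = fe_subfield[OF subfield_axioms subset_refl rs(1)]
    note sr = subringE[OF subfieldE(1)[OF f(1)]]
    have "Span K rs \<subseteq> finite_extension K rs"
    proof (rule subalgebra_Span_incl[OF subfield_axioms _ f(3)])
      show "subalgebra K (finite_extension K rs) L"
        using subring.axioms(1)[OF subfieldE(1)[OF f(1)]] sr(6) f(4)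
        by (intro subalgebra.intro subalgebra_axioms.intro) auto
    qed
    then show ?thesis using rs by simp
  qed
  moreover have "finite_extension K rs \<subseteq> M"
    using fe_minimal[OF subfield_axioms rs(1) subfieldE(1)[OF sM(1)] sM(2) rsM] .
  ultimately show thesis using that rsM by blast
qed

lemma galois_Emb_root:
  assumes M: "subfield M L" "K \<subseteq> M" and th: "\<theta> \<in> Emb M" and x: "x \<in> M"
  shows "is_root (Irr K x) (\<theta> x)"
proof -
  have xc: "x \<in> carrier L" using x subfieldE(3)[OF M(1)] by blast
  note I = IrrE[OF subfield_axioms xc algebraic_over[OF subset_refl xc]]
  have I': "Irr K x \<in> carrier (M[X])" using I(1) poly_carrier_mono[OF M(2)] by blast
  have "map \<theta> (Irr K x) = Irr K x"
    using poly_coeffs_subset[OF I(1)] th by (intro map_idI) (auto simp: Emb_def)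
  then have "eval (Irr K x) (\<theta> x) = \<zero>"
    using Emb_eval[OF M(1) th I' x] I(4) Emb_simps(5)[OF M(1) th] by (simp only:)
  then show ?thesis
    using Emb_simps(1)[OF M(1) th x] Irr_degree_pos(2)[OF subfield_axioms subset_refl xc] by (simp add: is_root_def)
qed

lemma galois_separable: "finite_galois_ext L K M \<Longrightarrow> x \<in> M \<Longrightarrow> alg_mult (Irr K x) y \<le> 1"
  by (simp add: finite_galois_ext_def separable_ext_def)

lemma galois_normal:
  assumes "finite_galois_ext L K M" "x \<in> M" "is_root (Irr K x) y" shows "y \<in> M"
proof -
  have xc: "x \<in> carrier L" using assms subfieldE(3) by (auto simp: finite_galois_ext_def)
  have "Irr K x \<in> carrier (poly_ring L)"
    using IrrE(1)[OF subfield_axioms xc algebraic_over[OF subset_refl xc]]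
      poly_carrier_mono[OF subfieldE(3)[OF subfield_axioms]] by blast
  then have "y \<in># roots (Irr K x)" using assms(3) roots_mem_iff_is_root by simp
  then show ?thesis using assms(1,2) unfolding finite_galois_ext_def normal_ext_def by blast
qed

lemma sep_chain_separable:
  assumes "subfield M L" "K \<subseteq> M" "set rs \<subseteq> carrier L" "\<And>r y. r \<in> set rs \<Longrightarrow> alg_mult (Irr K r) y \<le> 1"
  shows "sep_chain M rs"
  using assms(3,4)
proof (induction rs)
  case (Cons r rs)
  then show ?case using fe_subfield[OF assms(1,2), of rs] sep_stepI_separable by simp
qed simp

text \<open>The criterion applies to every finite Galois extension: separability makes its
  generators a chain, and normality keeps their conjugates inside M.\<close>

lemma galois_props:
  assumes "finite_galois_ext L K M"
  shows "carrier (gal L K M) = Emb M" "finite (Emb M)" "dimension (card (Emb M)) K M"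
    "\<And>\<theta>. \<theta> \<in> Emb M \<Longrightarrow> \<theta> ` M \<subseteq> M"
proof -
  obtain rs where rs: "set rs \<subseteq> M" "M = finite_extension K rs" using galois_generators[OF assms] .
  have sM: "subfield M L" "K \<subseteq> M" using assms by (auto simp: finite_galois_ext_def)
  have rc: "set rs \<subseteq> carrier L" using rs subfieldE(3)[OF sM(1)] by blast
  have "sep_chain K rs"
    using galois_separable[OF assms] rs(1) by (intro sep_chain_separable[OF subfield_axioms subset_refl rc]) blast
  moreover have "\<theta> r \<in> M" if "\<theta> \<in> Emb M" "r \<in> set rs" for \<theta> r
    using galois_normal[OF assms] galois_Emb_root[OF sM that(1)] that rs(1) by blast
  ultimately show "carrier (gal L K M) = Emb M" "finite (Emb M)" "dimension (card (Emb M)) K M"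
    "\<And>\<theta>. \<theta> \<in> Emb M \<Longrightarrow> \<theta> ` M \<subseteq> M" using finite_galois_criterion[OF rc _ rs(2)] by blast+
qed

end


text \<open>A prime q other than p dividing the order would, by Sylow's theorem with exponent 1,
  yield a subgroup of order q, whose nontrivial elements cannot have p-power order.\<close>

lemma (in group) p_power_order:
  assumes fin: "finite (carrier G)" and p: "prime (p::nat)"
    and tors: "\<And>h. h \<in> carrier G \<Longrightarrow> \<exists>m::nat. h [^] (p ^ m) = \<one>"
  shows "\<exists>k. order G = p ^ k"
proof -
  have pos: "order G > 0" using fin order_gt_0_iff_finite by blast
  have only_p: "q = p" if q: "prime q" "q dvd order G" for q
  proof (rule ccontr)
    assume "q \<noteq> p"
    obtain m where m: "order G = q ^ 1 * m" using q(2) by (auto elim: dvdE)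
    obtain H where H: "subgroup H G" "card H = q ^ 1"
      using sylow_thm[OF q(1) group_axioms m fin] by blast
    then have "card H > 1" using prime_gt_1_nat[OF q(1)] by simp
    then obtain x where x: "x \<in> H" "x \<noteq> \<one>"
      by (metis (mono_tags, lifting) card.empty card_insert_disjoint finite.emptyI empty_iff insert_iff
          is_singletonI' is_singleton_altdef less_irrefl not_less_zero)
    have xc: "x \<in> carrier G" using subgroup.mem_carrier[OF H(1) x(1)] .
    interpret H: group "G\<lparr>carrier := H\<rparr>" using subgroup.subgroup_is_group[OF H(1)] group_axioms by blast
    have "x [^]\<^bsub>G\<lparr>carrier := H\<rparr>\<^esub> q = \<one>" using H.pow_order_eq_1[of x] x(1) H(2) by (simp add: order_def)
    then have "x [^] q = \<one>" by (simp add: nat_pow_consistent[symmetric])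
    then have "ord x dvd q" using pow_eq_id[OF xc] by blast
    moreover obtain n where "x [^] (p ^ n) = \<one>" using tors[OF xc] by blast
    then have "ord x dvd p ^ n" using pow_eq_id[OF xc] by blast
    moreover have "coprime q (p ^ n)" using \<open>q \<noteq> p\<close> q(1) p by (simp add: primes_coprime coprime_power_right_iff)
    ultimately have "ord x = 1" by (metis coprime_common_divisor_nat nat_dvd_1_iff_1)
    then show False using pow_ord_eq_1[OF xc] x(2) xc by simp
  qed
  have "p \<noteq> 0" "\<not> is_unit p" using p prime_gt_1_nat by auto
  then obtain y where y: "order G = p ^ multiplicity p (order G) * y" "\<not> p dvd y"
    using multiplicity_decompose'[of "order G" p] pos by auto
  have "y = 1"
  proof (rule ccontr)
    assume "y \<noteq> 1"
    then obtain q where "prime q" "q dvd y" using prime_factor_nat by blast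
    then show False using only_p y by (metis dvd_mult)
  qed
  then show ?thesis using y by auto
qed

lemma (in domain) nat_pow_nonzero: "x \<in> carrier R \<Longrightarrow> x \<noteq> \<zero> \<Longrightarrow> x [^] (n::nat) \<noteq> \<zero>"
  by (induction n) (auto simp: integral_iff)

context algebraic_closure
begin

subsection \<open>The group \<open>gal\<close>\<close>

lemma gal_mem_iff: "\<rho> \<in> carrier (gal L K E) \<longleftrightarrow>
    \<rho> \<in> Bij E \<and> \<rho> \<in> ring_hom (L\<lparr>carrier := E\<rparr>) (L\<lparr>carrier := E\<rparr>) \<and> (\<forall>x\<in>K. \<rho> x = x)"
  by (simp add: gal_def)

lemma gal_group:
  assumes E: "subfield E L" "K \<subseteq> E"
  shows "group (gal L K E)"
proof -
  interpret B: group "BijGroup E" by (rule group_BijGroup)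
  let ?E = "L\<lparr>carrier := E\<rparr>"
  let ?H = "carrier (gal L K E)"
  note sr = subringE[OF subfieldE(1)[OF E(1)]]
  have bm: "\<rho> \<otimes>\<^bsub>BijGroup E\<^esub> \<tau> = compose E \<rho> \<tau>" if "\<rho> \<in> Bij E" "\<tau> \<in> Bij E" for \<rho> \<tau>
    using that by (simp add: BijGroup_def)
  have "subgroup ?H (BijGroup E)"
  proof (rule B.subgroupI)
    show "?H \<subseteq> carrier (BijGroup E)" by (auto simp: gal_def BijGroup_def)
    have "(\<lambda>x\<in>E. x) \<in> ring_hom ?E ?E" using sr by (intro ring_hom_memI) auto
    then have "(\<lambda>x\<in>E. x) \<in> ?H" using E id_Bij by (auto simp: gal_mem_iff)
    then show "?H \<noteq> {}" by blast
    show "\<rho> \<otimes>\<^bsub>BijGroup E\<^esub> \<tau> \<in> ?H" if "\<rho> \<in> ?H" "\<tau> \<in> ?H" for \<rho> \<tau>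
    proof -
      have s: "\<rho> \<in> Bij E" "\<tau> \<in> Bij E" "\<rho> \<in> ring_hom ?E ?E" "\<tau> \<in> ring_hom ?E ?E"
        "\<forall>x\<in>K. \<rho> x = x" "\<forall>x\<in>K. \<tau> x = x" using that by (auto simp: gal_mem_iff)
      have "compose E \<rho> \<tau> \<in> ring_hom ?E ?E"
        using s sr ring_hom_closed[OF s(4)] ring_hom_closed[OF s(3)]
          ring_hom_mult[OF s(4)] ring_hom_mult[OF s(3)] ring_hom_add[OF s(4)] ring_hom_add[OF s(3)]
          ring_hom_one[OF s(4)] ring_hom_one[OF s(3)]
        by (intro ring_hom_memI) (auto simp: compose_def)
      moreover have "compose E \<rho> \<tau> x = x" if "x \<in> K" for x
        using s(5,6) that E(2) by (auto simp: compose_def)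
      ultimately show ?thesis using s bm compose_Bij[OF s(1,2)] by (simp add: gal_mem_iff)
    qed
    show "inv\<^bsub>BijGroup E\<^esub> \<rho> \<in> ?H" if "\<rho> \<in> ?H" for \<rho>
    proof -
      have s: "\<rho> \<in> Bij E" "\<rho> \<in> ring_hom ?E ?E" "\<forall>x\<in>K. \<rho> x = x" using that by (auto simp: gal_mem_iff)
      define \<tau> where "\<tau> = (\<lambda>x\<in>E. (inv_into E \<rho>) x)"
      have t: "\<tau> \<in> Bij E" using restrict_inv_into_Bij[OF s(1)] by (simp add: \<tau>_def)
      have "\<tau> \<otimes>\<^bsub>BijGroup E\<^esub> \<rho> = \<one>\<^bsub>BijGroup E\<^esub>"
        using bm[OF t s(1)] Bij_compose_restrict_eq[OF s(1)] by (simp add: BijGroup_def \<tau>_def)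
      then have i: "inv\<^bsub>BijGroup E\<^esub> \<rho> = \<tau>"
        using B.inv_equality[of \<tau> \<rho>] s(1) t by (simp add: BijGroup_def)
      have bij: "bij_betw \<rho> E E" using s(1) by (simp add: Bij_def)
      have img: "\<And>y. y \<in> E \<Longrightarrow> \<exists>x\<in>E. y = \<rho> x" using bij by (auto simp: bij_betw_def)
      have ts: "\<tau> (\<rho> x) = x" if "x \<in> E" for x
        using that bij ring_hom_closed[OF s(2)] by (auto simp: bij_betw_def \<tau>_def)
      have "\<tau> \<in> ring_hom ?E ?E"
      proof (rule ring_hom_memI)
        fix u v assume "u \<in> carrier ?E" "v \<in> carrier ?E"
        then have uv: "u \<in> E" "v \<in> E" by auto
        obtain x where x: "x \<in> E" "u = \<rho> x" using img[OF uv(1)] by blast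
        obtain y where y: "y \<in> E" "v = \<rho> y" using img[OF uv(2)] by blast
        note xy = x y
        show "\<tau> u \<in> carrier ?E" using xy ts[OF xy(1)] by simp
        have "\<rho> (x \<otimes> y) = u \<otimes> v" "\<rho> (x \<oplus> y) = u \<oplus> v"
          using ring_hom_mult[OF s(2), of x y] ring_hom_add[OF s(2), of x y] xy by auto
        then have "\<tau> (u \<otimes> v) = x \<otimes> y" "\<tau> (u \<oplus> v) = x \<oplus> y"
          using ts[OF sr(6)[OF xy(1,3)]] ts[OF sr(7)[OF xy(1,3)]] by simp_all
        then show "\<tau> (u \<otimes>\<^bsub>?E\<^esub> v) = \<tau> u \<otimes>\<^bsub>?E\<^esub> \<tau> v" "\<tau> (u \<oplus>\<^bsub>?E\<^esub> v) = \<tau> u \<oplus>\<^bsub>?E\<^esub> \<tau> v"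
          using ts[OF xy(1)] ts[OF xy(3)] xy(2,4) by simp_all
      next
        have "\<rho> \<one> = \<one>" using ring_hom_one[OF s(2)] by simp
        then show "\<tau> \<one>\<^bsub>?E\<^esub> = \<one>\<^bsub>?E\<^esub>" using ts[OF sr(3)] by simp
      qed
      moreover have "\<tau> x = x" if "x \<in> K" for x using ts[of x] s(3) that E(2) by (metis subsetD)
      ultimately show ?thesis unfolding i using t by (simp add: gal_mem_iff)
    qed
  qed
  then show ?thesis using subgroup.subgroup_is_group[OF _ group_BijGroup] unfolding gal_def by force
qed

end

locale galois_setting = algebraic_closure +
  fixes E assumes E: "subfield E L" "K \<subseteq> E"
begin

abbreviation G where "G \<equiv> gal L K E"

sublocale G: group G using gal_group[OF E] .

lemma Ec: "E \<subseteq> carrier L" using subfieldE(3)[OF E(1)] .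

lemmas E_subring = subringE[OF subfieldE(1)[OF E(1)]]

lemma gal_bij: "\<rho> \<in> carrier G \<Longrightarrow> bij_betw \<rho> E E"
  by (simp add: gal_mem_iff Bij_def)

lemma gal_simps:
  assumes s: "\<rho> \<in> carrier G"
  shows "x \<in> E \<Longrightarrow> \<rho> x \<in> E" "x \<in> E \<Longrightarrow> y \<in> E \<Longrightarrow> \<rho> (x \<otimes> y) = \<rho> x \<otimes> \<rho> y"
    "x \<in> E \<Longrightarrow> y \<in> E \<Longrightarrow> \<rho> (x \<oplus> y) = \<rho> x \<oplus> \<rho> y" "\<rho> \<one> = \<one>" "\<rho> \<zero> = \<zero>" "x \<in> K \<Longrightarrow> \<rho> x = x"
    "x \<in> E \<Longrightarrow> \<rho> (x [^] (n::nat)) = \<rho> x [^] n"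
proof -
  have h: "\<rho> \<in> ring_hom (L\<lparr>carrier := E\<rparr>) (L\<lparr>carrier := E\<rparr>)" using s by (simp add: gal_mem_iff)
  show 1: "\<And>x. x \<in> E \<Longrightarrow> \<rho> x \<in> E" using ring_hom_closed[OF h] by simp
  show 2: "\<And>x y. x \<in> E \<Longrightarrow> y \<in> E \<Longrightarrow> \<rho> (x \<otimes> y) = \<rho> x \<otimes> \<rho> y" using ring_hom_mult[OF h] by simp
  show 3: "\<And>x y. x \<in> E \<Longrightarrow> y \<in> E \<Longrightarrow> \<rho> (x \<oplus> y) = \<rho> x \<oplus> \<rho> y" using ring_hom_add[OF h] by simp
  show 4: "\<rho> \<one> = \<one>" using ring_hom_one[OF h] by simp
  show "x \<in> K \<Longrightarrow> \<rho> x = x" using s by (simp add: gal_mem_iff)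
  have "\<zero> \<in> K" using subringE(2)[OF subfieldE(1)[OF subfield_axioms]] .
  then show "\<rho> \<zero> = \<zero>" using s by (simp add: gal_mem_iff)
  show "\<rho> (x [^] (n::nat)) = \<rho> x [^] n" if x: "x \<in> E"
  proof (induction n)
    case (Suc n)
    have "x [^] n \<in> E" using x E_subring by (induction n) auto
    then show ?case using Suc 2 x by simp
  qed (simp add: 4)
qed

lemma gal_mult: "\<rho> \<in> carrier G \<Longrightarrow> \<tau> \<in> carrier G \<Longrightarrow> x \<in> E \<Longrightarrow> (\<rho> \<otimes>\<^bsub>G\<^esub> \<tau>) x = \<rho> (\<tau> x)"
  by (simp add: gal_def BijGroup_def compose_def)

lemma gal_one: "x \<in> E \<Longrightarrow> \<one>\<^bsub>G\<^esub> x = x"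
  by (simp add: gal_def BijGroup_def)

lemma gal_inv:
  assumes s: "\<rho> \<in> carrier G" and x: "x \<in> E"
  shows "(inv\<^bsub>G\<^esub> \<rho>) (\<rho> x) = x" "\<rho> ((inv\<^bsub>G\<^esub> \<rho>) x) = x"
  using gal_mult[OF G.inv_closed[OF s] s x] gal_mult[OF s G.inv_closed[OF s] x] G.l_inv[OF s] G.r_inv[OF s] gal_one[OF x]
  by auto

lemma gal_eqI:
  assumes "\<rho> \<in> carrier G" "\<tau> \<in> carrier G" "\<And>x. x \<in> E \<Longrightarrow> \<rho> x = \<tau> x"
  shows "\<rho> = \<tau>"
  using assms by (intro extensionalityI[of _ E]) (auto simp: gal_mem_iff Bij_def)

lemma gal_pow: "\<rho> \<in> carrier G \<Longrightarrow> x \<in> E \<Longrightarrow> (\<rho> [^]\<^bsub>G\<^esub> (n::nat)) x = (\<rho> ^^ n) x"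
proof (induction n arbitrary: x)
  case (Suc n)
  then show ?case using gal_mult gal_simps(1) by (simp add: funpow_swap1)
qed (simp add: gal_one)

lemma gal_funpow_closed: "\<rho> \<in> carrier G \<Longrightarrow> x \<in> E \<Longrightarrow> (\<rho> ^^ n) x \<in> E"
  by (induction n) (auto simp: gal_simps)

lemma gal_inj: "\<rho> \<in> carrier G \<Longrightarrow> x \<in> E \<Longrightarrow> y \<in> E \<Longrightarrow> \<rho> x = \<rho> y \<longleftrightarrow> x = y"
  using gal_bij by (auto simp: bij_betw_def inj_on_def)

end

context algebraic_closure
begin

subsection \<open>Galois extensions of prime power degree\<close>

definition p_ext :: "nat \<Rightarrow> 'a set \<Rightarrow> bool" where
  "p_ext p M \<longleftrightarrow> finite_galois_ext L K M \<and> (\<exists>k. dimension (p ^ k) K M)"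

lemma galois_setting: "finite_galois_ext L K M \<Longrightarrow> galois_setting L K M"
  using algebraic_closure_axioms
  unfolding galois_setting_def galois_setting_axioms_def finite_galois_ext_def by blast

lemma Emb_fixed_subring:
  assumes M: "subfield M L" and th: "\<theta> \<in> Emb M"
  shows "subring {u \<in> M. \<theta> u = u} L"
proof (rule subringI)
  note sr = subringE[OF subfieldE(1)[OF M]]
  show "{u \<in> M. \<theta> u = u} \<subseteq> carrier L" using sr(1) by blast
  show "\<one> \<in> {u \<in> M. \<theta> u = u}" using sr(3) Emb_simps(4)[OF M th] by simp
  show "\<ominus> h \<in> {u \<in> M. \<theta> u = u}" if "h \<in> {u \<in> M. \<theta> u = u}" for h
    using that sr(5) Emb_simps(7)[OF M th] by simp
  show "h1 \<otimes> h2 \<in> {u \<in> M. \<theta> u = u}" "h1 \<oplus> h2 \<in> {u \<in> M. \<theta> u = u}"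
    if "h1 \<in> {u \<in> M. \<theta> u = u}" "h2 \<in> {u \<in> M. \<theta> u = u}" for h1 h2
    using that sr(6,7) Emb_simps(2,3)[OF M th] by simp_all
qed

text \<open>The degree is the order of the Galois group, so it is enough that one power of p kills
  every automorphism on the generators. This replaces degree computations for composites and root
  extensions.\<close>

lemma p_extI:
  assumes gal: "finite_galois_ext L K M" and rs: "M = finite_extension K rs" "set rs \<subseteq> M" and p: "prime p"
    and tors: "\<And>\<theta> r. \<theta> \<in> Emb M \<Longrightarrow> r \<in> set rs \<Longrightarrow> (\<theta> ^^ (p ^ m)) r = r"
  shows "p_ext p M"
proof -
  interpret M: galois_setting L K M using galois_setting[OF gal] .
  note pr = galois_props[OF gal]
  have rc: "set rs \<subseteq> carrier L" using rs M.Ec by blast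
  have "\<theta> [^]\<^bsub>M.G\<^esub> (p ^ m) = \<one>\<^bsub>M.G\<^esub>" if th: "\<theta> \<in> carrier M.G" for \<theta>
  proof -
    let ?\<psi> = "\<theta> [^]\<^bsub>M.G\<^esub> (p ^ m)"
    have psi: "?\<psi> \<in> carrier M.G" "?\<psi> \<in> Emb M" using th pr(1) by auto
    note s = Emb_simps[OF M.E(1) psi(2)]
    have "subring {u \<in> M. ?\<psi> u = u} L"
      by (rule Emb_fixed_subring[OF M.E(1) psi(2)])
    moreover have "K \<subseteq> {u \<in> M. ?\<psi> u = u}" using M.E(2) s(6) by (simp add: subset_iff)
    moreover have "set rs \<subseteq> {u \<in> M. ?\<psi> u = u}"
    proof
      fix r assume r: "r \<in> set rs"
      then have "r \<in> M" using rs by blast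
      then have "?\<psi> r = (\<theta> ^^ (p ^ m)) r" using M.gal_pow[OF th] by blast
      also have "\<dots> = r" using tors[OF _ r] th pr(1) by blast
      finally show "r \<in> {u \<in> M. ?\<psi> u = u}" using \<open>r \<in> M\<close> by blast
    qed
    ultimately have "M \<subseteq> {u \<in> M. ?\<psi> u = u}"
      using fe_minimal[OF subfield_axioms rc] rs(1) by blast
    then show ?thesis using psi M.gal_one by (intro M.gal_eqI) auto
  qed
  then obtain k where "order M.G = p ^ k"
    using M.G.p_power_order[OF _ p] pr(1,2) by auto
  then show ?thesis using gal pr by (auto simp: p_ext_def order_def)
qed

lemma Emb_restrict_galois:
  assumes gal: "finite_galois_ext L K M1" and M: "subfield M L" "M1 \<subseteq> M" and th: "\<theta> \<in> Emb M"
  shows "restrict \<theta> M1 \<in> Emb M1" "x \<in> M1 \<Longrightarrow> \<theta> x \<in> M1"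
proof -
  interpret M: galois_setting L K M1 using galois_setting[OF gal] .
  show 1: "restrict \<theta> M1 \<in> Emb M1" using Emb_restrict[OF M(1) M.E(1) M(2) th M.E(2)] .
  show "\<theta> x \<in> M1" if "x \<in> M1" using galois_props(4)[OF gal 1] that by auto
qed

text \<open>Lagrange's theorem in the Galois group of M1. The exponent is stated for embeddings of
  any larger field, so that it can be used inside a compositum or a root extension.\<close>

lemma p_ext_torsion:
  assumes "p_ext p M1"
  obtains k where "\<And>M \<theta> x. \<lbrakk>subfield M L; M1 \<subseteq> M; \<theta> \<in> Emb M; x \<in> M1\<rbrakk> \<Longrightarrow> (\<theta> ^^ (p ^ k)) x = x"
proof -
  obtain k where gal: "finite_galois_ext L K M1" and k: "dimension (p ^ k) K M1" using assms by (auto simp: p_ext_def)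
  interpret M: galois_setting L K M1 using galois_setting[OF gal] .
  note pr = galois_props[OF gal]
  have ord: "order M.G = p ^ k" using dimension_is_inj[OF subfield_axioms pr(3) k] pr(1) by (simp add: order_def)
  have "(\<theta> ^^ (p ^ k)) x = x" if a: "subfield M L" "M1 \<subseteq> M" "\<theta> \<in> Emb M" "x \<in> M1" for M \<theta> x
  proof -
    note r = Emb_restrict_galois[OF gal a(1-3)]
    have rg: "restrict \<theta> M1 \<in> carrier M.G" using r(1) pr(1) by simp
    have "(restrict \<theta> M1 ^^ n) x = (\<theta> ^^ n) x \<and> (\<theta> ^^ n) x \<in> M1" for n
      using a(4) r(2) by (induction n) auto
    then have "(\<theta> ^^ (p ^ k)) x = (restrict \<theta> M1 [^]\<^bsub>M.G\<^esub> (p ^ k)) x" using M.gal_pow[OF rg a(4)] by simp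
    also have "\<dots> = x" using M.G.pow_order_eq_1[OF rg] ord M.gal_one[OF a(4)] by simp
    finally show ?thesis .
  qed
  then show thesis using that by blast
qed

lemma p_ext_base: "prime p \<Longrightarrow> p_ext p K"
proof -
  assume p: "prime p"
  have e: "K = finite_extension K []" by simp
  have "finite_galois_ext L K K"
    by (rule finite_galois_criterion(1)[of "[]"]) auto
  then show ?thesis by (rule p_extI[OF _ e _ p]) auto
qed

lemma funpow_fix: "(f ^^ a) x = x \<Longrightarrow> (f ^^ (a * b)) x = x"
  by (induction b) (auto simp: funpow_add mult.commute)

text \<open>The generators of both fields are joined; adding the exponents gives one power of p that
  serves both kinds.\<close>

lemma p_ext_compositum:
  assumes p: "prime p" and "p_ext p M1" "p_ext p M2"
  obtains M where "p_ext p M" "M1 \<subseteq> M" "M2 \<subseteq> M"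
proof -
  have g: "finite_galois_ext L K M1" "finite_galois_ext L K M2" using assms by (auto simp: p_ext_def)
  interpret M1: galois_setting L K M1 using galois_setting[OF g(1)] .
  interpret M2: galois_setting L K M2 using galois_setting[OF g(2)] .
  obtain rs1 where rs1: "set rs1 \<subseteq> M1" "M1 = finite_extension K rs1" using galois_generators[OF g(1)] .
  obtain rs2 where rs2: "set rs2 \<subseteq> M2" "M2 = finite_extension K rs2" using galois_generators[OF g(2)] .
  define rs where "rs = rs1 @ rs2"
  define M where "M = finite_extension K rs"
  have rc: "set rs \<subseteq> carrier L" "set rs1 \<subseteq> carrier L" "set rs2 \<subseteq> carrier L"
    using rs1 rs2 M1.Ec M2.Ec by (auto simp: rs_def)
  note f = fe_subfield[OF subfield_axioms subset_refl rc(1), folded M_def]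
  have sub: "M1 \<subseteq> M" "M2 \<subseteq> M"
    unfolding rs1(2) rs2(2)
    using fe_minimal[OF subfield_axioms rc(2) subfieldE(1)[OF f(1)] f(4)]
      fe_minimal[OF subfield_axioms rc(3) subfieldE(1)[OF f(1)] f(4)] f(3) by (auto simp: rs_def)
  have "sep_chain K rs"
    using galois_separable[OF g(1)] galois_separable[OF g(2)] rs1(1) rs2(1)
    by (intro sep_chain_separable[OF subfield_axioms subset_refl rc(1)]) (auto simp: rs_def)
  moreover have "\<theta> r \<in> M" if "\<theta> \<in> Emb M" "r \<in> set rs" for \<theta> r
    using Emb_restrict_galois(2)[OF g(1) f(1) sub(1) that(1)] Emb_restrict_galois(2)[OF g(2) f(1) sub(2) that(1)]
      that(2) rs1(1) rs2(1) sub unfolding rs_def set_append by blast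
  ultimately have gal: "finite_galois_ext L K M"
    using finite_galois_criterion(1)[OF rc(1) _ M_def] by blast
  obtain k1 where k1: "\<And>M \<theta> x. \<lbrakk>subfield M L; M1 \<subseteq> M; \<theta> \<in> Emb M; x \<in> M1\<rbrakk> \<Longrightarrow> (\<theta> ^^ (p ^ k1)) x = x"
    using p_ext_torsion[OF assms(2)] by blast
  obtain k2 where k2: "\<And>M \<theta> x. \<lbrakk>subfield M L; M2 \<subseteq> M; \<theta> \<in> Emb M; x \<in> M2\<rbrakk> \<Longrightarrow> (\<theta> ^^ (p ^ k2)) x = x"
    using p_ext_torsion[OF assms(3)] by blast
  have "(\<theta> ^^ (p ^ (k1 + k2))) r = r" if "\<theta> \<in> Emb M" "r \<in> set rs" for \<theta> r
  proof -
    have "r \<in> M1 \<or> r \<in> M2" using that(2) rs1(1) rs2(1) by (auto simp: rs_def)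
    then show ?thesis
    proof
      assume "r \<in> M1"
      then show ?thesis using funpow_fix[OF k1[OF f(1) sub(1) that(1)]] by (simp add: power_add)
    next
      assume "r \<in> M2"
      then show ?thesis using funpow_fix[OF k2[OF f(1) sub(2) that(1)], of r "p ^ k1"] by (simp add: power_add mult.commute)
    qed
  qed
  then have "p_ext p M" by (rule p_extI[OF gal M_def f(3) p])
  then show thesis using that sub by blast
qed

subsection \<open>Adjoining \<open>p\<close>-th roots\<close>

definition kummer_poly :: "nat \<Rightarrow> 'a \<Rightarrow> 'a list" where
  "kummer_poly p c = \<one> # replicate (p - 1) \<zero> @ [\<ominus> c]"

lemma eval_kummer_poly:
  assumes "p > (0::nat)" "c \<in> carrier L" "y \<in> carrier L"
  shows "eval (kummer_poly p c) y = y [^] p \<ominus> c"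
proof -
  have "eval (replicate n \<zero> @ [\<ominus> c]) y = \<ominus> c" for n
    using assms by (induction n) auto
  then show ?thesis using assms by (simp add: kummer_poly_def minus_eq)
qed

lemma kummer_poly_carrier:
  assumes "subfield M L" "c \<in> M" shows "kummer_poly p c \<in> carrier (M[X])"
  using subringE[OF subfieldE(1)[OF assms(1)]] assms(2)
  by (auto simp: kummer_poly_def univ_poly_carrier[symmetric] polynomial_def)

lemma kummer_poly_degree: "p > 0 \<Longrightarrow> degree (kummer_poly p c) = p" "kummer_poly p c \<noteq> []"
  by (auto simp: kummer_poly_def)

lemma exists_root:
  assumes "p > (0::nat)" "c \<in> carrier L" obtains y where "y \<in> carrier L" "y [^] p = c"
proof -
  have P: "kummer_poly p c \<in> carrier (poly_ring L)"
    using kummer_poly_carrier[OF carrier_is_subfield assms(2)] .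
  have "size (roots (kummer_poly p c)) = p"
    using roots_over_carrier[OF P] kummer_poly_degree(1)[OF assms(1)] by (simp add: splitted_def)
  then obtain y where "y \<in># roots (kummer_poly p c)" using assms(1) by (metis multiset_nonemptyE size_empty less_irrefl)
  then have "is_root (kummer_poly p c) y" using roots_mem_iff_is_root[OF P] by simp
  then have "y \<in> carrier L" "y [^] p \<ominus> c = \<zero>" using eval_kummer_poly[OF assms] by (auto simp: is_root_def)
  then show thesis using that assms(2) by auto
qed

end

section \<open>Kummer extensions over a field with a primitive p-th root of unity\<close>

locale kummer_closure = algebraic_closure +
  fixes p :: nat and \<xi>
  assumes p: "prime p" and xi: "\<xi> \<in> K" and prim: "primitive_root_of_unity L p \<xi>"
begin

lemma p0: "p > 0" and p1: "p > 1" using prime_gt_1_nat[OF p] by auto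

lemma xi_carrier: "\<xi> \<in> carrier L" and xi_pow_p: "\<xi> [^] p = \<one>"
  using prim by (auto simp: primitive_root_of_unity_def)

lemma xi_nonzero: "\<xi> \<noteq> \<zero>"
proof
  assume "\<xi> = \<zero>"
  then have "\<xi> [^] p = \<zero>" using p0 by (simp add: nat_pow_zero)
  then show False using xi_pow_p by simp
qed

lemma xi_pow_nonzero: "\<xi> [^] (i::nat) \<noteq> \<zero>"
  using xi_carrier xi_nonzero nat_pow_nonzero by blast

lemma xi_pow_mod: "\<xi> [^] (i::nat) = \<xi> [^] (i mod p)"
proof -
  have "\<xi> [^] i = \<xi> [^] (p * (i div p) + i mod p)" by simp
  also have "\<dots> = (\<xi> [^] p) [^] (i div p) \<otimes> \<xi> [^] (i mod p)"
    using xi_carrier by (simp only: nat_pow_mult nat_pow_pow nat_pow_closed)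
  finally show ?thesis using xi_pow_p xi_carrier by simp
qed

lemma xi_pow_eq_iff: "\<xi> [^] (i::nat) = \<xi> [^] (j::nat) \<longleftrightarrow> i mod p = j mod p"
proof -
  have aux: "i = j" if ij: "i \<le> j" "j < p" "\<xi> [^] i = \<xi> [^] j" for i j :: nat
  proof (rule ccontr)
    assume "i \<noteq> j"
    have "\<xi> [^] i \<otimes> \<xi> [^] (j - i) = \<xi> [^] i \<otimes> \<one>" using ij(1,3) xi_carrier nat_pow_mult[OF xi_carrier, of i "j - i"] by simp
    then have "\<xi> [^] (j - i) = \<one>"
      using m_lcancel[OF xi_pow_nonzero[of i] nat_pow_closed[OF xi_carrier], of "\<xi> [^] (j - i)" \<one>] xi_carrier
      by blast
    then show False using prim ij \<open>i \<noteq> j\<close> by (auto simp: primitive_root_of_unity_def)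
  qed
  have "\<xi> [^] (i mod p) = \<xi> [^] (j mod p) \<longleftrightarrow> i mod p = j mod p"
    using aux[of "i mod p" "j mod p"] aux[of "j mod p" "i mod p"] p0 by (metis linear mod_less_divisor)
  then show ?thesis using xi_pow_mod by metis
qed

text \<open>Multiplying y0 by the powers of \<xi> produces p distinct roots, as many as the degree.
  Separability thus follows from the primitive root, without a case distinction on the
  characteristic.\<close>

lemma kummer_roots:
  assumes y0: "y0 \<in> carrier L" "y0 \<noteq> \<zero>"
  shows "{y. is_root (kummer_poly p (y0 [^] p)) y} = (\<lambda>i::nat. \<xi> [^] i \<otimes> y0) ` {..<p}"
    "simple_roots (kummer_poly p (y0 [^] p))"
proof -
  let ?P = "kummer_poly p (y0 [^] p)"
  have P: "?P \<in> carrier (poly_ring L)" using kummer_poly_carrier[OF carrier_is_subfield] y0 by simp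
  have inj: "inj_on (\<lambda>i::nat. \<xi> [^] i \<otimes> y0) {..<p}"
  proof (rule inj_onI)
    fix i j assume ij: "i \<in> {..<p}" "j \<in> {..<p}" "\<xi> [^] i \<otimes> y0 = \<xi> [^] j \<otimes> y0"
    then have "\<xi> [^] i = \<xi> [^] j" using m_rcancel[OF y0(2,1)] xi_carrier by simp
    then show "i = j" using xi_pow_eq_iff ij by simp
  qed
  have sub: "(\<lambda>i::nat. \<xi> [^] i \<otimes> y0) ` {..<p} \<subseteq> {y. is_root ?P y}"
  proof
    fix y assume "y \<in> (\<lambda>i::nat. \<xi> [^] i \<otimes> y0) ` {..<p}"
    then obtain i :: nat where i: "y = \<xi> [^] i \<otimes> y0" by blast
    have "(\<xi> [^] i) [^] p = (\<xi> [^] p) [^] i" using xi_carrier by (simp add: nat_pow_pow mult.commute)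
    then have "y [^] p = y0 [^] p" using i y0 xi_carrier xi_pow_p by (simp add: nat_pow_distrib)
    then show "y \<in> {y. is_root ?P y}"
      using eval_kummer_poly[OF p0, of "y0 [^] p" y] i y0 xi_carrier kummer_poly_degree(2) by (simp add: is_root_def)
  qed
  have c: "card ((\<lambda>i::nat. \<xi> [^] i \<otimes> y0) ` {..<p}) = p" using inj by (simp add: card_image)
  have "card {y. is_root ?P y} \<le> p" "finite {y. is_root ?P y}"
    using card_roots_le[OF P] kummer_poly_degree(1)[OF p0] by auto
  then show eq: "{y. is_root ?P y} = (\<lambda>i::nat. \<xi> [^] i \<otimes> y0) ` {..<p}"
    using sub c by (intro card_seteq[symmetric]) auto
  show "simple_roots ?P" unfolding simple_roots_def eq c kummer_poly_degree(1)[OF p0] ..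
qed

lemma same_pow_p:
  assumes "x \<in> carrier L" "y \<in> carrier L" "y \<noteq> \<zero>" "x [^] p = y [^] p"
  obtains i where "i < p" "x = \<xi> [^] (i::nat) \<otimes> y"
proof -
  have "is_root (kummer_poly p (y [^] p)) x"
    using eval_kummer_poly[OF p0, of "y [^] p" x] assms kummer_poly_degree(2) by (simp add: is_root_def)
  then show thesis using kummer_roots(1)[OF assms(2,3)] that by blast
qed

lemma sep_step_kummer:
  assumes M: "subfield M L" "K \<subseteq> M" and g: "\<gamma> \<in> carrier L" "\<gamma> [^] p \<in> M" "\<gamma> \<noteq> \<zero>"
  shows "sep_step M \<gamma>"
  unfolding sep_step_def
proof (intro bexI conjI ballI)
  let ?c = "\<gamma> [^] p"
  show "kummer_poly p ?c \<in> carrier (M[X])" using kummer_poly_carrier[OF M(1) g(2)] .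
  show "kummer_poly p ?c \<noteq> []" by (rule kummer_poly_degree)
  show "eval (kummer_poly p ?c) \<gamma> = \<zero>" using eval_kummer_poly[OF p0, of ?c \<gamma>] g by simp
  fix \<theta> assume th: "\<theta> \<in> Emb M"
  have c: "\<theta> ?c \<in> carrier L" using Emb_simps(1)[OF M(1) th g(2)] .
  have "map \<theta> (kummer_poly p ?c) = kummer_poly p (\<theta> ?c)"
    using Emb_simps(4,5,7)[OF M(1) th] g(2) by (simp add: kummer_poly_def)
  moreover obtain y where y: "y \<in> carrier L" "y [^] p = \<theta> ?c" using exists_root[OF p0 c] .
  moreover have "y \<noteq> \<zero>"
  proof
    assume "y = \<zero>"
    then have "\<theta> ?c = \<theta> \<zero>" using y p0 Emb_simps(5)[OF M(1) th] by (simp add: nat_pow_zero)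
    then have "?c = \<zero>" using Emb_inj_on[OF M(1) th] g(2) subringE(2)[OF subfieldE(1)[OF M(1)]] by (auto dest: inj_onD)
    then show False using g nat_pow_nonzero by blast
  qed
  ultimately show "simple_roots (map \<theta> (kummer_poly p ?c))" using kummer_roots(2)[of y] by simp
qed

text \<open>To stay normal, all p-th roots of all conjugates of z are adjoined. If the iterate
  \<theta>^(p^k) is trivial on M, it multiplies each new root by a power of \<xi>, and its p-th
  iterate is then trivial.\<close>

lemma p_ext_root:
  assumes pe: "p_ext p M" and z: "z \<in> M" "z \<noteq> \<zero>"
  obtains M' \<gamma> where "p_ext p M'" "\<gamma> \<in> M'" "\<gamma> [^] p = z"
proof -
  have gal: "finite_galois_ext L K M" using pe by (simp add: p_ext_def)
  interpret M: galois_setting L K M using galois_setting[OF gal] .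
  note pr = galois_props[OF gal]
  define R where "R = {\<gamma> \<in> carrier L. \<gamma> [^] p \<in> (\<lambda>\<theta>. \<theta> z) ` Emb M}"
  have "finite R"
  proof -
    have "R \<subseteq> (\<Union>c\<in>(\<lambda>\<theta>. \<theta> z) ` Emb M. {y. is_root (kummer_poly p c) y})"
    proof
      fix \<gamma> assume "\<gamma> \<in> R"
      then have g: "\<gamma> \<in> carrier L" "\<gamma> [^] p \<in> (\<lambda>\<theta>. \<theta> z) ` Emb M" by (auto simp: R_def)
      then have "is_root (kummer_poly p (\<gamma> [^] p)) \<gamma>"
        using eval_kummer_poly[OF p0, of "\<gamma> [^] p" \<gamma>] kummer_poly_degree(2) by (simp add: is_root_def)
      then show "\<gamma> \<in> (\<Union>c\<in>(\<lambda>\<theta>. \<theta> z) ` Emb M. {y. is_root (kummer_poly p c) y})" using g(2) by blast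
    qed
    moreover have "finite (\<Union>c\<in>(\<lambda>\<theta>. \<theta> z) ` Emb M. {y. is_root (kummer_poly p c) y})"
      using pr(2) card_roots_le(2)[OF kummer_poly_carrier[OF carrier_is_subfield]] Emb_simps(1)[OF M.E(1) _ z(1)]
      by (intro finite_UN_I) auto
    ultimately show ?thesis by (rule finite_subset)
  qed
  then obtain gs where gs: "set gs = R" using finite_list by blast
  obtain rs where rs: "set rs \<subseteq> M" "M = finite_extension K rs" using galois_generators[OF gal] .
  define M' where "M' = finite_extension K (gs @ rs)"
  have M'2: "M' = finite_extension M gs" using rs(2) by (simp add: M'_def)
  have rc: "set gs \<subseteq> carrier L" "set rs \<subseteq> carrier L" "set (gs @ rs) \<subseteq> carrier L" using gs rs M.Ec by (auto simp: R_def)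
  note f = fe_subfield[OF subfield_axioms subset_refl rc(3), folded M'_def]
  note f2 = fe_subfield[OF M.E rc(1), folded M'2]
  have conjM: "\<theta> z \<in> M" "\<theta> z \<noteq> \<zero>" if "\<theta> \<in> Emb M" for \<theta>
    using pr(4)[OF that] z Emb_inj_on[OF M.E(1) that] M.E_subring(2) Emb_simps(5)[OF M.E(1) that]
    by (auto dest: inj_onD[of \<theta> M z \<zero>])
  have Rprop: "\<gamma> \<in> carrier L" "\<gamma> [^] p \<in> M" "\<gamma> \<noteq> \<zero>" if gR: "\<gamma> \<in> R" for \<gamma>
  proof -
    obtain \<theta> where th: "\<gamma> \<in> carrier L" "\<theta> \<in> Emb M" "\<gamma> [^] p = \<theta> z" using gR by (auto simp: R_def)
    then show "\<gamma> \<in> carrier L" "\<gamma> [^] p \<in> M" using conjM by auto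
    show "\<gamma> \<noteq> \<zero>" using th conjM(2)[OF th(2)] p0 by (auto simp: nat_pow_zero)
  qed
  have "sep_chain K rs"
    using galois_separable[OF gal] rs(1) by (intro sep_chain_separable[OF subfield_axioms subset_refl rc(2)]) blast
  moreover have "sep_chain M gs'" if "set gs' \<subseteq> R" for gs'
    using that
  proof (induction gs')
    case (Cons g gs')
    have "set gs' \<subseteq> carrier L" using Cons.prems Rprop(1) by auto
    note f3 = fe_subfield[OF M.E this]
    have "sep_step (finite_extension M gs') g"
      using Cons.prems Rprop[of g] f3 by (intro sep_step_kummer) auto
    then show ?case using Cons by simp
  qed simp
  ultimately have sc: "sep_chain K (gs @ rs)" using rs(2) gs by (simp add: sep_chain_append del: finite_extension.simps)
  have conj: "\<theta> r \<in> M'" if th: "\<theta> \<in> Emb M'" and r: "r \<in> set (gs @ rs)" for \<theta> r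
  proof (cases "r \<in> M")
    case True
    then show ?thesis using Emb_restrict_galois(2)[OF gal f(1) f2(2) th] f2(2) by blast
  next
    case False
    then have rR: "r \<in> R" "r \<in> M'" using r gs rs(1) f(3) by auto
    then obtain \<psi> where psi: "r \<in> carrier L" "\<psi> \<in> Emb M" "r [^] p = \<psi> z" by (auto simp: R_def)
    note re = Emb_restrict_galois[OF gal f(1) f2(2) th]
    have "(\<theta> r) [^] p = \<theta> (\<psi> z)" using Emb_simps(8)[OF f(1) th rR(2), of p] psi by simp
    also have "\<dots> = compose M (restrict \<theta> M) \<psi> z" using z conjM(1)[OF psi(2)] by (simp add: compose_def)
    finally have "(\<theta> r) [^] p \<in> (\<lambda>\<theta>. \<theta> z) ` Emb M"
      using Emb_comp[OF M.E(1) re(1) psi(2) M.E(2) pr(4)[OF psi(2)]] by blast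
    then have "\<theta> r \<in> R" using Emb_simps(1)[OF f(1) th rR(2)] by (simp add: R_def)
    then show ?thesis using gs f(3) by auto
  qed
  have gal': "finite_galois_ext L K M'" by (rule finite_galois_criterion(1)[OF rc(3) sc M'_def]) (rule conj)
  obtain k where k: "\<And>M' \<theta> x. \<lbrakk>subfield M' L; M \<subseteq> M'; \<theta> \<in> Emb M'; x \<in> M\<rbrakk> \<Longrightarrow> (\<theta> ^^ (p ^ k)) x = x"
    using p_ext_torsion[OF pe] by blast
  interpret M': galois_setting L K M' using galois_setting[OF gal'] .
  have "(\<theta> ^^ (p ^ Suc k)) r = r" if th: "\<theta> \<in> Emb M'" and r: "r \<in> set (gs @ rs)" for \<theta> r
  proof (cases "r \<in> M")
    case True
    then show ?thesis using funpow_fix[OF k[OF f(1) f2(2) th], of r p] by (simp add: mult.commute)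
  next
    case False
    then have rR: "r \<in> R" "r \<in> M'" using r gs rs(1) f(3) by auto
    note rp = Rprop[OF rR(1)]
    have thg: "\<theta> \<in> carrier M'.G" using th galois_props(1)[OF gal'] by simp
    let ?\<psi> = "\<theta> [^]\<^bsub>M'.G\<^esub> (p ^ k)"
    have psi: "?\<psi> \<in> carrier M'.G" using thg by simp
    have "(?\<psi> r) [^] p = ?\<psi> (r [^] p)" using M'.gal_simps(7)[OF psi rR(2), of p] by simp
    also have "\<dots> = r [^] p"
      using M'.gal_pow[OF thg, of "r [^] p" "p ^ k"] k[OF f(1) f2(2) th rp(2)] rp(2) f2(2) by auto
    finally obtain i where i: "?\<psi> r = \<xi> [^] (i::nat) \<otimes> r"
      using same_pow_p[of "?\<psi> r" r] rp M'.gal_simps(1)[OF psi rR(2)] M'.Ec by blast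
    have xiM: "\<xi> [^] (j::nat) \<in> M'" "?\<psi> (\<xi> [^] j) = \<xi> [^] j" for j
    proof -
      have "\<xi> [^] j \<in> K" using xi subringE[OF subfieldE(1)[OF subfield_axioms]] by (induction j) auto
      then show "\<xi> [^] j \<in> M'" "?\<psi> (\<xi> [^] j) = \<xi> [^] j" using f(4) M'.gal_simps(6)[OF psi] by auto
    qed
    have "(?\<psi> ^^ n) r = \<xi> [^] (i * n) \<otimes> r" for n
    proof (induction n)
      case (Suc n)
      have "(?\<psi> ^^ Suc n) r = \<xi> [^] (i * n) \<otimes> (\<xi> [^] i \<otimes> r)"
        using Suc M'.gal_simps(2)[OF psi xiM(1) rR(2), of "i * n"] xiM(2)[of "i * n"] i by simp
      also have "\<dots> = \<xi> [^] (i * Suc n) \<otimes> r"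
        using xi_carrier rp(1) by (simp add: m_assoc[symmetric] nat_pow_mult add.commute)
      finally show ?case .
    qed (use rp in simp)
    from this[of p] have "(?\<psi> ^^ p) r = r"
      using xi_pow_eq_iff[of "i * p" 0] rp(1) by simp
    moreover have "(?\<psi> ^^ n) r = (\<theta> ^^ (p ^ k * n)) r \<and> (?\<psi> ^^ n) r \<in> M'" for n
    proof (induction n)
      case (Suc n)
      have "(?\<psi> ^^ Suc n) r = ?\<psi> ((?\<psi> ^^ n) r)" by simp
      also have "\<dots> = (\<theta> ^^ (p ^ k)) ((?\<psi> ^^ n) r)" using M'.gal_pow[OF thg] Suc by blast
      also have "\<dots> = (\<theta> ^^ (p ^ k)) ((\<theta> ^^ (p ^ k * n)) r)" using Suc by simp
      also have "\<dots> = (\<theta> ^^ (p ^ k * Suc n)) r" by (simp add: funpow_add)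
      finally have "(?\<psi> ^^ Suc n) r = (\<theta> ^^ (p ^ k * Suc n)) r" .
      then show ?case using M'.gal_funpow_closed[OF psi rR(2), of "Suc n"] by blast
    qed (use rR in simp)
    ultimately show ?thesis by (simp add: mult.commute)
  qed
  then have "p_ext p M'" by (rule p_extI[OF gal' M'_def f(3) p])
  moreover obtain \<gamma> where g: "\<gamma> \<in> carrier L" "\<gamma> [^] p = z" using exists_root[OF p0, of z] z(1) M.Ec by blast
  \<comment> \<open>The identity embedding shows that z is among its own conjugates, so R contains
    its p-th roots.\<close>
  moreover have "restrict id M \<in> Emb M"
    using M.E M.E_subring subsetD[OF M.Ec] by (auto simp: Emb_def ring_hom_def)
  then have "\<gamma> \<in> R" using g z(1) by (auto simp: R_def intro!: image_eqI[of _ _ "restrict id M"])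
  then have "\<gamma> \<in> M'" using gs f(3) by auto
  ultimately show thesis using that by blast
qed

section \<open>The maximal p-extension as a directed union\<close>

definition Ep where "Ep = max_p_ext L K p"

lemma Ep_iff: "x \<in> Ep \<longleftrightarrow> (\<exists>M. p_ext p M \<and> x \<in> M)"
  by (auto simp: Ep_def max_p_ext_def p_ext_def)

lemma Ep_directed:
  assumes "x \<in> Ep" "y \<in> Ep" obtains M where "p_ext p M" "x \<in> M" "y \<in> M"
proof -
  obtain M1 M2 where m: "p_ext p M1" "x \<in> M1" "p_ext p M2" "y \<in> M2" using assms Ep_iff by blast
  obtain M where "p_ext p M" "M1 \<subseteq> M" "M2 \<subseteq> M" using p_ext_compositum[OF p m(1,3)] .
  then show thesis using that m by blast
qed

lemma p_ext_subfield: "p_ext p M \<Longrightarrow> subfield M L" "p_ext p M \<Longrightarrow> K \<subseteq> M" "p_ext p M \<Longrightarrow> M \<subseteq> Ep"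
  using Ep_iff by (auto simp: p_ext_def finite_galois_ext_def)

lemma Ep_subfield: "subfield Ep L" "K \<subseteq> Ep"
proof -
  show K: "K \<subseteq> Ep" using p_ext_subfield(3)[OF p_ext_base[OF p]] .
  have clos: "x \<in> carrier L \<and> \<ominus> x \<in> Ep \<and> x \<otimes> y \<in> Ep \<and> x \<oplus> y \<in> Ep \<and> (x \<noteq> \<zero> \<longrightarrow> inv x \<in> Ep)"
    if xy: "x \<in> Ep" "y \<in> Ep" for x y
  proof -
    obtain M where M: "p_ext p M" "x \<in> M" "y \<in> M" using Ep_directed[OF xy] .
    have sM: "subfield M L" "M \<subseteq> Ep" using p_ext_subfield[OF M(1)] by auto
    note s = subringE[OF subfieldE(1)[OF sM(1)]]
    have "x \<noteq> \<zero> \<Longrightarrow> inv x \<in> M" using subfield_m_inv(1)[OF sM(1), of x] M(2) by simp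
    moreover have "x \<in> carrier L" using s(1) M(2) by (rule subsetD)
    ultimately show ?thesis using s(5)[OF M(2)] s(6)[OF M(2,3)] s(7)[OF M(2,3)] subsetD[OF sM(2)] by simp
  qed
  show "subfield Ep L"
  proof (rule subfieldI')
    show "subring Ep L"
    proof (rule subringI)
      show "Ep \<subseteq> carrier L" using clos by blast
      show "\<one> \<in> Ep" using K subringE(3)[OF subfieldE(1)[OF subfield_axioms]] by blast
    qed (use clos in blast)+
    show "inv k \<in> Ep" if "k \<in> Ep - {\<zero>}" for k using clos[of k k] that by blast
  qed
qed

text \<open>This closure property of F(p) supplies the element \<gamma> on which
  \<open>character_is_norm\<close> rests.\<close>

lemma Ep_root:
  assumes "z \<in> Ep" obtains \<gamma> where "\<gamma> \<in> Ep" "\<gamma> [^] p = z"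
proof (cases "z = \<zero>")
  case True
  then have "\<zero> [^] p = z" "\<zero> \<in> Ep" using p0 subringE(2)[OF subfieldE(1)[OF Ep_subfield(1)]] by (auto simp: nat_pow_zero)
  then show thesis using that by blast
next
  case False
  obtain M where M: "p_ext p M" "z \<in> M" using assms Ep_iff by blast
  obtain M' \<gamma> where g: "p_ext p M'" "\<gamma> \<in> M'" "\<gamma> [^] p = z" using p_ext_root[OF M False] .
  show thesis using p_ext_subfield(3)[OF g(1)] g(2,3) by (intro that) auto
qed

end


text \<open>Subtracting g s times the relation at t from the relation at s t removes g and turns
  each coefficient c f into c f (f s - g s). The domain S is just a multiplicative set; it will be
  an intermediate field.\<close>

theorem (in domain) dedekind_independence:
  assumes "finite fs" "S \<noteq> {}" and S: "\<And>s t. s \<in> S \<Longrightarrow> t \<in> S \<Longrightarrow> s \<otimes> t \<in> S"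
    and f: "\<And>f s. f \<in> fs \<Longrightarrow> s \<in> S \<Longrightarrow> f s \<in> carrier R"
      "\<And>f s t. f \<in> fs \<Longrightarrow> s \<in> S \<Longrightarrow> t \<in> S \<Longrightarrow> f (s \<otimes> t) = f s \<otimes> f t"
      "\<And>f. f \<in> fs \<Longrightarrow> \<exists>s\<in>S. f s \<noteq> \<zero>"
      "\<And>f g. f \<in> fs \<Longrightarrow> g \<in> fs \<Longrightarrow> f \<noteq> g \<Longrightarrow> \<exists>s\<in>S. f s \<noteq> g s"
    and c: "\<And>f. f \<in> fs \<Longrightarrow> c f \<in> carrier R"
    and zero: "\<And>s. s \<in> S \<Longrightarrow> (\<Oplus>f\<in>fs. c f \<otimes> f s) = \<zero>"
  shows "\<forall>f\<in>fs. c f = \<zero>"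
  using assms(1,4-)
proof (induction fs arbitrary: c rule: finite_induct)
  case (insert g fs)
  have gc: "g s \<in> carrier R" if "s \<in> S" for s using insert.prems(1) that by blast
  have fc: "f s \<in> carrier R" if "f \<in> fs" "s \<in> S" for f s using insert.prems(1) that by blast
  have cc: "c f \<in> carrier R" if "f \<in> fs" for f using insert.prems(5) that by blast
  have cg: "c g \<in> carrier R" using insert.prems(5) by blast
  have sum: "c g \<otimes> g s \<oplus> (\<Oplus>f\<in>fs. c f \<otimes> f s) = \<zero>" if s: "s \<in> S" for s
    using insert.prems(6)[OF s] insert.hyps gc fc cc cg s by (subst (asm) finsum_insert) auto
  have step: "\<forall>f\<in>fs. c f \<otimes> (f s \<ominus> g s) = \<zero>" if s: "s \<in> S" for s
  proof (rule insert.IH[of "\<lambda>f. c f \<otimes> (f s \<ominus> g s)"])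
    show "f t \<in> carrier R" if "f \<in> fs" "t \<in> S" for f t using fc that by blast
    show "f (t \<otimes> u) = f t \<otimes> f u" if "f \<in> fs" "t \<in> S" "u \<in> S" for f t u using insert.prems(2) that by blast
    show "\<exists>t\<in>S. f t \<noteq> \<zero>" if "f \<in> fs" for f using insert.prems(3) that by blast
    show "\<exists>t\<in>S. f t \<noteq> f' t" if "f \<in> fs" "f' \<in> fs" "f \<noteq> f'" for f f' using insert.prems(4) that by blast
    show "c f \<otimes> (f s \<ominus> g s) \<in> carrier R" if "f \<in> fs" for f using cc fc gc that s by auto
    fix t assume t: "t \<in> S"
    have e1: "(\<Oplus>f\<in>fs. c f \<otimes> f (s \<otimes> t)) = \<ominus> (c g \<otimes> g (s \<otimes> t))"
      using sum[OF S[OF s t]] fc cc cg gc S[OF s t] by (intro minus_equality[symmetric]) (auto intro!: finsum_closed simp: a_comm)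
    have e2: "(\<Oplus>f\<in>fs. c f \<otimes> f t) = \<ominus> (c g \<otimes> g t)"
      using sum[OF t] fc cc cg gc t by (intro minus_equality[symmetric]) (auto intro!: finsum_closed simp: a_comm)
    have "(\<Oplus>f\<in>fs. c f \<otimes> (f s \<ominus> g s) \<otimes> f t) = (\<Oplus>f\<in>fs. c f \<otimes> f (s \<otimes> t) \<oplus> (\<ominus> g s) \<otimes> (c f \<otimes> f t))"
    proof (rule finsum_cong')
      fix f assume f: "f \<in> fs"
      have "f (s \<otimes> t) = f s \<otimes> f t" using insert.prems(2) f s t by blast
      then show "c f \<otimes> (f s \<ominus> g s) \<otimes> f t = c f \<otimes> f (s \<otimes> t) \<oplus> (\<ominus> g s) \<otimes> (c f \<otimes> f t)"
        using fc[OF f s] fc[OF f t] gc[OF s] cc[OF f] by (simp add: minus_eq l_distr r_distr m_ac l_minus r_minus)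
    qed (use fc gc cc s t S in auto)
    also have "\<dots> = (\<Oplus>f\<in>fs. c f \<otimes> f (s \<otimes> t)) \<oplus> (\<Oplus>f\<in>fs. (\<ominus> g s) \<otimes> (c f \<otimes> f t))"
      using fc gc cc s t S by (intro finsum_addf) auto
    also have "(\<Oplus>f\<in>fs. (\<ominus> g s) \<otimes> (c f \<otimes> f t)) = (\<ominus> g s) \<otimes> (\<Oplus>f\<in>fs. c f \<otimes> f t)"
      using fc gc cc s t by (intro finsum_rdistr[symmetric] insert.hyps) auto
    finally show "(\<Oplus>f\<in>fs. c f \<otimes> (f s \<ominus> g s) \<otimes> f t) = \<zero>"
      unfolding e1 e2 using insert.prems(2)[of g s t] gc[OF s] gc[OF t] cg s t
      by (simp add: l_minus r_minus m_ac l_neg)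
  qed
  have z: "c f = \<zero>" if f: "f \<in> fs" for f
  proof -
    have "f \<noteq> g" using f insert.hyps by blast
    then obtain s where s: "s \<in> S" "f s \<noteq> g s" using insert.prems(4) f by blast
    have "c f \<otimes> (f s \<ominus> g s) = \<zero>" using step[OF s(1)] f by blast
    moreover have "f s \<ominus> g s \<noteq> \<zero>" using s fc[OF f s(1)] gc[OF s(1)] by simp
    ultimately show ?thesis using integral_iff[of "c f" "f s \<ominus> g s"] cc[OF f] fc[OF f s(1)] gc[OF s(1)] by auto
  qed
  have "c g = \<zero>"
  proof -
    obtain s where s: "s \<in> S" "g s \<noteq> \<zero>" using insert.prems(3) by blast
    have "(\<Oplus>f\<in>fs. c f \<otimes> f s) = (\<Oplus>f\<in>fs. \<zero>)"
      using z fc[OF _ s(1)] by (intro finsum_cong') auto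
    then have "c g \<otimes> g s = \<zero>" using sum[OF s(1)] cg gc[OF s(1)] by simp
    then show ?thesis using integral_iff[OF cg gc[OF s(1)]] s(2) by simp
  qed
  then show ?case using z by blast
qed simp

section \<open>Resolvents attached to stabilizers of finite sets\<close>

context galois_setting
begin

text \<open>For finite S, a basic neighbourhood of g in the topology of pointwise
  convergence.\<close>

definition agree :: "'a set \<Rightarrow> ('a \<Rightarrow> 'a) \<Rightarrow> ('a \<Rightarrow> 'a) set" where
  "agree S g = {h \<in> carrier G. \<forall>e\<in>S. h e = g e}"

lemma agree_left: "g \<in> carrier G \<Longrightarrow> h \<in> carrier G \<Longrightarrow> S \<subseteq> E \<Longrightarrow> h \<in> agree S g \<longleftrightarrow> inv\<^bsub>G\<^esub> g \<otimes>\<^bsub>G\<^esub> h \<in> agree S \<one>\<^bsub>G\<^esub>"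
proof -
  assume a: "g \<in> carrier G" "h \<in> carrier G" "S \<subseteq> E"
  have "(inv\<^bsub>G\<^esub> g \<otimes>\<^bsub>G\<^esub> h) e = \<one>\<^bsub>G\<^esub> e \<longleftrightarrow> h e = g e" if "e \<in> S" for e
  proof -
    have e: "e \<in> E" using a that by blast
    have "(inv\<^bsub>G\<^esub> g \<otimes>\<^bsub>G\<^esub> h) e = e \<longleftrightarrow> (inv\<^bsub>G\<^esub> g) (h e) = (inv\<^bsub>G\<^esub> g) (g e)"
      using gal_mult[OF G.inv_closed[OF a(1)] a(2) e] gal_inv(1)[OF a(1) e] by simp
    then show ?thesis
      using gal_inj[OF G.inv_closed[OF a(1)] gal_simps(1)[OF a(2) e] gal_simps(1)[OF a(1) e]] gal_one[OF e] by simp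
  qed
  then show ?thesis using a by (auto simp: agree_def)
qed

lemma orbit_finite:
  assumes e: "e \<in> E" shows "finite ((\<lambda>g. g e) ` carrier G)"
proof -
  have ec: "e \<in> carrier L" using e Ec by blast
  have I: "Irr K e \<in> carrier (poly_ring L)"
    using IrrE(1)[OF subfield_axioms ec algebraic_over[OF subset_refl ec]]
      poly_carrier_mono[OF subfieldE(3)[OF subfield_axioms]] by blast
  have "g e \<in> {y. is_root (Irr K e) y}" if g: "g \<in> carrier G" for g
  proof -
    have "g \<in> Emb E" using g Ec by (auto simp: gal_mem_iff Emb_def Bij_def ring_hom_def)
    then show ?thesis using galois_Emb_root[OF E _ e] by blast
  qed
  then have "(\<lambda>g. g e) ` carrier G \<subseteq> {y. is_root (Irr K e) y}" by blast
  then show ?thesis using card_roots_le(2)[OF I] by (rule finite_subset)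
qed

end

text \<open>A finite set S0 takes the place of a finite Galois subextension. The restrictions
  \<open>Rs\<close> of G to the fixed field \<open>Fx\<close> of the stabilizer \<open>U\<close>
  represent G/U, although \<open>U\<close> need not be normal and G need not map \<open>Fx\<close>
  to itself.\<close>

locale stabilizer_setting = galois_setting +
  fixes S0 assumes S0: "finite S0" "S0 \<subseteq> E"
begin

definition U where "U = agree S0 \<one>\<^bsub>G\<^esub>"
definition Fx where "Fx = {e \<in> E. \<forall>u\<in>U. u e = e}"
definition Rs where "Rs = (\<lambda>g. restrict g Fx) ` carrier G"
definition pick where "pick f = (SOME g. g \<in> carrier G \<and> restrict g Fx = f)"

lemma S0_Fx: "S0 \<subseteq> Fx" and Fx_E: "Fx \<subseteq> E"
  using S0(2) gal_one by (auto simp: Fx_def U_def agree_def)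

lemma restrict_eq_iff:
  assumes "g \<in> carrier G" "h \<in> carrier G"
  shows "restrict g Fx = restrict h Fx \<longleftrightarrow> (\<forall>e\<in>S0. g e = h e)"
proof
  assume "restrict g Fx = restrict h Fx"
  then show "\<forall>e\<in>S0. g e = h e" using S0_Fx by (metis restrict_apply' subsetD)
next
  assume a: "\<forall>e\<in>S0. g e = h e"
  then have "g \<in> agree S0 h" using assms by (simp add: agree_def)
  then have u: "inv\<^bsub>G\<^esub> h \<otimes>\<^bsub>G\<^esub> g \<in> U" using agree_left[OF assms(2,1) S0(2)] by (simp add: U_def)
  show "restrict g Fx = restrict h Fx"
  proof (rule restrict_ext)
    fix e assume e: "e \<in> Fx"
    then have eE: "e \<in> E" using Fx_E by blast
    have "(inv\<^bsub>G\<^esub> h) (g e) = e" using u e gal_mult[OF G.inv_closed[OF assms(2)] assms(1) eE] by (auto simp: Fx_def)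
    then show "g e = h e" using gal_inv(2)[OF assms(2) gal_simps(1)[OF assms(1) eE]] by simp
  qed
qed

text \<open>An element of \<open>Rs\<close> is determined by its values on the finite set S0, and
  each point of S0 has a finite orbit.\<close>

lemma finite_Rs: "finite Rs"
proof -
  have inj: "inj_on (\<lambda>f. restrict f S0) Rs"
  proof (rule inj_onI)
    fix f f' assume a: "f \<in> Rs" "f' \<in> Rs" "restrict f S0 = restrict f' S0"
    then obtain g h where gh: "g \<in> carrier G" "f = restrict g Fx" "h \<in> carrier G" "f' = restrict h Fx"
      by (auto simp: Rs_def)
    have "g e = h e" if "e \<in> S0" for e
      using fun_cong[OF a(3), of e] that gh S0_Fx by auto
    then show "f = f'" using restrict_eq_iff gh by simp
  qed
  have "(\<lambda>f. restrict f S0) ` Rs \<subseteq> (\<Pi>\<^sub>E e\<in>S0. (\<lambda>g. g e) ` carrier G)"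
    using S0_Fx by (auto simp: Rs_def)
  moreover have "finite (\<Pi>\<^sub>E e\<in>S0. (\<lambda>g. g e) ` carrier G)"
    using S0 orbit_finite by (intro finite_PiE) auto
  ultimately show ?thesis using inj finite_subset finite_imageD by metis
qed

lemma pick: assumes "f \<in> Rs" shows "pick f \<in> carrier G" "restrict (pick f) Fx = f"
proof -
  have "\<exists>g. g \<in> carrier G \<and> restrict g Fx = f" using assms by (auto simp: Rs_def)
  then have "pick f \<in> carrier G \<and> restrict (pick f) Fx = f" unfolding pick_def by (rule someI_ex)
  then show "pick f \<in> carrier G" "restrict (pick f) Fx = f" by auto
qed

text \<open>Functions on G/U with values in the base field, so that automorphisms leave the
  coefficients of a resolvent alone.\<close>

definition invariant where
  "invariant c \<longleftrightarrow> (\<forall>g\<in>carrier G. c g \<in> K) \<and>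
     (\<forall>g\<in>carrier G. \<forall>h\<in>carrier G. (\<forall>e\<in>S0. g e = h e) \<longrightarrow> c g = c h)"

lemma invariantD:
  assumes "invariant c" "g \<in> carrier G"
  shows "c g \<in> K" "h \<in> carrier G \<Longrightarrow> (\<And>e. e \<in> S0 \<Longrightarrow> g e = h e) \<Longrightarrow> c g = c h"
  using assms unfolding invariant_def by blast+

text \<open>The Lagrange resolvent with coefficients c, as a function of the element e.\<close>

definition theta where "theta c e = (\<Oplus>f\<in>Rs. c (pick f) \<otimes> f e)"

lemma Rs_E: "f \<in> Rs \<Longrightarrow> e \<in> Fx \<Longrightarrow> f e \<in> E"
  using gal_simps(1) Fx_E by (auto simp: Rs_def)

lemma KE: "x \<in> K \<Longrightarrow> x \<in> E" and KL: "x \<in> K \<Longrightarrow> x \<in> carrier L" and EL: "x \<in> E \<Longrightarrow> x \<in> carrier L"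
  using E(2) Ec by auto

lemma theta_terms:
  assumes "invariant c" "f \<in> Rs" "e \<in> Fx" shows "c (pick f) \<in> K" "c (pick f) \<otimes> f e \<in> E"
proof -
  show 1: "c (pick f) \<in> K" using invariantD(1)[OF assms(1) pick(1)[OF assms(2)]] .
  show "c (pick f) \<otimes> f e \<in> E" using E_subring(6)[OF KE[OF 1] Rs_E[OF assms(2,3)]] .
qed

lemma sum_in_E:
  assumes "finite A" "\<And>a. a \<in> A \<Longrightarrow> t a \<in> E"
  shows "(\<Oplus>a\<in>A. t a) \<in> E \<and> (\<forall>g\<in>carrier G. g (\<Oplus>a\<in>A. t a) = (\<Oplus>a\<in>A. g (t a)))"
  using assms
proof (induction A rule: finite_induct)
  case empty
  then show ?case using E_subring(2) gal_simps(5) by simp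
next
  case (insert a A)
  have IH: "(\<Oplus>a\<in>A. t a) \<in> E" "\<And>g. g \<in> carrier G \<Longrightarrow> g (\<Oplus>a\<in>A. t a) = (\<Oplus>a\<in>A. g (t a))" using insert by auto
  have ta: "t a \<in> E" using insert by blast
  have e: "(\<Oplus>a\<in>insert a A. t a) = t a \<oplus> (\<Oplus>a\<in>A. t a)"
    using insert EL by (intro finsum_insert) auto
  have "g (t a \<oplus> (\<Oplus>a\<in>A. t a)) = (\<Oplus>a\<in>insert a A. g (t a))" if g: "g \<in> carrier G" for g
  proof -
    have gt: "g (t b) \<in> carrier L" if "b \<in> insert a A" for b using insert.prems[OF that] gal_simps(1)[OF g] EL by blast
    have "(\<Oplus>a\<in>insert a A. g (t a)) = g (t a) \<oplus> (\<Oplus>a\<in>A. g (t a))"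
      using insert.hyps gt by (intro finsum_insert) auto
    then show ?thesis using gal_simps(3)[OF g ta IH(1)] IH(2)[OF g] by simp
  qed
  then show ?case using e E_subring(7)[OF ta IH(1)] by simp
qed

lemma theta_E: "invariant c \<Longrightarrow> e \<in> Fx \<Longrightarrow> theta c e \<in> E"
  unfolding theta_def using sum_in_E[OF finite_Rs, of "\<lambda>f. c (pick f) \<otimes> f e"] theta_terms(2) by simp

text \<open>Composition with \<tau> permutes \<open>Rs\<close>, so applying \<tau> to a resolvent
  only moves its coefficients.\<close>

lemma theta_translate:
  assumes c: "invariant c" and e: "e \<in> Fx" and t: "\<tau> \<in> carrier G"
  shows "invariant (\<lambda>g. c (inv\<^bsub>G\<^esub> \<tau> \<otimes>\<^bsub>G\<^esub> g))" "\<tau> (theta c e) = theta (\<lambda>g. c (inv\<^bsub>G\<^esub> \<tau> \<otimes>\<^bsub>G\<^esub> g)) e"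
proof -
  let ?c = "\<lambda>g. c (inv\<^bsub>G\<^esub> \<tau> \<otimes>\<^bsub>G\<^esub> g)"
  have it: "inv\<^bsub>G\<^esub> \<tau> \<in> carrier G" using t by simp
  show "invariant ?c"
    unfolding invariant_def
  proof (intro conjI ballI impI)
    show "?c g \<in> K" if "g \<in> carrier G" for g using invariantD(1)[OF c G.m_closed[OF it that]] .
    fix g h assume gh: "g \<in> carrier G" "h \<in> carrier G" "\<forall>e\<in>S0. g e = h e"
    have "(inv\<^bsub>G\<^esub> \<tau> \<otimes>\<^bsub>G\<^esub> g) e = (inv\<^bsub>G\<^esub> \<tau> \<otimes>\<^bsub>G\<^esub> h) e" if "e \<in> S0" for e
      using gal_mult[OF it gh(1), of e] gal_mult[OF it gh(2), of e] gh(3) that S0(2) by auto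
    then show "?c g = ?c h" by (rule invariantD(2)[OF c G.m_closed[OF it gh(1)] G.m_closed[OF it gh(2)]])
  qed
  define m where "m = (\<lambda>f. restrict (\<tau> \<otimes>\<^bsub>G\<^esub> pick f) Fx)"
  have mR: "m f \<in> Rs" if "f \<in> Rs" for f using pick(1)[OF that] t by (auto simp: m_def Rs_def)
  have mval: "m f x = \<tau> (f x)" if "f \<in> Rs" "x \<in> Fx" for f x
  proof -
    have "f x = pick f x" using pick(2)[OF that(1)] that(2) by (metis restrict_apply')
    then show ?thesis using gal_mult[OF t pick(1)[OF that(1)], of x] that(2) Fx_E by (auto simp: m_def)
  qed
  have inj: "inj_on m Rs"
  proof (rule inj_onI)
    fix f f' assume a: "f \<in> Rs" "f' \<in> Rs" "m f = m f'"
    show "f = f'"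
    proof (rule extensionalityI[of _ Fx])
      show "f \<in> extensional Fx" "f' \<in> extensional Fx" using a by (auto simp: Rs_def)
      fix x assume x: "x \<in> Fx"
      have "\<tau> (f x) = \<tau> (f' x)" using mval a x by metis
      then show "f x = f' x" using gal_inj[OF t Rs_E[OF a(1) x] Rs_E[OF a(2) x]] by simp
    qed
  qed
  have bij: "m ` Rs = Rs" using endo_inj_surj[OF finite_Rs _ inj] mR by blast
  have cm: "?c (pick (m f)) = c (pick f)" if f: "f \<in> Rs" for f
  proof -
    have p: "pick (m f) \<in> carrier G" "pick f \<in> carrier G" using pick(1) f mR by auto
    have "(inv\<^bsub>G\<^esub> \<tau> \<otimes>\<^bsub>G\<^esub> pick (m f)) x = pick f x" if x: "x \<in> S0" for x
    proof -
      have xF: "x \<in> Fx" "x \<in> E" using x S0_Fx S0(2) by auto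
      have "pick (m f) x = m f x" "pick f x = f x"
        using pick(2)[OF mR[OF f]] pick(2)[OF f] xF(1) by (metis restrict_apply')+
      then have "pick (m f) x = \<tau> (pick f x)" using mval[OF f xF(1)] by simp
      then show ?thesis
        using gal_mult[OF it p(1) xF(2)] gal_inv(1)[OF t gal_simps(1)[OF p(2) xF(2)]] by simp
    qed
    then show ?thesis by (rule invariantD(2)[OF c G.m_closed[OF it p(1)] p(2)])
  qed
  have "\<tau> (theta c e) = (\<Oplus>f\<in>Rs. \<tau> (c (pick f) \<otimes> f e))"
    unfolding theta_def using sum_in_E[OF finite_Rs, of "\<lambda>f. c (pick f) \<otimes> f e"] theta_terms(2)[OF c _ e] t by simp
  also have "\<dots> = (\<Oplus>f\<in>Rs. ?c (pick (m f)) \<otimes> m f e)"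
  proof (rule finsum_cong')
    fix f assume f: "f \<in> Rs"
    note k = theta_terms(1)[OF c f e]
    show "\<tau> (c (pick f) \<otimes> f e) = ?c (pick (m f)) \<otimes> m f e"
      using cm[OF f] mval[OF f e] gal_simps(2)[OF t KE[OF k] Rs_E[OF f e]] gal_simps(6)[OF t k] by simp
  next
    show "(\<lambda>f. ?c (pick (m f)) \<otimes> m f e) \<in> Rs \<rightarrow> carrier L"
    proof
      fix f assume f: "f \<in> Rs"
      show "?c (pick (m f)) \<otimes> m f e \<in> carrier L"
        using cm[OF f] theta_terms(1)[OF c f e] Rs_E[OF mR[OF f] e] KL EL by auto
    qed
  qed simp
  also have "\<dots> = (\<Oplus>f\<in>m ` Rs. ?c (pick f) \<otimes> f e)"
  proof (rule finsum_reindex[OF _ inj, symmetric])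
    show "(\<lambda>f. ?c (pick f) \<otimes> f e) \<in> m ` Rs \<rightarrow> carrier L"
    proof
      fix f' assume "f' \<in> m ` Rs"
      then obtain f where f: "f \<in> Rs" "f' = m f" by blast
      show "?c (pick f') \<otimes> f' e \<in> carrier L"
        using cm[OF f(1)] theta_terms(1)[OF c f(1) e] Rs_E[OF mR[OF f(1)] e] KL EL f(2) by auto
    qed
  qed
  finally show "\<tau> (theta c e) = theta ?c e" using bij by (simp add: theta_def)
qed

lemma theta_smult:
  assumes "invariant c" "invariant c'" "e \<in> Fx" "k \<in> K" "\<And>g. g \<in> carrier G \<Longrightarrow> c' g = k \<otimes> c g"
  shows "theta c' e = k \<otimes> theta c e"
proof -
  have "theta c' e = (\<Oplus>f\<in>Rs. k \<otimes> (c (pick f) \<otimes> f e))"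
    unfolding theta_def
  proof (rule finsum_cong')
    fix f assume f: "f \<in> Rs"
    show "c' (pick f) \<otimes> f e = k \<otimes> (c (pick f) \<otimes> f e)"
      using assms(5)[OF pick(1)[OF f]] theta_terms(1)[OF assms(1) f assms(3)] KL EL[OF Rs_E[OF f assms(3)]] assms(4)
      by (simp add: m_assoc)
  next
    show "(\<lambda>f. k \<otimes> (c (pick f) \<otimes> f e)) \<in> Rs \<rightarrow> carrier L"
      using theta_terms(2)[OF assms(1) _ assms(3)] KL[OF assms(4)] EL by auto
  qed simp
  also have "\<dots> = k \<otimes> theta c e"
    unfolding theta_def using theta_terms(2)[OF assms(1) _ assms(3)] KL[OF assms(4)] EL
    by (intro finsum_rdistr[symmetric] finite_Rs) auto
  finally show ?thesis .
qed

text \<open>Distinct elements of \<open>Rs\<close> are distinct characters on \<open>Fx\<close>; by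
  Dedekind, a resolvent with a nonzero coefficient cannot vanish at every element of
  \<open>Fx\<close>.\<close>

lemma theta_nonzero:
  assumes c: "invariant c" and g: "g \<in> carrier G" "c g \<noteq> \<zero>"
  obtains e where "e \<in> Fx" "theta c e \<noteq> \<zero>"
proof -
  have one: "\<one> \<in> Fx" using E_subring(3) gal_simps(4) by (auto simp: Fx_def U_def agree_def)
  have ex: "\<exists>e\<in>Fx. theta c e \<noteq> \<zero>"
  proof (rule ccontr)
    assume "\<not> ?thesis"
    then have z: "theta c e = \<zero>" if "e \<in> Fx" for e using that by blast
    have mem: "restrict g Fx \<in> Rs" using g by (auto simp: Rs_def)
    have "\<forall>f\<in>Rs. c (pick f) = \<zero>"
    proof (rule dedekind_independence[where fs = Rs and S = Fx and c = "\<lambda>f. c (pick f)", OF finite_Rs])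
      show "Fx \<noteq> {}" using one by blast
      show FxM: "s \<otimes> t \<in> Fx" if "s \<in> Fx" "t \<in> Fx" for s t
      proof -
        have st: "s \<in> E" "t \<in> E" using that Fx_E by auto
        have "u (s \<otimes> t) = s \<otimes> t" if u: "u \<in> U" for u
        proof -
          have "u \<in> carrier G" "u s = s" "u t = t"
            using u \<open>s \<in> Fx\<close> \<open>t \<in> Fx\<close> by (auto simp: Fx_def U_def agree_def)
          then show ?thesis using gal_simps(2)[of u s t] st by simp
        qed
        then show ?thesis using E_subring(6)[OF st] unfolding Fx_def by blast
      qed
      show "f s \<in> carrier L" if "f \<in> Rs" "s \<in> Fx" for f s using Rs_E[OF that] EL by blast
      show "f (s \<otimes> t) = f s \<otimes> f t" if fst: "f \<in> Rs" "s \<in> Fx" "t \<in> Fx" for f s t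
      proof -
        obtain g where g: "g \<in> carrier G" "f = restrict g Fx" using fst(1) by (auto simp: Rs_def)
        show ?thesis using gal_simps(2)[OF g(1) subsetD[OF Fx_E fst(2)] subsetD[OF Fx_E fst(3)]]
            FxM[OF fst(2,3)] fst(2,3) g(2) by simp
      qed
      show "\<exists>s\<in>Fx. f s \<noteq> \<zero>" if "f \<in> Rs" for f
      proof -
        have "f \<one> = \<one>" using that one gal_simps(4) by (auto simp: Rs_def)
        then show ?thesis using one by (intro bexI[of _ \<one>]) auto
      qed
      show "\<exists>s\<in>Fx. f s \<noteq> f' s" if "f \<in> Rs" "f' \<in> Rs" "f \<noteq> f'" for f f'
      proof (rule ccontr)
        assume "\<not> ?thesis"
        then have "f = f'" using that by (intro extensionalityI[of _ Fx]) (auto simp: Rs_def)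
        then show False using that by blast
      qed
      show "c (pick f) \<in> carrier L" if "f \<in> Rs" for f using theta_terms(1)[OF c that one] KL by blast
      show "(\<Oplus>f\<in>Rs. c (pick f) \<otimes> f s) = \<zero>" if "s \<in> Fx" for s using z[OF that] by (simp add: theta_def)
    qed
    then have "c (pick (restrict g Fx)) = \<zero>" using mem by blast
    moreover have "c (pick (restrict g Fx)) = c g"
      using invariantD(2)[OF c pick(1)[OF mem] g(1)] pick(2)[OF mem] restrict_eq_iff[OF pick(1)[OF mem] g(1)]
      by blast
    ultimately show False using g(2) by simp
  qed
  then show thesis using that by blast
qed

end


section \<open>The Krull topology\<close>

context galois_setting
begin

lemma gal_over:
  assumes "K \<subseteq> M"
  shows "carrier (gal L M E) = {\<tau> \<in> carrier G. \<forall>x\<in>M. \<tau> x = x}"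
  using assms by (auto simp: gal_def)

lemma agree_finite_extension:
  assumes g: "g \<in> carrier G" and h: "h \<in> carrier G" and rs: "set rs \<subseteq> E" "\<And>r. r \<in> set rs \<Longrightarrow> h r = g r"
    and x: "x \<in> finite_extension K rs"
  shows "h x = g x"
proof -
  have rc: "set rs \<subseteq> carrier L" using rs(1) Ec by blast
  have "subring {u \<in> E. h u = g u} L"
  proof (rule subringI)
    show "{u \<in> E. h u = g u} \<subseteq> carrier L" using Ec by blast
    show "\<one> \<in> {u \<in> E. h u = g u}" using E_subring(3) gal_simps(4)[OF g] gal_simps(4)[OF h] by simp
    show "\<ominus> u \<in> {u \<in> E. h u = g u}" if "u \<in> {u \<in> E. h u = g u}" for u
    proof -
      have u: "u \<in> E" "h u = g u" "u \<in> carrier L" "\<ominus> u \<in> E" using that E_subring(5) Ec by auto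
      have neg: "f (\<ominus> u) = \<ominus> f u" if f: "f \<in> carrier G" for f
      proof -
        have fu: "f u \<in> carrier L" "f (\<ominus> u) \<in> carrier L" using gal_simps(1)[OF f] u Ec by auto
        have "f (\<ominus> u) \<oplus> f u = \<zero>"
          using gal_simps(3)[OF f u(4,1)] gal_simps(5)[OF f] u(3) by (simp add: l_neg)
        then show ?thesis using minus_equality[OF _ fu] by simp
      qed
      show ?thesis using neg[OF g] neg[OF h] u by simp
    qed
    show "u \<otimes> v \<in> {u \<in> E. h u = g u}" "u \<oplus> v \<in> {u \<in> E. h u = g u}"
      if uv: "u \<in> {u \<in> E. h u = g u}" "v \<in> {u \<in> E. h u = g u}" for u v
    proof -
      have e: "u \<in> E" "v \<in> E" "h u = g u" "h v = g v" using uv by auto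
      show "u \<otimes> v \<in> {u \<in> E. h u = g u}" "u \<oplus> v \<in> {u \<in> E. h u = g u}"
        using e E_subring(6,7)[OF e(1,2)] gal_simps(2,3)[OF g e(1,2)] gal_simps(2,3)[OF h e(1,2)] by auto
    qed
  qed
  moreover have "K \<subseteq> {u \<in> E. h u = g u}"
  proof
    fix u assume u: "u \<in> K"
    show "u \<in> {u \<in> E. h u = g u}" using subsetD[OF E(2) u] gal_simps(6)[OF g u] gal_simps(6)[OF h u] by simp
  qed
  moreover have "set rs \<subseteq> {u \<in> E. h u = g u}" using rs by blast
  ultimately have "finite_extension K rs \<subseteq> {u \<in> E. h u = g u}"
    by (rule fe_minimal[OF subfield_axioms rc])
  then show ?thesis using x by blast
qed

text \<open>The Krull topology is the topology of pointwise convergence on the discrete set \<open>E\<close>.\<close>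

lemma openin_krull:
  assumes cover: "\<And>e. e \<in> E \<Longrightarrow> \<exists>M. finite_galois_ext L K M \<and> M \<subseteq> E \<and> e \<in> M"
  shows "openin (krull_topology L K E) A \<longleftrightarrow>
    A \<subseteq> carrier G \<and> (\<forall>x\<in>A. \<exists>S. finite S \<and> S \<subseteq> E \<and> agree S x \<subseteq> A)"
proof
  define B where "B = {\<rho> <#\<^bsub>G\<^esub> carrier (gal L M E) | \<rho> M. \<rho> \<in> carrier G \<and> finite_galois_ext L K M \<and> M \<subseteq> E}"
  have T: "krull_topology L K E = topology_generated_by B" by (simp add: krull_topology_def B_def)
  have coset: "\<rho> <#\<^bsub>G\<^esub> carrier (gal L M E) = agree M \<rho>"
    if r: "\<rho> \<in> carrier G" and M: "finite_galois_ext L K M" "M \<subseteq> E" for \<rho> M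
  proof -
    have KM: "K \<subseteq> M" using M by (simp add: finite_galois_ext_def)
    have H: "carrier (gal L M E) = agree M \<one>\<^bsub>G\<^esub>"
      unfolding gal_over[OF KM] agree_def using M(2) gal_one by (auto simp: subset_iff)
    show ?thesis
    proof
      show "\<rho> <#\<^bsub>G\<^esub> carrier (gal L M E) \<subseteq> agree M \<rho>"
      proof
        fix y assume "y \<in> \<rho> <#\<^bsub>G\<^esub> carrier (gal L M E)"
        then obtain h where h: "h \<in> agree M \<one>\<^bsub>G\<^esub>" "y = \<rho> \<otimes>\<^bsub>G\<^esub> h" unfolding l_coset_def H by blast
        have hc: "h \<in> carrier G" using h by (simp add: agree_def)
        have "inv\<^bsub>G\<^esub> \<rho> \<otimes>\<^bsub>G\<^esub> y = h" using h(2) hc r by (simp add: G.m_assoc[symmetric])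
        then show "y \<in> agree M \<rho>" using agree_left[OF r, of y M] h hc r M(2) by simp
      qed
      show "agree M \<rho> \<subseteq> \<rho> <#\<^bsub>G\<^esub> carrier (gal L M E)"
      proof
        fix y assume y: "y \<in> agree M \<rho>"
        have yc: "y \<in> carrier G" using y by (simp add: agree_def)
        have "inv\<^bsub>G\<^esub> \<rho> \<otimes>\<^bsub>G\<^esub> y \<in> agree M \<one>\<^bsub>G\<^esub>" using agree_left[OF r yc M(2)] y by simp
        moreover have "y = \<rho> \<otimes>\<^bsub>G\<^esub> (inv\<^bsub>G\<^esub> \<rho> \<otimes>\<^bsub>G\<^esub> y)" using r yc by (simp add: G.m_assoc[symmetric])
        ultimately show "y \<in> \<rho> <#\<^bsub>G\<^esub> carrier (gal L M E)" unfolding l_coset_def H by blast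
      qed
    qed
  qed
  {
    assume "openin (krull_topology L K E) A"
    then have "generate_topology_on B A" unfolding T openin_topology_generated_by_iff .
    then show "A \<subseteq> carrier G \<and> (\<forall>x\<in>A. \<exists>S. finite S \<and> S \<subseteq> E \<and> agree S x \<subseteq> A)"
    proof (induction rule: generate_topology_on.induct)
      case (Int a b)
      show ?case
      proof (intro conjI ballI)
        show "a \<inter> b \<subseteq> carrier G" using Int by blast
        fix x assume x: "x \<in> a \<inter> b"
        obtain S1 where S1: "finite S1" "S1 \<subseteq> E" "agree S1 x \<subseteq> a" using Int(3) x by blast
        obtain S2 where S2: "finite S2" "S2 \<subseteq> E" "agree S2 x \<subseteq> b" using Int(4) x by blast
        have "agree (S1 \<union> S2) x \<subseteq> a \<inter> b" using S1 S2 by (auto simp: agree_def)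
        then show "\<exists>S. finite S \<and> S \<subseteq> E \<and> agree S x \<subseteq> a \<inter> b" using S1 S2 by (intro exI[of _ "S1 \<union> S2"]) auto
      qed
    next
      case (UN W)
      then show ?case by (meson Sup_le_iff Union_iff Union_upper order_trans)
    next
      case (Basis s)
      then obtain \<rho> M where s: "s = \<rho> <#\<^bsub>G\<^esub> carrier (gal L M E)" "\<rho> \<in> carrier G" "finite_galois_ext L K M" "M \<subseteq> E"
        by (auto simp: B_def)
      \<comment> \<open>Finitely many generators control a finite Galois subextension, so a basic
        coset contains the neighbourhood given by a finite set.\<close>
      obtain rs where rs: "set rs \<subseteq> M" "M = finite_extension K rs" using galois_generators[OF s(3)] .
      have sE: "s = agree M \<rho>" using coset s by simp
      have "agree (set rs) x \<subseteq> s" if x: "x \<in> s" for x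
      proof
        fix y assume y: "y \<in> agree (set rs) x"
        have xc: "x \<in> carrier G" and yc: "y \<in> carrier G" using x y by (auto simp: sE agree_def)
        have "y e = x e" if "e \<in> M" for e
          using agree_finite_extension[OF xc yc, of rs e] y rs s(4) that by (auto simp: agree_def)
        then show "y \<in> s" using x yc by (auto simp: sE agree_def)
      qed
      then show ?case using rs s(4) sE by (auto simp: agree_def intro!: exI[of _ "set rs"])
    qed auto
  }
  assume A: "A \<subseteq> carrier G \<and> (\<forall>x\<in>A. \<exists>S. finite S \<and> S \<subseteq> E \<and> agree S x \<subseteq> A)"
  show "openin (krull_topology L K E) A"
  proof (subst openin_subopen, intro ballI)
    fix x assume x: "x \<in> A"
    then have xc: "x \<in> carrier G" using A by blast
    obtain S where S: "finite S" "S \<subseteq> E" "agree S x \<subseteq> A" using A x by blast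
    obtain m where m: "\<And>e. e \<in> E \<Longrightarrow> finite_galois_ext L K (m e) \<and> m e \<subseteq> E \<and> e \<in> m e" using cover by metis
    \<comment> \<open>Inserting \<one> keeps the family nonempty when S is empty, as a finite
      intersection of open sets requires.\<close>
    let ?F = "(\<lambda>e. agree (m e) x) ` insert \<one> S"
    have "agree (m e) x \<in> B" if "e \<in> insert \<one> S" for e
    proof -
      have "finite_galois_ext L K (m e)" "m e \<subseteq> E" using m that S(2) E_subring(3) by auto
      then show ?thesis using coset[OF xc] xc unfolding B_def by blast
    qed
    then have "openin (krull_topology L K E) (\<Inter>?F)"
      using S(1) unfolding T by (intro openin_Inter) (auto intro: topology_generated_by_Basis)
    moreover have "x \<in> \<Inter>?F" using xc by (auto simp: agree_def)
    moreover have "\<Inter>?F \<subseteq> agree S x"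
    proof
      fix y assume y: "y \<in> \<Inter>?F"
      have "y \<in> carrier G" using y by (auto simp: agree_def)
      moreover have "y e = x e" if "e \<in> S" for e using y m[of e] that S(2) by (auto simp: agree_def)
      ultimately show "y \<in> agree S x" by (auto simp: agree_def)
    qed
    ultimately show "\<exists>Ta. openin (krull_topology L K E) Ta \<and> x \<in> Ta \<and> Ta \<subseteq> A" using S(3) by blast
  qed
qed

end

sublocale kummer_closure \<subseteq> galois_setting L K Ep
  by (intro galois_setting.intro algebraic_closure_axioms galois_setting_axioms.intro Ep_subfield)

lemma (in stabilizer_setting) invariantI:
  assumes "\<And>g. g \<in> carrier G \<Longrightarrow> c g \<in> K"
    and "\<And>g h. g \<in> carrier G \<Longrightarrow> h \<in> carrier G \<Longrightarrow> \<forall>e\<in>S0. g e = h e \<Longrightarrow> c g = c h"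
  shows "invariant c"
  unfolding invariant_def using assms by blast

context kummer_closure
begin

definition T where "T = krull_topology L K Ep"

lemma openin_T: "openin T A \<longleftrightarrow> A \<subseteq> carrier G \<and> (\<forall>x\<in>A. \<exists>S. finite S \<and> S \<subseteq> Ep \<and> agree S x \<subseteq> A)"
  unfolding T_def
proof (rule openin_krull)
  fix e assume "e \<in> Ep"
  then obtain M where M: "p_ext p M" "e \<in> M" using Ep_iff by blast
  then show "\<exists>M. finite_galois_ext L K M \<and> M \<subseteq> Ep \<and> e \<in> M"
    using p_ext_subfield(3)[OF M(1)] unfolding p_ext_def by blast
qed

lemma topspace_T: "topspace T = carrier G"
proof -
  have "openin T (carrier G)" unfolding openin_T by (auto simp: agree_def intro!: exI[of _ "{}"])
  then show ?thesis using openin_T openin_topspace openin_subset by (metis subset_antisym)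
qed

lemma continuous_left_mult: "g \<in> carrier G \<Longrightarrow> continuous_map T T (\<lambda>x. g \<otimes>\<^bsub>G\<^esub> x)"
  unfolding continuous_map_def topspace_T
proof (intro conjI allI impI)
  assume g: "g \<in> carrier G"
  show "(\<lambda>x. g \<otimes>\<^bsub>G\<^esub> x) \<in> carrier G \<rightarrow> carrier G" using g by auto
  fix A assume A: "openin T A"
  show "openin T {x \<in> carrier G. g \<otimes>\<^bsub>G\<^esub> x \<in> A}"
    unfolding openin_T
  proof (intro conjI ballI)
    fix x assume "x \<in> {x \<in> carrier G. g \<otimes>\<^bsub>G\<^esub> x \<in> A}"
    then have x: "x \<in> carrier G" "g \<otimes>\<^bsub>G\<^esub> x \<in> A" by auto
    obtain S where S: "finite S" "S \<subseteq> Ep" "agree S (g \<otimes>\<^bsub>G\<^esub> x) \<subseteq> A" using A x(2) unfolding openin_T by blast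
    have "agree S x \<subseteq> {x \<in> carrier G. g \<otimes>\<^bsub>G\<^esub> x \<in> A}"
    proof
      fix y assume y: "y \<in> agree S x"
      have "(g \<otimes>\<^bsub>G\<^esub> y) e = (g \<otimes>\<^bsub>G\<^esub> x) e" if "e \<in> S" for e
        using gal_mult[OF g, of y e] gal_mult[OF g x(1), of e] y that S(2) by (auto simp: agree_def)
      then have "g \<otimes>\<^bsub>G\<^esub> y \<in> agree S (g \<otimes>\<^bsub>G\<^esub> x)" using g y by (simp add: agree_def)
      then show "y \<in> {x \<in> carrier G. g \<otimes>\<^bsub>G\<^esub> x \<in> A}" using S(3) y by (auto simp: agree_def)
    qed
    then show "\<exists>S. finite S \<and> S \<subseteq> Ep \<and> agree S x \<subseteq> {x \<in> carrier G. g \<otimes>\<^bsub>G\<^esub> x \<in> A}" using S by blast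
  qed auto
qed

lemma continuous_right_mult: "g \<in> carrier G \<Longrightarrow> continuous_map T T (\<lambda>x. x \<otimes>\<^bsub>G\<^esub> g)"
  unfolding continuous_map_def topspace_T
proof (intro conjI allI impI)
  assume g: "g \<in> carrier G"
  show "(\<lambda>x. x \<otimes>\<^bsub>G\<^esub> g) \<in> carrier G \<rightarrow> carrier G" using g by auto
  fix A assume A: "openin T A"
  show "openin T {x \<in> carrier G. x \<otimes>\<^bsub>G\<^esub> g \<in> A}"
    unfolding openin_T
  proof (intro conjI ballI)
    fix x assume "x \<in> {x \<in> carrier G. x \<otimes>\<^bsub>G\<^esub> g \<in> A}"
    then have x: "x \<in> carrier G" "x \<otimes>\<^bsub>G\<^esub> g \<in> A" by auto
    obtain S where S: "finite S" "S \<subseteq> Ep" "agree S (x \<otimes>\<^bsub>G\<^esub> g) \<subseteq> A" using A x(2) unfolding openin_T by blast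
    \<comment> \<open>The values of x g on S are the values of x on the image of S under g.\<close>
    have "agree (g ` S) x \<subseteq> {x \<in> carrier G. x \<otimes>\<^bsub>G\<^esub> g \<in> A}"
    proof
      fix y assume y: "y \<in> agree (g ` S) x"
      have yc: "y \<in> carrier G" using y by (simp add: agree_def)
      have "(y \<otimes>\<^bsub>G\<^esub> g) e = (x \<otimes>\<^bsub>G\<^esub> g) e" if "e \<in> S" for e
        using gal_mult[OF yc g, of e] gal_mult[OF x(1) g, of e] y that S(2) by (auto simp: agree_def)
      then have "y \<otimes>\<^bsub>G\<^esub> g \<in> agree S (x \<otimes>\<^bsub>G\<^esub> g)" using g yc by (simp add: agree_def)
      then show "y \<in> {x \<in> carrier G. x \<otimes>\<^bsub>G\<^esub> g \<in> A}" using S(3) yc by auto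
    qed
    moreover have "finite (g ` S)" "g ` S \<subseteq> Ep" using S gal_simps(1)[OF g] by auto
    ultimately show "\<exists>S. finite S \<and> S \<subseteq> Ep \<and> agree S x \<subseteq> {x \<in> carrier G. x \<otimes>\<^bsub>G\<^esub> g \<in> A}" by blast
  qed auto
qed

subsection \<open>Integer powers of the root of unity\<close>

text \<open>Reduction of the exponent makes powers of \<xi> available for all integers, and equality
  of powers becomes congruence modulo p.\<close>

definition xp :: "int \<Rightarrow> 'a" where "xp k = \<xi> [^] nat (k mod int p)"

lemma xp_K: "xp k \<in> K"
proof -
  have "\<xi> [^] (j::nat) \<in> K" for j using xi subringE[OF subfieldE(1)[OF subfield_axioms]] by (induction j) auto
  then show ?thesis by (simp add: xp_def)
qed

lemma xp_carrier: "xp k \<in> carrier L" "xp k \<in> Ep" "xp k \<noteq> \<zero>"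
proof -
  show "xp k \<in> carrier L" "xp k \<in> Ep" using xp_K E Ec by auto
  show "xp k \<noteq> \<zero>" using xi_pow_nonzero by (simp add: xp_def)
qed

lemma xp_nat: "xp (int i) = \<xi> [^] i"
  using xi_pow_mod[of i] by (simp add: xp_def nat_mod_distrib)

lemma xp_eq_iff: "xp k = xp l \<longleftrightarrow> [k = l] (mod int p)"
proof -
  have "nat (k mod int p) < p" "nat (l mod int p) < p" using p0 by (simp_all add: nat_less_iff)
  then have "xp k = xp l \<longleftrightarrow> nat (k mod int p) = nat (l mod int p)" unfolding xp_def xi_pow_eq_iff by simp
  then show ?thesis using p0 by (simp add: cong_def nat_eq_iff)
qed

lemma xp_0: "xp 0 = \<one>" using xp_nat[of 0] by simp

lemma xp_add: "xp (k + l) = xp k \<otimes> xp l"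
proof -
  have "xp k \<otimes> xp l = xp (int (nat (k mod int p) + nat (l mod int p)))"
    unfolding xp_nat by (simp add: xp_def nat_pow_mult[symmetric] xi_carrier)
  also have "\<dots> = xp (k + l)"
    unfolding xp_eq_iff using p0 by (simp add: cong_def mod_add_eq)
  finally show ?thesis ..
qed

lemma gal_xp: "g \<in> carrier G \<Longrightarrow> g (xp k) = xp k"
  using gal_simps(6) xp_K by blast

lemma same_pow_xp:
  assumes "x \<in> carrier L" "y \<in> carrier L" "y \<noteq> \<zero>" "x [^] p = y [^] p"
  shows "\<exists>k. x = xp k \<otimes> y"
  using same_pow_p[OF assms] xp_nat by metis

lemma xp_cancel:
  assumes "y \<in> carrier L" "y \<noteq> \<zero>" "xp k \<otimes> y = xp l \<otimes> y"
  shows "[k = l] (mod int p)"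
  using assms m_rcancel[OF assms(2,1) xp_carrier(1) xp_carrier(1)] xp_eq_iff by simp

subsection \<open>Kummer theory for open subgroups\<close>

lemma open_subgroup_stabilizer:
  assumes "openin T N" "subgroup N G"
  obtains S where "finite S" "S \<subseteq> Ep" "agree S \<one>\<^bsub>G\<^esub> \<subseteq> N"
  using assms subgroup.one_closed[OF assms(2)] unfolding openin_T by blast

lemma agree_coset:
  assumes "S \<subseteq> Ep" "agree S \<one>\<^bsub>G\<^esub> \<subseteq> N" "g \<in> carrier G" "h \<in> carrier G" "\<And>e. e \<in> S \<Longrightarrow> g e = h e"
  shows "inv\<^bsub>G\<^esub> g \<otimes>\<^bsub>G\<^esub> h \<in> N"
proof -
  have "h \<in> agree S g" using assms by (simp add: agree_def)
  then show ?thesis using agree_left[OF assms(3,4,1)] assms(2) by blast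
qed

text \<open>Hilbert 90 by a resolvent. The coefficients \<xi>^(-h g) on N, extended by 0 to G, are
  multiplied by \<xi>^(h \<tau>) when translated by \<tau> in N, and so is the resolvent. Extension
  by 0 allows sums over a quotient of G with coefficients in K, without passing to the fixed field
  of N as a new base.\<close>

theorem kummer_character:
  fixes h :: "('a \<Rightarrow> 'a) \<Rightarrow> int"
  assumes N: "openin T N" "subgroup N G"
    and h: "\<And>g g'. g \<in> N \<Longrightarrow> g' \<in> N \<Longrightarrow> [h (g \<otimes>\<^bsub>G\<^esub> g') = h g + h g'] (mod int p)"
    and S1: "finite S1" "S1 \<subseteq> Ep" "\<And>u. u \<in> agree S1 \<one>\<^bsub>G\<^esub> \<Longrightarrow> u \<in> N \<Longrightarrow> [h u = 0] (mod int p)"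
  obtains \<beta> where "\<beta> \<in> Ep" "\<beta> \<noteq> \<zero>" "\<And>\<tau>. \<tau> \<in> N \<Longrightarrow> \<tau> \<beta> = xp (h \<tau>) \<otimes> \<beta>"
proof -
  interpret N: subgroup N G by fact
  \<comment> \<open>S2 makes N a union of cosets of the stabilizer, and S1 makes h constant modulo p
    on those cosets.\<close>
  obtain S2 where S2: "finite S2" "S2 \<subseteq> Ep" "agree S2 \<one>\<^bsub>G\<^esub> \<subseteq> N" using open_subgroup_stabilizer[OF N] .
  interpret st: stabilizer_setting L K Ep "S1 \<union> S2"
    using S1 S2 by unfold_locales auto
  define c where "c = (\<lambda>g. if g \<in> N then xp (- h g) else \<zero>)"
  have sub: "agree (S1 \<union> S2) \<one>\<^bsub>G\<^esub> \<subseteq> agree S1 \<one>\<^bsub>G\<^esub> \<inter> N" using S2(3) by (auto simp: agree_def)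
  have inv: "st.invariant c"
    unfolding st.invariant_def
  proof (intro conjI ballI impI)
    show "c g \<in> K" if "g \<in> carrier G" for g
      using xp_K subringE(2)[OF subfieldE(1)[OF subfield_axioms]] by (simp add: c_def)
    fix g g' assume g: "g \<in> carrier G" "g' \<in> carrier G" "\<forall>e\<in>S1 \<union> S2. g e = g' e"
    have u: "inv\<^bsub>G\<^esub> g \<otimes>\<^bsub>G\<^esub> g' \<in> agree S1 \<one>\<^bsub>G\<^esub> \<inter> N"
      using agree_coset[OF _ sub g(1,2)] g(3) S1(2) S2(2) by blast
    let ?u = "inv\<^bsub>G\<^esub> g \<otimes>\<^bsub>G\<^esub> g'"
    have g': "g' = g \<otimes>\<^bsub>G\<^esub> ?u" using g by (simp add: G.m_assoc[symmetric])
    show "c g = c g'"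
    proof (cases "g \<in> N")
      case True
      then have "g' \<in> N" using g' u N.m_closed by (metis IntD2)
      moreover have "[- h g = - h g'] (mod int p)"
      proof -
        have "[h (g \<otimes>\<^bsub>G\<^esub> ?u) = h g + h ?u] (mod int p)" using h[OF True, of ?u] u by blast
        then have "int p dvd h g' - (h g + h ?u)" unfolding g'[symmetric] by (simp only: cong_iff_dvd_diff)
        moreover have "int p dvd h ?u - 0" using S1(3)[OF IntD1[OF u] IntD2[OF u]] by (simp only: cong_iff_dvd_diff)
        ultimately have "int p dvd (h g' - (h g + h ?u)) + (h ?u - 0)" by (rule dvd_add)
        moreover have "(h g' - (h g + h ?u)) + (h ?u - 0) = - h g - - h g'" by simp
        ultimately show ?thesis by (simp only: cong_iff_dvd_diff)
      qed
      ultimately show ?thesis using True xp_eq_iff by (simp add: c_def)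
    next
      case False
      have "g' \<notin> N"
      proof
        assume "g' \<in> N"
        moreover have "g = g' \<otimes>\<^bsub>G\<^esub> inv\<^bsub>G\<^esub> ?u" using g by (simp add: G.inv_mult_group G.m_assoc[symmetric])
        ultimately show False using False u N.m_closed N.m_inv_closed by (metis IntD2)
      qed
      then show ?thesis using False by (simp add: c_def)
    qed
  qed
  have c1: "c \<one>\<^bsub>G\<^esub> \<noteq> \<zero>" using xp_carrier(3) by (simp add: c_def)
  obtain e where e: "e \<in> st.Fx" "st.theta c e \<noteq> \<zero>" using st.theta_nonzero[OF inv G.one_closed c1] .
  have "\<tau> (st.theta c e) = xp (h \<tau>) \<otimes> st.theta c e" if t: "\<tau> \<in> N" for \<tau>
  proof -
    have tc: "\<tau> \<in> carrier G" using N.mem_carrier[OF t] .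
    note tr = st.theta_translate[OF inv e(1) tc]
    have "c (inv\<^bsub>G\<^esub> \<tau> \<otimes>\<^bsub>G\<^esub> g) = xp (h \<tau>) \<otimes> c g" if g: "g \<in> carrier G" for g
    proof (cases "g \<in> N")
      case True
      have i: "inv\<^bsub>G\<^esub> \<tau> \<otimes>\<^bsub>G\<^esub> g \<in> N" using True t by simp
      have "\<tau> \<otimes>\<^bsub>G\<^esub> (inv\<^bsub>G\<^esub> \<tau> \<otimes>\<^bsub>G\<^esub> g) = g" using tc g by (simp add: G.m_assoc[symmetric])
      then have "[h g = h \<tau> + h (inv\<^bsub>G\<^esub> \<tau> \<otimes>\<^bsub>G\<^esub> g)] (mod int p)" using h[OF t i] by simp
      then have "int p dvd h g - (h \<tau> + h (inv\<^bsub>G\<^esub> \<tau> \<otimes>\<^bsub>G\<^esub> g))" by (simp add: cong_iff_dvd_diff)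
      moreover have "- h (inv\<^bsub>G\<^esub> \<tau> \<otimes>\<^bsub>G\<^esub> g) - (h \<tau> + - h g) = h g - (h \<tau> + h (inv\<^bsub>G\<^esub> \<tau> \<otimes>\<^bsub>G\<^esub> g))" by simp
      ultimately have "[- h (inv\<^bsub>G\<^esub> \<tau> \<otimes>\<^bsub>G\<^esub> g) = h \<tau> + - h g] (mod int p)" by (simp only: cong_iff_dvd_diff)
      then show ?thesis using True i xp_eq_iff by (simp add: c_def xp_add[symmetric])
    next
      case False
      have "inv\<^bsub>G\<^esub> \<tau> \<otimes>\<^bsub>G\<^esub> g \<notin> N"
      proof
        assume "inv\<^bsub>G\<^esub> \<tau> \<otimes>\<^bsub>G\<^esub> g \<in> N"
        then have "\<tau> \<otimes>\<^bsub>G\<^esub> (inv\<^bsub>G\<^esub> \<tau> \<otimes>\<^bsub>G\<^esub> g) \<in> N" using t by blast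
        then show False using False tc g by (simp add: G.m_assoc[symmetric])
      qed
      then show ?thesis using False xp_carrier(1) by (simp add: c_def)
    qed
    then show ?thesis using tr(2) st.theta_smult[OF inv tr(1) e(1) xp_K] by simp
  qed
  then show thesis using that st.theta_E[OF inv e(1)] e(2) by blast
qed

text \<open>The Galois correspondence for open subgroups. The resolvent of the indicator of N lies
  in the fixed field; the resolvent of the indicator of N minus that of g N is its difference from
  its image under g, and Dedekind makes this nonzero at some element.\<close>

lemma fixed_field_separates:
  assumes N: "openin T N" "subgroup N G" and g: "g \<in> carrier G" "g \<notin> N"
  obtains b where "b \<in> fixed_field Ep N" "g b \<noteq> b"
proof -
  interpret N: subgroup N G by fact
  obtain S where S: "finite S" "S \<subseteq> Ep" "agree S \<one>\<^bsub>G\<^esub> \<subseteq> N" using open_subgroup_stabilizer[OF N] .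
  interpret st: stabilizer_setting L K Ep S using S by unfold_locales auto
  define c where "c = (\<lambda>h. if h \<in> N then \<one> else \<zero>)"
  define c' where "c' = (\<lambda>h. if h \<in> N then \<one> else if inv\<^bsub>G\<^esub> g \<otimes>\<^bsub>G\<^esub> h \<in> N then \<ominus> \<one> else \<zero>)"
  note Ks = subringE[OF subfieldE(1)[OF subfield_axioms]]
  have mN: "a \<otimes>\<^bsub>G\<^esub> b \<in> N \<longleftrightarrow> b \<in> N" if "a \<in> N" "b \<in> carrier G" for a b
  proof
    assume "a \<otimes>\<^bsub>G\<^esub> b \<in> N"
    then have "inv\<^bsub>G\<^esub> a \<otimes>\<^bsub>G\<^esub> (a \<otimes>\<^bsub>G\<^esub> b) \<in> N" using that by blast
    then show "b \<in> N" using that by (simp add: G.m_assoc[symmetric])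
  qed (use that in blast)
  have mN': "a \<otimes>\<^bsub>G\<^esub> h \<in> N \<longleftrightarrow> a \<otimes>\<^bsub>G\<^esub> h' \<in> N"
    if a: "a \<in> carrier G" and h: "h \<in> carrier G" "h' \<in> carrier G" "\<forall>e\<in>S. h e = h' e" for a h h'
  proof -
    have u: "inv\<^bsub>G\<^esub> h \<otimes>\<^bsub>G\<^esub> h' \<in> N" using agree_coset[OF S(2,3) h(1,2)] h(3) by blast
    have 1: "a \<otimes>\<^bsub>G\<^esub> h' = (a \<otimes>\<^bsub>G\<^esub> h) \<otimes>\<^bsub>G\<^esub> (inv\<^bsub>G\<^esub> h \<otimes>\<^bsub>G\<^esub> h')"
      using a h by (metis G.inv_closed G.inv_solve_left G.m_assoc G.m_closed)
    have 2: "a \<otimes>\<^bsub>G\<^esub> h = (a \<otimes>\<^bsub>G\<^esub> h') \<otimes>\<^bsub>G\<^esub> inv\<^bsub>G\<^esub> (inv\<^bsub>G\<^esub> h \<otimes>\<^bsub>G\<^esub> h')"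
      unfolding 1 using a h by (metis G.inv_closed G.inv_solve_right G.m_closed)
    show ?thesis using 1 2 u N.m_closed N.m_inv_closed by metis
  qed
  have mN1: "h \<in> N \<longleftrightarrow> h' \<in> N" if h: "h \<in> carrier G" "h' \<in> carrier G" "\<forall>e\<in>S. h e = h' e" for h h'
    using mN'[OF G.one_closed h] h by simp
  have ic: "inv\<^bsub>G\<^esub> g \<in> carrier G" using g by simp
  have inv: "st.invariant c"
  proof (rule st.invariantI)
    show "c h \<in> K" for h using Ks(2,3) by (simp add: c_def)
    show "c h = c h'" if "h \<in> carrier G" "h' \<in> carrier G" "\<forall>e\<in>S. h e = h' e" for h h'
      unfolding c_def using mN1[OF that] by (simp only:)
  qed
  have inv': "st.invariant c'"
  proof (rule st.invariantI)
    show "c' h \<in> K" for h using Ks(2,3) Ks(5)[OF Ks(3)] by (simp add: c'_def)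
    show "c' h = c' h'" if "h \<in> carrier G" "h' \<in> carrier G" "\<forall>e\<in>S. h e = h' e" for h h'
      unfolding c'_def using mN1[OF that] mN'[OF ic that] by (simp only:)
  qed
  have "c' \<one>\<^bsub>G\<^esub> \<noteq> \<zero>" by (simp add: c'_def)
  then obtain e where e: "e \<in> st.Fx" "st.theta c' e \<noteq> \<zero>" using st.theta_nonzero[OF inv' G.one_closed] by blast
  have fixd: "\<tau> (st.theta c e) = st.theta c e" if t: "\<tau> \<in> N" for \<tau>
  proof -
    have tc: "\<tau> \<in> carrier G" using N.mem_carrier[OF t] .
    note tr = st.theta_translate[OF inv e(1) tc]
    have "st.theta (\<lambda>h. c (inv\<^bsub>G\<^esub> \<tau> \<otimes>\<^bsub>G\<^esub> h)) e = \<one> \<otimes> st.theta c e"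
      using mN[OF N.m_inv_closed[OF t]] by (intro st.theta_smult[OF inv tr(1) e(1) Ks(3)]) (auto simp: c_def)
    then show ?thesis using tr(2) st.theta_E[OF inv e(1)] Ec by auto
  qed
  have "g (st.theta c e) \<noteq> st.theta c e"
  proof
    assume eq: "g (st.theta c e) = st.theta c e"
    note tr = st.theta_translate[OF inv e(1) g(1)]
    let ?c = "\<lambda>h. c (inv\<^bsub>G\<^esub> g \<otimes>\<^bsub>G\<^esub> h)"
    have cl: "(\<lambda>f. c (st.pick f) \<otimes> f e) \<in> st.Rs \<rightarrow> carrier L" "(\<lambda>f. ?c (st.pick f) \<otimes> f e) \<in> st.Rs \<rightarrow> carrier L"
      "(\<lambda>f. c' (st.pick f) \<otimes> f e) \<in> st.Rs \<rightarrow> carrier L"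
      using st.theta_terms(2)[OF inv _ e(1)] st.theta_terms(2)[OF tr(1) _ e(1)] st.theta_terms(2)[OF inv' _ e(1)] Ec by blast+
    have "st.theta c' e \<oplus> st.theta ?c e = (\<Oplus>f\<in>st.Rs. c' (st.pick f) \<otimes> f e \<oplus> ?c (st.pick f) \<otimes> f e)"
      unfolding st.theta_def using cl by (intro finsum_addf[symmetric]) auto
    also have "\<dots> = st.theta c e"
      unfolding st.theta_def
    proof (rule finsum_cong')
      fix f assume f: "f \<in> st.Rs"
      have fe: "f e \<in> carrier L" using st.Rs_E[OF f e(1)] Ec by blast
      \<comment> \<open>N and g N are disjoint because g lies outside N, so the case order in the
        definition of \<open>c'\<close> hides nothing.\<close>
      have "\<not> (st.pick f \<in> N \<and> inv\<^bsub>G\<^esub> g \<otimes>\<^bsub>G\<^esub> st.pick f \<in> N)"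
      proof
        assume a: "st.pick f \<in> N \<and> inv\<^bsub>G\<^esub> g \<otimes>\<^bsub>G\<^esub> st.pick f \<in> N"
        then have "(inv\<^bsub>G\<^esub> g \<otimes>\<^bsub>G\<^esub> st.pick f) \<otimes>\<^bsub>G\<^esub> inv\<^bsub>G\<^esub> (st.pick f) \<in> N" by blast
        then have "inv\<^bsub>G\<^esub> g \<in> N" using ic st.pick(1)[OF f] by (simp add: G.m_assoc)
        then have "inv\<^bsub>G\<^esub> (inv\<^bsub>G\<^esub> g) \<in> N" by blast
        then show False using g by simp
      qed
      then show "c' (st.pick f) \<otimes> f e \<oplus> ?c (st.pick f) \<otimes> f e = c (st.pick f) \<otimes> f e"
        using fe by (auto simp: c_def c'_def l_minus l_neg)
    qed (use cl in auto)
    finally have s: "st.theta c' e \<oplus> st.theta c e = st.theta c e" using tr(2) eq by simp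
    have cL: "st.theta c' e \<in> carrier L" "st.theta c e \<in> carrier L"
      using st.theta_E[OF inv' e(1)] st.theta_E[OF inv e(1)] Ec by auto
    have "st.theta c' e = \<zero>" using s cL by (metis add.l_cancel_one' a_comm zero_closed)
    then show False using e(2) by blast
  qed
  then show thesis using that[of "st.theta c e"] fixd st.theta_E[OF inv e(1)] by (auto simp: fixed_field_def)
qed

end


section \<open>Characters that are norms\<close>

text \<open>For p = 2 h + 1 the sum 0 + 1 + ... + (p - 1) is divisible by p; this is how odd p
  enters the norm computation.\<close>

lemma sum_lessThan_odd: "(\<Sum>i<2 * h + 1. i) = (2 * h + 1) * (h::nat)"
  by (induction h) (auto simp: algebra_simps)

section \<open>Products over the powers of one automorphism\<close>

context kummer_closure
begin

definition loc_const :: "(('a \<Rightarrow> 'a) \<Rightarrow> 'c) \<Rightarrow> bool" where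
  "loc_const f \<longleftrightarrow> (\<forall>x\<in>carrier G. \<exists>S. finite S \<and> S \<subseteq> Ep \<and> (\<forall>y\<in>agree S x. f y = f x))"

text \<open>If g generates G modulo N, u is fixed by N and m = p, this is the norm of u. For other u
  it depends on the choice of g, but it stays multiplicative in u.\<close>

definition act_prod :: "('a \<Rightarrow> 'a) \<Rightarrow> nat \<Rightarrow> 'a \<Rightarrow> 'a" where
  "act_prod g m u = (\<Otimes>i\<in>{..<m}. (g [^]\<^bsub>G\<^esub> (i::nat)) u)"

lemma act_closed: "g \<in> carrier G \<Longrightarrow> u \<in> Ep \<Longrightarrow> (g [^]\<^bsub>G\<^esub> (i::nat)) u \<in> Ep"
  using gal_simps(1)[OF G.nat_pow_closed] .

lemma prod_in_Ep: "(\<And>i::nat. i < m \<Longrightarrow> t i \<in> Ep) \<Longrightarrow> (\<Otimes>i\<in>{..<m}. t i) \<in> Ep"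
proof (induction m)
  case 0
  then show ?case using E_subring(3) by simp
next
  case (Suc m)
  have t: "t i \<in> Ep" "t i \<in> carrier L" if "i < Suc m" for i using Suc.prems[OF that] Ec by auto
  have "(\<Otimes>i\<in>{..<Suc m}. t i) = t m \<otimes> (\<Otimes>i\<in>{..<m}. t i)"
    unfolding lessThan_Suc using t by (intro finprod_insert) auto
  then show ?case using E_subring(6)[OF t(1)[of m]] Suc.IH[OF t(1)] by simp
qed

lemma prod_Suc:
  assumes "\<And>i::nat. i < Suc m \<Longrightarrow> t i \<in> Ep"
  shows "(\<Otimes>i\<in>{..<Suc m}. t i) = (\<Otimes>i\<in>{..<m}. t i) \<otimes> t m"
proof -
  have t: "t i \<in> carrier L" if "i < Suc m" for i using assms[OF that] Ec by auto
  have "(\<Otimes>i\<in>{..<Suc m}. t i) = t m \<otimes> (\<Otimes>i\<in>{..<m}. t i)"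
    unfolding lessThan_Suc using t by (intro finprod_insert) auto
  also have "\<dots> = (\<Otimes>i\<in>{..<m}. t i) \<otimes> t m" using t by (intro m_comm finprod_closed) auto
  finally show ?thesis .
qed

lemma gal_prod:
  assumes g: "g \<in> carrier G" and t: "\<And>i::nat. i < m \<Longrightarrow> t i \<in> Ep"
  shows "g (\<Otimes>i\<in>{..<m}. t i) = (\<Otimes>i\<in>{..<m}. g (t i))"
  using t
proof (induction m)
  case 0
  then show ?case using gal_simps(4)[OF g] by simp
next
  case (Suc m)
  have "(\<Otimes>i\<in>{..<m}. t i) \<in> Ep" using Suc.prems by (intro prod_in_Ep) auto
  then have "g (\<Otimes>i\<in>{..<Suc m}. t i) = g (\<Otimes>i\<in>{..<m}. t i) \<otimes> g (t m)"
    using prod_Suc[OF Suc.prems] gal_simps(2)[OF g _ Suc.prems[of m]] by simp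
  also have "\<dots> = (\<Otimes>i\<in>{..<Suc m}. g (t i))"
    using Suc gal_simps(1)[OF g] by (subst prod_Suc) auto
  finally show ?case .
qed

lemma act_prod_Suc:
  assumes "g \<in> carrier G" "u \<in> Ep"
  shows "act_prod g (Suc m) u = act_prod g m u \<otimes> (g [^]\<^bsub>G\<^esub> m) u" "act_prod g m u \<in> Ep" "act_prod g 0 u = \<one>"
  unfolding act_prod_def using prod_Suc prod_in_Ep act_closed[OF assms] by auto

lemma act_prod_mult:
  assumes g: "g \<in> carrier G" and u: "u \<in> Ep" "v \<in> Ep"
  shows "act_prod g m (u \<otimes> v) = act_prod g m u \<otimes> act_prod g m v"
proof (induction m)
  case (Suc m)
  note a = act_prod_Suc[OF g]
  have gm: "g [^]\<^bsub>G\<^esub> m \<in> carrier G" using g by simp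
  have c: "act_prod g m u \<in> carrier L" "act_prod g m v \<in> carrier L" "(g [^]\<^bsub>G\<^esub> m) u \<in> carrier L" "(g [^]\<^bsub>G\<^esub> m) v \<in> carrier L"
    using a(2) u act_closed[OF g] Ec by auto
  show ?case
    unfolding a(1)[OF E_subring(6)[OF u]] a(1)[OF u(1)] a(1)[OF u(2)] Suc gal_simps(2)[OF gm u]
    using c by (simp add: m_ac)
qed (use act_prod_Suc(3)[OF g] u E_subring(6)[OF u] in simp)

lemma act_prod_one: "g \<in> carrier G \<Longrightarrow> act_prod g m \<one> = \<one>"
proof (induction m)
  case (Suc m)
  then show ?case using act_prod_Suc(1)[OF Suc.prems E_subring(3)] gal_simps(4)[OF G.nat_pow_closed[OF Suc.prems]] by simp
qed (use act_prod_Suc(3) E_subring(3) in simp)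

lemma pow_Ep: "u \<in> Ep \<Longrightarrow> u [^] (n::nat) \<in> Ep"
  using E_subring(3,6) by (induction n) auto

lemma act_prod_pow:
  assumes g: "g \<in> carrier G" and u: "u \<in> Ep"
  shows "act_prod g m (u [^] (n::nat)) = (act_prod g m u) [^] n"
proof (induction n)
  case (Suc n)
  have "act_prod g m (u [^] Suc n) = act_prod g m (u [^] n) \<otimes> act_prod g m u"
    using act_prod_mult[OF g pow_Ep[OF u] u] by simp
  then show ?case using Suc by simp
qed (use act_prod_one[OF g] in simp)

lemma xp_prod:
  assumes "\<And>i::nat. i < m \<Longrightarrow> t i \<in> Ep"
  shows "(\<Otimes>i\<in>{..<m}. xp (k i) \<otimes> t i) = xp (\<Sum>i<m. k i) \<otimes> (\<Otimes>i\<in>{..<m}. t i)"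
  using assms
proof (induction m)
  case 0
  then show ?case by (simp add: xp_0)
next
  case (Suc m)
  have c: "(\<Otimes>i\<in>{..<m}. t i) \<in> carrier L" "t m \<in> carrier L"
    using Suc.prems prod_in_Ep[of m t] Ec by auto
  have "(\<Otimes>i\<in>{..<Suc m}. xp (k i) \<otimes> t i) = xp (\<Sum>i<m. k i) \<otimes> (\<Otimes>i\<in>{..<m}. t i) \<otimes> (xp (k m) \<otimes> t m)"
    using Suc E_subring(6)[OF xp_carrier(2)] by (subst prod_Suc) auto
  also have "\<dots> = xp (\<Sum>i<Suc m. k i) \<otimes> ((\<Otimes>i\<in>{..<m}. t i) \<otimes> t m)"
    using c xp_carrier(1) by (simp add: xp_add m_ac)
  finally show ?case using prod_Suc[OF Suc.prems] by simp
qed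

lemma inv_Ep: "u \<in> Ep \<Longrightarrow> u \<noteq> \<zero> \<Longrightarrow> inv u \<in> Ep \<and> u \<otimes> inv u = \<one> \<and> inv u \<otimes> u = \<one>"
  using subfield_m_inv[OF E(1), of u] by blast

text \<open>Hilbert 90 enters through \<open>\<beta>\<close> and \<open>\<phi>\<close>: the element \<open>z\<close> with \<open>s\<^sup>-\<^sup>1 \<beta> = \<beta> \<phi> z\<close> is fixed by \<open>N\<close> and
  has norm \<open>\<phi>\<^sup>-\<^sup>p\<close>, so a \<open>p\<close>-th root \<open>\<gamma>\<close> of its inverse has norm \<open>\<phi>\<close> up to a root of unity, and the
  Kummer character of \<open>\<gamma>\<close> corestricts to \<open>f\<close>.\<close>

theorem character_is_norm:
  fixes \<chi> :: "('a \<Rightarrow> 'a) \<Rightarrow> nat" and W f :: "('a \<Rightarrow> 'a) \<Rightarrow> int"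
  assumes N: "openin T N" "subgroup N G"
    and chi: "\<And>g. g \<in> carrier G \<Longrightarrow> \<chi> g < p"
      "\<And>g h. g \<in> carrier G \<Longrightarrow> h \<in> carrier G \<Longrightarrow> [\<chi> (g \<otimes>\<^bsub>G\<^esub> h) = \<chi> g + \<chi> h] (mod p)"
      "\<And>g. g \<in> carrier G \<Longrightarrow> g \<in> N \<longleftrightarrow> \<chi> g = 0" "loc_const \<chi>"
    and s: "s \<in> carrier G" "\<chi> s = 1" and odd: "odd p"
    and W: "\<And>\<tau> x. \<tau> \<in> N \<Longrightarrow> x \<in> carrier G \<Longrightarrow> [W (\<tau> \<otimes>\<^bsub>G\<^esub> x) = W \<tau> + W x] (mod int p)"
      "loc_const (\<lambda>x. W x mod int p)"
    and f: "\<And>g h. g \<in> carrier G \<Longrightarrow> h \<in> carrier G \<Longrightarrow> [f (g \<otimes>\<^bsub>G\<^esub> h) = f g + f h] (mod int p)"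
      "loc_const (\<lambda>x. f x mod int p)"
    and rel: "\<And>y. y \<in> carrier G \<Longrightarrow> [W (s \<otimes>\<^bsub>G\<^esub> y) = W y + f y + W s] (mod int p)"
  obtains \<nu> :: "('a \<Rightarrow> 'a) \<Rightarrow> int" where
    "\<And>\<tau> x. \<tau> \<in> N \<Longrightarrow> x \<in> carrier G \<Longrightarrow> [\<nu> (\<tau> \<otimes>\<^bsub>G\<^esub> x) = \<nu> \<tau> + \<nu> x] (mod int p)" "loc_const \<nu>"
    "\<And>x. x \<in> carrier G \<Longrightarrow> [(\<Sum>i<p. \<nu> (s [^]\<^bsub>G\<^esub> i \<otimes>\<^bsub>G\<^esub> x)) = f x] (mod int p)"
proof -
  interpret N: subgroup N G by fact
  have NG: "\<tau> \<in> carrier G" if "\<tau> \<in> N" for \<tau> using N.mem_carrier[OF that] .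
  have one_c: "[W \<one>\<^bsub>G\<^esub> = 0] (mod int p)" "[f \<one>\<^bsub>G\<^esub> = 0] (mod int p)"
    using W(1)[OF N.one_closed G.one_closed] f(1)[OF G.one_closed G.one_closed] by (auto simp: cong_iff_dvd_diff)
  have W_kernel: "\<exists>S. finite S \<and> S \<subseteq> Ep \<and> (\<forall>u\<in>agree S \<one>\<^bsub>G\<^esub>. [W u = 0] (mod int p))"
    and f_kernel: "\<exists>S. finite S \<and> S \<subseteq> Ep \<and> (\<forall>u\<in>agree S \<one>\<^bsub>G\<^esub>. [f u = 0] (mod int p))"
    using W(2) f(2) G.one_closed one_c unfolding loc_const_def cong_def by (metis (no_types, lifting))+
  obtain S1 where S1: "finite S1" "S1 \<subseteq> Ep" "\<And>u. u \<in> agree S1 \<one>\<^bsub>G\<^esub> \<Longrightarrow> [W u = 0] (mod int p)"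
    using W_kernel by blast
  obtain S2 where S2: "finite S2" "S2 \<subseteq> Ep" "\<And>u. u \<in> agree S2 \<one>\<^bsub>G\<^esub> \<Longrightarrow> [f u = 0] (mod int p)"
    using f_kernel by blast
  have G_open: "openin T (carrier G)" using openin_topspace[of T] topspace_T by simp
  \<comment> \<open>Kummer generators: \<beta> realizes W on N, and \<phi> below realizes f on all
    of G.\<close>
  obtain \<beta> where b: "\<beta> \<in> Ep" "\<beta> \<noteq> \<zero>" "\<And>\<tau>. \<tau> \<in> N \<Longrightarrow> \<tau> \<beta> = xp (W \<tau>) \<otimes> \<beta>"
    using kummer_character[OF N W(1)[OF _ NG] S1(1,2) S1(3)] by blast
  obtain \<phi> where ph: "\<phi> \<in> Ep" "\<phi> \<noteq> \<zero>" "\<And>g. g \<in> carrier G \<Longrightarrow> g \<phi> = xp (f g) \<otimes> \<phi>"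
    using kummer_character[OF G_open G.subgroup_self f(1) S2(1,2) S2(3)] by blast
  let ?s' = "inv\<^bsub>G\<^esub> s"
  let ?sp = "\<lambda>i::nat. ?s' [^]\<^bsub>G\<^esub> i"
  have s': "?s' \<in> carrier G" and sp: "\<And>i. ?sp i \<in> carrier G" using s by auto
  have EL: "\<And>u. u \<in> Ep \<Longrightarrow> u \<in> carrier L" using Ec by blast
  have chi1: "\<chi> \<one>\<^bsub>G\<^esub> = 0" using chi(3)[OF G.one_closed] N.one_closed by blast
  define z where "z = inv (\<beta> \<otimes> \<phi>) \<otimes> ?s' \<beta>"
  have bp: "\<beta> \<otimes> \<phi> \<in> Ep" "\<beta> \<otimes> \<phi> \<noteq> \<zero>"
    using b ph E_subring(6) EL integral_iff[of \<beta> \<phi>] by auto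
  note ibp = inv_Ep[OF bp]
  have sb: "?s' \<beta> \<in> Ep" "?s' \<beta> \<noteq> \<zero>"
    using gal_simps(1)[OF s' b(1)] gal_inj[OF s' b(1) E_subring(2)] gal_simps(5)[OF s'] b(2) by auto
  have zE: "z \<in> Ep" using ibp sb E_subring(6) by (simp add: z_def)
  have zeq: "?s' \<beta> = \<beta> \<otimes> \<phi> \<otimes> z"
    using ibp sb bp EL unfolding z_def by (simp add: m_assoc[symmetric])
  have znz: "z \<noteq> \<zero>" using zeq sb(2) bp EL by auto
  have pz: "\<phi> \<otimes> z \<in> Ep" using E_subring(6)[OF ph(1) zE] .
  \<comment> \<open>Conjugation by s changes W on N by f, and the factor \<phi> in the definition of
    z compensates for exactly this change.\<close>
  have zfix: "\<tau> z = z" if t: "\<tau> \<in> N" for \<tau>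
  proof -
    have tc: "\<tau> \<in> carrier G" using NG[OF t] .
    let ?t = "s \<otimes>\<^bsub>G\<^esub> \<tau> \<otimes>\<^bsub>G\<^esub> ?s'"
    have tt: "?t \<in> carrier G" using tc s s' by simp
    have ct: "\<chi> \<tau> = 0" using chi(3)[OF tc] t by simp
    have "[\<chi> ?t = \<chi> (s \<otimes>\<^bsub>G\<^esub> \<tau>) + \<chi> ?s'] (mod p)" using chi(2)[of "s \<otimes>\<^bsub>G\<^esub> \<tau>" ?s'] s s' tc by simp
    moreover have "[\<chi> (s \<otimes>\<^bsub>G\<^esub> \<tau>) + \<chi> ?s' = (\<chi> s + \<chi> \<tau>) + \<chi> ?s'] (mod p)"
      using chi(2)[OF s(1) tc] by (rule cong_add[OF _ cong_refl])
    moreover have "[\<chi> s + \<chi> ?s' = 0] (mod p)" using chi(2)[OF s(1) s'] s chi1 by (simp add: cong_sym)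
    ultimately have "[\<chi> ?t = 0] (mod p)" using ct by (metis add.right_neutral cong_trans)
    then have tN: "?t \<in> N" using chi(3)[OF tt] chi(1)[OF tt] by (simp add: cong_def)
    have "?t \<otimes>\<^bsub>G\<^esub> s = s \<otimes>\<^bsub>G\<^esub> \<tau>" using tc s by (simp add: G.m_assoc)
    then have "[W (s \<otimes>\<^bsub>G\<^esub> \<tau>) = W ?t + W s] (mod int p)" using W(1)[OF tN s(1)] by simp
    then have "int p dvd (W (s \<otimes>\<^bsub>G\<^esub> \<tau>) - (W \<tau> + f \<tau> + W s)) - (W (s \<otimes>\<^bsub>G\<^esub> \<tau>) - (W ?t + W s))"
      using rel[OF tc] by (simp only: cong_iff_dvd_diff dvd_diff)
    moreover have "(W (s \<otimes>\<^bsub>G\<^esub> \<tau>) - (W \<tau> + f \<tau> + W s)) - (W (s \<otimes>\<^bsub>G\<^esub> \<tau>) - (W ?t + W s)) = W ?t - (W \<tau> + f \<tau>)" by simp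
    ultimately have Wt: "[W ?t = W \<tau> + f \<tau>] (mod int p)" by (simp only: cong_iff_dvd_diff)
    have "\<tau> \<otimes>\<^bsub>G\<^esub> ?s' = ?s' \<otimes>\<^bsub>G\<^esub> ?t" using tc s by (simp add: G.m_assoc[symmetric])
    then have "\<tau> (?s' \<beta>) = ?s' (?t \<beta>)" using gal_mult[OF tc s' b(1)] gal_mult[OF s' tt b(1)] by simp
    also have "\<dots> = xp (W ?t) \<otimes> ?s' \<beta>"
      using b(3)[OF tN] gal_simps(2)[OF s' xp_carrier(2) b(1)] gal_xp[OF s'] by simp
    also have "xp (W ?t) = xp (W \<tau> + f \<tau>)" using Wt xp_eq_iff by blast
    also have "xp (W \<tau> + f \<tau>) \<otimes> ?s' \<beta> = xp (W \<tau> + f \<tau>) \<otimes> (\<beta> \<otimes> \<phi>) \<otimes> z" using zeq bp zE EL xp_carrier(1) by (simp add: m_assoc)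
    finally have 1: "\<tau> (?s' \<beta>) = xp (W \<tau> + f \<tau>) \<otimes> (\<beta> \<otimes> \<phi>) \<otimes> z" .
    have "\<tau> (?s' \<beta>) = \<tau> \<beta> \<otimes> \<tau> \<phi> \<otimes> \<tau> z"
      unfolding zeq using gal_simps(2)[OF tc bp(1) zE] gal_simps(2)[OF tc b(1) ph(1)] by simp
    also have "\<dots> = xp (W \<tau> + f \<tau>) \<otimes> (\<beta> \<otimes> \<phi>) \<otimes> \<tau> z"
      using b(3)[OF t] ph(3)[OF tc] xp_carrier(1) EL[OF b(1)] EL[OF ph(1)] EL[OF gal_simps(1)[OF tc zE]]
      by (simp add: xp_add m_ac)
    finally have 2: "xp (W \<tau> + f \<tau>) \<otimes> (\<beta> \<otimes> \<phi>) \<otimes> \<tau> z = xp (W \<tau> + f \<tau>) \<otimes> (\<beta> \<otimes> \<phi>) \<otimes> z" using 1 by simp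
    have "xp (W \<tau> + f \<tau>) \<otimes> (\<beta> \<otimes> \<phi>) \<noteq> \<zero>" "xp (W \<tau> + f \<tau>) \<otimes> (\<beta> \<otimes> \<phi>) \<in> carrier L"
      using integral_iff[OF xp_carrier(1) EL[OF bp(1)]] xp_carrier bp EL by auto
    then show ?thesis using 2 m_lcancel EL[OF gal_simps(1)[OF tc zE]] EL[OF zE] by blast
  qed
  \<comment> \<open>Iteration of s^(-1) \<beta> = \<beta> \<phi> z.\<close>
  have A: "(?sp m) \<beta> = \<beta> \<otimes> act_prod ?s' m (\<phi> \<otimes> z)" for m
  proof (induction m)
    case 0
    then show ?case using gal_one[OF b(1)] act_prod_Suc(3)[OF s' pz] EL[OF b(1)] by simp
  next
    case (Suc m)
    have "(?sp (Suc m)) \<beta> = (?sp m) (\<beta> \<otimes> (\<phi> \<otimes> z))"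
      using gal_mult[OF sp s' b(1), of m] zeq EL b(1) ph(1) zE by (simp add: m_assoc)
    also have "\<dots> = (\<beta> \<otimes> act_prod ?s' m (\<phi> \<otimes> z)) \<otimes> (?sp m) (\<phi> \<otimes> z)"
      using gal_simps(2)[OF sp b(1) pz] Suc by simp
    also have "\<dots> = \<beta> \<otimes> act_prod ?s' (Suc m) (\<phi> \<otimes> z)"
      using act_prod_Suc(1)[OF s' pz] EL[OF b(1)] EL[OF act_prod_Suc(2)[OF s' pz]] EL[OF act_closed[OF s' pz]]
      by (simp add: m_assoc)
    finally show ?case .
  qed
  have sphi: "(?sp m) \<phi> = xp (f ?s' * int m) \<otimes> \<phi>" for m
  proof (induction m)
    case 0
    then show ?case using gal_one[OF ph(1)] EL[OF ph(1)] by (simp add: xp_0)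
  next
    case (Suc m)
    have "(?sp (Suc m)) \<phi> = (?sp m) (xp (f ?s') \<otimes> \<phi>)" using gal_mult[OF sp s' ph(1)] ph(3)[OF s'] by simp
    also have "\<dots> = xp (f ?s') \<otimes> (xp (f ?s' * int m) \<otimes> \<phi>)"
      using gal_simps(2)[OF sp xp_carrier(2) ph(1)] gal_xp[OF sp] Suc by simp
    also have "\<dots> = xp (f ?s' * int (Suc m)) \<otimes> \<phi>"
      using xp_carrier(1) EL[OF ph(1)] by (simp add: m_assoc[symmetric] xp_add[symmetric] algebra_simps)
    finally show ?case .
  qed
  have Pphi: "act_prod ?s' m \<phi> = xp (f ?s' * int (\<Sum>i<m. i)) \<otimes> \<phi> [^] m" for m
  proof (induction m)
    case 0
    then show ?case using act_prod_Suc(3)[OF s' ph(1)] by (simp add: xp_0)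
  next
    case (Suc m)
    have "act_prod ?s' (Suc m) \<phi> = xp (f ?s' * int (\<Sum>i<m. i)) \<otimes> \<phi> [^] m \<otimes> (xp (f ?s' * int m) \<otimes> \<phi>)"
      using act_prod_Suc(1)[OF s' ph(1)] Suc sphi by simp
    also have "\<dots> = xp (f ?s' * int (\<Sum>i<m. i) + f ?s' * int m) \<otimes> \<phi> [^] Suc m"
      using xp_carrier(1) EL[OF ph(1)] by (simp add: xp_add m_ac)
    finally show ?case by (simp add: algebra_simps)
  qed
  obtain h where h: "p = 2 * h + 1" using odd by (auto elim: oddE)
  have sump: "(\<Sum>i<p. i) = p * h" unfolding h by (rule sum_lessThan_odd)
  \<comment> \<open>The power of \<xi> collected from the p factors has an exponent divisible by 0 +
    1 + ... + (p - 1), hence by p.\<close>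
  have Pphip: "act_prod ?s' p \<phi> = \<phi> [^] p"
    using Pphi[of p] xp_eq_iff[of "f ?s' * int (p * h)" 0] EL[OF ph(1)] unfolding sump by (simp add: xp_0 cong_def)
  have fs: "[f (s [^]\<^bsub>G\<^esub> m) = int m * f s] (mod int p)" for m :: nat
  proof (induction m)
    case 0
    then show ?case using one_c by simp
  next
    case (Suc m)
    have "[f (s [^]\<^bsub>G\<^esub> Suc m) = f (s [^]\<^bsub>G\<^esub> m) + f s] (mod int p)" using f(1)[of "s [^]\<^bsub>G\<^esub> m" s] s by simp
    also have "[f (s [^]\<^bsub>G\<^esub> m) + f s = int m * f s + f s] (mod int p)" using Suc by (rule cong_add[OF _ cong_refl])
    finally show ?case by (simp add: algebra_simps)
  qed
  have Ws: "[W (s [^]\<^bsub>G\<^esub> m) = int m * W s + f s * int (\<Sum>i<m. i)] (mod int p)" for m :: nat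
  proof (induction m)
    case 0
    then show ?case using one_c by simp
  next
    case (Suc m)
    have "s [^]\<^bsub>G\<^esub> Suc m = s \<otimes>\<^bsub>G\<^esub> s [^]\<^bsub>G\<^esub> m" using s(1) by (rule G.nat_pow_Suc2)
    then have "[W (s [^]\<^bsub>G\<^esub> Suc m) = W (s [^]\<^bsub>G\<^esub> m) + f (s [^]\<^bsub>G\<^esub> m) + W s] (mod int p)" using rel[of "s [^]\<^bsub>G\<^esub> m"] s by simp
    also have "[W (s [^]\<^bsub>G\<^esub> m) + f (s [^]\<^bsub>G\<^esub> m) + W s = (int m * W s + f s * int (\<Sum>i<m. i)) + int m * f s + W s] (mod int p)"
      using Suc fs by (intro cong_add cong_refl)
    finally show ?case by (simp add: algebra_simps)
  qed
  have chis: "[\<chi> (g [^]\<^bsub>G\<^esub> m) = m * \<chi> g] (mod p)" if "g \<in> carrier G" for g and m :: nat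
  proof (induction m)
    case 0
    then show ?case using chi1 by simp
  next
    case (Suc m)
    have "[\<chi> (g [^]\<^bsub>G\<^esub> Suc m) = \<chi> (g [^]\<^bsub>G\<^esub> m) + \<chi> g] (mod p)" using chi(2)[of "g [^]\<^bsub>G\<^esub> m" g] that by simp
    also have "[\<chi> (g [^]\<^bsub>G\<^esub> m) + \<chi> g = m * \<chi> g + \<chi> g] (mod p)" using Suc by (rule cong_add[OF _ cong_refl])
    finally show ?case by (simp add: algebra_simps)
  qed
  have N_of_cong: "g \<in> N" if "g \<in> carrier G" "[\<chi> g = 0] (mod p)" for g
    using chi(3)[OF that(1)] chi(1)[OF that(1)] that(2) by (simp add: cong_def)
  have pN: "g [^]\<^bsub>G\<^esub> p \<in> N" if "g \<in> carrier G" for g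
    using N_of_cong[of "g [^]\<^bsub>G\<^esub> p"] chis[OF that, of p] that by (simp add: cong_def)
  \<comment> \<open>Oddness once more: W(s^p) is divisible by p, so s^p and its inverse fix
    \<beta>.\<close>
  have Wsp: "[W (s [^]\<^bsub>G\<^esub> p) = 0] (mod int p)" using Ws[of p] unfolding sump by (simp add: cong_def)
  have "?sp p \<otimes>\<^bsub>G\<^esub> s [^]\<^bsub>G\<^esub> p = \<one>\<^bsub>G\<^esub>" using s by (simp add: G.nat_pow_inv)
  then have "[W \<one>\<^bsub>G\<^esub> = W (?sp p) + W (s [^]\<^bsub>G\<^esub> p)] (mod int p)" using W(1)[OF pN[OF s'], of "s [^]\<^bsub>G\<^esub> p"] s by simp
  then have "int p dvd (W \<one>\<^bsub>G\<^esub> - 0) - (W \<one>\<^bsub>G\<^esub> - (W (?sp p) + W (s [^]\<^bsub>G\<^esub> p))) - (W (s [^]\<^bsub>G\<^esub> p) - 0)"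
    using one_c(1) Wsp by (simp only: cong_iff_dvd_diff dvd_diff)
  moreover have "(W \<one>\<^bsub>G\<^esub> - 0) - (W \<one>\<^bsub>G\<^esub> - (W (?sp p) + W (s [^]\<^bsub>G\<^esub> p))) - (W (s [^]\<^bsub>G\<^esub> p) - 0) = W (?sp p) - 0" by simp
  ultimately have "[W (?sp p) = 0] (mod int p)" by (simp only: cong_iff_dvd_diff)
  then have "(?sp p) \<beta> = \<beta>"
    using b(3)[OF pN[OF s']] xp_eq_iff[of "W (?sp p)" 0] EL[OF b(1)] by (simp add: xp_0)
  \<comment> \<open>After p steps \<beta> returns to itself, so the product of the translates of
    \<phi> z is 1.\<close>
  then have "\<beta> \<otimes> act_prod ?s' p (\<phi> \<otimes> z) = \<beta> \<otimes> \<one>" using A[of p] EL[OF b(1)] by simp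
  then have "act_prod ?s' p (\<phi> \<otimes> z) = \<one>"
    using m_lcancel[OF b(2) EL[OF b(1)] EL[OF act_prod_Suc(2)[OF s' pz]] EL[OF E_subring(3)]] by blast
  then have norm_z: "\<phi> [^] p \<otimes> act_prod ?s' p z = \<one>" using act_prod_mult[OF s' ph(1) zE] Pphip by simp
  note iz = inv_Ep[OF zE znz]
  \<comment> \<open>Available because F(p) is closed under p-th roots. The product B of the
    translates of \<gamma> has the same p-th power as \<phi>, so it transforms under G by the
    character f.\<close>
  obtain \<gamma> where g: "\<gamma> \<in> Ep" "\<gamma> [^] p = inv z" using Ep_root iz by blast
  have gz: "\<gamma> [^] p \<otimes> z = \<one>" using g iz by simp
  have gnz: "\<gamma> \<noteq> \<zero>"
  proof
    assume "\<gamma> = \<zero>"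
    then show False using gz p0 EL[OF zE] by (simp add: nat_pow_zero)
  qed
  define B where "B = act_prod ?s' p \<gamma>"
  have BE: "B \<in> Ep" using act_prod_Suc(2)[OF s' g(1)] by (simp add: B_def)
  have Pz: "act_prod ?s' p z \<in> carrier L" using EL[OF act_prod_Suc(2)[OF s' zE]] .
  have "B [^] p \<otimes> act_prod ?s' p z = \<one>"
    using act_prod_mult[OF s' pow_Ep[OF g(1)] zE, of p p] act_prod_pow[OF s' g(1), of p p] gz act_prod_one[OF s', of p]
    by (simp add: B_def)
  then have "B [^] p \<otimes> act_prod ?s' p z = \<phi> [^] p \<otimes> act_prod ?s' p z" using norm_z by simp
  moreover have "act_prod ?s' p z \<noteq> \<zero>" using norm_z EL[OF ph(1)] by auto
  ultimately have "B [^] p = \<phi> [^] p"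
    using m_rcancel[OF _ Pz] EL[OF BE] EL[OF ph(1)] by blast
  then obtain j where j: "B = xp j \<otimes> \<phi>" using same_pow_xp[OF EL[OF BE] EL[OF ph(1)] ph(2)] by blast
  have Bnz: "B \<noteq> \<zero>" using j integral_iff[OF xp_carrier(1) EL[OF ph(1)]] xp_carrier(3) ph(2) by simp
  have actB: "x B = xp (f x) \<otimes> B" if x: "x \<in> carrier G" for x
    unfolding j using gal_simps(2)[OF x xp_carrier(2) ph(1)] gal_xp[OF x] ph(3)[OF x] xp_carrier(1) EL[OF ph(1)]
    by (simp add: m_ac)
  have kum: "\<exists>k. \<tau> \<gamma> = xp k \<otimes> \<gamma>" if t: "\<tau> \<in> N" for \<tau>
  proof (rule same_pow_xp)
    have tc: "\<tau> \<in> carrier G" using NG[OF t] .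
    show "\<tau> \<gamma> \<in> carrier L" using EL[OF gal_simps(1)[OF tc g(1)]] .
    show "\<gamma> \<in> carrier L" using EL[OF g(1)] .
    show "\<gamma> \<noteq> \<zero>" by fact
    have "\<tau> (\<gamma> [^] p) \<otimes> z = \<one>"
      using gal_simps(2)[OF tc pow_Ep[OF g(1)] zE, of p] gz gal_simps(4)[OF tc] zfix[OF t] by simp
    then have "\<tau> (\<gamma> [^] p) \<otimes> z = \<gamma> [^] p \<otimes> z" using gz by simp
    then have "\<tau> (\<gamma> [^] p) = \<gamma> [^] p"
      using m_rcancel[OF znz EL[OF zE] EL[OF gal_simps(1)[OF tc pow_Ep[OF g(1)]]] EL[OF pow_Ep[OF g(1)]]] by blast
    then show "\<tau> \<gamma> [^] p = \<gamma> [^] p" using gal_simps(7)[OF tc g(1)] by simp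
  qed
  \<comment> \<open>The Kummer character of \<gamma> on N, extended to G along x |-> x s^(-\<chi>
    x), which maps G to N.\<close>
  define \<nu> where "\<nu> x = (SOME k. (x \<otimes>\<^bsub>G\<^esub> ?sp (\<chi> x)) \<gamma> = xp k \<otimes> \<gamma>)" for x
  have s1: "[\<chi> ?s' + 1 = 0] (mod p)" using chi(2)[OF s' s(1)] s chi1 by (simp add: cong_sym)
  have xN: "x \<otimes>\<^bsub>G\<^esub> ?sp (\<chi> x) \<in> N" if x: "x \<in> carrier G" for x
  proof (rule N_of_cong)
    show "x \<otimes>\<^bsub>G\<^esub> ?sp (\<chi> x) \<in> carrier G" using x sp by simp
    have "[\<chi> (x \<otimes>\<^bsub>G\<^esub> ?sp (\<chi> x)) = \<chi> x + \<chi> (?sp (\<chi> x))] (mod p)" using chi(2)[OF x sp] .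
    also have "[\<chi> x + \<chi> (?sp (\<chi> x)) = \<chi> x + \<chi> x * \<chi> ?s'] (mod p)" using chis[OF s'] by (rule cong_add[OF cong_refl])
    also have "\<chi> x + \<chi> x * \<chi> ?s' = \<chi> x * (\<chi> ?s' + 1)" by simp
    also have "[\<dots> = \<chi> x * 0] (mod p)" using s1 by (rule cong_mult[OF cong_refl])
    finally show "[\<chi> (x \<otimes>\<^bsub>G\<^esub> ?sp (\<chi> x)) = 0] (mod p)" by simp
  qed
  have nu: "(x \<otimes>\<^bsub>G\<^esub> ?sp (\<chi> x)) \<gamma> = xp (\<nu> x) \<otimes> \<gamma>" if "x \<in> carrier G" for x
    unfolding \<nu>_def using someI_ex[OF kum[OF xN[OF that]]] .
  show thesis
  proof (rule that)
    fix \<tau> x assume t: "\<tau> \<in> N" and x: "x \<in> carrier G"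
    have tc: "\<tau> \<in> carrier G" using NG[OF t] .
    have ct: "\<chi> \<tau> = 0" using chi(3)[OF tc] t by simp
    then have ctx: "\<chi> (\<tau> \<otimes>\<^bsub>G\<^esub> x) = \<chi> x"
      using chi(2)[OF tc x] chi(1)[OF x] chi(1)[of "\<tau> \<otimes>\<^bsub>G\<^esub> x"] tc x by (simp add: cong_def)
    have "xp (\<nu> (\<tau> \<otimes>\<^bsub>G\<^esub> x)) \<otimes> \<gamma> = (\<tau> \<otimes>\<^bsub>G\<^esub> (x \<otimes>\<^bsub>G\<^esub> ?sp (\<chi> x))) \<gamma>"
      using nu[of "\<tau> \<otimes>\<^bsub>G\<^esub> x"] ctx tc x sp by (simp add: G.m_assoc)
    also have "\<dots> = \<tau> (xp (\<nu> x) \<otimes> \<gamma>)" using gal_mult[OF tc _ g(1), of "x \<otimes>\<^bsub>G\<^esub> ?sp (\<chi> x)"] nu[OF x] x sp by simp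
    also have "\<dots> = xp (\<nu> x) \<otimes> \<tau> \<gamma>" using gal_simps(2)[OF tc xp_carrier(2) g(1)] gal_xp[OF tc] by simp
    also have "\<tau> \<gamma> = xp (\<nu> \<tau>) \<otimes> \<gamma>" using nu[OF tc] ct tc by simp
    also have "xp (\<nu> x) \<otimes> (xp (\<nu> \<tau>) \<otimes> \<gamma>) = xp (\<nu> \<tau> + \<nu> x) \<otimes> \<gamma>"
      using xp_carrier(1) EL[OF g(1)] by (simp add: xp_add m_ac)
    finally show "[\<nu> (\<tau> \<otimes>\<^bsub>G\<^esub> x) = \<nu> \<tau> + \<nu> x] (mod int p)" using xp_cancel[OF EL[OF g(1)] gnz] by blast
  next
    show "loc_const \<nu>"
      unfolding loc_const_def
    proof
      fix x assume x: "x \<in> carrier G"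
      obtain S where S: "finite S" "S \<subseteq> Ep" "\<forall>y\<in>agree S x. \<chi> y = \<chi> x" using chi(4) x unfolding loc_const_def by blast
      let ?e = "(?sp (\<chi> x)) \<gamma>"
      have e: "?e \<in> Ep" using gal_simps(1)[OF sp g(1)] .
      have "\<nu> y = \<nu> x" if y: "y \<in> agree (insert ?e S) x" for y
      proof -
        have yc: "y \<in> carrier G" "y ?e = x ?e" "\<chi> y = \<chi> x" using y S(3) by (auto simp: agree_def)
        then have "(y \<otimes>\<^bsub>G\<^esub> ?sp (\<chi> y)) \<gamma> = (x \<otimes>\<^bsub>G\<^esub> ?sp (\<chi> x)) \<gamma>"
          using gal_mult[OF yc(1) sp g(1)] gal_mult[OF x sp g(1)] by simp
        then show ?thesis by (simp add: \<nu>_def)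
      qed
      then show "\<exists>S. finite S \<and> S \<subseteq> Ep \<and> (\<forall>y\<in>agree S x. \<nu> y = \<nu> x)"
        using S e by (intro exI[of _ "insert ?e S"]) auto
    qed
  next
    fix x assume x: "x \<in> carrier G"
    \<comment> \<open>The residue of the coset of s^i x. As i runs through the residues so does m i,
      which reindexes the product defining B.\<close>
    define m where "m i = \<chi> (s [^]\<^bsub>G\<^esub> i \<otimes>\<^bsub>G\<^esub> x)" for i :: nat
    have sx: "s [^]\<^bsub>G\<^esub> i \<otimes>\<^bsub>G\<^esub> x \<in> carrier G" for i :: nat using s x by simp
    have mi: "[m i = i + \<chi> x] (mod p)" for i
    proof -
      have "[m i = \<chi> (s [^]\<^bsub>G\<^esub> i) + \<chi> x] (mod p)" unfolding m_def using chi(2)[of "s [^]\<^bsub>G\<^esub> i" x] s x by simp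
      also have "[\<chi> (s [^]\<^bsub>G\<^esub> i) + \<chi> x = i + \<chi> x] (mod p)" using chis[OF s(1), of i] s(2) by (intro cong_add cong_refl) simp
      finally show ?thesis .
    qed
    have inj: "inj_on m {..<p}"
    proof (rule inj_onI)
      fix i k assume ik: "i \<in> {..<p}" "k \<in> {..<p}" "m i = m k"
      have "[i + \<chi> x = k + \<chi> x] (mod p)" using mi[of i] mi[of k] ik(3) by (metis cong_sym cong_trans)
      then have "[i = k] (mod p)" by (simp add: cong_add_rcancel_nat)
      then show "i = k" using ik by (simp add: cong_def)
    qed
    have img: "m ` {..<p} = {..<p}"
      using chi(1)[OF sx] by (intro endo_inj_surj inj) (auto simp: m_def)
    have tm: "x ((?sp (m i)) \<gamma>) = xp (\<nu> (s [^]\<^bsub>G\<^esub> i \<otimes>\<^bsub>G\<^esub> x)) \<otimes> (?sp i) \<gamma>" for i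
    proof -
      have "(?sp i \<otimes>\<^bsub>G\<^esub> s [^]\<^bsub>G\<^esub> i) = \<one>\<^bsub>G\<^esub>" using s by (simp add: G.nat_pow_inv)
      then have "x \<otimes>\<^bsub>G\<^esub> ?sp (m i) = ?sp i \<otimes>\<^bsub>G\<^esub> (s [^]\<^bsub>G\<^esub> i \<otimes>\<^bsub>G\<^esub> x \<otimes>\<^bsub>G\<^esub> ?sp (m i))"
        using x sp s by (simp add: G.m_assoc[symmetric])
      then have "(x \<otimes>\<^bsub>G\<^esub> ?sp (m i)) \<gamma> = (?sp i) ((s [^]\<^bsub>G\<^esub> i \<otimes>\<^bsub>G\<^esub> x \<otimes>\<^bsub>G\<^esub> ?sp (m i)) \<gamma>)"
        using gal_mult[OF sp _ g(1), of "s [^]\<^bsub>G\<^esub> i \<otimes>\<^bsub>G\<^esub> x \<otimes>\<^bsub>G\<^esub> ?sp (m i)" i] sx sp by simp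
      also have "\<dots> = (?sp i) (xp (\<nu> (s [^]\<^bsub>G\<^esub> i \<otimes>\<^bsub>G\<^esub> x)) \<otimes> \<gamma>)" using nu[OF sx, of i] by (simp add: m_def)
      also have "\<dots> = xp (\<nu> (s [^]\<^bsub>G\<^esub> i \<otimes>\<^bsub>G\<^esub> x)) \<otimes> (?sp i) \<gamma>"
        using gal_simps(2)[OF sp xp_carrier(2) g(1)] gal_xp[OF sp] by simp
      finally show ?thesis using gal_mult[OF x sp g(1)] by simp
    qed
    have spE: "(?sp i) \<gamma> \<in> Ep" for i using gal_simps(1)[OF sp g(1)] .
    have "xp (\<Sum>i<p. \<nu> (s [^]\<^bsub>G\<^esub> i \<otimes>\<^bsub>G\<^esub> x)) \<otimes> B = (\<Otimes>i\<in>{..<p}. xp (\<nu> (s [^]\<^bsub>G\<^esub> i \<otimes>\<^bsub>G\<^esub> x)) \<otimes> (?sp i) \<gamma>)"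
      unfolding B_def act_prod_def using xp_prod[of p "\<lambda>i. (?sp i) \<gamma>"] spE by simp
    also have "\<dots> = (\<Otimes>i\<in>{..<p}. x ((?sp (m i)) \<gamma>))" using tm by simp
    also have "\<dots> = (\<Otimes>i\<in>m ` {..<p}. x ((?sp i) \<gamma>))"
      using EL[OF gal_simps(1)[OF x spE]] by (intro finprod_reindex[symmetric] inj) auto
    also have "\<dots> = x B" unfolding img B_def act_prod_def using gal_prod[OF x, of p "\<lambda>i. (?sp i) \<gamma>"] spE by simp
    also have "\<dots> = xp (f x) \<otimes> B" using actB[OF x] .
    finally show "[(\<Sum>i<p. \<nu> (s [^]\<^bsub>G\<^esub> i \<otimes>\<^bsub>G\<^esub> x)) = f x] (mod int p)"
      using xp_cancel[OF EL[OF BE] Bnz] by blast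
  qed
qed

end

section \<open>The Kummer character as a cyclic quotient\<close>

context kummer_closure
begin

lemma lc_iff_loc_const: "lc T f \<longleftrightarrow> loc_const f"
proof
  assume f: "lc T f"
  show "loc_const f"
    unfolding loc_const_def
  proof
    fix x assume "x \<in> carrier G"
    then obtain U where U: "openin T U" "x \<in> U" "\<forall>y\<in>U. f y = f x" using f unfolding lc_def topspace_T by meson
    then obtain S where S: "finite S" "S \<subseteq> Ep" "agree S x \<subseteq> U" unfolding openin_T by meson
    have "\<forall>y\<in>agree S x. f y = f x" using bspec[OF U(3) subsetD[OF S(3)]] by blast
    then show "\<exists>S. finite S \<and> S \<subseteq> Ep \<and> (\<forall>y\<in>agree S x. f y = f x)" using S(1,2) by blast
  qed
next
  assume f: "loc_const f"
  show "lc T f"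
    unfolding lc_def topspace_T
  proof
    fix x assume x: "x \<in> carrier G"
    then obtain S where S: "finite S" "S \<subseteq> Ep" "\<forall>y\<in>agree S x. f y = f x" using f unfolding loc_const_def by meson
    have "openin T (agree S x)"
      unfolding openin_T
    proof (intro conjI ballI)
      show "agree S x \<subseteq> carrier G" by (auto simp: agree_def)
      fix y assume "y \<in> agree S x"
      then have "agree S y \<subseteq> agree S x" by (auto simp: agree_def)
      then show "\<exists>S'. finite S' \<and> S' \<subseteq> Ep \<and> agree S' y \<subseteq> agree S x" using S(1,2) by blast
    qed
    moreover have "x \<in> agree S x" using x by (simp add: agree_def)
    ultimately show "\<exists>U. openin T U \<and> x \<in> U \<and> (\<forall>y\<in>U. f y = f x)" using S(3) by blast
  qed
qed

text \<open>The complement of N is a finite union of cosets, each of them closed as the preimage of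
  N under a right translation.\<close>

lemma closed_finite_index_open:
  assumes N: "subgroup N G" "closedin T N" and fin: "finite (rcosets\<^bsub>G\<^esub> N)"
  shows "openin T N"
proof -
  interpret N: subgroup N G by (rule N(1))
  have coset: "closedin T C" if C: "C \<in> rcosets\<^bsub>G\<^esub> N" for C
  proof -
    obtain x where x: "x \<in> carrier G" "C = N #>\<^bsub>G\<^esub> x" using C by (auto simp: RCOSETS_def)
    have "C = {y \<in> topspace T. y \<otimes>\<^bsub>G\<^esub> inv\<^bsub>G\<^esub> x \<in> N}"
    proof
      show "C \<subseteq> {y \<in> topspace T. y \<otimes>\<^bsub>G\<^esub> inv\<^bsub>G\<^esub> x \<in> N}"
        using x(1) by (auto simp: x(2) r_coset_def topspace_T G.m_assoc)
      show "{y \<in> topspace T. y \<otimes>\<^bsub>G\<^esub> inv\<^bsub>G\<^esub> x \<in> N} \<subseteq> C"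
      proof
        fix y assume y: "y \<in> {y \<in> topspace T. y \<otimes>\<^bsub>G\<^esub> inv\<^bsub>G\<^esub> x \<in> N}"
        then have "y = (y \<otimes>\<^bsub>G\<^esub> inv\<^bsub>G\<^esub> x) \<otimes>\<^bsub>G\<^esub> x" using x(1) by (simp add: topspace_T G.m_assoc)
        then show "y \<in> C" using y unfolding x(2) r_coset_def by blast
      qed
    qed
    then show ?thesis
      using closedin_continuous_map_preimage[OF continuous_right_mult[OF G.inv_closed[OF x(1)]] N(2)] by simp
  qed
  have NC: "N \<in> rcosets\<^bsub>G\<^esub> N" using N.subgroup_in_rcosets[OF G.is_group] .
  have "closedin T (\<Union> (rcosets\<^bsub>G\<^esub> N - {N}))" using fin coset by (intro closedin_Union) auto
  moreover have "N = topspace T - \<Union> (rcosets\<^bsub>G\<^esub> N - {N})"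
  proof
    show "N \<subseteq> topspace T - \<Union> (rcosets\<^bsub>G\<^esub> N - {N})"
    proof
      fix g assume g: "g \<in> N"
      have "g \<notin> C" if C: "C \<in> rcosets\<^bsub>G\<^esub> N" "C \<noteq> N" for C
        using pairwiseD[OF G.rcos_disjoint[OF N(1)] C(1) NC C(2)] g unfolding disjnt_def by blast
      then show "g \<in> topspace T - \<Union> (rcosets\<^bsub>G\<^esub> N - {N})" using g N.mem_carrier topspace_T by auto
    qed
    show "topspace T - \<Union> (rcosets\<^bsub>G\<^esub> N - {N}) \<subseteq> N"
      unfolding topspace_T G.rcosets_part_G[OF N(1), symmetric] by blast
  qed
  ultimately show ?thesis by (metis openin_diff openin_topspace)
qed

text \<open>\<open>kummer_char\<close> works with some p-th root of a, which need not be the given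
  \<alpha>; the two differ by a power of \<xi>, which every automorphism fixes.\<close>

lemma kummer_char_root:
  assumes a: "a \<in> K" "a \<noteq> \<zero>" and al: "\<alpha> \<in> Ep" "\<alpha> [^] p = a"
  obtains \<beta> j where "\<beta> \<in> Ep" "\<beta> \<noteq> \<zero>" "\<beta> = xp j \<otimes> \<alpha>"
    "\<And>g. g \<in> carrier G \<Longrightarrow> kummer_char L Ep p \<xi> a g \<in> {0..int p - 1} \<and> g \<beta> = xp (kummer_char L Ep p \<xi> a g) \<otimes> \<beta>"
proof -
  define \<beta> where "\<beta> = (SOME \<beta>. \<beta> \<in> Ep \<and> \<beta> [^] p = a)"
  have b: "\<beta> \<in> Ep" "\<beta> [^] p = a" using someI[of "\<lambda>\<beta>. \<beta> \<in> Ep \<and> \<beta> [^] p = a" \<alpha>] al by (auto simp: \<beta>_def)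
  have nz: "z \<noteq> \<zero>" if "z [^] p = a" for z using that a(2) p0 by (auto simp: nat_pow_zero)
  have c: "\<beta> \<in> carrier L" "\<alpha> \<in> carrier L" using b(1) al(1) Ec by auto
  obtain j where j: "\<beta> = xp j \<otimes> \<alpha>" using same_pow_xp[OF c(1,2) nz[OF al(2)]] b(2) al(2) by metis
  have kc: "kummer_char L Ep p \<xi> a g \<in> {0..int p - 1} \<and> g \<beta> = xp (kummer_char L Ep p \<xi> a g) \<otimes> \<beta>" if g: "g \<in> carrier G" for g
  proof -
    have "(g \<beta>) [^] p = a" using gal_simps(7)[OF g b(1), of p] gal_simps(6)[OF g a(1)] b(2) by simp
    then obtain i where i: "g \<beta> = xp i \<otimes> \<beta>"
      using same_pow_xp[of "g \<beta>" \<beta>] gal_simps(1)[OF g b(1)] Ec c(1) nz[OF b(2)] b(2) by auto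
    have xpn: "\<xi> [^] nat k = xp k" if "k \<in> {0..int p - 1}" for k using xp_nat[of "nat k"] that by simp
    have car: "carrier (residue_ring (int p)) = {0..int p - 1}" by (simp add: residue_ring_def)
    let ?P = "\<lambda>k. k \<in> carrier (residue_ring (int p)) \<and> g \<beta> = \<xi> [^] nat k \<otimes> \<beta>"
    have im: "i mod int p \<in> {0..int p - 1}" using p0 by simp
    have "xp (i mod int p) = xp i" by (simp add: xp_eq_iff cong_def)
    then have P: "?P (i mod int p)" using i im xpn[OF im] unfolding car by simp
    have U: "k = i mod int p" if k: "?P k" for k
    proof -
      have kr: "k \<in> {0..int p - 1}" using k car by simp
      have "xp k \<otimes> \<beta> = xp i \<otimes> \<beta>" using k i xpn[OF kr] by simp
      then have "[k = i] (mod int p)" by (rule xp_cancel[OF c(1) nz[OF b(2)]])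
      then show ?thesis using kr by (simp add: cong_def)
    qed
    have "kummer_char L Ep p \<xi> a g = (THE k. ?P k)" by (simp only: kummer_char_def \<beta>_def Let_def)
    then have "?P (kummer_char L Ep p \<xi> a g)" using theI[of ?P, OF P U] by simp
    then show ?thesis using xpn unfolding car by simp
  qed
  show thesis using that[OF b(1) nz[OF b(2)] j kc] .
qed

lemma fixes_generate_field:
  assumes g: "g \<in> carrier G" and H: "H \<subseteq> Ep" "\<And>x. x \<in> H \<Longrightarrow> g x = x" and b: "b \<in> generate_field L H"
  shows "b \<in> Ep \<and> g b = b"
  using b
proof (induction rule: generate_field.induct)
  case one then show ?case using gal_simps(4)[OF g] E_subring(3) by simp
next
  case (incl h) then show ?case using H by blast
next
  case (a_inv h)
  have h: "h \<in> Ep" "g h = h" "h \<in> carrier L" and m: "\<ominus> h \<in> Ep" using a_inv.IH Ec E_subring(5) by auto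
  have "g (\<ominus> h) \<oplus> h = \<zero>" using gal_simps(3)[OF g m h(1)] h gal_simps(5)[OF g] by (simp add: l_neg)
  then show ?case using m minus_equality[of "g (\<ominus> h)" h] h(3) gal_simps(1)[OF g m] Ec by auto
next
  case (m_inv h)
  have h: "h \<in> Ep" "g h = h" "h \<in> carrier L" using m_inv.IH Ec by auto
  have i: "inv h \<in> Ep" "inv h \<otimes> h = \<one>" using inv_Ep[OF h(1) m_inv.hyps(2)] by auto
  have "g (inv h) \<otimes> h = \<one>" using gal_simps(2)[OF g i(1) h(1)] h(2) i(2) gal_simps(4)[OF g] by simp
  then have "g (inv h) \<otimes> h = inv h \<otimes> h" using i(2) by simp
  then show ?case using i(1) m_rcancel[OF m_inv.hyps(2) h(3)] gal_simps(1)[OF g i(1)] Ec by auto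
next
  case (eng_add h1 h2)
  then show ?case using gal_simps(3)[OF g, of h1 h2] E_subring(7)[of h1 h2] by simp
next
  case (eng_mult h1 h2)
  then show ?case using gal_simps(2)[OF g, of h1 h2] E_subring(6)[of h1 h2] by simp
qed

text \<open>N is the kernel of the Kummer character: an automorphism that fixes \<alpha> fixes the
  field generated by it, which is the fixed field of N, and an open subgroup is recovered from its
  fixed field.\<close>

theorem kummer_cyclic_quotient:
  assumes N: "subgroup N G" "openin T N" "N \<noteq> carrier G" and a: "a \<in> K" "a \<noteq> \<zero>" and al: "\<alpha> [^] p = a"
    and ff: "fixed_field Ep N = generate_field L (insert \<alpha> K)"
  obtains s where "norm_lifting G T N p (\<lambda>g. nat (kummer_char L Ep p \<xi> a g)) s"
    "\<And>g. g \<in> carrier G \<Longrightarrow> kummer_char L Ep p \<xi> a g \<ge> 0"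
proof -
  interpret N: subgroup N G by (rule N(1))
  let ?kc = "kummer_char L Ep p \<xi> a"
  have alf: "\<alpha> \<in> fixed_field Ep N" unfolding ff by (rule generate_field.incl) simp
  then have alE: "\<alpha> \<in> Ep" and alN: "\<And>g. g \<in> N \<Longrightarrow> g \<alpha> = \<alpha>" by (auto simp: fixed_field_def)
  obtain \<beta> j where b: "\<beta> \<in> Ep" "\<beta> \<noteq> \<zero>" "\<beta> = xp j \<otimes> \<alpha>"
    and kc: "\<And>g. g \<in> carrier G \<Longrightarrow> ?kc g \<in> {0..int p - 1} \<and> g \<beta> = xp (?kc g) \<otimes> \<beta>"
    using kummer_char_root[OF a alE al] by metis
  have bc: "\<beta> \<in> carrier L" "\<alpha> \<in> carrier L" using b(1) alE Ec by auto
  have range: "0 \<le> ?kc g" "?kc g < int p" if "g \<in> carrier G" for g using kc[OF that] by auto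
  have act: "g \<beta> = xp (?kc g) \<otimes> \<beta>" if "g \<in> carrier G" for g using kc[OF that] by simp
  have hom: "[?kc (g \<otimes>\<^bsub>G\<^esub> h) = ?kc g + ?kc h] (mod int p)" if g: "g \<in> carrier G" and h: "h \<in> carrier G" for g h
  proof -
    have "xp (?kc (g \<otimes>\<^bsub>G\<^esub> h)) \<otimes> \<beta> = g (h \<beta>)" using act[OF G.m_closed[OF g h]] gal_mult[OF g h b(1)] by simp
    also have "\<dots> = g (xp (?kc h) \<otimes> \<beta>)" by (simp only: act[OF h])
    also have "\<dots> = xp (?kc h) \<otimes> g \<beta>"
      using gal_simps(2)[OF g xp_carrier(2) b(1), of "?kc h"] gal_xp[OF g] by simp
    also have "\<dots> = xp (?kc h) \<otimes> (xp (?kc g) \<otimes> \<beta>)" by (simp only: act[OF g])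
    also have "\<dots> = xp (?kc g + ?kc h) \<otimes> \<beta>"
      using m_assoc[OF xp_carrier(1) xp_carrier(1) bc(1), symmetric] xp_add[of "?kc h" "?kc g"] by (simp add: add.commute)
    finally show ?thesis by (rule xp_cancel[OF bc(1) b(2)])
  qed
  have eq0: "?kc g = 0 \<longleftrightarrow> g \<beta> = \<beta>" if g: "g \<in> carrier G" for g
  proof
    assume "?kc g = 0"
    then show "g \<beta> = \<beta>" using act[OF g] bc(1) by (simp add: xp_0)
  next
    assume "g \<beta> = \<beta>"
    then have "xp (?kc g) \<otimes> \<beta> = xp 0 \<otimes> \<beta>" using act[OF g] bc(1) by (simp add: xp_0)
    from xp_cancel[OF bc(1) b(2) this] show "?kc g = 0" using range[OF g] by (simp add: cong_def)
  qed
  have mem: "g \<in> N \<longleftrightarrow> ?kc g = 0" if g: "g \<in> carrier G" for g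
    unfolding eq0[OF g]
  proof
    assume "g \<in> N"
    then show "g \<beta> = \<beta>" unfolding b(3) gal_simps(2)[OF g xp_carrier(2) alE] gal_xp[OF g] by (simp only: alN)
  next
    assume gb: "g \<beta> = \<beta>"
    then have "xp j \<otimes> g \<alpha> = xp j \<otimes> \<alpha>" unfolding b(3) gal_simps(2)[OF g xp_carrier(2) alE] gal_xp[OF g] .
    then have ga: "g \<alpha> = \<alpha>"
      using m_lcancel[OF xp_carrier(3,1) _ bc(2), of "g \<alpha>"] gal_simps(1)[OF g alE] Ec by auto
    show "g \<in> N"
    proof (rule ccontr)
      assume gN: "g \<notin> N"
      obtain y where y: "y \<in> fixed_field Ep N" "g y \<noteq> y" using fixed_field_separates[OF N(2,1) g gN] .
      have "g y = y"
      proof (rule conjunct2[OF fixes_generate_field[OF g]])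
        show "insert \<alpha> K \<subseteq> Ep" using alE E(2) by simp
        show "g x = x" if "x \<in> insert \<alpha> K" for x using that ga gal_simps(6)[OF g] by auto
        show "y \<in> generate_field L (insert \<alpha> K)" using y(1) ff by simp
      qed
      then show False using y(2) by simp
    qed
  qed
  let ?\<chi> = "\<lambda>g. nat (?kc g)"
  have homn: "[?\<chi> (g \<otimes>\<^bsub>G\<^esub> h) = ?\<chi> g + ?\<chi> h] (mod p)" if g: "g \<in> carrier G" and h: "h \<in> carrier G" for g h
    using hom[OF g h] range(1)[OF g] range(1)[OF h] range(1)[OF G.m_closed[OF g h]]
    by (simp add: cong_int_iff[symmetric])
  have lcc: "loc_const ?\<chi>"
    unfolding loc_const_def
  proof
    fix x assume x: "x \<in> carrier G"
    have "?\<chi> y = ?\<chi> x" if y: "y \<in> agree {\<beta>} x" for y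
    proof -
      have yG: "y \<in> carrier G" and e: "y \<beta> = x \<beta>" using y by (auto simp: agree_def)
      have "xp (?kc y) \<otimes> \<beta> = xp (?kc x) \<otimes> \<beta>" using act[OF yG] act[OF x] e by simp
      from xp_cancel[OF bc(1) b(2) this] have "?kc y = ?kc x" using range[OF yG] range[OF x] by (simp add: cong_def)
      then show ?thesis by simp
    qed
    then show "\<exists>S. finite S \<and> S \<subseteq> Ep \<and> (\<forall>y\<in>agree S x. ?\<chi> y = ?\<chi> x)" using b(1) by (intro exI[of _ "{\<beta>}"]) simp
  qed
  \<comment> \<open>An element outside N has a character value prime to p, so a suitable power of it
    takes the value 1.\<close>
  obtain g where g: "g \<in> carrier G" "g \<notin> N" using N(3) N.subset by blast
  have cop: "coprime (?\<chi> g) p"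
  proof -
    have "?\<chi> g \<noteq> 0" "?\<chi> g < p" using mem[OF g(1)] g(2) range[OF g(1)] by auto
    then have "\<not> p dvd ?\<chi> g" by (auto dest: dvd_imp_le)
    then show ?thesis using prime_imp_coprime[OF p] by (subst coprime_commute) blast
  qed
  then obtain m where m: "[?\<chi> g * m = 1] (mod p)" using cong_solve_coprime_nat by auto
  have pw: "[?\<chi> (g [^]\<^bsub>G\<^esub> (i::nat)) = ?\<chi> g * i] (mod p)" for i
  proof (induction i)
    case 0
    have "?kc \<one>\<^bsub>G\<^esub> = 0" using mem[OF G.one_closed] N.one_closed by simp
    then show ?case by simp
  next
    case (Suc i)
    have "[?\<chi> (g [^]\<^bsub>G\<^esub> i \<otimes>\<^bsub>G\<^esub> g) = ?\<chi> (g [^]\<^bsub>G\<^esub> i) + ?\<chi> g] (mod p)" using homn g(1) by simp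
    also have "[?\<chi> (g [^]\<^bsub>G\<^esub> i) + ?\<chi> g = ?\<chi> g * i + ?\<chi> g] (mod p)" by (rule cong_add[OF Suc cong_refl])
    finally show ?case by (simp add: algebra_simps)
  qed
  define s where "s = g [^]\<^bsub>G\<^esub> m"
  have s: "s \<in> carrier G" using g(1) by (simp add: s_def)
  have "[?\<chi> s = 1] (mod p)" using cong_trans[OF pw[of m] m] by (simp add: s_def)
  then have s1: "?\<chi> s = 1" using range[OF s] p1 by (simp add: cong_def nat_less_iff)
  have less: "?\<chi> h < p" if "h \<in> carrier G" for h using range[OF that] by (simp add: nat_less_iff)
  have memn: "h \<in> N \<longleftrightarrow> ?\<chi> h = 0" if "h \<in> carrier G" for h using mem[OF that] range(1)[OF that] by auto
  have cq: "cyclic_quotient G T N p ?\<chi> s"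
    using continuous_left_mult continuous_right_mult less homn memn lcc s s1 N(1) p topspace_T
    by (intro cyclic_quotient.intro cyclic_quotient_axioms.intro G.is_group) (simp_all add: lc_iff_loc_const)
  have "norm_lifting G T N p ?\<chi> s"
  proof (intro norm_lifting.intro cq norm_lifting_axioms.intro)
    fix W f :: "('a \<Rightarrow> 'a) \<Rightarrow> int"
    assume odd: "odd p"
      and W: "\<And>\<tau> x. \<tau> \<in> N \<Longrightarrow> x \<in> carrier G \<Longrightarrow> [W (\<tau> \<otimes>\<^bsub>G\<^esub> x) = W \<tau> + W x] (mod int p)"
        "lc T (\<lambda>x. W x mod int p)"
      and f: "\<And>g h. g \<in> carrier G \<Longrightarrow> h \<in> carrier G \<Longrightarrow> [f (g \<otimes>\<^bsub>G\<^esub> h) = f g + f h] (mod int p)"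
        "lc T (\<lambda>x. f x mod int p)"
      and rel: "\<And>y. y \<in> carrier G \<Longrightarrow> [W (s \<otimes>\<^bsub>G\<^esub> y) = W y + f y + W s] (mod int p)"
    show "\<exists>\<nu>::('a \<Rightarrow> 'a) \<Rightarrow> int. (\<forall>\<tau>\<in>N. \<forall>x\<in>carrier G. [\<nu> (\<tau> \<otimes>\<^bsub>G\<^esub> x) = \<nu> \<tau> + \<nu> x] (mod int p)) \<and> lc T \<nu> \<and>
        (\<forall>x\<in>carrier G. [(\<Sum>i<p. \<nu> (s [^]\<^bsub>G\<^esub> i \<otimes>\<^bsub>G\<^esub> x)) = f x] (mod int p))"
    proof (rule character_is_norm[OF N(2,1) less homn memn lcc s s1 odd W(1) W(2)[unfolded lc_iff_loc_const]
          f(1) f(2)[unfolded lc_iff_loc_const] rel])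
      fix \<nu> :: "('a \<Rightarrow> 'a) \<Rightarrow> int"
      assume "\<And>\<tau> x. \<tau> \<in> N \<Longrightarrow> x \<in> carrier G \<Longrightarrow> [\<nu> (\<tau> \<otimes>\<^bsub>G\<^esub> x) = \<nu> \<tau> + \<nu> x] (mod int p)" "loc_const \<nu>"
        "\<And>x. x \<in> carrier G \<Longrightarrow> [(\<Sum>i<p. \<nu> (s [^]\<^bsub>G\<^esub> i \<otimes>\<^bsub>G\<^esub> x)) = f x] (mod int p)"
      then show ?thesis using lc_iff_loc_const[of \<nu>] by blast
    qed
  qed
  then show thesis using that range(1) by blast
qed

end

text \<open>The character with kernel N, the element s and the openness of N are recovered from the
  index, closedness and the generator \<alpha> of the fixed field. Finite dimension of H^2(N)
  belongs to the conclusion, because \<open>dim\<close> has its meaning only for finite-dimensional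
  spaces.\<close>

theorem mainTheorem9:
  fixes \<Omega> :: "('a, 'b) ring_scheme" and F E :: "'a set" and \<xi> a \<alpha> :: 'a
    and p x y :: nat and k :: "int ring"
    and G :: "('a \<Rightarrow> 'a) monoid" and T :: "('a \<Rightarrow> 'a) topology" and N :: "('a \<Rightarrow> 'a) set"
  assumes "algebraic_closure \<Omega> F"
    and "prime p"
    and "\<xi> \<in> F" and "primitive_root_of_unity \<Omega> p \<xi>"
    and k: "k = residue_ring (int p)"
    and E: "E = max_p_ext \<Omega> F p"
    and G: "G = gal \<Omega> F E"
    and T: "T = krull_topology \<Omega> F E"
    and "subgroup N G" and "closedin T N" and "card (rcosets\<^bsub>G\<^esub> N) = p"
    and "cor k G T N 2 ` carrier (cohomology k (G\<lparr>carrier := N\<rparr>) (subtopology T N) 2)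
           = carrier (cohomology k G T 2)"
    and "a \<in> F" and "a \<noteq> \<zero>\<^bsub>\<Omega>\<^esub>"
    and "\<alpha> \<in> carrier \<Omega>" and "\<alpha> [^]\<^bsub>\<Omega>\<^esub> p = a"
    and "fixed_field E N = generate_field \<Omega> (insert \<alpha> F)"
    and "vectorspace.fin_dim k (cohomology k G T 2)"
    and x: "x = vectorspace.dim k
          (quotient_module (cohomology k G T 1) (annihilator k G T (kummer_class \<Omega> F E p \<xi> a)))"
    and y: "y = vectorspace.dim k
          (quotient_module (cohomology k G T 2)
             (cup k G T 1 1 (kummer_class \<Omega> F E p \<xi> a) ` carrier (cohomology k G T 1)))"
  shows "vectorspace.fin_dim k (cohomology k (G\<lparr>carrier := N\<rparr>) (subtopology T N) 2) \<and>
         vectorspace.dim k (cohomology k (G\<lparr>carrier := N\<rparr>) (subtopology T N) 2) = x + p * y"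
proof -
  interpret kc: kummer_closure \<Omega> F p \<xi>
    using assms(1-4) by (intro kummer_closure.intro kummer_closure_axioms.intro)
  have EE: "E = kc.Ep" and GG: "G = gal \<Omega> F kc.Ep" and TT: "T = kc.T" by (simp_all add: E G T kc.Ep_def kc.T_def)
  have N: "subgroup N (gal \<Omega> F kc.Ep)" "closedin kc.T N" and cN: "card (rcosets\<^bsub>gal \<Omega> F kc.Ep\<^esub> N) = p"
    using assms(9-11) unfolding GG TT by blast+
  have cor: "cor k (gal \<Omega> F kc.Ep) kc.T N 2 ` carrier (cohomology k ((gal \<Omega> F kc.Ep)\<lparr>carrier := N\<rparr>) (subtopology kc.T N) 2)
      = carrier (cohomology k (gal \<Omega> F kc.Ep) kc.T 2)"
    using assms(12) unfolding GG TT .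
  have a: "a \<in> F" "a \<noteq> \<zero>\<^bsub>\<Omega>\<^esub>" "\<alpha> [^]\<^bsub>\<Omega>\<^esub> p = a" using assms(13,14,16) by blast+
  have fixed: "fixed_field kc.Ep N = generate_field \<Omega> (insert \<alpha> F)" using assms(17) unfolding EE .
  have fd: "vectorspace.fin_dim k (cohomology k (gal \<Omega> F kc.Ep) kc.T 2)" using assms(18) unfolding GG TT .
  \<comment> \<open>An infinite set has \<open>card\<close> 0, so cardinality p > 0 makes the index
    genuinely finite.\<close>
  have fin: "finite (rcosets\<^bsub>gal \<Omega> F kc.Ep\<^esub> N)" using cN kc.p0 by (metis card_ge_0_finite)
  have Ne: "N \<noteq> carrier (gal \<Omega> F kc.Ep)"
  proof
    assume Nc: "N = carrier (gal \<Omega> F kc.Ep)"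
    have "rcosets\<^bsub>gal \<Omega> F kc.Ep\<^esub> N \<subseteq> {carrier (gal \<Omega> F kc.Ep)}"
      unfolding RCOSETS_def Nc using kc.G.coset_join2[OF _ kc.G.subgroup_self] by auto
    then have "card (rcosets\<^bsub>gal \<Omega> F kc.Ep\<^esub> N) \<le> card {carrier (gal \<Omega> F kc.Ep)}" by (rule card_mono[rotated]) simp
    then show False using cN kc.p1 by simp
  qed
  obtain s where s: "norm_lifting (gal \<Omega> F kc.Ep) kc.T N p (\<lambda>g. nat (kummer_char \<Omega> kc.Ep p \<xi> a g)) s"
    and nonneg: "\<And>g. g \<in> carrier (gal \<Omega> F kc.Ep) \<Longrightarrow> kummer_char \<Omega> kc.Ep p \<xi> a g \<ge> 0"
    using kc.kummer_cyclic_quotient[OF N(1) kc.closed_finite_index_open[OF N fin] Ne a fixed] by blast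
  have kcl: "kummer_class \<Omega> F E p \<xi> a = coh_class k (gal \<Omega> F kc.Ep) kc.T 1 (\<lambda>x\<in>tuples (gal \<Omega> F kc.Ep) 1.
      kummer_char \<Omega> kc.Ep p \<xi> a (inv\<^bsub>gal \<Omega> F kc.Ep\<^esub> (x 0) \<otimes>\<^bsub>gal \<Omega> F kc.Ep\<^esub> x 1))"
    by (simp only: kummer_class_def EE k kc.T_def)
  note D = norm_lifting.dimension_formula[OF s, of "kummer_char \<Omega> kc.Ep p \<xi> a", folded k, OF cor fd]
  show ?thesis
    unfolding x y kcl GG TT
    using D nonneg by simp
qed

end
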